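(* Let $\mathcal{A}$ be a finite alphabet and let $\Omega\subseteq\mathcal{A}^{\mathbb{N}}$ be a minimal shift. Suppose there are constants $K,n_0\in\mathbb{N}$ and $C\in\mathbb{N}_0$ such that the complexity function of $\Omega$ satisfies $p_\Omega(n)=Kn+C$ for all $n\ge n_0$. If $K\ge 4$, then $\#\mathcal{E}(\Omega)\le K-2$.
   Context: $\mathbb{N}=\{1,2,\dots\}$ and $\mathbb{N}_0=\mathbb{N}\cup\{0\}$. $\mathcal{A}^{\mathbb{N}}$ carries the product topology ($\mathcal{A}$ discrete), and $T:\mathcal{A}^{\mathbb{N}}\to\mathcal{A}^{\mathbb{N}}$, $(Tx)_n=x_{n+1}$, is the left shift. A shift is a closed $T$-invariant subset $\Omega\subseteq\mathcal{A}^{\mathbb{N}}$ (what many texts call a subshift); it is minimal if every $T$-orbit in $\Omega$ is dense in $\Omega$. The language $\mathcal{L}_\Omega$ is the set of all finite words (including the empty word) occurring as $x_jx_{j+1}\cdots x_{j+n-1}$ in some $x\in\Omega$; $\mathcal{L}_\Omega(n)$ is the set of its words of length $n$, and $p_\Omega(n)=\#\mathcal{L}_\Omega(n)$. $\mathcal{E}(\Omega)$ is the set of ergodic $T$-invariant Borel probability measures on $\Omega$. *)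

theory Defs
  imports "HOL-Probability.Probability"
begin

text \<open>
  The alphabet is a finite type with the discrete topology, \<^typ>\<open>nat \<Rightarrow> 'a\<close> carries the
  library's product topology, and \<^term>\<open>borel\<close> is its Borel sigma-algebra. Sequences are
  indexed from 0 instead of 1.
\<close>

definition left_shift :: "(nat \<Rightarrow> 'a) \<Rightarrow> nat \<Rightarrow> 'a" where
  "left_shift x = (\<lambda>n. x (Suc n))"

definition is_shift :: "(nat \<Rightarrow> 'a::discrete_topology) set \<Rightarrow> bool" where
  "is_shift \<Omega> \<longleftrightarrow> closed \<Omega> \<and> left_shift ` \<Omega> \<subseteq> \<Omega>"

definition orbit :: "(nat \<Rightarrow> 'a) \<Rightarrow> (nat \<Rightarrow> 'a) set" where
  "orbit x = range (\<lambda>n. (left_shift ^^ n) x)"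

definition minimal_shift :: "(nat \<Rightarrow> 'a::discrete_topology) set \<Rightarrow> bool" where
  "minimal_shift \<Omega> \<longleftrightarrow> is_shift \<Omega> \<and> (\<forall>x\<in>\<Omega>. \<Omega> \<subseteq> closure (orbit x))"

definition language :: "(nat \<Rightarrow> 'a) set \<Rightarrow> 'a list set" where
  "language \<Omega> = {map x [j..<j + n] | x j n. x \<in> \<Omega>}"

definition complexity :: "(nat \<Rightarrow> 'a) set \<Rightarrow> nat \<Rightarrow> nat" where
  "complexity \<Omega> n = card {w \<in> language \<Omega>. length w = n}"

text \<open>Measures live on \<^term>\<open>\<Omega>\<close> itself: their space is \<^term>\<open>\<Omega>\<close> and their measurable sets
  are the Borel subsets of \<^term>\<open>\<Omega>\<close>, so distinct members of the following sets differ on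
  some Borel subset of \<^term>\<open>\<Omega>\<close>.\<close>

definition invariant_measures :: "(nat \<Rightarrow> 'a::discrete_topology) set \<Rightarrow> (nat \<Rightarrow> 'a) measure set" where
  "invariant_measures \<Omega> = {\<mu>. prob_space \<mu> \<and> sets \<mu> = sets (restrict_space borel \<Omega>) \<and>
     (\<forall>B\<in>sets \<mu>. emeasure \<mu> (left_shift -` B \<inter> \<Omega>) = emeasure \<mu> B)}"

definition ergodic_measures :: "(nat \<Rightarrow> 'a::discrete_topology) set \<Rightarrow> (nat \<Rightarrow> 'a) measure set" where
  "ergodic_measures \<Omega> = {\<mu> \<in> invariant_measures \<Omega>.
     \<forall>B\<in>sets \<mu>. left_shift -` B \<inter> \<Omega> = B \<longrightarrow> emeasure \<mu> B = 0 \<or> emeasure \<mu> B = 1}"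

end

theory Submission
  imports Defs
begin

text \<open>
  Suppose there are \<open>K - 1\<close> ergodic measures. Color the long words of the language by the measure that
  their frequencies are close to, if any; no word has two colors. Since \<open>p(n + 1) - p(n) = K\<close>, the right special words of length
  \<open>n\<close> have total excess \<open>K\<close>, and each of the \<open>K - 1\<close> colors owns at least one of them; the same holds on the left. Hence at
  most one color fails to own exactly one right special word with two extensions. If a color has just one
  such word on the right, long stretches of that color can only go
  around a single cycle of the Rauzy graph, so the color is carried by a long periodic loop; if this holds on the left too, the loop
  has a unique entrance and a unique exit.

  Once the longest occurrence of a loop is exhausted, its color has excess two on both sides, so at that length all
  other colors have loops. Moreover every passage through a loop lasts almost as long as the longest one.
  Let \<open>q\<close> be the color whose loop has the least depth \<open>N\<close> at such a length. In typical stretches of color \<open>q\<close>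
  successive passages through its loop are separated by gaps much shorter than \<open>N\<close>. At a length that is a
  suitable fraction of \<open>N\<close>, the common past of all entrances into the loop therefore yields a second left
  special word of color \<open>q\<close>, and the common future of the exits a second right special one. All other special words are
  then entrances and exits of loops of other colors, and after leaving the color \<open>q\<close> one always meets the
  same loop first. Applying the same analysis once more with \<open>q\<close> as the color without a loop is impossible,
  because there are at least three colors.
\<close>

section \<open>Words and special words of a two-sided sequence\<close>

text \<open>Irreducibility is the engine: by recurrence, a set of words of one length that is closed
  under moving forward contains all words of that length. Most contradictions consist in building
  such a set that carries only one or two of the at least three colors. Ergodicity enters only
  through the assumption \<open>window\<close>, which has to be two-scale: the depth
  \<open>N1\<close> of a loop is not comparable with the length \<open>n\<close> at which loops are
  present, but the new special words live at a length proportional to \<open>N1\<close>. The short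
  scale keeps successive passages close together, the long one gives colors to words of that length.
  Colors are robust because there are three tolerances, \<open>eps / 4\<close> for typical
  stretches, \<open>eps / 2\<close> for loops and \<open>eps\<close> for a color. The slack pays for
  cutting words and for padding a long word by a short one; \<open>Q\<close> with
  \<open>Q * eps \<ge> 8\<close> measures how much longer the long one must be. \<open>M\<close>
  makes windows long enough for the waiting times for special words, at most
  \<open>(K + 1) * n\<close>, and for a whole passage measured at the coarse scale.\<close>

definition blk :: "(int \<Rightarrow> 'a) \<Rightarrow> nat \<Rightarrow> int \<Rightarrow> 'a list" where
  "blk x n i = map (\<lambda>k. x (i + int k)) [0..<n]"

definition rv :: "(int \<Rightarrow> 'a) \<Rightarrow> int \<Rightarrow> 'a" where
  "rv x i = x (- i)"

lemma length_blk [simp]: "length (blk x n i) = n"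
  by (simp add: blk_def)

lemma blk_0 [simp]: "blk x 0 i = []"
  by (simp add: blk_def)

lemma blk_eq_iff: "blk x n i = blk y n j \<longleftrightarrow> (\<forall>t. 0 \<le> t \<and> t < int n \<longrightarrow> x (i + t) = y (j + t))"
proof -
  have "blk x n i = blk y n j \<longleftrightarrow> (\<forall>k<n. x (i + int k) = y (j + int k))"
    by (auto simp: blk_def)
  also have "\<dots> \<longleftrightarrow> (\<forall>t. 0 \<le> t \<and> t < int n \<longrightarrow> x (i + t) = y (j + t))"
  proof (intro iffI allI impI)
    fix t assume a: "\<forall>k<n. x (i + int k) = y (j + int k)" "0 \<le> t \<and> t < int n"
    then have "nat t < n" by linarith
    with a show "x (i + t) = y (j + t)" using a(1)[rule_format, of "nat t"] by simp
  next
    fix k assume a: "\<forall>t. 0 \<le> t \<and> t < int n \<longrightarrow> x (i + t) = y (j + t)" "k < n"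
    then show "x (i + int k) = y (j + int k)" by simp
  qed
  finally show ?thesis .
qed

lemma blk_eqI: "(\<And>t. 0 \<le> t \<Longrightarrow> t < int n \<Longrightarrow> x (i + t) = y (j + t)) \<Longrightarrow> blk x n i = blk y n j"
  by (simp add: blk_eq_iff)

lemma blk_eqD: "blk x n i = blk y n j \<Longrightarrow> 0 \<le> t \<Longrightarrow> t < int n \<Longrightarrow> x (i + t) = y (j + t)"
  by (simp add: blk_eq_iff)

lemma blk_eqD': "blk x n i = blk y n j \<Longrightarrow> i \<le> k \<Longrightarrow> k < i + int n \<Longrightarrow> x k = y (j + k - i)"
  using blk_eqD[of x n i y j "k - i"] by (simp add: algebra_simps)

lemma blk_sub:
  assumes "blk x n i = blk y n j" "0 \<le> t" "t + int k \<le> int n"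
  shows "blk x k (i + t) = blk y k (j + t)"
  by (rule blk_eqI) (use blk_eqD[OF assms(1)] assms(2,3) in \<open>simp add: add.assoc\<close>)

lemma blk_sub':
  assumes "blk x n i = blk y n j" "i \<le> a" "a + int k \<le> i + int n"
  shows "blk x k a = blk y k (j + a - i)"
  using blk_sub[OF assms(1), of "a - i" k] assms(2,3) by (simp add: algebra_simps)

lemma blk_take: "blk x n i = blk y n j \<Longrightarrow> k \<le> n \<Longrightarrow> blk x k i = blk y k j"
  using blk_sub[of x n i y j 0 k] by simp

lemma blk_append: "blk x (a + b) i = blk x a i @ blk x b (i + int a)"
  by (rule nth_equalityI) (auto simp: blk_def nth_append algebra_simps of_nat_diff)

lemma blk_Suc: "blk x (Suc n) i = blk x n i @ [x (i + int n)]"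
  by (simp add: blk_def)

lemma blk_Suc': "blk x (Suc n) i = x i # blk x n (i + 1)"
  using blk_append[of x 1 n i] by (simp add: blk_def)

lemma blk_Suc_eq: "blk x (Suc n) i = blk y (Suc n) j \<longleftrightarrow> blk x n i = blk y n j \<and> x (i + int n) = y (j + int n)"
  by (simp add: blk_Suc)

lemma blk_Suc_eq': "blk x (Suc n) i = blk y (Suc n) j \<longleftrightarrow> x i = y j \<and> blk x n (i + 1) = blk y n (j + 1)"
  by (simp add: blk_Suc')

lemma blk_step:
  assumes "blk x n i = blk y n j" "x (i + int n) = y (j + int n)"
  shows "blk x n (i + 1) = blk y n (j + 1)"
  using assms blk_Suc_eq[of x n i y j] blk_Suc_eq'[of x n i y j] by simp

lemma blk_back:
  assumes "blk x n i = blk y n j" "x (i - 1) = y (j - 1)"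
  shows "blk x n (i - 1) = blk y n (j - 1)"
  using assms blk_Suc_eq[of x n "i-1" y "j-1"] blk_Suc_eq'[of x n "i-1" y "j-1"] by simp

lemma blk_rv: "blk (rv x) n i = rev (blk x n (1 - i - int n))"
proof (rule nth_equalityI)
  fix k assume "k < length (blk (rv x) n i)"
  then have k: "k < n" by simp
  have "int (n - 1 - k) = int n - 1 - int k" using k by (simp add: of_nat_diff)
  then show "blk (rv x) n i ! k = rev (blk x n (1 - i - int n)) ! k"
    using k by (simp add: blk_def rv_def rev_nth algebra_simps)
qed simp

lemma rv_rv [simp]: "rv (rv x) = x"
  by (simp add: rv_def fun_eq_iff)

definition RS :: "(int \<Rightarrow> 'a) \<Rightarrow> nat \<Rightarrow> 'a list set" where
  "RS x n = {v. \<exists>i j. blk x n i = v \<and> blk x n j = v \<and> x (i + int n) \<noteq> x (j + int n)}"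

definition LS :: "(int \<Rightarrow> 'a) \<Rightarrow> nat \<Rightarrow> 'a list set" where
  "LS x n = {v. \<exists>i j. blk x n i = v \<and> blk x n j = v \<and> x (i - 1) \<noteq> x (j - 1)}"

definition rx :: "(int \<Rightarrow> 'a) \<Rightarrow> 'a list \<Rightarrow> 'a set" where
  "rx x v = {x (i + int (length v)) | i. blk x (length v) i = v}"

definition lx :: "(int \<Rightarrow> 'a) \<Rightarrow> 'a list \<Rightarrow> 'a set" where
  "lx x v = {x (i - 1) | i. blk x (length v) i = v}"

definition facs :: "(int \<Rightarrow> 'a) \<Rightarrow> nat \<Rightarrow> 'a list set" where
  "facs x n = range (blk x n)"

text \<open>All phases \<open>\<kappa>\<close> are required at once, so the predicate does not
  depend on a starting phase, and it only becomes stronger with \<open>n\<close>; this is what makes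
  \<open>depth\<close> meaningful.\<close>

definition occ :: "(int \<Rightarrow> 'a) \<Rightarrow> (int \<Rightarrow> 'a) \<Rightarrow> nat \<Rightarrow> bool" where
  "occ x \<pi> n \<longleftrightarrow> (\<forall>\<kappa>. \<exists>i. blk x n i = blk \<pi> n \<kappa>)"

lemma RS_rv: "v \<in> RS (rv x) n \<longleftrightarrow> rev v \<in> LS x n"
proof
  assume "v \<in> RS (rv x) n"
  then obtain i j where ij: "blk (rv x) n i = v" "blk (rv x) n j = v" "rv x (i + int n) \<noteq> rv x (j + int n)"
    unfolding RS_def by blast
  have "blk x n (1 - i - int n) = rev v" "blk x n (1 - j - int n) = rev v"
    using ij(1,2) by (auto simp: blk_rv)
  moreover have "x (1 - i - int n - 1) \<noteq> x (1 - j - int n - 1)"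
    using ij(3) by (simp add: rv_def)
  ultimately show "rev v \<in> LS x n" unfolding LS_def by blast
next
  assume "rev v \<in> LS x n"
  then obtain i j where ij: "blk x n i = rev v" "blk x n j = rev v" "x (i - 1) \<noteq> x (j - 1)"
    unfolding LS_def by blast
  have "blk (rv x) n (1 - i - int n) = v" "blk (rv x) n (1 - j - int n) = v"
    using ij(1,2) by (auto simp: blk_rv)
  moreover have "rv x (1 - i - int n + int n) \<noteq> rv x (1 - j - int n + int n)"
    using ij(3) by (simp add: rv_def)
  ultimately show "v \<in> RS (rv x) n" unfolding RS_def by blast
qed

lemma LS_rv: "v \<in> LS (rv x) n \<longleftrightarrow> rev v \<in> RS x n"
  using RS_rv[of "rev v" "rv x" n] by simp

lemma rx_rv: "rx (rv x) v = lx x (rev v)"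
proof
  show "rx (rv x) v \<subseteq> lx x (rev v)"
  proof
    fix a assume "a \<in> rx (rv x) v"
    then obtain i where i: "a = rv x (i + int (length v))" "blk (rv x) (length v) i = v"
      unfolding rx_def by blast
    have "blk x (length v) (1 - i - int (length v)) = rev v"
      using i(2) by (metis blk_rv rev_rev_ident)
    then show "a \<in> lx x (rev v)" using i(1) unfolding lx_def
      by (intro CollectI exI[of _ "1 - i - int (length v)"]) (simp add: rv_def)
  qed
  show "lx x (rev v) \<subseteq> rx (rv x) v"
  proof
    fix a assume "a \<in> lx x (rev v)"
    then obtain i where i: "a = x (i - 1)" "blk x (length v) i = rev v"
      unfolding lx_def by auto
    have "blk (rv x) (length v) (1 - i - int (length v)) = v"
      using i(2) by (simp add: blk_rv)
    then show "a \<in> rx (rv x) v" using i(1) unfolding rx_def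
      by (intro CollectI exI[of _ "1 - i - int (length v)"]) (simp add: rv_def)
  qed
qed

lemma lx_rv: "lx (rv x) v = rx x (rev v)"
  using rx_rv[of "rv x" "rev v"] by simp

lemma occ_rv: "occ (rv x) (rv \<pi>) n \<longleftrightarrow> occ x \<pi> n"
proof -
  have *: "occ x \<pi> n \<Longrightarrow> occ (rv x) (rv \<pi>) n" for x \<pi> :: "int \<Rightarrow> 'a"
    unfolding occ_def blk_rv rev_is_rev_conv
  proof
    fix \<kappa> assume "\<forall>\<kappa>. \<exists>i. blk x n i = blk \<pi> n \<kappa>"
    then obtain i where "blk x n i = blk \<pi> n (1 - \<kappa> - int n)" by blast
    then show "\<exists>i. blk x n (1 - i - int n) = blk \<pi> n (1 - \<kappa> - int n)"
      by (intro exI[of _ "1 - i - int n"]) simp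
  qed
  show ?thesis using *[of x \<pi>] *[of "rv x" "rv \<pi>"] by auto
qed

lemma occ_mono: "occ x \<pi> n \<Longrightarrow> k \<le> n \<Longrightarrow> occ x \<pi> k"
  unfolding occ_def by (meson blk_take)

lemma facs_rv: "facs (rv x) n = rev ` facs x n"
proof -
  have "blk (rv x) n ` UNIV = (\<lambda>i. rev (blk x n (1 - i - int n))) ` UNIV"
    by (simp add: blk_rv)
  also have "\<dots> = (\<lambda>i. rev (blk x n i)) ` (\<lambda>i. 1 - i - int n) ` UNIV"
    by (simp add: image_image)
  also have "(\<lambda>i. 1 - i - int n) ` UNIV = (UNIV :: int set)"
    by (rule surjI[of _ "\<lambda>i. 1 - i - int n"]) simp
  finally show ?thesis by (simp add: facs_def image_image)
qed

lemma finite_facs [simp]: "finite (facs (x :: int \<Rightarrow> 'a::finite) n)"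
  by (rule finite_subset[OF _ finite_lists_length_eq[of UNIV n]]) (auto simp: facs_def)

lemma RS_subset: "RS x n \<subseteq> facs x n"
  by (auto simp: RS_def facs_def)

lemma RS_length: "v \<in> RS x n \<Longrightarrow> length v = n"
  by (auto simp: RS_def)

lemma rx_RS:
  assumes "v \<in> facs (x :: int \<Rightarrow> 'a::finite) n"
  shows "card (rx x v) \<ge> 1" "card (rx x v) \<ge> 2 \<longleftrightarrow> v \<in> RS x n"
proof -
  obtain i where i: "blk x n i = v" "length v = n" using assms by (auto simp: facs_def)
  then have mem: "x (i + int n) \<in> rx x v" unfolding rx_def by auto
  have fin: "finite (rx x v)" by simp
  show "card (rx x v) \<ge> 1" using mem fin by (metis One_nat_def Suc_leI card_gt_0_iff empty_iff)
  show "card (rx x v) \<ge> 2 \<longleftrightarrow> v \<in> RS x n"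
  proof
    assume "card (rx x v) \<ge> 2"
    then have "\<not> (\<forall>a\<in>rx x v. \<forall>b\<in>rx x v. a = b)"
      using card_le_Suc0_iff_eq[OF fin] by simp
    then obtain a b where "a \<in> rx x v" "b \<in> rx x v" "a \<noteq> b"
      by blast
    then show "v \<in> RS x n" unfolding rx_def RS_def i(2) by blast
  next
    assume "v \<in> RS x n"
    then obtain i j where ij: "blk x n i = v" "blk x n j = v" "x (i + int n) \<noteq> x (j + int n)"
      unfolding RS_def by blast
    then have "{x (i + int n), x (j + int n)} \<subseteq> rx x v" unfolding rx_def i(2) by blast
    then have "card {x (i + int n), x (j + int n)} \<le> card (rx x v)" by (rule card_mono[OF fin])
    then show "card (rx x v) \<ge> 2" using ij(3) by simp
  qed
qed

lemma card_facs_Suc: "card (facs (x :: int \<Rightarrow> 'a::finite) (Suc n)) = (\<Sum>v\<in>facs x n. card (rx x v))"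
proof -
  have "facs x (Suc n) = (\<lambda>(v, a). v @ [a]) ` (SIGMA v:facs x n. rx x v)"
  proof
    show "facs x (Suc n) \<subseteq> (\<lambda>(v, a). v @ [a]) ` (SIGMA v:facs x n. rx x v)"
    proof
      fix w assume "w \<in> facs x (Suc n)"
      then obtain i where "w = blk x n i @ [x (i + int n)]" by (auto simp: facs_def blk_Suc)
      moreover have "(blk x n i, x (i + int n)) \<in> (SIGMA v:facs x n. rx x v)"
        by (auto simp: facs_def rx_def)
      ultimately show "w \<in> (\<lambda>(v, a). v @ [a]) ` (SIGMA v:facs x n. rx x v)" by force
    qed
    show "(\<lambda>(v, a). v @ [a]) ` (SIGMA v:facs x n. rx x v) \<subseteq> facs x (Suc n)"
    proof clarsimp
      fix v a assume "v \<in> facs x n" "a \<in> rx x v"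
      then obtain i where "a = x (i + int n)" "blk x n i = v" by (auto simp: facs_def rx_def)
      then have "v @ [a] = blk x (Suc n) i" by (simp add: blk_Suc)
      then show "v @ [a] \<in> facs x (Suc n)" by (simp add: facs_def)
    qed
  qed
  moreover have "inj_on (\<lambda>(v, a). v @ [a]) (SIGMA v:facs x n. rx x v)" by (auto simp: inj_on_def)
  ultimately have "card (facs x (Suc n)) = card (SIGMA v:facs x n. rx x v)" by (simp add: card_image)
  then show ?thesis by simp
qed

section \<open>Sequences colored by frequencies\<close>

text \<open>The number \<open>dev c w\<close> measures how far the word frequencies in \<open>w\<close> are from those of the measure
  \<open>c\<close>. The assumption \<open>window\<close> says that generic points of \<open>c\<close> are typical at the two scales \<open>B \<le> n\<close>
  simultaneously: up to length \<open>M * n\<close> all factors of length at least \<open>n\<close> are typical, and in every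
  stretch of length \<open>n\<close> one meets consecutive typical blocks of length \<open>B\<close>. The numerical constants
  are not optimized.\<close>

locale colored_sequence =
  fixes \<xi> :: "int \<Rightarrow> 'a::finite" and K C N0 :: nat and Cs :: "'c set"
    and dev :: "'c \<Rightarrow> 'a list \<Rightarrow> real" and m eps :: real and Q M :: nat
  assumes K4: "K \<ge> 4" and N0: "N0 \<ge> 1" "C \<le> N0"
    and comp: "\<And>n. n \<ge> N0 \<Longrightarrow> card (facs \<xi> n) = K * n + C"
    and urec: "\<And>n. \<exists>G. \<forall>i j. \<exists>k. j \<le> k \<and> k \<le> j + int G \<and> blk \<xi> n k = blk \<xi> n i"
    and Cs: "card Cs = K - 1"
    and dev_app: "\<And>c v w. c \<in> Cs \<Longrightarrow> dev c (v @ w) \<le> dev c v + dev c w + m"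
    and dev_len: "\<And>c v. c \<in> Cs \<Longrightarrow> dev c v \<le> real (length v)"
    and m0: "m \<ge> 0" and eps0: "eps > 0" and Q: "real Q * eps \<ge> 8"
    and small: "8 * (m + 2) \<le> eps * real N0"
    and sep: "\<And>c c' v. c \<in> Cs \<Longrightarrow> c' \<in> Cs \<Longrightarrow> v \<noteq> [] \<Longrightarrow> dev c v \<le> eps * real (length v) \<Longrightarrow>
               dev c' v \<le> eps * real (length v) \<Longrightarrow> c = c'"
    and M: "M = 100 * (K + 10) * (Q + 20)"
    and window: "\<And>B n c. N0 \<le> B \<Longrightarrow> B \<le> n \<Longrightarrow> c \<in> Cs \<Longrightarrow>
      \<exists>i. (\<forall>t k. n \<le> t \<longrightarrow> i \<le> k \<longrightarrow> k + int t \<le> i + int (M * n) \<longrightarrow> dev c (blk \<xi> t k) \<le> eps / 4 * real t) \<and>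
          (\<forall>k. i \<le> k \<longrightarrow> k + int n + int ((K + 3) * B) \<le> i + int (M * n) \<longrightarrow>
             (\<exists>y. k \<le> y \<and> y \<le> k + int n \<and>
               (\<forall>y'. y \<le> y' \<longrightarrow> y' \<le> y + int ((K + 2) * B) \<longrightarrow> dev c (blk \<xi> B y') \<le> eps / 4 * real B)))"
begin

text \<open>The loosest of the three tolerances. By \<open>sep\<close> a nonempty word still has at
  most one color.\<close>

definition pure :: "'c \<Rightarrow> 'a list \<Rightarrow> bool" where
  "pure c v \<longleftrightarrow> dev c v \<le> eps * real (length v)"

text \<open>Such a color uses exactly one unit of the total excess \<open>K\<close>, which is what
  forces its long stretches into a single cycle.\<close>

definition rsimple :: "'c \<Rightarrow> nat \<Rightarrow> 'a list \<Rightarrow> bool" where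
  "rsimple c n r \<longleftrightarrow> r \<in> RS \<xi> n \<and> pure c r \<and> card (rx \<xi> r) = 2 \<and> (\<forall>v\<in>RS \<xi> n. pure c v \<longrightarrow> v = r)"

definition lsimple :: "'c \<Rightarrow> nat \<Rightarrow> 'a list \<Rightarrow> bool" where
  "lsimple c n r \<longleftrightarrow> r \<in> LS \<xi> n \<and> pure c r \<and> card (lx \<xi> r) = 2 \<and> (\<forall>v\<in>LS \<xi> n. pure c v \<longrightarrow> v = r)"

lemma finCs: "finite Cs"
  using Cs K4 by (intro card_ge_0_finite) simp

lemma pure_unique: "pure c v \<Longrightarrow> pure c' v \<Longrightarrow> v \<noteq> [] \<Longrightarrow> c \<in> Cs \<Longrightarrow> c' \<in> Cs \<Longrightarrow> c = c'"
  unfolding pure_def using sep by blast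

text \<open>All hypotheses survive reflection, so each statement about right special words, exits
  and futures yields its mirror image by instantiation instead of a second proof.\<close>

lemma colored_sequence_rv: "colored_sequence (rv \<xi>) K C N0 Cs (\<lambda>c w. dev c (rev w)) m eps Q M"
proof
  show "K \<ge> 4" "N0 \<ge> 1" "C \<le> N0" "card Cs = K - 1" "m \<ge> 0" "eps > 0" "real Q * eps \<ge> 8"
    "8 * (m + 2) \<le> eps * real N0" "M = 100 * (K + 10) * (Q + 20)"
    using K4 N0 Cs m0 eps0 Q small M by auto
  show "card (facs (rv \<xi>) n) = K * n + C" if "N0 \<le> n" for n
    using comp[OF that] by (simp add: facs_rv card_image inj_on_def)
  show "\<exists>G. \<forall>i j. \<exists>k\<ge>j. k \<le> j + int G \<and> blk (rv \<xi>) n k = blk (rv \<xi>) n i" for n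
  proof -
    obtain G where G: "\<And>i j. \<exists>k\<ge>j. k \<le> j + int G \<and> blk \<xi> n k = blk \<xi> n i" using urec by metis
    show ?thesis
    proof (intro exI[of _ G] allI)
      fix i j
      obtain k where k: "k \<ge> 1 - j - int n - int G" "k \<le> 1 - j - int n - int G + int G"
        "blk \<xi> n k = blk \<xi> n (1 - i - int n)" using G by blast
      show "\<exists>k\<ge>j. k \<le> j + int G \<and> blk (rv \<xi>) n k = blk (rv \<xi>) n i"
        using k by (intro exI[of _ "1 - k - int n"]) (simp add: blk_rv)
    qed
  qed
  show "dev c (rev (v @ w)) \<le> dev c (rev v) + dev c (rev w) + m" if "c \<in> Cs" for c v w
    using dev_app[OF that, of "rev w" "rev v"] by simp
  show "dev c (rev v) \<le> real (length v)" if "c \<in> Cs" for c v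
    using dev_len[OF that, of "rev v"] by simp
  show "c = c'" if "c \<in> Cs" "c' \<in> Cs" "v \<noteq> []" "dev c (rev v) \<le> eps * real (length v)"
     "dev c' (rev v) \<le> eps * real (length v)" for c c' v
    using sep[of c c' "rev v"] that by simp
  show "\<exists>i. (\<forall>t k. n \<le> t \<longrightarrow> i \<le> k \<longrightarrow> k + int t \<le> i + int (M * n) \<longrightarrow> dev c (rev (blk (rv \<xi>) t k)) \<le> eps / 4 * real t) \<and>
          (\<forall>k. i \<le> k \<longrightarrow> k + int n + int ((K + 3) * B) \<le> i + int (M * n) \<longrightarrow>
             (\<exists>y. k \<le> y \<and> y \<le> k + int n \<and>
               (\<forall>y'. y \<le> y' \<longrightarrow> y' \<le> y + int ((K + 2) * B) \<longrightarrow> dev c (rev (blk (rv \<xi>) B y')) \<le> eps / 4 * real B)))"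
    if a: "N0 \<le> B" "B \<le> n" "c \<in> Cs" for B n c
  proof -
    obtain i where
      i1: "\<And>t k. n \<le> t \<Longrightarrow> i \<le> k \<Longrightarrow> k + int t \<le> i + int (M * n) \<Longrightarrow> dev c (blk \<xi> t k) \<le> eps / 4 * real t"
      and i2: "\<And>k. i \<le> k \<Longrightarrow> k + int n + int ((K + 3) * B) \<le> i + int (M * n) \<Longrightarrow>
             (\<exists>y. k \<le> y \<and> y \<le> k + int n \<and>
               (\<forall>y'. y \<le> y' \<longrightarrow> y' \<le> y + int ((K + 2) * B) \<longrightarrow> dev c (blk \<xi> B y') \<le> eps / 4 * real B))"
      using window[OF a] by blast
    define e where "e = 1 - i - int (M * n)"
    show ?thesis unfolding blk_rv rev_rev_ident
    proof (rule exI[of _ e], intro conjI allI impI)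
      fix t k assume "n \<le> t" "e \<le> k" "k + int t \<le> e + int (M * n)"
      then show "dev c (blk \<xi> t (1 - k - int t)) \<le> eps / 4 * real t"
        by (intro i1) (auto simp: e_def)
    next
      fix k assume k: "e \<le> k" "k + int n + int ((K + 3) * B) \<le> e + int (M * n)"
      have KB: "int ((K + 3) * B) = int ((K + 2) * B) + int B" by (simp add: algebra_simps)
      \<comment> \<open>The blocks starting in \<open>[y, y + (K + 2) * B]\<close> fill
        \<open>(K + 3) * B\<close> positions, so this is the length of the stretch to be
        reflected.\<close>
      define k' where "k' = 1 - k - int n - int ((K + 3) * B)"
      have "i \<le> k'" "k' + int n + int ((K + 3) * B) \<le> i + int (M * n)"
        using k by (auto simp: e_def k'_def)
      from i2[OF this] obtain y where y: "k' \<le> y" "y \<le> k' + int n"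
        "\<And>y'. y \<le> y' \<Longrightarrow> y' \<le> y + int ((K + 2) * B) \<Longrightarrow> dev c (blk \<xi> B y') \<le> eps / 4 * real B"
        by blast
      show "\<exists>y\<ge>k. y \<le> k + int n \<and> (\<forall>y'\<ge>y. y' \<le> y + int ((K + 2) * B) \<longrightarrow> dev c (blk \<xi> B (1 - y' - int B)) \<le> eps / 4 * real B)"
      proof -
        have 1: "k \<le> 1 - y - int ((K + 3) * B)" "1 - y - int ((K + 3) * B) \<le> k + int n"
          using y(1,2) by (auto simp: k'_def)
        have 2: "dev c (blk \<xi> B (1 - y' - int B)) \<le> eps / 4 * real B"
          if "1 - y - int ((K + 3) * B) \<le> y'" "y' \<le> 1 - y - int ((K + 3) * B) + int ((K + 2) * B)" for y'
          using KB that by (intro y(3)) auto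
        show ?thesis
          by (rule exI[of _ "1 - y - int ((K + 3) * B)"]) (intro conjI allI impI 1 2)
      qed
    qed
  qed
qed

section \<open>Recurrence, excess, and waiting times for right special words\<close>

lemma recur_right: "\<exists>k\<ge>j. blk \<xi> n k = blk \<xi> n i"
  using urec by metis

lemma recur_left: "\<exists>k\<le>j. blk \<xi> n k = blk \<xi> n i"
proof -
  obtain G where G: "\<And>i j. \<exists>k. j \<le> k \<and> k \<le> j + int G \<and> blk \<xi> n k = blk \<xi> n i" using urec by metis
  then obtain k where "j - int G \<le> k \<and> k \<le> j - int G + int G \<and> blk \<xi> n k = blk \<xi> n i" by blast
  then show ?thesis by auto
qed

text \<open>Every factor occurs somewhere to the right of \<open>i0\<close>, so a set that cannot be
  left going forward contains all of them. This is the strong connectedness of the Rauzy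
  graph.\<close>

lemma closed_fwd:
  assumes "blk \<xi> n i0 \<in> S" "\<And>i. blk \<xi> n i \<in> S \<Longrightarrow> blk \<xi> n (i + 1) \<in> S"
  shows "blk \<xi> n j \<in> S"
proof -
  have *: "blk \<xi> n (i0 + int t) \<in> S" for t
  proof (induction t)
    case (Suc t)
    then show ?case using assms(2)[of "i0 + int t"] by (simp add: ac_simps)
  qed (use assms(1) in simp)
  obtain k where "k \<ge> i0" "blk \<xi> n k = blk \<xi> n j" using recur_right by metis
  then show ?thesis using *[of "nat (k - i0)"] by simp
qed

lemma RS_sum:
  assumes "n \<ge> N0"
  shows "(\<Sum>v\<in>RS \<xi> n. card (rx \<xi> v) - 1) = K"
proof -
  have "(\<Sum>v\<in>facs \<xi> n. card (rx \<xi> v)) = card (facs \<xi> (Suc n))" by (simp add: card_facs_Suc)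
  also have "\<dots> = card (facs \<xi> n) + K" using comp[of n] comp[of "Suc n"] assms by simp
  finally have 1: "(\<Sum>v\<in>facs \<xi> n. card (rx \<xi> v)) = card (facs \<xi> n) + K" .
  have "(\<Sum>v\<in>facs \<xi> n. card (rx \<xi> v)) = (\<Sum>v\<in>facs \<xi> n. (card (rx \<xi> v) - 1) + 1)"
  proof (rule sum.cong)
    fix v assume "v \<in> facs \<xi> n"
    from rx_RS(1)[OF this] show "card (rx \<xi> v) = (card (rx \<xi> v) - 1) + 1" by simp
  qed simp
  also have "\<dots> = (\<Sum>v\<in>facs \<xi> n. card (rx \<xi> v) - 1) + card (facs \<xi> n)"
    by (simp only: sum.distrib) simp
  finally have "(\<Sum>v\<in>facs \<xi> n. card (rx \<xi> v) - 1) = K" using 1 by simp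
  moreover have "(\<Sum>v\<in>facs \<xi> n. card (rx \<xi> v) - 1) = (\<Sum>v\<in>RS \<xi> n. card (rx \<xi> v) - 1)"
  proof (rule sum.mono_neutral_right)
    show "\<forall>v\<in>facs \<xi> n - RS \<xi> n. card (rx \<xi> v) - 1 = 0"
      using rx_RS(2)[where x = \<xi> and n = n] by force
  qed (auto simp: RS_subset)
  ultimately show ?thesis by simp
qed

lemma finite_RS [simp]: "finite (RS \<xi> n)"
  by (rule finite_subset[OF RS_subset]) simp

lemma RS_sum_le:
  assumes "n \<ge> N0" "S \<subseteq> RS \<xi> n"
  shows "(\<Sum>v\<in>S. card (rx \<xi> v) - 1) \<le> K"
  using sum_mono2[OF finite_RS assms(2), of "\<lambda>v. card (rx \<xi> v) - 1"] RS_sum[OF assms(1)] by simp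

lemma RS_rx: "v \<in> RS \<xi> n \<Longrightarrow> card (rx \<xi> v) \<ge> 2"
  using rx_RS(2)[of v \<xi> n] RS_subset by blast

text \<open>Each right special word costs at least one unit of the total excess \<open>K\<close> of
  \<open>RS_sum\<close>, so \<open>K\<close> of them leave nothing for a further word or for a third
  extension.\<close>

lemma RS_full:
  assumes "n \<ge> N0" "S \<subseteq> RS \<xi> n" "card S \<ge> K"
  shows "RS \<xi> n = S" "\<And>v. v \<in> S \<Longrightarrow> card (rx \<xi> v) = 2" "card S = K"
proof -
  have fS: "finite S" using finite_subset[OF assms(2)] by simp
  have ge: "card (rx \<xi> v) - 1 \<ge> 1" if "v \<in> RS \<xi> n" for v using RS_rx[OF that] by simp
  have cS: "card T \<le> (\<Sum>v\<in>T. card (rx \<xi> v) - 1)" if "T \<subseteq> RS \<xi> n" for T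
    using sum_mono[of T "\<lambda>_. 1" "\<lambda>v. card (rx \<xi> v) - 1"] ge that by (auto simp: subset_iff)
  show c: "card S = K"
    using RS_sum_le[OF assms(1,2)] cS[OF assms(2)] assms(3) by simp
  show "RS \<xi> n = S"
  proof (rule ccontr)
    assume "RS \<xi> n \<noteq> S"
    then obtain v where v: "v \<in> RS \<xi> n" "v \<notin> S" using assms(2) by blast
    have "card (insert v S) \<le> (\<Sum>v\<in>insert v S. card (rx \<xi> v) - 1)" using v assms(2) by (intro cS) auto
    also have "\<dots> \<le> K" using v assms(1,2) by (intro RS_sum_le) auto
    finally show False using v fS assms(3) by simp
  qed
  fix v assume v: "v \<in> S"
  have "(\<Sum>v\<in>S. card (rx \<xi> v) - 1) = (card (rx \<xi> v) - 1) + (\<Sum>v\<in>S - {v}. card (rx \<xi> v) - 1)"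
    using fS v by (simp add: sum.remove)
  moreover have "(\<Sum>v\<in>S - {v}. card (rx \<xi> v) - 1) \<ge> card (S - {v})" using assms(2) by (intro cS) auto
  moreover have "card (S - {v}) = K - 1" using v fS c by simp
  moreover have "(\<Sum>v\<in>S. card (rx \<xi> v) - 1) \<le> K" by (rule RS_sum_le[OF assms(1,2)])
  moreover have "card (rx \<xi> v) \<ge> 2" using RS_rx v assms(2) by blast
  ultimately show "card (rx \<xi> v) = 2" using K4 by linarith
qed

lemma det_fwd:
  assumes "blk \<xi> n i = blk \<xi> n j" "blk \<xi> n i \<notin> RS \<xi> n"
  shows "\<xi> (i + int n) = \<xi> (j + int n)"
proof (rule ccontr)
  assume "\<xi> (i + int n) \<noteq> \<xi> (j + int n)"
  then have "blk \<xi> n i \<in> RS \<xi> n"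
    unfolding RS_def using assms(1) by (intro CollectI exI[of _ i] exI[of _ j]) simp
  then show False using assms(2) by simp
qed

lemma det_bwd:
  assumes "blk \<xi> n i = blk \<xi> n j" "blk \<xi> n i \<notin> LS \<xi> n"
  shows "\<xi> (i - 1) = \<xi> (j - 1)"
proof (rule ccontr)
  assume "\<xi> (i - 1) \<noteq> \<xi> (j - 1)"
  then have "blk \<xi> n i \<in> LS \<xi> n"
    unfolding LS_def using assms(1) by (intro CollectI exI[of _ i] exI[of _ j]) simp
  then show False using assms(2) by simp
qed

lemma two_letters:
  assumes "card (rx \<xi> (blk \<xi> n i)) = 2" "blk \<xi> n j = blk \<xi> n i" "blk \<xi> n k = blk \<xi> n i"
    "\<xi> (i + int n) \<noteq> \<xi> (j + int n)"
  shows "\<xi> (k + int n) = \<xi> (i + int n) \<or> \<xi> (k + int n) = \<xi> (j + int n)"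
proof -
  have "{\<xi> (i + int n), \<xi> (j + int n), \<xi> (k + int n)} \<subseteq> rx \<xi> (blk \<xi> n i)"
    unfolding rx_def using assms(2,3) by auto
  then have "card {\<xi> (i + int n), \<xi> (j + int n), \<xi> (k + int n)} \<le> 2"
    using assms(1) by (metis card_mono finite)
  then show ?thesis using assms(4) by (auto simp: card_insert_if split: if_splits)
qed

text \<open>The additive constant is absorbed by \<open>C \<le> N0 \<le> n\<close>; waiting times
  thereby become multiples of \<open>n\<close>.\<close>

lemma card_facs_le:
  assumes "n \<ge> N0" shows "card (facs \<xi> n) \<le> (K + 1) * n"
  using comp[OF assms] N0 assms by simp

lemma RS_nonempty: "n \<ge> N0 \<Longrightarrow> RS \<xi> n \<noteq> {}"
  using RS_sum[of n] K4 by auto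

text \<open>Pigeonhole: among \<open>(K + 1) * n + 1\<close> consecutive words two coincide. If none
  in between were right special, the cycle joining them could never be left and would contain all
  words of length \<open>n\<close>, although a right special one exists.\<close>

lemma RS_within:
  assumes "n \<ge> N0"
  shows "\<exists>k\<ge>i. k \<le> i + int ((K + 1) * n) \<and> blk \<xi> n k \<in> RS \<xi> n"
proof (rule ccontr)
  assume "\<not> ?thesis"
  then have no: "\<And>k. i \<le> k \<Longrightarrow> k \<le> i + int ((K + 1) * n) \<Longrightarrow> blk \<xi> n k \<notin> RS \<xi> n" by blast
  define p where "p = (K + 1) * n"
  have "\<not> inj_on (\<lambda>t. blk \<xi> n (i + int t)) {..p}"
  proof
    assume "inj_on (\<lambda>t. blk \<xi> n (i + int t)) {..p}"
    then have "card {..p} \<le> card (facs \<xi> n)" by (intro card_inj_on_le[OF _ _ finite_facs]) (auto simp: facs_def)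
    then show False using card_facs_le[OF assms] by (simp add: p_def)
  qed
  then obtain a b where ab: "a < b" "b \<le> p" "blk \<xi> n (i + int a) = blk \<xi> n (i + int b)"
    unfolding inj_on_def by (auto, metis linorder_neqE_nat)
  define S where "S = (\<lambda>t. blk \<xi> n (i + int t)) ` {a..<b}"
  have S_RS: "v \<notin> RS \<xi> n" if vS: "v \<in> S" for v
  proof -
    obtain t where t: "a \<le> t" "t < b" "v = blk \<xi> n (i + int t)"
      using vS unfolding S_def by fastforce
    have "int t \<le> int p" using t(2) ab(2) by simp
    then show ?thesis unfolding t(3) by (intro no) (auto simp: p_def)
  qed
  have "blk \<xi> n j \<in> S" for j
  proof (rule closed_fwd)
    show "blk \<xi> n (i + int a) \<in> S" unfolding S_def using ab(1) by (intro image_eqI[of _ _ a]) simp_all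
    fix k assume k: "blk \<xi> n k \<in> S"
    then obtain t where t: "a \<le> t" "t < b" "blk \<xi> n k = blk \<xi> n (i + int t)" by (auto simp: S_def)
    have "blk \<xi> n (k + 1) = blk \<xi> n (i + int t + 1)"
      by (rule blk_step[OF t(3) det_fwd[OF t(3)]]) (use S_RS k in auto)
    moreover have "blk \<xi> n (i + int t + 1) \<in> S"
    proof (cases "Suc t = b")
      case True
      then have e: "i + int t + 1 = i + int b" by simp
      show ?thesis unfolding S_def e ab(3)[symmetric] by (rule imageI) (use ab(1) in simp)
    next
      case False
      have e: "i + int t + 1 = i + int (Suc t)" by simp
      show ?thesis unfolding S_def e by (rule imageI) (use t False in simp)
    qed
    ultimately show "blk \<xi> n (k + 1) \<in> S" by simp
  qed
  then show False using RS_nonempty[OF assms] S_RS unfolding RS_def by blast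
qed

text \<open>Length up to which a loop detected in a window of length \<open>M * n\<close> is certain
  to occur. The loss consists of three waiting times \<open>(K + 1) * n\<close>, namely before the
  first special word, for its first return and at the end of the window, and of \<open>5 * n\<close>
  for rounding.\<close>

definition reach :: "nat \<Rightarrow> nat" where "reach n = (M - (3 * K + 8)) * n"

lemma M_large: "200 * (K + 10) + 100 * (K + 10) * Q \<le> M" "2000 \<le> M" "4 * K + 20 \<le> M"
  using M by (auto simp: algebra_simps)

lemma Mn: "a \<le> M \<Longrightarrow> int (a * n) \<le> int (M * n)"
  by (simp add: mult_right_mono)

lemma reach_eq: "int (reach n) + int ((3 * K + 8) * n) = int (M * n)"
proof -
  have "(M - (3 * K + 8)) * n + (3 * K + 8) * n = M * n"
    using M_large by (simp add: add_mult_distrib[symmetric])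
  then show ?thesis unfolding reach_def by (metis of_nat_add)
qed

lemma reach_ge: "a \<le> M - (3 * K + 8) \<Longrightarrow> a * n \<le> reach n"
  unfolding reach_def by simp

lemma small_n: "n \<ge> N0 \<Longrightarrow> m + 2 \<le> eps / 8 * real n"
proof -
  assume "n \<ge> N0"
  then have "eps * real N0 \<le> eps * real n" using eps0 by simp
  then show ?thesis using small by simp
qed

text \<open>By \<open>dev_len\<close> a word of length \<open>k\<close> adds at most
  \<open>k + m\<close> to the deviation, whatever its letters; so a word within
  \<open>eps / 2\<close> may be padded on either side without losing its color.\<close>

lemma pure_append:
  assumes "c \<in> Cs" "dev c v \<le> eps / 2 * real (length v)" "length v + k = n"
    "real k + m \<le> eps / 2 * real n" "length w = k"
  shows "pure c (w @ v)" "pure c (v @ w)"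
proof -
  have "eps / 2 * real (length v) \<le> eps / 2 * real n" using assms(3) eps0 by (intro mult_left_mono) auto
  then have "dev c v \<le> eps / 2 * real n" using assms(2) by linarith
  moreover have "length (w @ v) = n" "length (v @ w) = n" using assms(3,5) by simp_all
  moreover have "dev c w \<le> real k" using dev_len[OF assms(1), of w] assms(5) by simp
  moreover have "dev c (w @ v) \<le> dev c w + dev c v + m" "dev c (v @ w) \<le> dev c v + dev c w + m"
    by (rule dev_app[OF assms(1)])+
  ultimately have "dev c (w @ v) \<le> eps * real n" "dev c (v @ w) \<le> eps * real n"
    using assms(4) by linarith+
  with \<open>length (w @ v) = n\<close> \<open>length (v @ w) = n\<close> show "pure c (w @ v)" "pure c (v @ w)"
    by (simp_all only: pure_def)
qed

section \<open>How the excess is divided among the colors\<close>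

lemma color_RS:
  assumes "n \<ge> N0" "c \<in> Cs" shows "\<exists>v\<in>RS \<xi> n. pure c v"
proof -
  obtain i where i: "\<And>t k. n \<le> t \<Longrightarrow> i \<le> k \<Longrightarrow> k + int t \<le> i + int (M * n) \<Longrightarrow> dev c (blk \<xi> t k) \<le> eps / 4 * real t"
    using window[OF assms(1) order_refl assms(2)] by blast
  obtain k where k: "k \<ge> i" "k \<le> i + int ((K + 1) * n)" "blk \<xi> n k \<in> RS \<xi> n"
    using RS_within[OF assms(1)] by blast
  have "int ((K + 2) * n) \<le> int (M * n)" using M_large by (intro Mn) simp
  moreover have "int ((K + 2) * n) = int ((K + 1) * n) + int n" by (simp add: algebra_simps)
  ultimately have "dev c (blk \<xi> n k) \<le> eps / 4 * real n" using k by (intro i) auto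
  also have "\<dots> \<le> eps * real n" using eps0 by (intro mult_right_mono) auto
  finally show ?thesis using k(3) unfolding pure_def by (intro bexI[of _ "blk \<xi> n k"]) simp_all
qed

lemma RS_pure_unique: "v \<in> RS \<xi> n \<Longrightarrow> n \<ge> N0 \<Longrightarrow> pure c v \<Longrightarrow> pure c' v \<Longrightarrow> c \<in> Cs \<Longrightarrow> c' \<in> Cs \<Longrightarrow> c = c'"
  using pure_unique[of c v c'] RS_length[of v \<xi> n] N0 by (cases v) auto

lemma color_choice:
  assumes "n \<ge> N0"
  obtains f where "\<And>e. e \<in> Cs \<Longrightarrow> f e \<in> RS \<xi> n" "\<And>e. e \<in> Cs \<Longrightarrow> pure e (f e)" "inj_on f Cs"
proof -
  obtain f where f: "\<And>e. e \<in> Cs \<Longrightarrow> f e \<in> RS \<xi> n" "\<And>e. e \<in> Cs \<Longrightarrow> pure e (f e)"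
    using color_RS[OF assms] by metis
  then have "inj_on f Cs" unfolding inj_on_def using RS_pure_unique[OF _ assms] by metis
  then show thesis using f that by blast
qed

text \<open>The two words of color \<open>c\<close> and one word for each of the
  \<open>K - 2\<close> other colors are already \<open>K\<close> right special words, so
  \<open>RS_full\<close> settles everything.\<close>

lemma RS_struct:
  assumes n: "n \<ge> N0" and c: "c \<in> Cs"
    and v: "v \<in> RS \<xi> n" "v' \<in> RS \<xi> n" "v \<noteq> v'" "pure c v" "pure c v'"
  shows "card (rx \<xi> v) = 2" "card (rx \<xi> v') = 2"
    "\<And>w. w \<in> RS \<xi> n \<Longrightarrow> pure c w \<Longrightarrow> w = v \<or> w = v'"
    "\<And>w. w \<in> RS \<xi> n \<Longrightarrow> \<not> pure c w \<Longrightarrow> \<exists>e\<in>Cs - {c}. rsimple e n w"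
    "\<And>e. e \<in> Cs \<Longrightarrow> e \<noteq> c \<Longrightarrow> \<exists>r. rsimple e n r"
proof -
  obtain f where f: "\<And>e. e \<in> Cs \<Longrightarrow> f e \<in> RS \<xi> n" "\<And>e. e \<in> Cs \<Longrightarrow> pure e (f e)" "inj_on f Cs"
    using color_choice[OF n] by metis
  define S where "S = {v, v'} \<union> f ` (Cs - {c})"
  have disj: "\<not> pure c (f e)" if "e \<in> Cs - {c}" for e
    using that RS_pure_unique[OF f(1)[of e] n _ f(2)[of e] c] by blast
  have "card (f ` (Cs - {c})) = K - 2"
    using card_image[of f "Cs - {c}"] inj_on_subset[OF f(3), of "Cs - {c}"] Cs c finCs by simp
  moreover have "{v, v'} \<inter> f ` (Cs - {c}) = {}" using disj v by blast
  ultimately have "card S = 2 + (K - 2)" unfolding S_def using finCs v(3) by (subst card_Un_disjoint) auto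
  then have cS: "card S \<ge> K" using K4 by simp
  have S: "S \<subseteq> RS \<xi> n" unfolding S_def using v f by auto
  note full = RS_full[OF n S cS]
  show "card (rx \<xi> v) = 2" "card (rx \<xi> v') = 2" using full(2) unfolding S_def by auto
  show "w = v \<or> w = v'" if "w \<in> RS \<xi> n" "pure c w" for w
    using that full(1) disj unfolding S_def by auto
  have simp_f: "rsimple e n (f e)" if e: "e \<in> Cs - {c}" for e
    unfolding rsimple_def
  proof (intro conjI ballI impI)
    show "f e \<in> RS \<xi> n" "pure e (f e)" using f e by auto
    show "card (rx \<xi> (f e)) = 2" using full(2)[of "f e"] e unfolding S_def by auto
    fix w assume w: "w \<in> RS \<xi> n" "pure e w"
    have "w \<noteq> v" "w \<noteq> v'" using RS_pure_unique[OF w(1) n _ w(2) c] v e by auto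
    then obtain e' where e': "e' \<in> Cs - {c}" "w = f e'" using w(1) full(1) unfolding S_def by auto
    then have "e' = e" using RS_pure_unique[OF w(1) n f(2)[of e', folded e'(2)] w(2)] e by auto
    then show "w = f e" using e' by simp
  qed
  show "\<exists>e\<in>Cs - {c}. rsimple e n w" if "w \<in> RS \<xi> n" "\<not> pure c w" for w
    using that full(1) v simp_f unfolding S_def by auto
  show "\<exists>r. rsimple e n r" if "e \<in> Cs" "e \<noteq> c" for e using simp_f that by blast
qed

text \<open>If two colors failed, neither could have two right special words, since
  \<open>RS_struct\<close> would make the other one simple; so each has a single one with at least
  three extensions. The excess would be at least \<open>(K - 3) + 2 + 2 = K + 1\<close>.\<close>

lemma not_rsimple:
  assumes n: "n \<ge> N0" and c: "c \<in> Cs" "\<And>r. \<not> rsimple c n r" and e: "e \<in> Cs" "e \<noteq> c"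
  shows "\<exists>r. rsimple e n r"
proof (rule ccontr)
  assume neg: "\<not> (\<exists>r. rsimple e n r)"
  obtain f where f: "\<And>e. e \<in> Cs \<Longrightarrow> f e \<in> RS \<xi> n" "\<And>e. e \<in> Cs \<Longrightarrow> pure e (f e)" "inj_on f Cs"
    using color_choice[OF n] by metis
  have only: "v = f a" if "a \<in> {c, e}" "v \<in> RS \<xi> n" "pure a v" for a v
  proof (rule ccontr)
    assume "v \<noteq> f a"
    then have "\<And>b. b \<in> Cs \<Longrightarrow> b \<noteq> a \<Longrightarrow> \<exists>r. rsimple b n r"
      using RS_struct(5)[OF n _ that(2) f(1)[of a] _ that(3) f(2)[of a]] that(1) c e by auto
    then show False using neg c e that(1) by blast
  qed
  have deg3: "card (rx \<xi> (f a)) \<ge> 3" if "a \<in> {c, e}" for a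
  proof -
    have "card (rx \<xi> (f a)) \<noteq> 2"
      using only[OF that] neg c(2) f(1,2)[of a] that c(1) e(1) unfolding rsimple_def by blast
    then show ?thesis using RS_rx[OF f(1)[of a]] that c e by auto
  qed
  have "K + 1 = (\<Sum>a\<in>Cs. if a = c \<or> a = e then 2 else 1)"
  proof -
    have "(\<Sum>a\<in>Cs. if a = c \<or> a = e then 2 else 1) = (\<Sum>a\<in>Cs. 1 + (if a = c then 1 else 0) + (if a = e then 1 else (0::nat)))"
      by (rule sum.cong) (use e in auto)
    also have "\<dots> = card Cs + 1 + 1" using c e finCs by (simp only: sum.distrib) simp
    finally show ?thesis using Cs K4 by simp
  qed
  also have "\<dots> \<le> (\<Sum>a\<in>Cs. card (rx \<xi> (f a)) - 1)"
  proof (rule sum_mono)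
    fix a assume a: "a \<in> Cs"
    show "(if a = c \<or> a = e then 2 else 1) \<le> card (rx \<xi> (f a)) - 1"
      using deg3[of a] RS_rx[OF f(1)[OF a]] by auto
  qed
  also have "\<dots> = (\<Sum>v\<in>f ` Cs. card (rx \<xi> v) - 1)" by (simp add: sum.reindex[OF f(3)])
  also have "\<dots> \<le> K" using f by (intro RS_sum_le[OF n]) auto
  finally show False by simp
qed

section \<open>A color with a single right special word is periodic on long stretches\<close>

lemma other_color: "c \<in> Cs \<Longrightarrow> \<exists>e\<in>Cs. e \<noteq> c"
proof -
  assume "c \<in> Cs"
  have "card {c} < card Cs" using Cs K4 by simp
  then have "\<not> Cs \<subseteq> {c}" by (metis card_mono finite.emptyI finite.insertI linorder_not_le)
  then show ?thesis by blast
qed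

text \<open>A third color exists because \<open>K - 1 \<ge> 3\<close>; it refutes, for instance,
  situations in which two colors alternate forever.\<close>

lemma other_color2: "\<exists>e\<in>Cs. e \<noteq> c \<and> e \<noteq> c'"
proof -
  have "card {c, c'} \<le> 2" by (simp add: card_insert_if)
  then have "card {c, c'} < card Cs" using Cs K4 by simp
  then have "\<not> Cs \<subseteq> {c, c'}" by (metis card_mono finite.emptyI finite.insertI linorder_not_le)
  then show ?thesis by blast
qed

text \<open>By \<open>closed_fwd\<close> all words would have color \<open>c\<close>, but
  \<open>color_RS\<close> provides a word of another color.\<close>

lemma closed_pure:
  assumes n: "n \<ge> N0" and c: "c \<in> Cs"
    and S: "\<And>v. v \<in> S \<Longrightarrow> pure c v" "blk \<xi> n i0 \<in> S" "\<And>i. blk \<xi> n i \<in> S \<Longrightarrow> blk \<xi> n (i + 1) \<in> S"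
  shows False
proof -
  obtain e where e: "e \<in> Cs" "e \<noteq> c" using other_color[OF c] by blast
  obtain v where v: "v \<in> RS \<xi> n" "pure e v" using color_RS[OF n e(1)] by blast
  then obtain j where "v = blk \<xi> n j" unfolding RS_def by blast
  then have "v \<in> S" using closed_fwd[of n i0 S j] S(2,3) by blast
  then show False using RS_pure_unique[OF v(1) n S(1) v(2) c e(1)] e(2) by blast
qed

text \<open>Both continuations of the only right special word of color \<open>c\<close> cannot
  return into a set of words of that color, for the set would be closed. Hence long stretches of
  color \<open>c\<close> must always take the same letter after \<open>r\<close>.\<close>

lemma escape:
  assumes n: "n \<ge> N0" and c: "c \<in> Cs" and r: "rsimple c n r"
    and S: "\<And>v. v \<in> S \<Longrightarrow> pure c v" "\<And>i. blk \<xi> n i \<in> S \<Longrightarrow> blk \<xi> n i \<notin> RS \<xi> n \<Longrightarrow> blk \<xi> n (i + 1) \<in> S"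
    and y: "blk \<xi> n y1 = r" "blk \<xi> n y2 = r" "\<xi> (y1 + int n) \<noteq> \<xi> (y2 + int n)"
      "blk \<xi> n (y1 + 1) \<in> S" "blk \<xi> n (y2 + 1) \<in> S"
  shows False
proof (rule closed_pure[OF n c S(1) y(4)])
  fix i assume i: "blk \<xi> n i \<in> S"
  show "blk \<xi> n (i + 1) \<in> S"
  proof (cases "blk \<xi> n i \<in> RS \<xi> n")
    case True
    then have ir: "blk \<xi> n i = r" using r S(1)[OF i] unfolding rsimple_def by blast
    have "card (rx \<xi> (blk \<xi> n y1)) = 2" using r y(1) unfolding rsimple_def by simp
    from two_letters[OF this, of y2 i] have "\<xi> (i + int n) = \<xi> (y1 + int n) \<or> \<xi> (i + int n) = \<xi> (y2 + int n)"
      using y ir by simp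
    then show ?thesis using blk_step[of \<xi> n i \<xi> y1] blk_step[of \<xi> n i \<xi> y2] y ir by auto
  qed (use S(2) i in blast)
qed

text \<open>In a typical stretch of \<open>c\<close> only \<open>r\<close> leaves a choice, and
  \<open>escape\<close> fixes the letter taken there. The stretch is therefore periodic with the
  first return time of \<open>r\<close> as period, and \<open>\<pi>\<close> is its periodic
  continuation.\<close>

lemma loop_of_rsimple:
  assumes n: "n \<ge> N0" and c: "c \<in> Cs" and r: "rsimple c n r"
  obtains \<pi> l where "0 < l" "l \<le> (K + 2) * n" "\<And>k. \<pi> (k + int l) = \<pi> k"
    "\<And>t \<kappa>. n \<le> t \<Longrightarrow> t \<le> reach n \<Longrightarrow> dev c (blk \<pi> t \<kappa>) \<le> eps / 4 * real t"
    "occ \<xi> \<pi> (reach n)" "blk \<pi> n 0 = r" "\<And>\<kappa>. blk \<pi> n \<kappa> = r \<Longrightarrow> int l dvd \<kappa>"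
proof -
  obtain i0 where i0: "\<And>t k. n \<le> t \<Longrightarrow> i0 \<le> k \<Longrightarrow> k + int t \<le> i0 + int (M * n) \<Longrightarrow> dev c (blk \<xi> t k) \<le> eps / 4 * real t"
    using window[OF n order_refl c] by blast
  define p where "p = int ((K + 1) * n)"
  define L where "L = i0 + int (M * n)"
  have pn: "p \<ge> int n" "n \<ge> 1" using n N0 by (auto simp: p_def)
  have reach: "int (reach n) + 3 * p + 5 * int n = int (M * n)"
    using reach_eq[of n] by (simp add: p_def algebra_simps)
  have T2: "int (reach n) \<ge> 2 * p + 10 * int n"
  proof -
    have "(2 * (K + 1) + 10) * n \<le> reach n" using M_large by (intro reach_ge) simp
    then have "int ((2 * (K + 1) + 10) * n) \<le> int (reach n)" by (simp only: of_nat_le_iff)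
    then show ?thesis by (simp add: p_def algebra_simps)
  qed
  have pu: "pure c (blk \<xi> n k)" if "i0 \<le> k" "k + int n \<le> L" for k
  proof -
    have "dev c (blk \<xi> n k) \<le> eps / 4 * real n" using that by (intro i0) (auto simp: L_def)
    also have "\<dots> \<le> eps * real n" using eps0 by (intro mult_right_mono) auto
    finally show ?thesis by (simp add: pure_def)
  qed
  have RSr: "blk \<xi> n k = r" if "i0 \<le> k" "k + int n \<le> L" "blk \<xi> n k \<in> RS \<xi> n" for k
    using r pu that unfolding rsimple_def by blast
  have nxt: "\<exists>k\<ge>i. k \<le> i + p \<and> blk \<xi> n k = r" if "i0 \<le> i" "i + p + int n \<le> L" for i
  proof -
    obtain k where "k \<ge> i" "k \<le> i + p" "blk \<xi> n k \<in> RS \<xi> n"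
      using RS_within[OF n, of i] unfolding p_def by blast
    then show ?thesis using RSr[of k] that by auto
  qed
  obtain i1 where i1: "i0 \<le> i1" "i1 \<le> i0 + p" "blk \<xi> n i1 = r"
    using nxt[of i0] reach T2 pn unfolding L_def by auto
  define P where "P d \<longleftrightarrow> d > 0 \<and> blk \<xi> n (i1 + int d) = r" for d
  obtain k2 where k2: "k2 \<ge> i1 + 1" "k2 \<le> i1 + 1 + p" "blk \<xi> n k2 = r"
    using nxt[of "i1 + 1"] reach T2 pn i1 unfolding L_def by auto
  have P2: "P (nat (k2 - i1))" using k2 by (simp add: P_def)
  define l where "l = (LEAST d. P d)"
  have Pl: "P l" unfolding l_def by (rule LeastI[where P = P, OF P2])
  have l0: "l > 0" using Pl by (simp add: P_def)
  have "l \<le> nat (k2 - i1)" unfolding l_def by (rule Least_le[where P = P, OF P2])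
  then have lp: "int l \<le> p + 1" using k2 by simp
  have lmin: "blk \<xi> n (i1 + int d) \<noteq> r" if "0 < d" "d < l" for d
    using not_less_Least[of d P] that unfolding l_def P_def by auto
  have il: "blk \<xi> n (i1 + int l) = r" using Pl by (simp add: P_def)
  \<comment> \<open>Away from the end of the window the next \<open>r\<close> after \<open>y\<close>
    is still inside it. Two different letters after \<open>r\<close> would give two paths of color
    \<open>c\<close> from \<open>r\<close> to \<open>r\<close>, and \<open>escape\<close> applies to
    their union.\<close>
  have letter: "\<xi> (y + int n) = \<xi> (i1 + int n)"
    if y: "i0 \<le> y" "y + p + 1 + int n \<le> L" "blk \<xi> n y = r" for y
  proof (rule ccontr)
    assume ne: "\<xi> (y + int n) \<noteq> \<xi> (i1 + int n)"
    obtain z where z: "z \<ge> y + 1" "z \<le> y + 1 + p" "blk \<xi> n z = r"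
      using nxt[of "y + 1"] y by auto
    define S where "S = blk \<xi> n ` {y..z} \<union> blk \<xi> n ` {i1..k2}"
    have "k2 + int n \<le> L" using k2 i1 reach T2 pn unfolding L_def by linarith
    then have Sp: "pure c v" if "v \<in> S" for v
      using that y z i1 k2 unfolding S_def by (auto intro!: pu)
    have rRS: "r \<in> RS \<xi> n" using r by (simp add: rsimple_def)
    have cl: "blk \<xi> n (k + 1) \<in> S" if k: "blk \<xi> n k \<in> S" "blk \<xi> n k \<notin> RS \<xi> n" for k
    proof -
      obtain x where x: "x \<in> {y..z} \<union> {i1..k2}" "blk \<xi> n k = blk \<xi> n x" using k(1) unfolding S_def by blast
      have "x \<noteq> z" "x \<noteq> k2" using x(2) k(2) rRS z k2 by auto
      then have "x + 1 \<in> {y..z} \<union> {i1..k2}" using x(1) by auto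
      moreover have "blk \<xi> n (k + 1) = blk \<xi> n (x + 1)" by (rule blk_step[OF x(2) det_fwd[OF x(2) k(2)]])
      ultimately show ?thesis unfolding S_def by auto
    qed
    show False
    proof (rule escape[OF n c r Sp cl])
      show "blk \<xi> n y = r" "blk \<xi> n i1 = r" "\<xi> (y + int n) \<noteq> \<xi> (i1 + int n)" using y i1 ne by auto
      show "blk \<xi> n (y + 1) \<in> S" "blk \<xi> n (i1 + 1) \<in> S" using z k2 unfolding S_def by auto
    qed
  qed
  \<comment> \<open>The largest shift for which the translate by \<open>l\<close> still stays a full
    waiting time away from the end \<open>L\<close>, so that \<open>letter\<close> applies to both
    copies.\<close>
  define E where "E = L - int n - p - (i1 + int l)"
  have E: "E + int n \<ge> int (reach n)" using reach i1 lp pn unfolding E_def L_def by linarith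
  have per: "blk \<xi> n (i1 + int t) = blk \<xi> n (i1 + int l + int t)" if "int t \<le> E" for t
    using that
  proof (induction t)
    case 0
    then show ?case using il i1 by simp
  next
    case (Suc t)
    then have IH: "blk \<xi> n (i1 + int t) = blk \<xi> n (i1 + int l + int t)" by simp
    have "\<xi> (i1 + int t + int n) = \<xi> (i1 + int l + int t + int n)"
    proof (cases "blk \<xi> n (i1 + int t) \<in> RS \<xi> n")
      case False
      show ?thesis by (rule det_fwd[OF IH False])
    next
      case True
      have b: "i1 + int l + int t + p + 1 + int n \<le> L" using Suc.prems unfolding E_def by simp
      have "blk \<xi> n (i1 + int t) = r" using True b i1 l0 pn by (intro RSr) auto
      then show ?thesis using letter[of "i1 + int t"] letter[of "i1 + int l + int t"] IH b i1 l0 by simp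
    qed
    from blk_step[OF IH this] show ?case by (simp add: algebra_simps)
  qed
  have per': "\<xi> (i1 + x) = \<xi> (i1 + int l + x)" if "0 \<le> x" "x < E + int n" for x
  proof (cases "x \<le> E")
    case True
    have "blk \<xi> n (i1 + x) = blk \<xi> n (i1 + int l + x)" using per[of "nat x"] True that by simp
    from blk_eqD[OF this, of 0] show ?thesis using pn by simp
  next
    case False
    have "E \<ge> 0" using E T2 pn by linarith
    then have "blk \<xi> n (i1 + E) = blk \<xi> n (i1 + int l + E)" using per[of "nat E"] by simp
    from blk_eqD[OF this, of "x - E"] show ?thesis using False that by (simp add: algebra_simps)
  qed
  define \<pi> where "\<pi> k = \<xi> (i1 + k mod int l)" for k
  have \<pi>per: "\<pi> (k + int l) = \<pi> k" for k by (simp add: \<pi>_def)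
  have \<pi>nat: "\<pi> (int x) = \<xi> (i1 + int x)" if "int x < E + int n + int l" for x
    using that
  proof (induction x rule: less_induct)
    case (less x)
    show ?case
    proof (cases "x < l")
      case True then show ?thesis by (simp add: \<pi>_def)
    next
      case False
      have "\<pi> (int x) = \<pi> (int (x - l) + int l)" using False by (simp add: of_nat_diff)
      also have "\<dots> = \<pi> (int (x - l))" by (rule \<pi>per)
      also have "\<dots> = \<xi> (i1 + int (x - l))" using less.IH[of "x - l"] less.prems False l0 by simp
      also have "\<dots> = \<xi> (i1 + int l + int (x - l))" using less.prems False by (intro per') auto
      finally show ?thesis using False by (simp add: of_nat_diff)
    qed
  qed
  have \<pi>blk: "blk \<pi> t \<kappa> = blk \<xi> t (i1 + \<kappa> mod int l)" if "int t \<le> E + int n" for t \<kappa>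
  proof (rule blk_eqI)
    fix s assume s: "0 \<le> s" "s < int t"
    have km: "0 \<le> \<kappa> mod int l" "\<kappa> mod int l < int l" using l0 by simp_all
    have "\<pi> (\<kappa> + s) = \<pi> (\<kappa> mod int l + s)" by (simp add: \<pi>_def mod_add_left_eq)
    also have "\<dots> = \<xi> (i1 + (\<kappa> mod int l + s))"
      using \<pi>nat[of "nat (\<kappa> mod int l + s)"] s km that by simp
    finally show "\<pi> (\<kappa> + s) = \<xi> (i1 + \<kappa> mod int l + s)" by (simp add: add.assoc)
  qed
  show thesis
  proof (rule that)
    show "0 < l" by (rule l0)
    have "int l \<le> int ((K + 2) * n)" using lp pn unfolding p_def by (simp add: algebra_simps)
    then show "l \<le> (K + 2) * n" by (simp only: of_nat_le_iff)
    show "\<pi> (k + int l) = \<pi> k" for k by (rule \<pi>per)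
    show "dev c (blk \<pi> t \<kappa>) \<le> eps / 4 * real t" if t: "n \<le> t" "t \<le> reach n" for t \<kappa>
    proof -
      have km: "0 \<le> \<kappa> mod int l" "\<kappa> mod int l < int l" using l0 by simp_all
      have "int t \<le> int (reach n)" using t by simp
      then have "dev c (blk \<xi> t (i1 + \<kappa> mod int l)) \<le> eps / 4 * real t"
        using t i1 km lp reach pn by (intro i0) linarith+
      then show ?thesis using \<pi>blk[of t \<kappa>] t E by simp
    qed
    show "occ \<xi> \<pi> (reach n)" unfolding occ_def using \<pi>blk[of "reach n"] E by metis
    have nE: "int n \<le> E + int n" using E T2 pn by linarith
    show "blk \<pi> n 0 = r" using \<pi>blk[OF nE, of 0] i1 by simp
    \<comment> \<open>A nonzero residue would be an earlier return of \<open>r\<close>.\<close>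
    show "int l dvd \<kappa>" if "blk \<pi> n \<kappa> = r" for \<kappa>
    proof (rule ccontr)
      assume "\<not> int l dvd \<kappa>"
      then have nz: "\<kappa> mod int l \<noteq> 0" by (simp add: dvd_eq_mod_eq_0)
      have km: "0 \<le> \<kappa> mod int l" "\<kappa> mod int l < int l" using l0 by simp_all
      have "blk \<xi> n (i1 + int (nat (\<kappa> mod int l))) = r" using \<pi>blk[OF nE, of \<kappa>] that km by simp
      moreover have "nat (\<kappa> mod int l) < l" using km by linarith
      ultimately show False using lmin[of "nat (\<kappa> mod int l)"] km nz by simp
    qed
  qed
qed

end

section \<open>Loops\<close>

text \<open>\<open>Max\<close> is meaningful only for a finite set; for loops this is
  \<open>ploop_depth\<close>.\<close>

definition depth :: "(int \<Rightarrow> 'a) \<Rightarrow> (int \<Rightarrow> 'a) \<Rightarrow> nat" where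
  "depth x \<pi> = Max {n. occ x \<pi> n}"

lemma depth_rv: "depth (rv x) (rv \<pi>) = depth x \<pi>"
  by (simp add: depth_def occ_rv)

lemma blk_prefix_ne: "blk x n i \<noteq> blk y n j \<Longrightarrow> n \<le> k \<Longrightarrow> blk x k i \<noteq> blk y k j"
  using blk_take by blast

definition per :: "nat \<Rightarrow> (int \<Rightarrow> 'a) \<Rightarrow> bool" where
  "per l \<pi> \<longleftrightarrow> (\<forall>k. \<pi> (k + int l) = \<pi> k)"

lemma periodic_mult:
  assumes "per l \<pi>"
  shows "\<pi> (k + int l * q) = \<pi> k"
proof -
  have nat: "\<pi> (k + int l * int q) = \<pi> k" for k q
  proof (induction q)
    case (Suc q)
    have "\<pi> (k + int l * int (Suc q)) = \<pi> (k + int l * int q + int l)" by (simp add: algebra_simps)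
    then show ?case using assms Suc by (simp add: per_def)
  qed simp
  show ?thesis
  proof (cases "q \<ge> 0")
    case True then show ?thesis using nat[of k "nat q"] by simp
  next
    case False
    have "\<pi> (k + int l * q + int l * int (nat (- q))) = \<pi> (k + int l * q)" by (rule nat)
    moreover have "k + int l * q + int l * int (nat (- q)) = k" using False by (simp add: algebra_simps)
    ultimately show ?thesis by (simp only:)
  qed
qed

lemma periodic_mod:
  assumes "per l \<pi>"
  shows "\<pi> (k mod int l) = \<pi> k"
  using periodic_mult[OF assms, of "k mod int l" "k div int l"] by (simp add: add.commute)

text \<open>Moving by a multiple of \<open>l * l'\<close> brings any \<open>t\<close> to the
  nonnegative side.\<close>

lemma periodic_shift_eq:
  assumes "l > 0" "per l \<pi>" "l' > 0" "per l' \<rho>"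
    and "\<And>t. t \<ge> 0 \<Longrightarrow> \<pi> (a + t) = \<rho> (b + t)"
  shows "\<pi> (a + t) = \<rho> (b + t)"
proof -
  define s where "s = int (l * l') * \<bar>t\<bar>"
  have "int (l * l') \<ge> 1" using assms(1,3) by (metis One_nat_def Suc_leI nat_0_less_mult_iff of_nat_1 of_nat_le_iff)
  then have "s \<ge> \<bar>t\<bar>" unfolding s_def using mult_right_mono[of 1 "int (l * l')" "\<bar>t\<bar>"] by simp
  then have "\<pi> (a + (t + s)) = \<rho> (b + (t + s))" by (intro assms(5)) simp
  moreover have "\<pi> (a + t + int l * (int l' * \<bar>t\<bar>)) = \<pi> (a + t)" by (rule periodic_mult[OF assms(2)])
  moreover have "\<rho> (b + t + int l' * (int l * \<bar>t\<bar>)) = \<rho> (b + t)" by (rule periodic_mult[OF assms(4)])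
  ultimately show ?thesis by (simp add: s_def algebra_simps)
qed

context colored_sequence
begin

text \<open>The tolerance is demanded for all lengths from \<open>n\<close> on, not only up to
  \<open>reach n\<close>, so that a loop stays one for larger \<open>n\<close>;
  \<open>dev_concat\<close> provides it.\<close>

definition ploop :: "'c \<Rightarrow> nat \<Rightarrow> (int \<Rightarrow> 'a) \<Rightarrow> bool" where
  "ploop c n \<pi> \<longleftrightarrow> (\<exists>l>0. l \<le> (K + 2) * n \<and> per l \<pi>) \<and>
     (\<forall>t\<ge>n. \<forall>\<kappa>. dev c (blk \<pi> t \<kappa>) \<le> eps / 2 * real t)"

text \<open>A loop is a periodic sequence of which \<open>\<xi>\<close> contains long stretches, with a unique entrance and a
  unique exit: \<open>\<xi>\<close> enters it only at the phase \<open>g\<close>, coming from the letter \<open>b\<close>, and leaves it only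
  at the phase \<open>h\<close>, with the letter \<open>d\<close>.\<close>

definition loop :: "'c \<Rightarrow> nat \<Rightarrow> (int \<Rightarrow> 'a) \<Rightarrow> int \<Rightarrow> 'a \<Rightarrow> int \<Rightarrow> 'a \<Rightarrow> bool" where
  "loop c n \<pi> g b h d \<longleftrightarrow> ploop c n \<pi> \<and> occ \<xi> \<pi> (reach n) \<and>
     (\<forall>\<kappa> \<kappa>'. blk \<pi> n \<kappa> = blk \<pi> n \<kappa>' \<longrightarrow> (\<forall>t. \<pi> (\<kappa> + t) = \<pi> (\<kappa>' + t))) \<and>
     (\<forall>j \<kappa>. blk \<xi> n j = blk \<pi> n \<kappa> \<longrightarrow> \<xi> (j - 1) \<noteq> \<pi> (\<kappa> - 1) \<longrightarrow>
        \<xi> (j - 1) = b \<and> (\<forall>t. \<pi> (\<kappa> + t) = \<pi> (g + t))) \<and>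
     (\<forall>j \<kappa>. blk \<xi> n j = blk \<pi> n \<kappa> \<longrightarrow> \<xi> (j + int n) \<noteq> \<pi> (\<kappa> + int n) \<longrightarrow>
        \<xi> (j + int n) = d \<and> (\<forall>t. \<pi> (\<kappa> + int n + t) = \<pi> (h + t)))"

lemma ploop_mono: "ploop c n \<pi> \<Longrightarrow> n \<le> n' \<Longrightarrow> ploop c n' \<pi>"
  unfolding ploop_def using mult_le_mono2[of n n' "K + 2"] by (auto intro: order_trans)

lemma ploop_pure: "ploop c n \<pi> \<Longrightarrow> n \<le> t \<Longrightarrow> pure c (blk \<pi> t \<kappa>)"
proof -
  assume a: "ploop c n \<pi>" "n \<le> t"
  then have "dev c (blk \<pi> t \<kappa>) \<le> eps / 2 * real t" by (simp add: ploop_def)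
  also have "\<dots> \<le> eps * real t" using eps0 by (intro mult_right_mono) auto
  finally show ?thesis by (simp add: pure_def)
qed

text \<open>If \<open>\<xi>\<close> agreed with \<open>\<pi>\<close> on a stretch longer than a
  recurrence gap, that stretch would contain all words of length \<open>N\<close>. Periodicity
  leaves at most \<open>l\<close> of them, while there are \<open>K * N + C > l\<close>.\<close>

lemma ploop_depth:
  assumes "ploop c n \<pi>"
  shows "occ \<xi> \<pi> k \<longleftrightarrow> k \<le> depth \<xi> \<pi>"
proof -
  obtain l where l: "l > 0" "per l \<pi>" using assms unfolding ploop_def by blast
  define N where "N = N0 + l + 1"
  obtain G where G: "\<And>i j. \<exists>k. j \<le> k \<and> k \<le> j + int G \<and> blk \<xi> N k = blk \<xi> N i" using urec by metis
  have no: "\<not> occ \<xi> \<pi> (N + G)"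
  proof
    assume "occ \<xi> \<pi> (N + G)"
    then obtain j where j: "blk \<xi> (N + G) j = blk \<pi> (N + G) 0" unfolding occ_def by blast
    have "facs \<xi> N \<subseteq> (\<lambda>q. blk \<pi> N (int q)) ` {..<l}"
    proof
      fix v assume "v \<in> facs \<xi> N"
      then obtain i where i: "v = blk \<xi> N i" by (auto simp: facs_def)
      obtain k where k: "j \<le> k" "k \<le> j + int G" "blk \<xi> N k = v" using G[of j i] i by auto
      have "blk \<xi> N k = blk \<pi> N (0 + k - j)" using k by (intro blk_sub'[OF j]) auto
      moreover have "blk \<pi> N (0 + k - j) = blk \<pi> N (int (nat ((k - j) mod int l)))"
      proof (rule blk_eqI)
        fix t
        have "\<pi> (0 + k - j + t) = \<pi> ((k - j + t) mod int l)" using periodic_mod[OF l(2)] by simp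
        also have "\<dots> = \<pi> (((k - j) mod int l + t) mod int l)" by (simp add: mod_add_left_eq)
        also have "\<dots> = \<pi> ((k - j) mod int l + t)" by (rule periodic_mod[OF l(2)])
        finally show "\<pi> (0 + k - j + t) = \<pi> (int (nat ((k - j) mod int l)) + t)" using l(1) by simp
      qed
      moreover have "nat ((k - j) mod int l) < l" using l(1) by (simp add: nat_less_iff)
      ultimately show "v \<in> (\<lambda>q. blk \<pi> N (int q)) ` {..<l}" using k(3)
        by (intro rev_image_eqI[of "nat ((k - j) mod int l)"]) (simp_all only: lessThan_iff)
    qed
    then have "card (facs \<xi> N) \<le> l" by (metis card_lessThan finite_lessThan surj_card_le)
    then have "K * N + C \<le> l" using comp[of N] by (simp add: N_def)
    moreover have "N \<le> K * N" using K4 by simp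
    ultimately show False by (simp add: N_def)
  qed
  have "\<And>k. occ \<xi> \<pi> k \<Longrightarrow> k < N + G" using no occ_mono by (metis not_le_imp_less)
  then have fin: "finite {k. occ \<xi> \<pi> k}" using finite_nat_set_iff_bounded by blast
  have "occ \<xi> \<pi> 0" by (simp add: occ_def)
  then have "occ \<xi> \<pi> (depth \<xi> \<pi>)" unfolding depth_def using Max_in[OF fin] by blast
  then show ?thesis using occ_mono Max_ge[OF fin, of k] unfolding depth_def by blast
qed

text \<open>Otherwise the blocks of \<open>\<pi>\<close> would form a closed set of one
  color.\<close>

lemma ploop_exit:
  assumes "ploop c n \<pi>" "c \<in> Cs" "n \<le> n'" "N0 \<le> n'" "occ \<xi> \<pi> n'"
  shows "\<exists>j \<kappa>. blk \<xi> n' j = blk \<pi> n' \<kappa> \<and> \<xi> (j + int n') \<noteq> \<pi> (\<kappa> + int n')"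
proof (rule ccontr)
  assume neg: "\<not> ?thesis"
  obtain j0 where "blk \<xi> n' j0 = blk \<pi> n' 0" using assms(5) unfolding occ_def by blast
  show False
  proof (rule closed_pure[OF assms(4,2), of "range (blk \<pi> n')" j0])
    show "\<And>v. v \<in> range (blk \<pi> n') \<Longrightarrow> pure c v" using ploop_pure[OF assms(1,3)] by auto
    show "blk \<xi> n' j0 \<in> range (blk \<pi> n')" using \<open>blk \<xi> n' j0 = blk \<pi> n' 0\<close> by simp
    fix i assume "blk \<xi> n' i \<in> range (blk \<pi> n')"
    then obtain \<kappa> where \<kappa>: "blk \<xi> n' i = blk \<pi> n' \<kappa>" by blast
    then have "\<xi> (i + int n') = \<pi> (\<kappa> + int n')" using neg by blast
    from blk_step[OF \<kappa> this] show "blk \<xi> n' (i + 1) \<in> range (blk \<pi> n')" by simp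
  qed
qed

text \<open>Cut off pieces of length \<open>n\<close> until less than \<open>2 * n\<close> remains;
  each cut costs \<open>m\<close>, which is at most \<open>eps / 4 * n\<close>. The induction
  carries an additional \<open>m\<close> to pay for the next cut.\<close>

lemma dev_concat:
  assumes n: "n \<ge> N0" and c: "c \<in> Cs"
    and blocks: "\<And>t \<kappa>. n \<le> t \<Longrightarrow> t < 2 * n \<Longrightarrow> dev c (blk x t \<kappa>) \<le> eps / 4 * real t"
  shows "n \<le> t \<Longrightarrow> dev c (blk x t \<kappa>) \<le> eps / 2 * real t"
proof -
  have m8: "m \<le> eps / 4 * real n" using small_n[OF n] m0 eps0 by simp
  have n0: "n > 0" using n N0 by simp
  have "n \<le> t \<Longrightarrow> dev c (blk x t \<kappa>) + m \<le> eps / 2 * real t" for t \<kappa>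
  proof (induction t arbitrary: \<kappa> rule: less_induct)
    case (less t)
    show ?case
    proof (cases "t < 2 * n")
      case True
      have "eps / 4 * real n \<le> eps / 4 * real t" using less.prems eps0 by (intro mult_left_mono) auto
      then show ?thesis using blocks[OF less.prems True, of \<kappa>] m8 by linarith
    next
      case False
      have t: "t = n + (t - n)" using False by simp
      have "dev c (blk x t \<kappa>) \<le> dev c (blk x n \<kappa>) + dev c (blk x (t - n) (\<kappa> + int n)) + m"
        by (subst t, subst blk_append) (rule dev_app[OF c])
      moreover have "dev c (blk x (t - n) (\<kappa> + int n)) + m \<le> eps / 2 * real (t - n)"
        using False n0 by (intro less.IH) auto
      moreover have "dev c (blk x n \<kappa>) \<le> eps / 4 * real n" using n0 by (intro blocks) auto
      moreover have "eps / 2 * real t = eps / 2 * real n + eps / 2 * real (t - n)"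
        using False by (simp add: distrib_left[symmetric])
      ultimately show ?thesis using m8 by linarith
    qed
  qed
  from this[of t \<kappa>] show "n \<le> t \<Longrightarrow> dev c (blk x t \<kappa>) \<le> eps / 2 * real t" using m0 by linarith
qed

lemma ploop_of_rsimple:
  assumes n: "n \<ge> N0" and c: "c \<in> Cs" and r: "rsimple c n r"
  shows "\<exists>\<pi> l. ploop c n \<pi> \<and> occ \<xi> \<pi> (reach n) \<and> 0 < l \<and> per l \<pi> \<and> blk \<pi> n 0 = r \<and>
    (\<forall>\<kappa>. blk \<pi> n \<kappa> = r \<longrightarrow> int l dvd \<kappa>)"
proof (rule loop_of_rsimple[OF n c r])
  fix l and \<pi> :: "int \<Rightarrow> 'a"
  assume \<pi>: "0 < l" "l \<le> (K + 2) * n" "\<And>k. \<pi> (k + int l) = \<pi> k"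
    "\<And>t \<kappa>. n \<le> t \<Longrightarrow> t \<le> reach n \<Longrightarrow> dev c (blk \<pi> t \<kappa>) \<le> eps / 4 * real t"
    "occ \<xi> \<pi> (reach n)" "blk \<pi> n 0 = r" "\<And>\<kappa>. blk \<pi> n \<kappa> = r \<Longrightarrow> int l dvd \<kappa>"
  have "2 * n \<le> reach n" using M_large by (intro reach_ge) simp
  then have "dev c (blk \<pi> t \<kappa>) \<le> eps / 2 * real t" if "n \<le> t" for t \<kappa>
    using dev_concat[OF n c \<pi>(4)] that by auto
  moreover have "per l \<pi>" using \<pi>(3) by (simp add: per_def)
  ultimately have "ploop c n \<pi>" unfolding ploop_def using \<pi>(1,2) by blast
  then show ?thesis using \<pi> \<open>per l \<pi>\<close> by blast
qed

lemma reach_gt: "n \<ge> N0 \<Longrightarrow> n + 10 \<le> reach n"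
proof -
  assume "n \<ge> N0"
  then have "n + 10 \<le> 11 * n" using N0 by simp
  also have "\<dots> \<le> reach n" using M_large by (intro reach_ge) simp
  finally show ?thesis .
qed

lemma occ_det:
  assumes "occ \<xi> \<pi> (Suc n)" "blk \<xi> n i = blk \<pi> n \<kappa>" "blk \<xi> n i \<notin> RS \<xi> n"
  shows "\<xi> (i + int n) = \<pi> (\<kappa> + int n)"
proof -
  obtain j where "blk \<xi> (Suc n) j = blk \<pi> (Suc n) \<kappa>" using assms(1) unfolding occ_def by blast
  then have j: "blk \<xi> n j = blk \<pi> n \<kappa>" "\<xi> (j + int n) = \<pi> (\<kappa> + int n)" by (auto simp: blk_Suc_eq)
  then show ?thesis using det_fwd[of n i j] assms by simp
qed

text \<open>Equal blocks of \<open>\<pi>\<close> evolve equally, since a choice exists only at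
  \<open>r\<close>, whose phase is known modulo \<open>l\<close>. Exits can happen only at
  \<open>r\<close> and entrances only at \<open>s\<close>; each of these words has two extensions,
  one of which belongs to \<open>\<pi>\<close>, so the other letter is determined.\<close>

lemma loop_of_simple:
  assumes n: "n \<ge> N0" and c: "c \<in> Cs" and r: "rsimple c n r" and s: "lsimple c n s"
  shows "\<exists>\<pi> g b h d. loop c n \<pi> g b h d"
proof -
  obtain \<pi> l where pl: "ploop c n \<pi>" and oc: "occ \<xi> \<pi> (reach n)" and l: "0 < l"
    and per: "per l \<pi>" and r0: "blk \<pi> n 0 = r" and rd: "\<And>\<kappa>. blk \<pi> n \<kappa> = r \<Longrightarrow> int l dvd \<kappa>"
    using ploop_of_rsimple[OF n c r] by blast
  have oc1: "occ \<xi> \<pi> (Suc n)" using occ_mono[OF oc, of "Suc n"] reach_gt[OF n] by simp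
  have oc0: "occ \<xi> \<pi> n" using occ_mono[OF oc1] by simp
  have pure: "pure c (blk \<pi> n \<kappa>)" for \<kappa> using ploop_pure[OF pl] by simp
  have rsr: "blk \<pi> n \<kappa> = r" if "blk \<pi> n \<kappa> \<in> RS \<xi> n" for \<kappa>
    using r pure that unfolding rsimple_def by blast
  have dvd: "\<pi> (\<kappa> + t) = \<pi> t" if "int l dvd \<kappa>" for \<kappa> t
    using that periodic_mult[OF per, of t] by (auto simp: dvd_def add.commute)
  have ph: "\<pi> (\<kappa> + t) = \<pi> (\<kappa>' + t)" if eq: "blk \<pi> n \<kappa> = blk \<pi> n \<kappa>'" for \<kappa> \<kappa>' t
  proof -
    have *: "blk \<pi> n (\<kappa> + int t) = blk \<pi> n (\<kappa>' + int t)" for t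
    proof (induction t)
      case (Suc t)
      have "\<pi> (\<kappa> + int t + int n) = \<pi> (\<kappa>' + int t + int n)"
      proof (cases "blk \<pi> n (\<kappa> + int t) \<in> RS \<xi> n")
        case True
        then have "blk \<pi> n (\<kappa> + int t) = r" by (rule rsr)
        with Suc have "int l dvd \<kappa> + int t" "int l dvd \<kappa>' + int t" by (simp_all add: rd)
        then show ?thesis using dvd[of "\<kappa> + int t" "int n"] dvd[of "\<kappa>' + int t" "int n"] by simp
      next
        case False
        obtain i where i: "blk \<xi> (Suc n) i = blk \<pi> (Suc n) (\<kappa> + int t)" using oc1 unfolding occ_def by blast
        have i': "blk \<xi> n i = blk \<pi> n (\<kappa> + int t)" "\<xi> (i + int n) = \<pi> (\<kappa> + int t + int n)"
          using i by (auto simp: blk_Suc_eq)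
        have "\<xi> (i + int n) = \<pi> (\<kappa>' + int t + int n)"
          by (rule occ_det[OF oc1]) (use i' Suc False in auto)
        then show ?thesis using i' by simp
      qed
      from blk_step[OF Suc this] show ?case by (simp add: algebra_simps)
    qed (simp add: eq)
    have "\<pi> (\<kappa> + t) = \<pi> (\<kappa>' + t)" if "t \<ge> 0" for t
      using blk_eqD[OF *[of "nat t"], of 0] that n N0 by simp
    then show ?thesis using periodic_shift_eq[OF l(1) per l(1) per] by blast
  qed
  obtain j1 \<kappa>1 where ex: "blk \<xi> n j1 = blk \<pi> n \<kappa>1" "\<xi> (j1 + int n) \<noteq> \<pi> (\<kappa>1 + int n)"
    using ploop_exit[OF pl c order_refl n oc0] by blast
  have exr: "blk \<pi> n \<kappa> = r" if "blk \<xi> n j = blk \<pi> n \<kappa>" "\<xi> (j + int n) \<noteq> \<pi> (\<kappa> + int n)" for j \<kappa>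
  proof -
    have "blk \<pi> n \<kappa> \<in> RS \<xi> n" using occ_det[OF oc1 that(1)] that by auto
    then show ?thesis by (rule rsr)
  qed
  obtain i0 where i0: "blk \<xi> n i0 = r" "\<xi> (i0 + int n) = \<pi> (int n)"
  proof -
    obtain i where "blk \<xi> (Suc n) i = blk \<pi> (Suc n) 0" using oc1 unfolding occ_def by blast
    then show ?thesis using r0 by (intro that[of i]) (simp_all add: blk_Suc_eq)
  qed
  have UX: "\<xi> (j + int n) = \<xi> (j1 + int n) \<and> (\<forall>t. \<pi> (\<kappa> + int n + t) = \<pi> (int n + t))"
    if j: "blk \<xi> n j = blk \<pi> n \<kappa>" "\<xi> (j + int n) \<noteq> \<pi> (\<kappa> + int n)" for j \<kappa>
  proof -
    have "int l dvd \<kappa>" "int l dvd \<kappa>1" using exr[OF j] exr[OF ex] rd by auto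
    then have pn: "\<pi> (\<kappa> + int n) = \<pi> (int n)" "\<pi> (\<kappa>1 + int n) = \<pi> (int n)" using dvd by auto
    have "\<xi> (j + int n) = \<xi> (i0 + int n) \<or> \<xi> (j + int n) = \<xi> (j1 + int n)"
      using r i0 ex(2) pn exr[OF ex] ex(1) exr[OF j] j(1)
      by (intro two_letters) (auto simp: rsimple_def)
    then have "\<xi> (j + int n) = \<xi> (j1 + int n)" using i0 j(2) pn by auto
    moreover have "\<pi> (\<kappa> + int n + t) = \<pi> (int n + t)" for t using dvd[OF \<open>int l dvd \<kappa>\<close>, of "int n + t"] by (simp add: add.assoc)
    ultimately show ?thesis by blast
  qed
  have "\<exists>g b. \<forall>j \<kappa>. blk \<xi> n j = blk \<pi> n \<kappa> \<longrightarrow> \<xi> (j - 1) \<noteq> \<pi> (\<kappa> - 1) \<longrightarrow>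
        \<xi> (j - 1) = b \<and> (\<forall>t. \<pi> (\<kappa> + t) = \<pi> (g + t))"
  proof (cases "\<exists>j \<kappa>. blk \<xi> n j = blk \<pi> n \<kappa> \<and> \<xi> (j - 1) \<noteq> \<pi> (\<kappa> - 1)")
    case True
    then obtain j2 \<kappa>2 where en: "blk \<xi> n j2 = blk \<pi> n \<kappa>2" "\<xi> (j2 - 1) \<noteq> \<pi> (\<kappa>2 - 1)" by blast
    have before: "\<exists>i. blk \<xi> n i = blk \<pi> n \<kappa> \<and> \<xi> (i - 1) = \<pi> (\<kappa> - 1)" for \<kappa>
    proof -
      obtain i where "blk \<xi> (Suc n) i = blk \<pi> (Suc n) (\<kappa> - 1)" using oc1 unfolding occ_def by blast
      then show ?thesis by (intro exI[of _ "i + 1"]) (auto simp: blk_Suc_eq')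
    qed
    have ens: "blk \<pi> n \<kappa> = s" if en: "blk \<xi> n j = blk \<pi> n \<kappa>" "\<xi> (j - 1) \<noteq> \<pi> (\<kappa> - 1)" for j \<kappa>
    proof -
      obtain i where i: "blk \<xi> n i = blk \<pi> n \<kappa>" "\<xi> (i - 1) = \<pi> (\<kappa> - 1)" using before by blast
      then have "blk \<pi> n \<kappa> \<in> LS \<xi> n" unfolding LS_def using en
        by (intro CollectI exI[of _ i] exI[of _ j]) auto
      then show ?thesis using s pure unfolding lsimple_def by blast
    qed
    show ?thesis
    proof (intro exI allI impI conjI)
      fix j \<kappa> assume j: "blk \<xi> n j = blk \<pi> n \<kappa>" "\<xi> (j - 1) \<noteq> \<pi> (\<kappa> - 1)"
      have eq: "blk \<pi> n \<kappa> = blk \<pi> n \<kappa>2" using ens[OF j] ens[OF en] by simp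
      show pt: "\<pi> (\<kappa> + t) = \<pi> (\<kappa>2 + t)" for t using ph[OF eq] .
      obtain i where i: "blk \<xi> n i = blk \<pi> n \<kappa>" "\<xi> (i - 1) = \<pi> (\<kappa> - 1)" using before by blast
      show "\<xi> (j - 1) = \<xi> (j2 - 1)"
      proof (rule ccontr)
        assume ne: "\<xi> (j - 1) \<noteq> \<xi> (j2 - 1)"
        have "{\<xi> (j - 1), \<xi> (j2 - 1), \<xi> (i - 1)} \<subseteq> lx \<xi> s"
          unfolding lx_def using ens[OF j] eq i(1) j(1) en(1) by auto
        then have "card {\<xi> (j - 1), \<xi> (j2 - 1), \<xi> (i - 1)} \<le> 2"
          using s unfolding lsimple_def by (metis card_mono finite)
        moreover have "\<pi> (\<kappa> - 1) = \<pi> (\<kappa>2 - 1)" using pt[of "-1"] by simp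
        ultimately show False using ne j(2) en(2) i(2) by (auto simp: card_insert_if split: if_splits)
      qed
    qed
  qed blast
  then obtain g b where UE': "\<forall>j \<kappa>. blk \<xi> n j = blk \<pi> n \<kappa> \<longrightarrow> \<xi> (j - 1) \<noteq> \<pi> (\<kappa> - 1) \<longrightarrow>
        \<xi> (j - 1) = b \<and> (\<forall>t. \<pi> (\<kappa> + t) = \<pi> (g + t))" by blast
  \<comment> \<open>The word \<open>r\<close> sits at phase 0, so the first letter that can differ
    has phase \<open>n\<close>.\<close>
  have "loop c n \<pi> g b (int n) (\<xi> (j1 + int n))"
    unfolding loop_def
  proof (intro conjI pl oc UE')
    show "\<forall>\<kappa> \<kappa>'. blk \<pi> n \<kappa> = blk \<pi> n \<kappa>' \<longrightarrow> (\<forall>t. \<pi> (\<kappa> + t) = \<pi> (\<kappa>' + t))"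
      using ph by blast
    show "\<forall>j \<kappa>. blk \<xi> n j = blk \<pi> n \<kappa> \<longrightarrow> \<xi> (j + int n) \<noteq> \<pi> (\<kappa> + int n) \<longrightarrow>
        \<xi> (j + int n) = \<xi> (j1 + int n) \<and> (\<forall>t. \<pi> (\<kappa> + int n + t) = \<pi> (int n + t))"
      using UX by blast
  qed
  then show ?thesis by blast
qed

text \<open>The loop \<open>\<rho>\<close> that the color has at length \<open>n'\<close> lasts up
  to \<open>reach n'\<close>, and \<open>\<pi>\<close> is a translate of it: both pass through
  \<open>r\<close>, and by \<open>escape\<close> they take the same letter there. So a loop cannot
  run out at a length where its color is still simple.\<close>

lemma depth_of_rsimple:
  assumes pl: "ploop c n \<pi>" and c: "c \<in> Cs" and n: "N0 \<le> n" "n \<le> n'" and oc1: "occ \<xi> \<pi> (Suc n')"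
    and r: "rsimple c n' r"
  shows "occ \<xi> \<pi> (reach n')"
proof -
  have n': "N0 \<le> n'" using n by simp
  obtain \<rho> l' where pl': "ploop c n' \<rho>" and oc': "occ \<xi> \<rho> (reach n')" and l': "0 < l'" "per l' \<rho>"
    and r0: "blk \<rho> n' 0 = r" and rd: "\<And>\<kappa>. blk \<rho> n' \<kappa> = r \<Longrightarrow> int l' dvd \<kappa>"
    using ploop_of_rsimple[OF n' c r] by blast
  obtain l where l: "l > 0" "per l \<pi>" using pl unfolding ploop_def by blast
  have oc1': "occ \<xi> \<rho> (Suc n')" using occ_mono[OF oc', of "Suc n'"] reach_gt[OF n'] by simp
  have oc0: "occ \<xi> \<pi> n'" using occ_mono[OF oc1] by simp
  have p: "pure c (blk \<pi> n' \<kappa>)" "pure c (blk \<rho> n' \<kappa>)" for \<kappa>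
    using ploop_pure[OF pl n(2)] ploop_pure[OF pl'] by auto
  have rsr: "v = r" if "v \<in> RS \<xi> n'" "v \<in> range (blk \<pi> n') \<union> range (blk \<rho> n')" for v
    using r p that unfolding rsimple_def by blast
  obtain j0 \<kappa>0 where ex: "blk \<xi> n' j0 = blk \<pi> n' \<kappa>0" "\<xi> (j0 + int n') \<noteq> \<pi> (\<kappa>0 + int n')"
    using ploop_exit[OF pl c n(2) n' oc0] by blast
  have "blk \<pi> n' \<kappa>0 \<in> RS \<xi> n'" using occ_det[OF oc1 ex(1)] ex by auto
  then have \<kappa>0: "blk \<pi> n' \<kappa>0 = r" by (rule rsr) simp
  have letter: "\<pi> (\<kappa> + int n') = \<rho> (int n')" if \<kappa>: "blk \<pi> n' \<kappa> = r" for \<kappa>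
  proof (rule ccontr)
    assume ne: "\<pi> (\<kappa> + int n') \<noteq> \<rho> (int n')"
    obtain y1 where y1: "blk \<xi> (Suc n') y1 = blk \<pi> (Suc n') \<kappa>" using oc1 unfolding occ_def by blast
    obtain y2 where y2: "blk \<xi> (Suc n') y2 = blk \<rho> (Suc n') 0" using oc1' unfolding occ_def by blast
    show False
    proof (rule escape[OF n' c r, of "range (blk \<pi> n') \<union> range (blk \<rho> n')" y1 y2])
      show "\<And>v. v \<in> range (blk \<pi> n') \<union> range (blk \<rho> n') \<Longrightarrow> pure c v" using p by auto
    next
      fix i assume i: "blk \<xi> n' i \<in> range (blk \<pi> n') \<union> range (blk \<rho> n')" "blk \<xi> n' i \<notin> RS \<xi> n'"
      from i(1) consider \<kappa> where "blk \<xi> n' i = blk \<pi> n' \<kappa>" | \<kappa> where "blk \<xi> n' i = blk \<rho> n' \<kappa>" by blast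
      then show "blk \<xi> n' (i + 1) \<in> range (blk \<pi> n') \<union> range (blk \<rho> n')"
      proof cases
        case 1 then show ?thesis using blk_step[OF 1 occ_det[OF oc1 1 i(2)]] by simp
      next
        case 2 then show ?thesis using blk_step[OF 2 occ_det[OF oc1' 2 i(2)]] by simp
      qed
    next
      show "blk \<xi> n' y1 = r" "blk \<xi> n' y2 = r" using y1 y2 \<kappa> r0 by (simp_all add: blk_Suc_eq)
      show "\<xi> (y1 + int n') \<noteq> \<xi> (y2 + int n')" using y1 y2 ne by (simp add: blk_Suc_eq)
      show "blk \<xi> n' (y1 + 1) \<in> range (blk \<pi> n') \<union> range (blk \<rho> n')"
        "blk \<xi> n' (y2 + 1) \<in> range (blk \<pi> n') \<union> range (blk \<rho> n')"
        using y1 y2 by (simp_all add: blk_Suc_eq')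
    qed
  qed
  have *: "blk \<pi> n' (\<kappa>0 + int t) = blk \<rho> n' (int t)" for t
  proof (induction t)
    case (Suc t)
    have "\<pi> (\<kappa>0 + int t + int n') = \<rho> (int t + int n')"
    proof (cases "blk \<pi> n' (\<kappa>0 + int t) \<in> RS \<xi> n'")
      case True
      then have "blk \<pi> n' (\<kappa>0 + int t) = r" using rsr by blast
      moreover from this Suc have "int l' dvd int t" by (intro rd) simp
      then have "\<rho> (int t + int n') = \<rho> (int n')"
        using periodic_mult[OF l'(2), of "int n'"] by (auto simp: dvd_def add.commute)
      ultimately show ?thesis using letter by simp
    next
      case False
      obtain i where i: "blk \<xi> (Suc n') i = blk \<pi> (Suc n') (\<kappa>0 + int t)" using oc1 unfolding occ_def by blast
      have i': "blk \<xi> n' i = blk \<pi> n' (\<kappa>0 + int t)" "\<xi> (i + int n') = \<pi> (\<kappa>0 + int t + int n')"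
        using i by (auto simp: blk_Suc_eq)
      have "\<xi> (i + int n') = \<rho> (int t + int n')"
        by (rule occ_det[OF oc1']) (use i' Suc False in auto)
      then show ?thesis using i' by simp
    qed
    from blk_step[OF Suc this] show ?case by (simp add: algebra_simps)
  qed (simp add: \<kappa>0 r0)
  have "\<pi> (\<kappa>0 + t) = \<rho> (0 + t)" if "t \<ge> 0" for t
    using blk_eqD[OF *[of "nat t"], of 0] that n' N0 by simp
  then have shift: "\<pi> (\<kappa>0 + t) = \<rho> (0 + t)" for t by (rule periodic_shift_eq[OF l l'])
  show ?thesis
    unfolding occ_def
  proof
    fix \<kappa>
    obtain i where "blk \<xi> (reach n') i = blk \<rho> (reach n') (\<kappa> - \<kappa>0)" using oc' unfolding occ_def by blast
    moreover have "blk \<rho> (reach n') (\<kappa> - \<kappa>0) = blk \<pi> (reach n') \<kappa>"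
      by (rule blk_eqI) (use shift[of "\<kappa> - \<kappa>0 + t" for t] in \<open>simp add: algebra_simps\<close>)
    ultimately show "\<exists>i. blk \<xi> (reach n') i = blk \<pi> (reach n') \<kappa>" by metis
  qed
qed

end

abbreviation rdev :: "('c \<Rightarrow> 'a list \<Rightarrow> real) \<Rightarrow> 'c \<Rightarrow> 'a list \<Rightarrow> real" where
  "rdev dev \<equiv> \<lambda>c w. dev c (rev w)"

text \<open>The alignment is fixed by giving the first position the phase \<open>g\<close> of the
  entrance. For a loop this loses nothing: \<open>run_exists\<close> extends every agreement of
  length \<open>n\<close> to an interval of this form.\<close>

definition run :: "(int \<Rightarrow> 'a) \<Rightarrow> (int \<Rightarrow> 'a) \<Rightarrow> int \<Rightarrow> int \<Rightarrow> int \<Rightarrow> bool" where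
  "run x \<pi> g a e \<longleftrightarrow> a \<le> e \<and> (\<forall>k. a \<le> k \<and> k < e \<longrightarrow> x k = \<pi> (g + k - a)) \<and>
     x (a - 1) \<noteq> \<pi> (g - 1) \<and> x e \<noteq> \<pi> (g + e - a)"

lemma run_blk:
  assumes "run x \<pi> g a e" "a \<le> y" "y + int k \<le> e"
  shows "blk x k y = blk \<pi> k (g + y - a)"
proof (rule blk_eqI)
  fix t assume "0 \<le> t" "t < int k"
  then have "x (y + t) = \<pi> (g + (y + t) - a)" using assms unfolding run_def by auto
  then show "x (y + t) = \<pi> (g + y - a + t)" by (simp add: algebra_simps)
qed

lemma per_rv: "per l (rv \<pi>) \<longleftrightarrow> per l \<pi>"
proof -
  have *: "per l \<pi> \<Longrightarrow> per l (rv \<pi>)" for \<pi> :: "int \<Rightarrow> 'a"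
    unfolding per_def rv_def
  proof
    fix k assume "\<forall>k. \<pi> (k + int l) = \<pi> k"
    from this[rule_format, of "- (k + int l)"] show "\<pi> (- (k + int l)) = \<pi> (- k)" by simp
  qed
  show ?thesis using *[of \<pi>] *[of "rv \<pi>"] by auto
qed

section \<open>Mirror images of colors, special words and loops\<close>

context colored_sequence
begin

lemma pure_rv: "colored_sequence.pure (rdev dev) eps c v \<longleftrightarrow> pure c (rev v)"
  by (simp add: colored_sequence.pure_def[OF colored_sequence_rv] pure_def)

lemma RS_rv_image: "RS (rv x) n = rev ` LS x n"
proof (rule set_eqI)
  fix v show "v \<in> RS (rv x) n \<longleftrightarrow> v \<in> rev ` LS x n"
    using RS_rv[of v x n] by (metis image_iff rev_rev_ident)
qed

lemma LS_rv_image: "LS (rv x) n = rev ` RS x n"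
proof (rule set_eqI)
  fix v show "v \<in> LS (rv x) n \<longleftrightarrow> v \<in> rev ` RS x n"
    using LS_rv[of v x n] by (metis image_iff rev_rev_ident)
qed

lemma rsimple_rv: "colored_sequence.rsimple (rv \<xi>) (rdev dev) eps c n r \<longleftrightarrow> lsimple c n (rev r)"
  unfolding colored_sequence.rsimple_def[OF colored_sequence_rv] lsimple_def pure_rv RS_rv rx_rv
  by (simp add: RS_rv_image rev_swap)

lemma lsimple_rv: "colored_sequence.lsimple (rv \<xi>) (rdev dev) eps c n r \<longleftrightarrow> rsimple c n (rev r)"
  unfolding colored_sequence.lsimple_def[OF colored_sequence_rv] rsimple_def pure_rv LS_rv lx_rv
  by (simp add: LS_rv_image rev_swap)

lemma ploop_rv: "colored_sequence.ploop K (rdev dev) eps c n (rv \<pi>) \<longleftrightarrow> ploop c n \<pi>"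
proof -
  have "(\<forall>t\<ge>n. \<forall>\<kappa>. dev c (rev (blk (rv \<pi>) t \<kappa>)) \<le> eps / 2 * real t) \<longleftrightarrow>
      (\<forall>t\<ge>n. \<forall>\<kappa>. dev c (blk \<pi> t \<kappa>) \<le> eps / 2 * real t)"
  proof (intro iffI allI impI)
    fix t \<kappa> assume a: "\<forall>t\<ge>n. \<forall>\<kappa>. dev c (rev (blk (rv \<pi>) t \<kappa>)) \<le> eps / 2 * real t" "n \<le> t"
    have "rev (blk (rv \<pi>) t (1 - \<kappa> - int t)) = blk \<pi> t \<kappa>" by (simp add: blk_rv)
    moreover have "dev c (rev (blk (rv \<pi>) t (1 - \<kappa> - int t))) \<le> eps / 2 * real t" using a by blast
    ultimately show "dev c (blk \<pi> t \<kappa>) \<le> eps / 2 * real t" by (simp only:)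
  qed (simp add: blk_rv)
  then show ?thesis unfolding colored_sequence.ploop_def[OF colored_sequence_rv] ploop_def per_rv by blast
qed

lemma loop_ploop: "loop c n \<pi> g b h d \<Longrightarrow> ploop c n \<pi>"
  by (simp add: loop_def)

lemma loop_exit_base:
  assumes "loop c n \<pi> g b h d" "blk \<xi> n j = blk \<pi> n \<kappa>" "\<xi> (j + int n) \<noteq> \<pi> (\<kappa> + int n)"
  shows "\<xi> (j + int n) = d" "\<pi> (\<kappa> + int n + t) = \<pi> (h + t)"
  using assms unfolding loop_def by blast+

lemma loop_phase:
  assumes "loop c n \<pi> g b h d" "n \<le> k" "blk \<pi> k \<kappa> = blk \<pi> k \<kappa>'"
  shows "\<pi> (\<kappa> + t) = \<pi> (\<kappa>' + t)"
  using assms(1) blk_take[OF assms(3,2)] unfolding loop_def by blast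

lemma loop_exit_unique:
  assumes "loop c n \<pi> g b h d" "n \<le> k" "blk \<xi> k j = blk \<pi> k \<kappa>" "\<xi> (j + int k) \<noteq> \<pi> (\<kappa> + int k)"
  shows "\<xi> (j + int k) = d" "\<pi> (\<kappa> + int k + t) = \<pi> (h + t)"
proof -
  have 1: "blk \<xi> n (j + int (k - n)) = blk \<pi> n (\<kappa> + int (k - n))"
    using assms(2) by (intro blk_sub[OF assms(3)]) auto
  have 2: "int (k - n) = int k - int n" using assms(2) by (simp add: of_nat_diff)
  have 3: "\<xi> (j + int (k - n) + int n) \<noteq> \<pi> (\<kappa> + int (k - n) + int n)" using assms(4) unfolding 2 by simp
  show "\<xi> (j + int k) = d" using loop_exit_base(1)[OF assms(1) 1 3] unfolding 2 by simp
  show "\<pi> (\<kappa> + int k + t) = \<pi> (h + t)" using loop_exit_base(2)[OF assms(1) 1 3, of t] unfolding 2 by simp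
qed

lemma loop_entry_unique:
  assumes "loop c n \<pi> g b h d" "n \<le> k" "blk \<xi> k j = blk \<pi> k \<kappa>" "\<xi> (j - 1) \<noteq> \<pi> (\<kappa> - 1)"
  shows "\<xi> (j - 1) = b" "\<pi> (\<kappa> + t) = \<pi> (g + t)"
  using assms(1,4) blk_take[OF assms(3,2)] unfolding loop_def by blast+

text \<open>Read backwards, a loop is entered where it was left. Since \<open>h\<close> is the phase
  of the first letter off the loop, the first letter on it in reversed order has phase
  \<open>h - 1\<close>, which reflection turns into \<open>1 - h\<close>; in the same way the exit
  phase becomes \<open>1 - g\<close>.\<close>

lemma loop_rv:
  assumes "loop c n \<pi> g b h d"
  shows "colored_sequence.loop (rv \<xi>) K (rdev dev) eps M c n (rv \<pi>) (1 - h) d (1 - g) b"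
  unfolding colored_sequence.loop_def[OF colored_sequence_rv] ploop_rv occ_rv
proof (intro conjI allI impI)
  show "ploop c n \<pi>" "occ \<xi> \<pi> (reach n)" using assms by (auto simp: loop_def)
  fix \<kappa> \<kappa>' t assume "blk (rv \<pi>) n \<kappa> = blk (rv \<pi>) n \<kappa>'"
  then have "blk \<pi> n (1 - \<kappa> - int n) = blk \<pi> n (1 - \<kappa>' - int n)" by (simp add: blk_rv)
  from loop_phase[OF assms order_refl this, of "int n - 1 - t"]
  show "rv \<pi> (\<kappa> + t) = rv \<pi> (\<kappa>' + t)" by (simp add: rv_def algebra_simps)
next
  fix j \<kappa> assume j: "blk (rv \<xi>) n j = blk (rv \<pi>) n \<kappa>" "rv \<xi> (j - 1) \<noteq> rv \<pi> (\<kappa> - 1)"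
  have 1: "blk \<xi> n (1 - j - int n) = blk \<pi> n (1 - \<kappa> - int n)" using j(1) by (simp add: blk_rv)
  have 2: "\<xi> (1 - j - int n + int n) \<noteq> \<pi> (1 - \<kappa> - int n + int n)" using j(2) by (simp add: rv_def)
  show "rv \<xi> (j - 1) = d" using loop_exit_unique(1)[OF assms order_refl 1 2] by (simp add: rv_def)
  show "rv \<pi> (\<kappa> + t) = rv \<pi> (1 - h + t)" for t
  proof -
    have e: "1 - \<kappa> - int n + int n + (- 1 - t) = - (\<kappa> + t)" "h + (- 1 - t) = - (1 - h + t)" by simp_all
    show ?thesis using loop_exit_unique(2)[OF assms order_refl 1 2, of "- 1 - t"] unfolding e rv_def .
  qed
next
  fix j \<kappa> assume j: "blk (rv \<xi>) n j = blk (rv \<pi>) n \<kappa>" "rv \<xi> (j + int n) \<noteq> rv \<pi> (\<kappa> + int n)"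
  have 1: "blk \<xi> n (1 - j - int n) = blk \<pi> n (1 - \<kappa> - int n)" using j(1) by (simp add: blk_rv)
  have 2: "\<xi> (1 - j - int n - 1) \<noteq> \<pi> (1 - \<kappa> - int n - 1)" using j(2) by (simp add: rv_def)
  show "rv \<xi> (j + int n) = b" using loop_entry_unique(1)[OF assms order_refl 1 2] by (simp add: rv_def)
  show "rv \<pi> (\<kappa> + int n + t) = rv \<pi> (1 - g + t)" for t
  proof -
    have e: "1 - \<kappa> - int n + (- 1 - t) = - (\<kappa> + int n + t)" "g + (- 1 - t) = - (1 - g + t)" by simp_all
    show ?thesis using loop_entry_unique(2)[OF assms order_refl 1 2, of "- 1 - t"] unfolding e rv_def .
  qed
qed

lemma not_lsimple:
  assumes "n \<ge> N0" "c \<in> Cs" "\<And>r. \<not> lsimple c n r" "e \<in> Cs" "e \<noteq> c"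
  shows "\<exists>r. lsimple e n r"
  using colored_sequence.not_rsimple[OF colored_sequence_rv assms(1,2) _ assms(4,5)] assms(3) unfolding rsimple_rv by (metis rev_rev_ident)

lemma LS_struct:
  assumes n: "n \<ge> N0" and c: "c \<in> Cs"
    and v: "v \<in> LS \<xi> n" "v' \<in> LS \<xi> n" "v \<noteq> v'" "pure c v" "pure c v'"
  shows "card (lx \<xi> v) = 2" "card (lx \<xi> v') = 2"
    "\<And>w. w \<in> LS \<xi> n \<Longrightarrow> pure c w \<Longrightarrow> w = v \<or> w = v'"
    "\<And>w. w \<in> LS \<xi> n \<Longrightarrow> \<not> pure c w \<Longrightarrow> \<exists>e\<in>Cs - {c}. lsimple e n w"
    "\<And>e. e \<in> Cs \<Longrightarrow> e \<noteq> c \<Longrightarrow> \<exists>r. lsimple e n r"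
proof -
  have v': "rev v \<in> RS (rv \<xi>) n" "rev v' \<in> RS (rv \<xi>) n" "rev v \<noteq> rev v'"
    "colored_sequence.pure (rdev dev) eps c (rev v)" "colored_sequence.pure (rdev dev) eps c (rev v')"
    using v by (auto simp: RS_rv pure_rv)
  note st = colored_sequence.RS_struct[OF colored_sequence_rv n c v', unfolded rx_rv rev_rev_ident rsimple_rv pure_rv]
  show "card (lx \<xi> v) = 2" "card (lx \<xi> v') = 2" using st(1,2) by auto
  show "w = v \<or> w = v'" if "w \<in> LS \<xi> n" "pure c w" for w
    using st(3)[of "rev w"] that by (simp add: RS_rv)
  show "\<exists>e\<in>Cs - {c}. lsimple e n w" if "w \<in> LS \<xi> n" "\<not> pure c w" for w
    using st(4)[of "rev w"] that by (simp add: RS_rv)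
  show "\<exists>r. lsimple e n r" if "e \<in> Cs" "e \<noteq> c" for e
    using st(5)[of e] that by blast
qed

lemma LS_full:
  assumes "n \<ge> N0" "S \<subseteq> LS \<xi> n" "card S \<ge> K"
  shows "LS \<xi> n = S" "\<And>v. v \<in> S \<Longrightarrow> card (lx \<xi> v) = 2" "card S = K"
proof -
  have S: "rev ` S \<subseteq> RS (rv \<xi>) n" using assms(2) by (auto simp: RS_rv)
  have cS: "card (rev ` S) = card S" by (simp add: card_image inj_on_def)
  note full = colored_sequence.RS_full[OF colored_sequence_rv assms(1) S, unfolded cS, OF assms(3)]
  show "card S = K" by (rule full(3))
  show "LS \<xi> n = S"
  proof (rule set_eqI)
    fix v
    have "v \<in> LS \<xi> n \<longleftrightarrow> rev v \<in> RS (rv \<xi>) n" by (simp add: RS_rv)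
    then show "v \<in> LS \<xi> n \<longleftrightarrow> v \<in> S" unfolding full(1) by (auto simp: image_iff)
  qed
  show "card (lx \<xi> v) = 2" if "v \<in> S" for v using full(2)[of "rev v"] that by (simp add: rx_rv)
qed

lemma depth_of_lsimple:
  assumes pl: "ploop c n \<pi>" and c: "c \<in> Cs" and n: "N0 \<le> n" "n \<le> n'" and oc1: "occ \<xi> \<pi> (Suc n')"
    and r: "lsimple c n' r"
  shows "occ \<xi> \<pi> (reach n')"
  using colored_sequence.depth_of_rsimple[OF colored_sequence_rv, of c n "rv \<pi>" n' "rev r"] assms by (simp add: ploop_rv occ_rv rsimple_rv)

lemma ploop_entry:
  assumes "ploop c n \<pi>" "c \<in> Cs" "n \<le> n'" "N0 \<le> n'" "occ \<xi> \<pi> n'"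
  shows "\<exists>j \<kappa>. blk \<xi> n' j = blk \<pi> n' \<kappa> \<and> \<xi> (j - 1) \<noteq> \<pi> (\<kappa> - 1)"
proof -
  obtain j \<kappa> where "blk (rv \<xi>) n' j = blk (rv \<pi>) n' \<kappa>" "rv \<xi> (j + int n') \<noteq> rv \<pi> (\<kappa> + int n')"
    using colored_sequence.ploop_exit[OF colored_sequence_rv, of c n "rv \<pi>" n'] assms by (auto simp: ploop_rv occ_rv)
  then show ?thesis
    by (intro exI[of _ "1 - j - int n'"] exI[of _ "1 - \<kappa> - int n'"]) (simp add: blk_rv rv_def)
qed

lemma loop_exit:
  assumes L: "loop c n \<pi> g b h d" and "c \<in> Cs" "N0 \<le> n" "n \<le> k" "k \<le> depth \<xi> \<pi>"
  shows "\<exists>j. blk \<xi> k j = blk \<pi> k (h - int k) \<and> \<xi> (j + int k) = d" "d \<noteq> \<pi> h"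
proof -
  have "occ \<xi> \<pi> k" using ploop_depth[OF loop_ploop[OF L]] assms(5) by simp
  then obtain j \<kappa> where j: "blk \<xi> k j = blk \<pi> k \<kappa>" "\<xi> (j + int k) \<noteq> \<pi> (\<kappa> + int k)"
    using ploop_exit[OF loop_ploop[OF L], of k] assms by auto
  note u = loop_exit_unique[OF L assms(4) j]
  have "blk \<pi> k \<kappa> = blk \<pi> k (h - int k)"
    by (rule blk_eqI) (use u(2)[of "t - int k" for t] in \<open>simp add: algebra_simps\<close>)
  then show "\<exists>j. blk \<xi> k j = blk \<pi> k (h - int k) \<and> \<xi> (j + int k) = d" using j(1) u(1) by auto
  show "d \<noteq> \<pi> h" using j(2) u(1) u(2)[of 0] by simp
qed

lemma loop_entry:
  assumes L: "loop c n \<pi> g b h d" and "c \<in> Cs" "N0 \<le> n" "n \<le> k" "k \<le> depth \<xi> \<pi>"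
  shows "\<exists>j. blk \<xi> k j = blk \<pi> k g \<and> \<xi> (j - 1) = b" "b \<noteq> \<pi> (g - 1)"
proof -
  have "occ \<xi> \<pi> k" using ploop_depth[OF loop_ploop[OF L]] assms(5) by simp
  then obtain j \<kappa> where j: "blk \<xi> k j = blk \<pi> k \<kappa>" "\<xi> (j - 1) \<noteq> \<pi> (\<kappa> - 1)"
    using ploop_entry[OF loop_ploop[OF L], of k] assms by auto
  note u = loop_entry_unique[OF L assms(4) j]
  have "blk \<pi> k \<kappa> = blk \<pi> k g" by (rule blk_eqI) (rule u(2))
  then show "\<exists>j. blk \<xi> k j = blk \<pi> k g \<and> \<xi> (j - 1) = b" using j(1) u(1) by auto
  show "b \<noteq> \<pi> (g - 1)" using j(2) u(1) u(2)[of "-1"] by simp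
qed

lemma loop_occ: "loop c n \<pi> g b h d \<Longrightarrow> k \<le> depth \<xi> \<pi> \<Longrightarrow> \<exists>i. blk \<xi> k i = blk \<pi> k \<kappa>"
  using ploop_depth[OF loop_ploop, of c n \<pi> g b h d k] unfolding occ_def by blast

text \<open>The word before an exit is followed by \<open>d\<close> there, but by
  \<open>\<pi> h\<close> in an occurrence of the next longer block of \<open>\<pi>\<close>; the
  latter needs \<open>k < depth \<xi> \<pi>\<close> and not only \<open>\<le>\<close>.\<close>

lemma loop_RS:
  assumes L: "loop c n \<pi> g b h d" and "c \<in> Cs" "N0 \<le> n" "n \<le> k" "k < depth \<xi> \<pi>"
  shows "blk \<pi> k (h - int k) \<in> RS \<xi> k"
proof -
  obtain j where j: "blk \<xi> k j = blk \<pi> k (h - int k)" "\<xi> (j + int k) = d" "d \<noteq> \<pi> h"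
    using loop_exit[OF L, of k] assms by auto
  obtain i where i: "blk \<xi> (Suc k) i = blk \<pi> (Suc k) (h - int k)" using loop_occ[OF L, of "Suc k"] assms(5) by auto
  show ?thesis unfolding RS_def
    using i j by (intro CollectI exI[of _ i] exI[of _ j]) (auto simp: blk_Suc_eq)
qed

lemma loop_LS:
  assumes L: "loop c n \<pi> g b h d" and "c \<in> Cs" "N0 \<le> n" "n \<le> k" "k < depth \<xi> \<pi>"
  shows "blk \<pi> k g \<in> LS \<xi> k"
proof -
  obtain j where j: "blk \<xi> k j = blk \<pi> k g" "\<xi> (j - 1) = b" "b \<noteq> \<pi> (g - 1)"
    using loop_entry[OF L, of k] assms by auto
  obtain i where i: "blk \<xi> (Suc k) i = blk \<pi> (Suc k) (g - 1)" using loop_occ[OF L, of "Suc k"] assms(5) by auto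
  show ?thesis unfolding LS_def
    using i j by (intro CollectI exI[of _ "i + 1"] exI[of _ j]) (auto simp: blk_Suc_eq')
qed

lemma loop_TT_depth: "loop c n \<pi> g b h d \<Longrightarrow> reach n \<le> depth \<xi> \<pi>"
  using ploop_depth[OF loop_ploop] unfolding loop_def by blast

lemma loop_mono:
  assumes L: "loop c n \<pi> g b h d" and "n \<le> k" "reach k \<le> depth \<xi> \<pi>"
  shows "loop c k \<pi> g b h d"
  unfolding loop_def
proof (intro conjI allI impI)
  show "ploop c k \<pi>" using ploop_mono[OF loop_ploop[OF L] assms(2)] .
  show "occ \<xi> \<pi> (reach k)" using ploop_depth[OF loop_ploop[OF L]] assms(3) by simp
  show "\<pi> (\<kappa> + t) = \<pi> (\<kappa>' + t)" if "blk \<pi> k \<kappa> = blk \<pi> k \<kappa>'" for \<kappa> \<kappa>' t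
    by (rule loop_phase[OF L assms(2) that])
qed (use loop_exit_unique[OF L assms(2)] loop_entry_unique[OF L assms(2)] in blast)+

section \<open>Runs: maximal passages through a loop\<close>

lemma run_ends:
  assumes L: "loop c n \<pi> g b h d" and R: "run \<xi> \<pi> g a e" "a + int n \<le> e"
  shows "\<xi> (a - 1) = b" "\<xi> e = d" "\<pi> (g + e - a + t) = \<pi> (h + t)"
proof -
  have 1: "blk \<xi> n a = blk \<pi> n g" using run_blk[OF R(1), of a n] R(2) by simp
  show "\<xi> (a - 1) = b" by (rule loop_entry_unique(1)[OF L order_refl 1]) (use R in \<open>simp add: run_def\<close>)
  have 2: "blk \<xi> n (e - int n) = blk \<pi> n (g + (e - int n) - a)" by (rule run_blk[OF R(1)]) (use R(2) in auto)
  have 3: "\<xi> (e - int n + int n) \<noteq> \<pi> (g + (e - int n) - a + int n)" using R(1) by (simp add: run_def algebra_simps)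
  show "\<xi> e = d" using loop_exit_unique(1)[OF L order_refl 2 3] by simp
  show "\<pi> (g + e - a + t) = \<pi> (h + t)" using loop_exit_unique(2)[OF L order_refl 2 3, of t] by (simp add: algebra_simps)
qed

lemma run_rv:
  assumes L: "loop c n \<pi> g b h d" and R: "run \<xi> \<pi> g a e" "a + int n \<le> e"
  shows "run (rv \<xi>) (rv \<pi>) (1 - h) (1 - e) (1 - a)"
  unfolding run_def
proof (intro conjI allI impI)
  note ends = run_ends(3)[OF L R]
  show "1 - e \<le> 1 - a" using R(1) by (simp add: run_def)
  fix k assume k: "1 - e \<le> k \<and> k < 1 - a"
  then have "\<xi> (- k) = \<pi> (g + (- k) - a)" using R(1) unfolding run_def by auto
  then show "rv \<xi> k = rv \<pi> (1 - h + k - (1 - e))" using ends[of "- k - e"] by (simp add: rv_def algebra_simps)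
next
  note ends = run_ends(3)[OF L R]
  show "rv \<xi> (1 - e - 1) \<noteq> rv \<pi> (1 - h - 1)" using R(1) ends[of 0] by (simp add: rv_def run_def)
  show "rv \<xi> (1 - a) \<noteq> rv \<pi> (1 - h + (1 - a) - (1 - e))"
    using R(1) ends[of "a - 1 - e"] by (simp add: rv_def run_def algebra_simps)
qed

text \<open>An overlap of \<open>n\<close> letters fixes the common phase, and then maximality fixes
  both ends.\<close>

lemma run_unique:
  assumes L: "loop c n \<pi> g b h d" and R: "run \<xi> \<pi> g a e" "run \<xi> \<pi> g a' e'"
    and y: "a \<le> y" "a' \<le> y" "y + int n \<le> e" "y + int n \<le> e'"
  shows "a = a'" "e = e'"
proof -
  have ph: "\<pi> (g + y - a + t) = \<pi> (g + y - a' + t)" for t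
    by (rule loop_phase[OF L order_refl]) (use run_blk[OF R(1)] run_blk[OF R(2)] y in metis)
  show a: "a = a'"
  proof (rule ccontr)
    assume "a \<noteq> a'"
    then consider "a < a'" | "a' < a" by linarith
    then show False
    proof cases
      case 1
      then have "\<xi> (a' - 1) = \<pi> (g + (a' - 1) - a)" using R(1) y unfolding run_def by auto
      then show False using ph[of "a' - 1 - y"] R(2) by (simp add: run_def algebra_simps)
    next
      case 2
      then have "\<xi> (a - 1) = \<pi> (g + (a - 1) - a')" using R(2) y unfolding run_def by auto
      then show False using ph[of "a - 1 - y"] R(1) by (simp add: run_def algebra_simps)
    qed
  qed
  show "e = e'"
  proof (rule ccontr)
    assume "e \<noteq> e'"
    then consider "e < e'" | "e' < e" by linarith
    then show False
    proof cases
      case 1 then show False using R y a unfolding run_def by auto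
    next
      case 2 then show False using R y a unfolding run_def by auto
    qed
  qed
qed

text \<open>A stretch of \<open>k + l\<close> letters contains a block of length \<open>k\<close> at
  every phase modulo \<open>l\<close>.\<close>

lemma occ_of_agree:
  assumes "per l \<pi>" "l > 0" "\<And>x. u \<le> x \<Longrightarrow> x < u + int k + int l \<Longrightarrow> \<xi> x = \<pi> (\<kappa> + x)"
  shows "occ \<xi> \<pi> k"
  unfolding occ_def
proof
  fix \<rho>
  define r where "r = (\<rho> - \<kappa> - u) mod int l"
  have r: "0 \<le> r" "r < int l" using assms(2) by (auto simp: r_def)
  have "\<pi> (\<kappa> + (u + r + t)) = \<pi> (\<rho> + t)" for t
  proof -
    have "\<rho> + t = \<kappa> + (u + r + t) + int l * ((\<rho> - \<kappa> - u) div int l)"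
      using mult_div_mod_eq[of "int l" "\<rho> - \<kappa> - u"] unfolding r_def by linarith
    then show ?thesis using periodic_mult[OF assms(1)] by metis
  qed
  then have "blk \<xi> k (u + r) = blk \<pi> k \<rho>" using r by (intro blk_eqI) (simp add: assms(3))
  then show "\<exists>i. blk \<xi> k i = blk \<pi> k \<rho>" by blast
qed

text \<open>Extend the agreement in both directions; it stops because the depth is finite. The left
  end is an entrance and hence has phase \<open>g\<close>.\<close>

lemma run_exists:
  assumes L: "loop c n \<pi> g b h d" and i: "blk \<xi> n i = blk \<pi> n \<kappa>"
  shows "\<exists>a e. run \<xi> \<pi> g a e \<and> a \<le> i \<and> i + int n \<le> e \<and> e - a \<le> int (depth \<xi> \<pi>) + int ((K + 2) * n)"
proof -
  obtain l where l: "l > 0" "l \<le> (K + 2) * n" "per l \<pi>" using loop_ploop[OF L] unfolding ploop_def by blast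
  define B where "B = depth \<xi> \<pi> + l"
  define ag where "ag x \<longleftrightarrow> \<xi> x = \<pi> (\<kappa> - i + x)" for x
  have bound: "w - u \<le> int B" if "\<And>x. u \<le> x \<Longrightarrow> x < w \<Longrightarrow> ag x" for u w
  proof (rule ccontr)
    assume "\<not> w - u \<le> int B"
    then have "occ \<xi> \<pi> (Suc (depth \<xi> \<pi>))"
      using that by (intro occ_of_agree[OF l(3,1), of u _ "\<kappa> - i"]) (auto simp: B_def ag_def)
    then show False using ploop_depth[OF loop_ploop[OF L]] by auto
  qed
  have in_i: "ag x" if "i \<le> x" "x < i + int n" for x
    using blk_eqD'[OF i, of x] that by (simp add: ag_def algebra_simps)
  define P where "P q \<longleftrightarrow> (\<forall>x. i - int q \<le> x \<and> x < i \<longrightarrow> ag x)" for q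
  have Pb: "\<forall>q. P q \<longrightarrow> q \<le> B" using bound[of "i - int q" i for q] by (auto simp: P_def)
  have P0: "P 0" by (auto simp: P_def)
  define q where "q = (GREATEST q. P q)"
  have Pq: "P q" unfolding q_def using GreatestI_nat[of P 0 B, OF P0] Pb by blast
  have nPq: "\<not> P (Suc q)" using Greatest_le_nat[of P "Suc q" B] Pb unfolding q_def by auto
  define a where "a = i - int q"
  have na: "\<not> ag (a - 1)"
  proof
    assume "ag (a - 1)"
    have "P (Suc q)" unfolding P_def
    proof (intro allI impI)
      fix x assume "i - int (Suc q) \<le> x \<and> x < i"
      then have "x = a - 1 \<or> (i - int q \<le> x \<and> x < i)" unfolding a_def of_nat_Suc by linarith
      then consider "x = a - 1" | "i - int q \<le> x \<and> x < i" by blast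
      then show "ag x" using \<open>ag (a - 1)\<close> Pq unfolding P_def by cases auto
    qed
    then show False using nPq by simp
  qed
  define R where "R q \<longleftrightarrow> (\<forall>x. i \<le> x \<and> x < i + int q \<longrightarrow> ag x)" for q
  have Rb: "\<forall>q. R q \<longrightarrow> q \<le> B" using bound[of i "i + int q" for q] by (auto simp: R_def)
  have Rn: "R n" using in_i by (simp add: R_def)
  define s where "s = (GREATEST q. R q)"
  have Rs: "R s" unfolding s_def using GreatestI_nat[of R n B, OF Rn] Rb by blast
  have sn: "n \<le> s" unfolding s_def using Greatest_le_nat[of R n B, OF Rn] Rb by blast
  have nRs: "\<not> R (Suc s)" using Greatest_le_nat[of R "Suc s" B] Rb unfolding s_def by auto
  define e where "e = i + int s"
  have ne: "\<not> ag e"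
  proof
    assume "ag e"
    have "R (Suc s)" unfolding R_def
    proof (intro allI impI)
      fix x assume "i \<le> x \<and> x < i + int (Suc s)"
      then have "x = e \<or> (i \<le> x \<and> x < i + int s)" unfolding e_def of_nat_Suc by linarith
      then consider "x = e" | "i \<le> x \<and> x < i + int s" by blast
      then show "ag x" using \<open>ag e\<close> Rs unfolding R_def by cases auto
    qed
    then show False using nRs by simp
  qed
  have all: "ag x" if "a \<le> x" "x < e" for x
    using that Pq Rs unfolding P_def R_def a_def e_def by (cases "x < i") auto
  have "blk \<xi> n a = blk \<pi> n (\<kappa> - i + a)"
  proof (rule blk_eqI)
    fix t assume "0 \<le> t" "t < int n"
    then have "ag (a + t)" using sn by (intro all) (auto simp: a_def e_def)
    then show "\<xi> (a + t) = \<pi> (\<kappa> - i + a + t)" by (simp add: ag_def add.assoc)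
  qed
  moreover have "\<xi> (a - 1) \<noteq> \<pi> (\<kappa> - i + a - 1)" using na by (simp add: ag_def algebra_simps)
  ultimately have ph: "\<pi> (\<kappa> - i + a + t) = \<pi> (g + t)" for t
    using loop_entry_unique(2)[OF L order_refl] by blast
  have ag': "ag x \<longleftrightarrow> \<xi> x = \<pi> (g + x - a)" for x
    using ph[of "x - a"] by (simp add: ag_def algebra_simps)
  have "run \<xi> \<pi> g a e"
    unfolding run_def
  proof (intro conjI allI impI)
    show "a \<le> e" by (simp add: a_def e_def)
    show "\<xi> k = \<pi> (g + k - a)" if "a \<le> k \<and> k < e" for k using all[of k] that ag' by simp
    show "\<xi> (a - 1) \<noteq> \<pi> (g - 1)" using na ag'[of "a - 1"] by simp
    show "\<xi> e \<noteq> \<pi> (g + e - a)" using ne ag' by simp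
  qed
  moreover have "e - a \<le> int B" using bound all by blast
  moreover have "int l \<le> int ((K + 2) * n)" using l(2) by (simp only: of_nat_le_iff)
  ultimately show ?thesis using sn
    by (intro exI[of _ a] exI[of _ e]) (auto simp: a_def e_def B_def)
qed

end

section \<open>The loop of least depth is the first one met\<close>

lemma LSI: "blk x n i = v \<Longrightarrow> blk x n j = v \<Longrightarrow> x (i - 1) \<noteq> x (j - 1) \<Longrightarrow> v \<in> LS x n"
  unfolding LS_def by blast

context colored_sequence
begin

lemma Q_ge_1: "Q \<ge> 1"
  using Q eps0 by (cases Q) auto

lemma pad_bound:
  assumes "N0 \<le> n" "real k \<le> real (100 * (K + 10) * n)" "100 * (K + 10) * Q * n \<le> t"
  shows "real k + m \<le> eps / 2 * real t"
proof -
  have t: "real (100 * (K + 10) * n) * real Q \<le> real t"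
  proof -
    have "real (100 * (K + 10) * n) * real Q = real (100 * (K + 10) * Q * n)" by simp
    then show ?thesis using assms(3) by (simp only: of_nat_le_iff)
  qed
  have "8 * real (100 * (K + 10) * n) \<le> (real Q * eps) * real (100 * (K + 10) * n)"
    using Q by (intro mult_right_mono) auto
  also have "\<dots> = eps * (real (100 * (K + 10) * n) * real Q)" by simp
  also have "\<dots> \<le> eps * real t" using t eps0 by (intro mult_left_mono) auto
  finally have 1: "8 * real (100 * (K + 10) * n) \<le> eps * real t" .
  have "n \<le> 100 * (K + 10) * Q * n" using Q_ge_1 by simp
  also note assms(3)
  finally have "eps * real n \<le> eps * real t" using eps0 by (intro mult_left_mono) auto
  then have "m \<le> eps / 8 * real t" using small_n[OF assms(1)] by simp
  then show ?thesis using 1 assms(2) by simp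
qed

lemma reach_large: "N0 \<le> n \<Longrightarrow> 100 * (K + 10) * Q * n + 10 \<le> reach n"
proof -
  assume "N0 \<le> n"
  have "100 * (K + 10) * Q * n + 10 \<le> (100 * (K + 10) * Q + 10) * n" using N0 \<open>N0 \<le> n\<close>
    by (simp add: algebra_simps)
  also have "\<dots> \<le> reach n" using M_large(1) by (intro reach_ge) simp
  finally show ?thesis .
qed

lemma pure_pad:
  assumes c: "c \<in> Cs" and pl: "ploop c n \<pi>" and n: "N0 \<le> n" "N0 \<le> n'"
    and j: "real k \<le> real (100 * (K + 10) * n')" "100 * (K + 10) * Q * n' \<le> k + t" "n \<le> t"
    and b: "blk x t y = blk \<pi> t \<kappa>"
  shows "pure c (blk x (k + t) (y - int k))" "pure c (blk x (t + k) y)"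
proof -
  have "dev c (blk x t y) \<le> eps / 2 * real (length (blk x t y))"
    using pl j(3) b by (simp add: ploop_def)
  note p = pure_append[OF c this, of k "k + t"]
  have jk: "real k + m \<le> eps / 2 * real (k + t)" by (rule pad_bound[OF n(2) j(1,2)])
  show "pure c (blk x (k + t) (y - int k))" unfolding blk_append
    using p(1)[of "blk x k (y - int k)"] jk by simp
  show "pure c (blk x (t + k) y)" unfolding blk_append
    using p(2)[of "blk x k (y + int t)"] jk by simp
qed

lemma first_RS:
  assumes "N0 \<le> n"
  shows "\<exists>k. k \<le> (K + 1) * n \<and> (\<forall>t<k. blk \<xi> n (a + int t) \<notin> RS \<xi> n) \<and> blk \<xi> n (a + int k) \<in> RS \<xi> n"
proof -
  define P where "P k \<longleftrightarrow> blk \<xi> n (a + int k) \<in> RS \<xi> n" for k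
  obtain y where y: "y \<ge> a" "y \<le> a + int ((K + 1) * n)" "blk \<xi> n y \<in> RS \<xi> n"
    using RS_within[OF assms] by blast
  then have P: "P (nat (y - a))" by (simp add: P_def)
  define k where "k = (LEAST k. P k)"
  have "P k" unfolding k_def by (rule LeastI[where P = P, OF P])
  moreover have "k \<le> nat (y - a)" unfolding k_def by (rule Least_le[where P = P, OF P])
  moreover have "nat (y - a) \<le> (K + 1) * n" using y(1,2) by linarith
  moreover have "\<not> P t" if "t < k" for t using not_less_Least[of t P] that unfolding k_def by simp
  ultimately show ?thesis unfolding P_def by (intro exI[of _ k]) auto
qed

lemma det_path:
  assumes "blk \<xi> n a = blk \<xi> n a'" "\<And>t. t < k \<Longrightarrow> blk \<xi> n (a + int t) \<notin> RS \<xi> n"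
  shows "t \<le> k \<Longrightarrow> blk \<xi> n (a + int t) = blk \<xi> n (a' + int t)"
proof (induction t)
  case (Suc t)
  then have IH: "blk \<xi> n (a + int t) = blk \<xi> n (a' + int t)" by simp
  have "\<xi> (a + int t + int n) = \<xi> (a' + int t + int n)"
    using Suc.prems by (intro det_fwd[OF IH] assms(2)) simp
  from blk_step[OF IH this] show ?case by (simp add: algebra_simps)
qed (simp add: assms)

text \<open>The \<open>K - 1\<close> entrances are left special up to the least depth
  \<open>D\<close>, so there is room for only one more left special word. The word at
  \<open>a\<close> fills this place: it leads into the loop of \<open>i1\<close> without any choice
  and stays left special as long as all runs of that loop agree. If \<open>q\<close> were not
  \<open>i1\<close>, then at length \<open>D - 1\<close> the entrance would be the only left special
  word of color \<open>q\<close>, and its loop could not end there.\<close>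

lemma depth_is_bounded_by_first_loop:
  assumes \<sigma>: "N0 \<le> \<sigma>" and F: "\<And>e. e \<in> Cs \<Longrightarrow> loop e \<sigma> (\<pi> e) (g e) (b e) (h e) (d e)"
    and la: "blk \<xi> \<sigma> a \<in> LS \<xi> \<sigma>" "\<And>e \<kappa>. e \<in> Cs \<Longrightarrow> blk \<xi> \<sigma> a \<noteq> blk (\<pi> e) \<sigma> \<kappa>"
    and i1: "i1 \<in> Cs" "\<And>t. t < k \<Longrightarrow> blk \<xi> \<sigma> (a + int t) \<notin> RS \<xi> \<sigma>" "blk \<xi> \<sigma> (a + int k) = blk (\<pi> i1) \<sigma> \<kappa>0"
    and q: "q \<in> Cs" "\<And>e. e \<in> Cs \<Longrightarrow> depth \<xi> (\<pi> q) \<le> depth \<xi> (\<pi> e)"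
  shows "q = i1"
proof (rule ccontr)
  assume qi: "q \<noteq> i1"
  define D where "D = depth \<xi> (\<pi> q)"
  have TD: "reach \<sigma> \<le> D" unfolding D_def by (rule loop_TT_depth[OF F[OF q(1)]])
  have big: "100 * (K + 10) * Q * \<sigma> + 10 \<le> D" using reach_large[OF \<sigma>] TD by simp
  have \<sigma>D: "\<sigma> + 10 \<le> D" using reach_gt[OF \<sigma>] TD by simp
  have pl: "ploop e \<sigma> (\<pi> e)" if "e \<in> Cs" for e using loop_ploop[OF F[OF that]] .
  define onl where "onl t \<longleftrightarrow> (\<exists>\<kappa>. blk \<xi> \<sigma> (a + int t) = blk (\<pi> i1) \<sigma> \<kappa>)" for t
  have onk: "onl k" using i1(3) by (auto simp: onl_def)
  define k' where "k' = (LEAST t. onl t)"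
  have onk': "onl k'" unfolding k'_def by (rule LeastI[where P = onl, OF onk])
  have k'k: "k' \<le> k" unfolding k'_def by (rule Least_le[where P = onl, OF onk])
  have before: "\<not> onl t" if "t < k'" for t using not_less_Least[of t onl] that unfolding k'_def by simp
  have k'0: "k' \<ge> 1"
  proof (rule ccontr)
    assume "\<not> k' \<ge> 1"
    then have "k' = 0" by simp
    then show False using onk' la(2)[OF i1(1)] by (simp add: onl_def)
  qed
  have kb: "k \<le> (K + 1) * \<sigma>"
  proof (rule ccontr)
    assume "\<not> k \<le> (K + 1) * \<sigma>"
    moreover obtain y where "y \<le> (K + 1) * \<sigma>" "blk \<xi> \<sigma> (a + int y) \<in> RS \<xi> \<sigma>" using first_RS[OF \<sigma>] by blast
    ultimately show False using i1(2)[of y] by simp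
  qed
  \<comment> \<open>No right special word occurs before \<open>k\<close>, so every occurrence of the
    word at \<open>a\<close> continues in the same way and enters the loop exactly at
    \<open>k'\<close>, the first time it is on it.\<close>
  have follow: "\<exists>e. run \<xi> (\<pi> i1) (g i1) (a' + int k') e \<and> a' + int k' + int \<sigma> \<le> e"
    and path: "\<And>t. t \<le> k' \<Longrightarrow> blk \<xi> \<sigma> (a' + int t) = blk \<xi> \<sigma> (a + int t)"
    if a': "blk \<xi> \<sigma> a' = blk \<xi> \<sigma> a" for a'
  proof -
    have path': "blk \<xi> \<sigma> (a + int t) = blk \<xi> \<sigma> (a' + int t)" if "t \<le> k" for t
      using det_path[of \<sigma> a a' k t] a' i1(2) that by auto
    then show "\<And>t. t \<le> k' \<Longrightarrow> blk \<xi> \<sigma> (a' + int t) = blk \<xi> \<sigma> (a + int t)" using k'k by simp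
    obtain \<kappa> where "blk \<xi> \<sigma> (a' + int k') = blk (\<pi> i1) \<sigma> \<kappa>" using onk' path'[OF k'k] unfolding onl_def by auto
    from run_exists[OF F[OF i1(1)] this] obtain ar er where
      r: "run \<xi> (\<pi> i1) (g i1) ar er" "ar \<le> a' + int k'" "a' + int k' + int \<sigma> \<le> er" by blast
    have "ar = a' + int k'"
    proof (rule ccontr)
      assume "ar \<noteq> a' + int k'"
      then have "ar \<le> a' + int (k' - 1)" using r(2) k'0 by simp
      moreover have "a' + int (k' - 1) + int \<sigma> \<le> er" using r(3) k'0 by simp
      ultimately have "blk \<xi> \<sigma> (a' + int (k' - 1)) = blk (\<pi> i1) \<sigma> (g i1 + (a' + int (k' - 1)) - ar)"
        by (intro run_blk[OF r(1)])
      then have "onl (k' - 1)" using path'[of "k' - 1"] k'k unfolding onl_def by auto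
      then show False using before[of "k' - 1"] k'0 by simp
    qed
    then show "\<exists>e. run \<xi> (\<pi> i1) (g i1) (a' + int k') e \<and> a' + int k' + int \<sigma> \<le> e" using r by blast
  qed
  \<comment> \<open>After the entrance all occurrences follow the same loop for \<open>R\<close>
    letters, so the two different letters on the left extend the word up to length
    \<open>k' + R\<close>.\<close>
  have stuck: "blk \<xi> r a \<in> LS \<xi> r"
    if R: "\<And>x y. run \<xi> (\<pi> i1) (g i1) x y \<Longrightarrow> x + int \<sigma> \<le> y \<Longrightarrow> x + int R \<le> y" and r: "\<sigma> \<le> r" "r \<le> k' + R" for R r
  proof -
    have eq: "blk \<xi> (k' + R) a' = blk \<xi> (k' + R) a" if a': "blk \<xi> \<sigma> a' = blk \<xi> \<sigma> a" for a'
    proof (rule blk_eqI)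
      fix t assume t: "0 \<le> t" "t < int (k' + R)"
      show "\<xi> (a' + t) = \<xi> (a + t)"
      proof (cases "t < int k'")
        case True
        have "blk \<xi> \<sigma> (a' + int (nat t)) = blk \<xi> \<sigma> (a + int (nat t))" using True t by (intro path[OF a']) auto
        from blk_eqD[OF this, of 0] show ?thesis using t \<sigma> N0 by simp
      next
        case False
        obtain e1 where e1: "run \<xi> (\<pi> i1) (g i1) (a' + int k') e1" "a' + int k' + int R \<le> e1" using follow[OF a'] R by blast
        obtain e2 where e2: "run \<xi> (\<pi> i1) (g i1) (a + int k') e2" "a + int k' + int R \<le> e2" using follow[OF refl] R by blast
        have "\<xi> (a' + t) = \<pi> i1 (g i1 + (a' + t) - (a' + int k'))" using e1 False t unfolding run_def by auto
        moreover have "\<xi> (a + t) = \<pi> i1 (g i1 + (a + t) - (a + int k'))" using e2 False t unfolding run_def by auto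
        ultimately show ?thesis by simp
      qed
    qed
    obtain x y where xy: "blk \<xi> \<sigma> x = blk \<xi> \<sigma> a" "blk \<xi> \<sigma> y = blk \<xi> \<sigma> a" "\<xi> (x - 1) \<noteq> \<xi> (y - 1)"
      using la(1) unfolding LS_def by blast
    show ?thesis by (rule LSI[OF blk_take[OF eq[OF xy(1)] r(2)] blk_take[OF eq[OF xy(2)] r(2)] xy(3)])
  qed
  define f where "f n e = blk (\<pi> e) n (g e)" for n e
  have fLS: "f n e \<in> LS \<xi> n" if "\<sigma> \<le> n" "n < D" "e \<in> Cs" for n e
    unfolding f_def using that q(2)[OF that(3)] by (intro loop_LS[OF F[OF that(3)]]) (auto simp: \<sigma> D_def)
  have fpure: "pure e (f n e)" if "\<sigma> \<le> n" "e \<in> Cs" for n e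
    unfolding f_def using ploop_pure[OF pl] that by blast
  have finj: "inj_on (f n) Cs" if "\<sigma> \<le> n" for n
  proof (rule inj_onI)
    fix e e' assume e: "e \<in> Cs" "e' \<in> Cs" "f n e = f n e'"
    have "length (f n e) > 0" using that \<sigma> N0 by (simp add: f_def)
    then show "e = e'" using pure_unique[OF fpure[OF that e(1)], of e'] fpure[OF that e(2)] e by auto
  qed
  have cardf: "card (f n ` Cs) = K - 1" if "\<sigma> \<le> n" for n using card_image[OF finj[OF that]] Cs by simp
  have a_not: "blk \<xi> n a \<notin> f n ` Cs" if "\<sigma> \<le> n" for n
    using blk_prefix_ne[OF la(2) that] unfolding f_def by auto
  \<comment> \<open>The shortest run of any loop is examined at length \<open>s + 1\<close>, just
    after its end. If \<open>s + 2 \<le> D\<close>, its first \<open>s + 1\<close> letters are a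
    further left special word: a longer passage ends with the same \<open>s\<close> letters and the
    same exit letter, but is preceded by a letter of the loop. With the word at \<open>a\<close> and
    the entrances this makes \<open>K + 1\<close>.\<close>
  have runs: "D - 1 \<le> nat (y - x)" if r: "e \<in> Cs" "run \<xi> (\<pi> e) (g e) x y" "x + int \<sigma> \<le> y" for e x y
  proof (rule ccontr)
    assume short: "\<not> D - 1 \<le> nat (y - x)"
    define P where "P s \<longleftrightarrow> (\<exists>e\<in>Cs. \<exists>x y. run \<xi> (\<pi> e) (g e) x y \<and> y - x = int s \<and> \<sigma> \<le> s)" for s
    have "P (nat (y - x))" unfolding P_def using r by (intro bexI[of _ e] exI[of _ x] exI[of _ y]) auto
    define s where "s = (LEAST s. P s)"
    have Ps: "P s" unfolding s_def by (rule LeastI[where P = P, OF \<open>P (nat (y - x))\<close>])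
    have "s \<le> nat (y - x)" unfolding s_def by (rule Least_le[where P = P, OF \<open>P (nat (y - x))\<close>])
    then have sD: "s + 2 \<le> D" using short by simp
    obtain e0 x0 y0 where e0: "e0 \<in> Cs" "run \<xi> (\<pi> e0) (g e0) x0 y0" "y0 = x0 + int s" "\<sigma> \<le> s"
      using Ps unfolding P_def by (metis add.commute diff_eq_eq)
    have smin: "x + int s \<le> y" if "run \<xi> (\<pi> i1) (g i1) x y" "x + int \<sigma> \<le> y" for x y
    proof -
      have "P (nat (y - x))" unfolding P_def using that i1(1) by (intro bexI[of _ i1] exI[of _ x] exI[of _ y]) auto
      then have "s \<le> nat (y - x)" unfolding s_def by (rule Least_le[where P = P])
      then show ?thesis using that by linarith
    qed
    have aLS: "blk \<xi> (s + 1) a \<in> LS \<xi> (s + 1)" by (rule stuck[OF smin]) (use e0 k'0 in auto)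
    note ends = run_ends[OF F[OF e0(1)] e0(2), unfolded e0(3)]
    have e4: "x0 + int \<sigma> \<le> x0 + int s" using e0(4) by simp
    obtain j where j: "blk \<xi> (s + 1) j = blk (\<pi> e0) (s + 1) (h e0 - int (s + 1))" "\<xi> (j + int (s + 1)) = d e0"
      using loop_exit(1)[OF F[OF e0(1)] e0(1) \<sigma>, of "s + 1"] e0(4) sD q(2)[OF e0(1)] unfolding D_def by auto
    have shift: "\<pi> e0 (h e0 - int s + t) = \<pi> e0 (g e0 + t)" for t
      using ends(3)[OF e4, of "t - int s"] by (simp add: algebra_simps)
    have x0blk: "blk \<xi> s x0 = blk (\<pi> e0) s (g e0)" using run_blk[OF e0(2), of x0 s] e0(3) by simp
    have j1: "blk \<xi> s (j + 1) = blk (\<pi> e0) s (g e0)"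
    proof (rule blk_eqI)
      fix t assume "0 \<le> t" "t < int s"
      then have "\<xi> (j + (1 + t)) = \<pi> e0 (h e0 - int (s + 1) + (1 + t))" by (intro blk_eqD[OF j(1)]) auto
      then show "\<xi> (j + 1 + t) = \<pi> e0 (g e0 + t)" using shift[of t] by (simp add: algebra_simps)
    qed
    have x0j: "blk \<xi> (s + 1) (j + 1) = blk \<xi> (s + 1) x0"
      using j1 x0blk j(2) ends(2)[OF e4] by (simp add: blk_Suc algebra_simps)
    have xl: "\<xi> (x0 - 1) \<noteq> \<xi> (j + 1 - 1)"
    proof -
      have "\<xi> j = \<pi> e0 (h e0 - int (s + 1))" using blk_eqD[OF j(1), of 0] by simp
      also have "\<dots> = \<pi> e0 (g e0 - 1)" using shift[of "-1"] by (simp add: algebra_simps)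
      finally show ?thesis using e0(2) by (simp add: run_def)
    qed
    have x0LS: "blk \<xi> (s + 1) x0 \<in> LS \<xi> (s + 1)" by (rule LSI[OF refl x0j xl])
    have x0_not: "blk \<xi> (s + 1) x0 \<notin> f (s + 1) ` Cs"
    proof
      assume "blk \<xi> (s + 1) x0 \<in> f (s + 1) ` Cs"
      then obtain e where e: "e \<in> Cs" "blk \<xi> (s + 1) x0 = blk (\<pi> e) (s + 1) (g e)" by (auto simp: f_def)
      have 1: "blk \<xi> s x0 = blk (\<pi> e) s (g e)" using blk_take[OF e(2), of s] by simp
      then have "f s e0 = f s e" using x0blk by (simp add: f_def)
      then have "e = e0" using finj[OF e0(4)] e(1) e0(1) by (auto dest: inj_onD)
      then have "\<xi> (x0 + int s) = \<pi> e0 (g e0 + int s)" using e(2) by (simp add: blk_Suc)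
      then show False using e0(2,3) by (simp add: run_def)
    qed
    have ax: "blk \<xi> (s + 1) a \<noteq> blk \<xi> (s + 1) x0"
    proof
      assume "blk \<xi> (s + 1) a = blk \<xi> (s + 1) x0"
      then have "blk \<xi> \<sigma> a = blk \<xi> \<sigma> x0" by (rule blk_take) (use e0(4) in simp)
      also have "\<dots> = blk (\<pi> e0) \<sigma> (g e0)" using x0blk e0(4) by (rule blk_take)
      finally show False using la(2)[OF e0(1)] by blast
    qed
    define S where "S = insert (blk \<xi> (s + 1) a) (insert (blk \<xi> (s + 1) x0) (f (s + 1) ` Cs))"
    have "S \<subseteq> LS \<xi> (s + 1)" unfolding S_def using aLS x0LS fLS[of "s + 1"] e0(4) sD by auto
    moreover have "card S = K + 1"
      unfolding S_def using a_not[of "s + 1"] x0_not ax e0(4) cardf[of "s + 1"] finCs K4 by simp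
    ultimately show False using LS_full(3)[of "s + 1" S] \<sigma> e0(4) by simp
  qed
  have runs': "x + int (D - 1) \<le> y" if "run \<xi> (\<pi> i1) (g i1) x y" "x + int \<sigma> \<le> y" for x y
    using runs[OF i1(1) that] that by linarith
  define n where "n = D - 1"
  have n: "\<sigma> \<le> n" "n < D" "Suc n = D" using \<sigma>D by (auto simp: n_def)
  have aLS: "blk \<xi> n a \<in> LS \<xi> n" by (rule stuck[OF runs']) (use n in \<open>auto simp: n_def\<close>)
  have k'b: "k' \<le> (K + 1) * \<sigma>" using kb k'k by simp
  have k'\<sigma>: "k' + \<sigma> \<le> n"
  proof -
    have "(K + 2) * \<sigma> \<le> 100 * (K + 10) * Q * \<sigma>" using Q_ge_1
      by (intro mult_right_mono) (auto intro: order_trans[of _ "100 * (K + 10) * 1"])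
    then show ?thesis using k'b big n by simp
  qed
  \<comment> \<open>Only the first \<open>k'\<close> letters may lie off the loop of
    \<open>i1\<close>, and they are few compared with \<open>n\<close>.\<close>
  have apure: "pure i1 (blk \<xi> n a)"
  proof -
    obtain e1 where e1: "run \<xi> (\<pi> i1) (g i1) (a + int k') e1" "a + int k' + int n \<le> e1"
      using follow[OF refl] runs' unfolding n_def by blast
    have "blk \<xi> (n - k') (a + int k') = blk (\<pi> i1) (n - k') (g i1 + (a + int k') - (a + int k'))"
      using e1 by (intro run_blk) auto
    moreover have "k' \<le> 100 * (K + 10) * \<sigma>" using k'b by (rule order_trans) (rule mult_le_mono1, simp)
    then have "real k' \<le> real (100 * (K + 10) * \<sigma>)" by (simp only: of_nat_le_iff)
    moreover have "100 * (K + 10) * Q * \<sigma> \<le> k' + (n - k')" using big n by simp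
    ultimately have "pure i1 (blk \<xi> (k' + (n - k')) (a + int k' - int k'))"
      using k'\<sigma> by (intro pure_pad(1)[OF i1(1) pl[OF i1(1)] \<sigma> \<sigma>]) auto
    then show ?thesis using k'\<sigma> by simp
  qed
  define S where "S = insert (blk \<xi> n a) (f n ` Cs)"
  have SLS: "S \<subseteq> LS \<xi> n" unfolding S_def using aLS fLS n by auto
  have cS: "card S = K" unfolding S_def using a_not[OF n(1)] cardf[OF n(1)] finCs K4 by simp
  have nN: "N0 \<le> n" using \<sigma> n by simp
  note full = LS_full[OF nN SLS eq_refl[OF cS[symmetric]]]
  have "lsimple q n (f n q)" unfolding lsimple_def
  proof (intro conjI ballI impI)
    show "f n q \<in> LS \<xi> n" "pure q (f n q)" using fLS fpure n q by auto
    show "card (lx \<xi> (f n q)) = 2" using full(2)[of "f n q"] q(1) unfolding S_def by auto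
    fix v assume v: "v \<in> LS \<xi> n" "pure q v"
    have "length v = n" using v(1) by (auto simp: LS_def)
    then have "v \<noteq> []" using nN N0 by auto
    have "v \<noteq> blk \<xi> n a" using pure_unique[OF v(2) _ \<open>v \<noteq> []\<close> q(1) i1(1)] apure qi by auto
    then obtain e where "e \<in> Cs" "v = f n e" using v(1) full(1) unfolding S_def by auto
    then show "v = f n q" using pure_unique[OF v(2) _ \<open>v \<noteq> []\<close> q(1), of e] fpure[OF n(1), of e] by auto
  qed
  moreover have "occ \<xi> (\<pi> q) (Suc n)" using ploop_depth[OF pl[OF q(1)]] n by (simp add: D_def)
  ultimately have "occ \<xi> (\<pi> q) (reach n)" by (intro depth_of_lsimple[OF pl[OF q(1)] q(1) \<sigma> n(1)])
  then have "reach n \<le> D" using ploop_depth[OF pl[OF q(1)]] by (simp add: D_def)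
  then show False using reach_gt[OF nN] n by simp
qed

section \<open>Runs of a loop are long\<close>

text \<open>A jump is a passage through a loop that ends before the depth of the loop is reached. At length
  \<open>s + 1\<close> it would produce a left and a right special word outside all loops. Following the first one forward
  and the second one backward, one would first meet two different loops, but
  \<open>depth_is_bounded_by_first_loop\<close> and its mirror image identify both as the loop of least depth.\<close>

definition jump :: "'c \<Rightarrow> nat \<Rightarrow> (int \<Rightarrow> 'a) \<Rightarrow> int \<Rightarrow> 'a \<Rightarrow> int \<Rightarrow> 'a \<Rightarrow> int \<Rightarrow> nat \<Rightarrow> bool" where
  "jump c n \<pi> g b h d a s \<longleftrightarrow> c \<in> Cs \<and> N0 \<le> n \<and> loop c n \<pi> g b h d \<and> run \<xi> \<pi> g a (a + int s) \<and>
     n \<le> s \<and> s + 2 \<le> depth \<xi> \<pi>"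

lemma jumpD:
  assumes "jump c n \<pi> g b h d a s"
  shows "c \<in> Cs" "N0 \<le> n" "loop c n \<pi> g b h d" "run \<xi> \<pi> g a (a + int s)" "n \<le> s" "s + 2 \<le> depth \<xi> \<pi>"
    "a + int n \<le> a + int s" "N0 \<le> Suc s" "ploop c n \<pi>"
  using assms loop_ploop unfolding jump_def by auto

lemma jump_rv:
  assumes "jump c n \<pi> g b h d a s"
  shows "colored_sequence.jump (rv \<xi>) K N0 Cs (rdev dev) eps M c n (rv \<pi>) (1 - h) d (1 - g) b (1 - a - int s) s"
proof -
  note J = jumpD[OF assms]
  have "run (rv \<xi>) (rv \<pi>) (1 - h) (1 - (a + int s)) (1 - a)" by (rule run_rv[OF J(3,4,7)])
  moreover have "1 - (a + int s) = 1 - a - int s" "1 - a = 1 - a - int s + int s" by simp_all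
  ultimately have r: "run (rv \<xi>) (rv \<pi>) (1 - h) (1 - a - int s) (1 - a - int s + int s)" by metis
  show ?thesis unfolding colored_sequence.jump_def[OF colored_sequence_rv] depth_rv using J r loop_rv[OF J(3)] by blast
qed

lemma jump_shift:
  assumes "jump c n \<pi> g b h d a s"
  shows "\<pi> (h - int s + t) = \<pi> (g + t)"
  using run_ends(3)[OF jumpD(3,4,7)[OF assms], of "t - int s"] by (simp add: algebra_simps)

text \<open>A passage longer than \<open>s\<close> ends with the same \<open>s\<close> letters and
  the same exit letter, because entrance and exit phase differ by \<open>s\<close>. To the left it
  shows a letter of the loop, while the jump shows \<open>b\<close>.\<close>

lemma jump_LS:
  assumes jp: "jump c n \<pi> g b h d a s"
  shows "blk \<xi> (Suc s) a \<in> LS \<xi> (Suc s)" "blk \<xi> (Suc s) a \<noteq> blk \<pi> (Suc s) \<kappa>"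
    "pure c (blk \<xi> (Suc s) a)"
    "\<And>j. blk \<xi> (Suc s) j = blk \<pi> (Suc s) (h - int (Suc s)) \<Longrightarrow> \<xi> (j + int (Suc s)) = d \<Longrightarrow>
      blk \<xi> (Suc s) (j + 1) = blk \<xi> (Suc s) a"
proof -
  note J = jumpD[OF jp]
  note ends = run_ends[OF J(3,4,7)]
  note shift = jump_shift[OF jp]
  have ablk: "blk \<xi> s a = blk \<pi> s g" using run_blk[OF J(4), of a s] by simp
  show nxt: "blk \<xi> (Suc s) (j + 1) = blk \<xi> (Suc s) a"
    if j: "blk \<xi> (Suc s) j = blk \<pi> (Suc s) (h - int (Suc s))" "\<xi> (j + int (Suc s)) = d" for j
  proof -
    have "blk \<xi> s (j + 1) = blk \<pi> s g"
    proof (rule blk_eqI)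
      fix t assume "0 \<le> t" "t < int s"
      then have "\<xi> (j + (1 + t)) = \<pi> (h - int (Suc s) + (1 + t))" by (intro blk_eqD[OF j(1)]) auto
      then show "\<xi> (j + 1 + t) = \<pi> (g + t)" using shift[of t] by (simp add: algebra_simps)
    qed
    then show ?thesis using ablk j(2) ends(2) by (simp add: blk_Suc algebra_simps)
  qed
  obtain j where j: "blk \<xi> (Suc s) j = blk \<pi> (Suc s) (h - int (Suc s))" "\<xi> (j + int (Suc s)) = d"
    using loop_exit(1)[OF J(3,1,2), of "Suc s"] J(5,6) by auto
  have "\<xi> (a - 1) \<noteq> \<xi> (j + 1 - 1)"
  proof -
    have "\<xi> j = \<pi> (h - int (Suc s))" using blk_eqD[OF j(1), of 0] by simp
    also have "\<dots> = \<pi> (g - 1)" using shift[of "-1"] by (simp add: algebra_simps)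
    finally show ?thesis using J(4) by (simp add: run_def)
  qed
  then show "blk \<xi> (Suc s) a \<in> LS \<xi> (Suc s)" by (intro LSI[OF refl nxt[OF j]])
  show "blk \<xi> (Suc s) a \<noteq> blk \<pi> (Suc s) \<kappa>"
  proof
    assume eq: "blk \<xi> (Suc s) a = blk \<pi> (Suc s) \<kappa>"
    then have "blk \<pi> s g = blk \<pi> s \<kappa>" using ablk by (simp add: blk_Suc)
    then have "\<pi> (g + int s) = \<pi> (\<kappa> + int s)" by (rule loop_phase[OF J(3,5)])
    then show False using eq J(4) by (simp add: blk_Suc run_def)
  qed
  have dv: "dev c (blk \<xi> s a) \<le> eps / 2 * real (length (blk \<xi> s a))"
    using J(9,5) ablk by (simp add: ploop_def)
  have "eps / 8 * real n \<le> eps / 2 * real (Suc s)" using J(5) eps0 by (intro mult_mono) auto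
  then have "real 1 + m \<le> eps / 2 * real (Suc s)" using small_n[OF J(2)] by simp
  then have "pure c (blk \<xi> s a @ [\<xi> (a + int s)])" by (intro pure_append(2)[OF J(1) dv, of 1]) auto
  then show "pure c (blk \<xi> (Suc s) a)" by (simp add: blk_Suc)
qed

lemma jump_RS:
  assumes jp: "jump c n \<pi> g b h d a s"
  shows "blk \<xi> (Suc s) (a - 1) \<in> RS \<xi> (Suc s)" "blk \<xi> (Suc s) (a - 1) \<noteq> blk \<pi> (Suc s) \<kappa>"
    "pure c (blk \<xi> (Suc s) (a - 1))"
proof -
  have e: "1 - (1 - a - int s) - int (Suc s) = a - 1" by simp
  note L = colored_sequence.jump_LS[OF colored_sequence_rv jump_rv[OF jp], unfolded LS_rv pure_rv]
  note B = blk_rv[of \<xi> "Suc s" "1 - a - int s", unfolded e]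
  show "blk \<xi> (Suc s) (a - 1) \<in> RS \<xi> (Suc s)" using L(1) unfolding B by simp
  show "pure c (blk \<xi> (Suc s) (a - 1))" using L(3) unfolding B by simp
  show "blk \<xi> (Suc s) (a - 1) \<noteq> blk \<pi> (Suc s) \<kappa>"
    using L(2)[of "1 - \<kappa> - int (Suc s)"] unfolding B by (simp add: blk_rv)
qed

text \<open>The word starting just before the jump and the exit word are two right special words of
  color \<open>c\<close>, so all other colors are simple. After either of them comes the entrance
  word or the word at \<open>a\<close>, since \<open>h - s\<close> and \<open>g\<close> are the same
  phase: the only way out of color \<open>c\<close> is through the word at \<open>a\<close>.\<close>

lemma jump_struct:
  assumes jp: "jump c n \<pi> g b h d a s"
  shows "\<And>w. w \<in> RS \<xi> (Suc s) \<Longrightarrow> pure c w \<Longrightarrow> w = blk \<xi> (Suc s) (a - 1) \<or> w = blk \<pi> (Suc s) (h - int (Suc s))"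
    "\<And>w. w \<in> RS \<xi> (Suc s) \<Longrightarrow> \<not> pure c w \<Longrightarrow> \<exists>e\<in>Cs - {c}. rsimple e (Suc s) w"
    "\<And>e. e \<in> Cs \<Longrightarrow> e \<noteq> c \<Longrightarrow> \<exists>r. rsimple e (Suc s) r"
    "\<And>y. blk \<xi> (Suc s) y \<in> RS \<xi> (Suc s) \<Longrightarrow> pure c (blk \<xi> (Suc s) y) \<Longrightarrow>
      blk \<xi> (Suc s) (y + 1) = blk \<xi> (Suc s) a \<or> blk \<xi> (Suc s) (y + 1) = blk \<pi> (Suc s) g"
    "blk \<pi> (Suc s) (h - int s) = blk \<pi> (Suc s) g"
proof -
  note J = jumpD[OF jp]
  define Y where "Y = blk \<xi> (Suc s) (a - 1)"
  define Z where "Z = blk \<pi> (Suc s) (h - int (Suc s))"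
  have Z: "Z \<in> RS \<xi> (Suc s)" unfolding Z_def using J by (intro loop_RS[OF J(3,1,2)]) auto
  have Zp: "pure c Z" unfolding Z_def using J by (intro ploop_pure) auto
  have YZ: "Y \<noteq> Z" unfolding Y_def Z_def by (rule jump_RS(2)[OF jp])
  note Y = jump_RS(1,3)[OF jp, folded Y_def]
  note st = RS_struct[OF J(8,1) Y(1) Z YZ Y(2) Zp]
  show only: "w = blk \<xi> (Suc s) (a - 1) \<or> w = blk \<pi> (Suc s) (h - int (Suc s))"
    if "w \<in> RS \<xi> (Suc s)" "pure c w" for w using st(3)[OF that] by (simp add: Y_def Z_def)
  show "\<exists>e\<in>Cs - {c}. rsimple e (Suc s) w" if "w \<in> RS \<xi> (Suc s)" "\<not> pure c w" for w using st(4)[OF that] .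
  show "\<exists>r. rsimple e (Suc s) r" if "e \<in> Cs" "e \<noteq> c" for e using st(5)[OF that] .
  show sh: "blk \<pi> (Suc s) (h - int s) = blk \<pi> (Suc s) g"
    by (rule blk_eqI) (rule jump_shift[OF jp])
  fix y assume y: "blk \<xi> (Suc s) y \<in> RS \<xi> (Suc s)" "pure c (blk \<xi> (Suc s) y)"
  from only[OF y] consider "blk \<xi> (Suc s) y = Y" | "blk \<xi> (Suc s) y = Z" by (auto simp: Y_def Z_def)
  then show "blk \<xi> (Suc s) (y + 1) = blk \<xi> (Suc s) a \<or> blk \<xi> (Suc s) (y + 1) = blk \<pi> (Suc s) g"
  proof cases
    case 1
    obtain j where j: "blk \<xi> (Suc s) j = blk \<pi> (Suc s) g" "\<xi> (j - 1) = b"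
      using loop_entry(1)[OF J(3,1,2), of "Suc s"] J(5,6) by auto
    have ablk: "blk \<xi> s a = blk \<pi> s g" using run_blk[OF J(4), of a s] by simp
    have "blk \<xi> s j = blk \<xi> s a" using ablk blk_take[OF j(1), of s] by simp
    then have jY: "blk \<xi> (Suc s) (j - 1) = Y"
      unfolding Y_def using j(2) run_ends(1)[OF J(3,4,7)] by (simp add: blk_Suc_eq')
    have l1: "\<xi> (j - 1 + int (Suc s)) = \<pi> (g + int s)" using j(1) by (simp add: blk_Suc algebra_simps)
    have l2: "\<xi> (a - 1 + int (Suc s)) = \<xi> (a + int s)" by (simp add: algebra_simps)
    have ne: "\<xi> (a - 1 + int (Suc s)) \<noteq> \<xi> (j - 1 + int (Suc s))" unfolding l1 l2 using J(4) by (simp add: run_def)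
    have "\<xi> (y + int (Suc s)) = \<xi> (a - 1 + int (Suc s)) \<or> \<xi> (y + int (Suc s)) = \<xi> (j - 1 + int (Suc s))"
      using st(1) jY 1 by (intro two_letters[OF _ _ _ ne]) (simp_all add: Y_def)
    then show ?thesis
    proof
      assume l: "\<xi> (y + int (Suc s)) = \<xi> (a - 1 + int (Suc s))"
      have p: "blk \<xi> (Suc s) y = blk \<xi> (Suc s) (a - 1)" using 1 by (simp add: Y_def)
      from blk_step[OF p l] show ?thesis by simp
    next
      assume l: "\<xi> (y + int (Suc s)) = \<xi> (j - 1 + int (Suc s))"
      have p: "blk \<xi> (Suc s) y = blk \<xi> (Suc s) (j - 1)" using 1 jY by simp
      from blk_step[OF p l] j(1) show ?thesis by simp
    qed
  next
    case 2
    obtain j where j: "blk \<xi> (Suc s) j = Z" "\<xi> (j + int (Suc s)) = d" "d \<noteq> \<pi> h"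
      using loop_exit[OF J(3,1,2), of "Suc s"] J(5,6) unfolding Z_def by auto
    obtain i where i: "blk \<xi> (Suc (Suc s)) i = blk \<pi> (Suc (Suc s)) (h - int (Suc s))"
      using loop_occ[OF J(3), of "Suc (Suc s)"] J(6) by auto
    then have i': "blk \<xi> (Suc s) i = Z" "\<xi> (i + int (Suc s)) = \<pi> h"
      unfolding Z_def by (simp_all add: blk_Suc_eq[of _ "Suc s"])
    have i1: "blk \<xi> (Suc s) (i + 1) = blk \<pi> (Suc s) g"
    proof -
      have "blk \<xi> (Suc s) (i + 1) = blk \<pi> (Suc s) (h - int (Suc s) + 1)" using i blk_Suc_eq'[of \<xi> "Suc s"] by blast
      also have "h - int (Suc s) + 1 = h - int s" by simp
      finally show ?thesis using sh by simp
    qed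
    have ne: "\<xi> (i + int (Suc s)) \<noteq> \<xi> (j + int (Suc s))" using i' j by simp
    have "\<xi> (y + int (Suc s)) = \<xi> (i + int (Suc s)) \<or> \<xi> (y + int (Suc s)) = \<xi> (j + int (Suc s))"
      using st(2) j(1) i' 2 by (intro two_letters[OF _ _ _ ne]) simp_all
    then show ?thesis
    proof
      assume l: "\<xi> (y + int (Suc s)) = \<xi> (i + int (Suc s))"
      have p: "blk \<xi> (Suc s) y = blk \<xi> (Suc s) i" using 2 i' by simp
      from blk_step[OF p l] i1 show ?thesis by simp
    next
      assume l: "\<xi> (y + int (Suc s)) = \<xi> (j + int (Suc s))"
      have p: "blk \<xi> (Suc s) y = blk \<xi> (Suc s) j" using 2 j(1) by simp
      have "blk \<xi> (Suc s) (y + 1) = blk \<xi> (Suc s) (j + 1)" by (rule blk_step[OF p l])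
      moreover have "blk \<xi> (Suc s) (j + 1) = blk \<xi> (Suc s) a" using jump_LS(4)[OF jp] j unfolding Z_def by blast
      ultimately show ?thesis by simp
    qed
  qed
qed

lemma jump_lsimple:
  assumes jp: "jump c n \<pi> g b h d a s" and "e \<in> Cs" "e \<noteq> c"
  shows "\<exists>r. lsimple e (Suc s) r"
  using colored_sequence.jump_struct(3)[OF colored_sequence_rv jump_rv[OF jp] assms(2,3)] unfolding rsimple_rv by blast

text \<open>If the first right special word after the jump still had color \<open>c\<close>, then
  \<open>jump_struct\<close> would lead from it back to the loop or to the jump, and the color could
  never be left.\<close>

lemma jump_fwd:
  assumes jp: "jump c n \<pi> g b h d a s"
  shows "\<exists>k i1. k \<le> (K + 1) * Suc s \<and> i1 \<in> Cs \<and> i1 \<noteq> c \<and> (\<forall>t<k. blk \<xi> (Suc s) (a + int t) \<notin> RS \<xi> (Suc s)) \<and>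
     rsimple i1 (Suc s) (blk \<xi> (Suc s) (a + int k))"
proof -
  note J = jumpD[OF jp]
  note st = jump_struct[OF jp]
  obtain k where k: "k \<le> (K + 1) * Suc s" "\<And>t. t < k \<Longrightarrow> blk \<xi> (Suc s) (a + int t) \<notin> RS \<xi> (Suc s)"
    "blk \<xi> (Suc s) (a + int k) \<in> RS \<xi> (Suc s)"
    using first_RS[OF J(8), of a] by blast
  have "\<not> pure c (blk \<xi> (Suc s) (a + int k))"
  proof
    assume pk: "pure c (blk \<xi> (Suc s) (a + int k))"
    define S where "S = insert (blk \<xi> (Suc s) (a - 1)) (range (blk \<pi> (Suc s)) \<union> (\<lambda>t. blk \<xi> (Suc s) (a + int t)) ` {..k})"
    have XS: "blk \<xi> (Suc s) a \<in> S" unfolding S_def by (intro insertI2 UnI2 image_eqI[of _ _ 0]) auto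
    have SR: "pure c v" if "v \<in> S" "v \<in> RS \<xi> (Suc s)" for v
    proof -
      from that(1) consider "v = blk \<xi> (Suc s) (a - 1)" | \<kappa> where "v = blk \<pi> (Suc s) \<kappa>" |
        t where "t \<le> k" "v = blk \<xi> (Suc s) (a + int t)" unfolding S_def by auto
      then show ?thesis
      proof cases
        case 1 then show ?thesis using jump_RS(3)[OF jp] by simp
      next
        case 2 then show ?thesis using ploop_pure[OF J(9), of "Suc s"] J(5) by simp
      next
        case 3 then show ?thesis using k(2)[of t] that(2) pk by (cases "t = k") auto
      qed
    qed
    have cl: "blk \<xi> (Suc s) y \<in> S" for y
    proof (rule closed_fwd[OF XS])
      fix y assume y: "blk \<xi> (Suc s) y \<in> S"
      show "blk \<xi> (Suc s) (y + 1) \<in> S"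
      proof (cases "blk \<xi> (Suc s) y \<in> RS \<xi> (Suc s)")
        case True
        from st(4)[OF True SR[OF y True]] show ?thesis using XS unfolding S_def by auto
      next
        case False
        from y consider "blk \<xi> (Suc s) y = blk \<xi> (Suc s) (a - 1)" | \<kappa> where "blk \<xi> (Suc s) y = blk \<pi> (Suc s) \<kappa>" |
          t where "t \<le> k" "blk \<xi> (Suc s) y = blk \<xi> (Suc s) (a + int t)" unfolding S_def by auto
        then show ?thesis
        proof cases
          case 1 then show ?thesis using jump_RS(1)[OF jp] False by simp
        next
          case 2
          have "occ \<xi> \<pi> (Suc (Suc s))" using ploop_depth[OF J(9)] J(6) by simp
          from blk_step[OF 2 occ_det[OF this 2 False]] show ?thesis unfolding S_def by auto
        next
          case 3
          have "t \<noteq> k" using 3 False k(3) by auto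
          from blk_step[OF 3(2) det_fwd[OF 3(2) False]]
          have "blk \<xi> (Suc s) (y + 1) = blk \<xi> (Suc s) (a + int (Suc t))" by (simp add: algebra_simps)
          then show ?thesis unfolding S_def using 3(1) \<open>t \<noteq> k\<close> by (intro insertI2 UnI2 image_eqI[of _ _ "Suc t"]) auto
        qed
      qed
    qed
    obtain e where e: "e \<in> Cs" "e \<noteq> c" using other_color[OF J(1)] by blast
    obtain r where r: "rsimple e (Suc s) r" using st(3)[OF e] by blast
    then obtain y where "r = blk \<xi> (Suc s) y" "r \<in> RS \<xi> (Suc s)" "pure e r" unfolding rsimple_def RS_def by blast
    then show False using RS_pure_unique[OF _ J(8) SR, of r e] cl[of y] e J(1) by auto
  qed
  then show ?thesis using st(2)[OF k(3)] k by blast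
qed

lemma jump_bwd:
  assumes jp: "jump c n \<pi> g b h d a s"
  shows "\<exists>k i2. k \<le> (K + 1) * Suc s \<and> i2 \<in> Cs \<and> i2 \<noteq> c \<and> (\<forall>t<k. blk \<xi> (Suc s) (a - 1 - int t) \<notin> LS \<xi> (Suc s)) \<and>
     lsimple i2 (Suc s) (blk \<xi> (Suc s) (a - 1 - int k))"
proof -
  obtain k i2 where k: "k \<le> (K + 1) * Suc s" "i2 \<in> Cs" "i2 \<noteq> c"
    "\<And>t. t < k \<Longrightarrow> blk (rv \<xi>) (Suc s) (1 - a - int s + int t) \<notin> RS (rv \<xi>) (Suc s)"
    "colored_sequence.rsimple (rv \<xi>) (rdev dev) eps i2 (Suc s) (blk (rv \<xi>) (Suc s) (1 - a - int s + int k))"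
    using colored_sequence.jump_fwd[OF colored_sequence_rv jump_rv[OF jp]] by blast
  have e: "blk (rv \<xi>) (Suc s) (1 - a - int s + int t) = rev (blk \<xi> (Suc s) (a - 1 - int t))" for t
  proof -
    have e: "1 - (1 - a - int s + int t) - int (Suc s) = a - 1 - int t" by simp
    show ?thesis by (simp only: blk_rv e)
  qed
  show ?thesis using k unfolding e RS_rv rsimple_rv by auto
qed

lemma loop_RS_simple:
  assumes "loop e n \<pi> g b h d" "e \<in> Cs" "N0 \<le> n" "n \<le> k" "k < depth \<xi> \<pi>" "rsimple e k r"
  shows "r = blk \<pi> k (h - int k)"
  using loop_RS[OF assms(1-5)] ploop_pure[OF loop_ploop[OF assms(1)] assms(4)] assms(6) unfolding rsimple_def by metis

lemma loop_LS_simple: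
  assumes "loop e n \<pi> g b h d" "e \<in> Cs" "N0 \<le> n" "n \<le> k" "k < depth \<xi> \<pi>" "lsimple e k r"
  shows "r = blk \<pi> k g"
  using loop_LS[OF assms(1-5)] ploop_pure[OF loop_ploop[OF assms(1)] assms(4)] assms(6) unfolding lsimple_def by metis

text \<open>In a stretch typical for \<open>c\<close> at scale \<open>s + 1\<close>, taking the jump
  would lead within one waiting time to a word of another color. So the stretch stays on the loop
  throughout, and the loop lasts much longer than the jump.\<close>

lemma jump_deep:
  assumes jp: "jump c n \<pi> g b h d a s"
  shows "reach (Suc s) \<le> depth \<xi> \<pi>"
proof -
  note J = jumpD[OF jp]
  note st = jump_struct[OF jp]
  define \<sigma> where "\<sigma> = Suc s"
  define p where "p = int ((K + 1) * \<sigma>)"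
  have \<sigma>N: "N0 \<le> \<sigma>" "\<sigma> \<ge> 1" using J(8) by (simp_all add: \<sigma>_def)
  obtain k i1 where k: "k \<le> (K + 1) * \<sigma>" "i1 \<in> Cs" "i1 \<noteq> c"
     "\<And>t. t < k \<Longrightarrow> blk \<xi> \<sigma> (a + int t) \<notin> RS \<xi> \<sigma>" "rsimple i1 \<sigma> (blk \<xi> \<sigma> (a + int k))"
    using jump_fwd[OF jp] unfolding \<sigma>_def by blast
  obtain i0 where i0: "\<And>t k. \<sigma> \<le> t \<Longrightarrow> i0 \<le> k \<Longrightarrow> k + int t \<le> i0 + int (M * \<sigma>) \<Longrightarrow> dev c (blk \<xi> t k) \<le> eps / 4 * real t"
    using window[OF \<sigma>N(1) order_refl J(1)] by blast
  define L where "L = i0 + int (M * \<sigma>)"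
  have reach: "int (reach \<sigma>) + 3 * p + 5 * int \<sigma> = int (M * \<sigma>)"
    using reach_eq[of \<sigma>] by (simp add: p_def algebra_simps)
  have T2: "int (reach \<sigma>) \<ge> 0" by simp
  have p0: "p \<ge> int \<sigma>" by (simp add: p_def)
  have pu: "pure c (blk \<xi> \<sigma> y)" if "i0 \<le> y" "y + int \<sigma> \<le> L" for y
  proof -
    have "dev c (blk \<xi> \<sigma> y) \<le> eps / 4 * real \<sigma>" using that by (intro i0) (auto simp: L_def)
    also have "\<dots> \<le> eps * real \<sigma>" using eps0 by (intro mult_right_mono) auto
    finally show ?thesis by (simp add: pure_def)
  qed
  have stay: "blk \<xi> \<sigma> (y + 1) = blk \<pi> \<sigma> g"
    if y: "i0 \<le> y" "y + 1 + p + int \<sigma> \<le> L" "blk \<xi> \<sigma> y \<in> RS \<xi> \<sigma>" for y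
  proof (rule ccontr)
    assume ne: "blk \<xi> \<sigma> (y + 1) \<noteq> blk \<pi> \<sigma> g"
    have "pure c (blk \<xi> \<sigma> y)" using y p0 by (intro pu) auto
    then have "blk \<xi> \<sigma> a = blk \<xi> \<sigma> (y + 1)" using st(4)[folded \<sigma>_def, OF y(3)] ne by auto
    from det_path[OF this k(4) order_refl] have "blk \<xi> \<sigma> (a + int k) = blk \<xi> \<sigma> (y + 1 + int k)" .
    moreover have kp: "int k \<le> p" unfolding p_def using k(1) by (simp only: of_nat_le_iff)
    then have "pure c (blk \<xi> \<sigma> (y + 1 + int k))" using y kp by (intro pu) auto
    ultimately show False using k(2,3,5) RS_pure_unique[OF _ \<sigma>N(1), of "blk \<xi> \<sigma> (a + int k)" c i1] J(1)
      unfolding rsimple_def by auto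
  qed
  obtain y0 where y0: "y0 \<ge> i0" "y0 \<le> i0 + p" "blk \<xi> \<sigma> y0 \<in> RS \<xi> \<sigma>"
    using RS_within[OF \<sigma>N(1), of i0] unfolding p_def by blast
  define y1 where "y1 = y0 + 1"
  have y1: "blk \<xi> \<sigma> y1 = blk \<pi> \<sigma> g"
    unfolding y1_def using y0 reach p0 T2 \<sigma>N by (intro stay) (auto simp: L_def)
  have oc: "occ \<xi> \<pi> (Suc \<sigma>)" using ploop_depth[OF J(9)] J(6) by (simp add: \<sigma>_def)
  have follow: "blk \<xi> \<sigma> (y1 + int t) = blk \<pi> \<sigma> (g + int t)" if "y1 + int t + p + int \<sigma> \<le> L" for t
    using that
  proof (induction t)
    case (Suc t)
    then have IH: "blk \<xi> \<sigma> (y1 + int t) = blk \<pi> \<sigma> (g + int t)" by simp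
    show ?case
    proof (cases "blk \<xi> \<sigma> (y1 + int t) \<in> RS \<xi> \<sigma>")
      case False
      from blk_step[OF IH occ_det[OF oc IH False]] show ?thesis by (simp add: algebra_simps)
    next
      case True
      have "blk \<xi> \<sigma> (y1 + int t + 1) = blk \<pi> \<sigma> g"
        using Suc.prems True y0(1) by (intro stay) (auto simp: y1_def)
      moreover have "blk \<pi> \<sigma> (g + int t + 1) = blk \<pi> \<sigma> g"
      proof -
        have "pure c (blk \<xi> \<sigma> (y1 + int t))" using Suc.prems y0(1) p0 by (intro pu) (auto simp: y1_def)
        from st(1)[folded \<sigma>_def, OF True this]
        have eq: "blk \<pi> \<sigma> (g + int t) = blk \<pi> \<sigma> (h - int \<sigma>)"
          using jump_RS(2)[OF jp, folded \<sigma>_def, of "g + int t"] IH by auto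
        have "n \<le> \<sigma>" using J(5) by (simp add: \<sigma>_def)
        have "blk \<pi> \<sigma> (g + int t + 1) = blk \<pi> \<sigma> (h - int s)"
        proof (rule blk_eqI)
          fix x show "\<pi> (g + int t + 1 + x) = \<pi> (h - int s + x)"
            using loop_phase[OF J(3) \<open>n \<le> \<sigma>\<close> eq, of "1 + x"] by (simp add: \<sigma>_def algebra_simps)
        qed
        then show ?thesis using st(5) by (simp add: \<sigma>_def)
      qed
      ultimately show ?thesis by (simp add: algebra_simps)
    qed
  qed (simp add: y1)
  obtain l where l: "l > 0" "l \<le> (K + 2) * n" "per l \<pi>" using J(9) unfolding ploop_def by blast
  have "(K + 2) * n \<le> (K + 2) * \<sigma>" using J(5) by (intro mult_left_mono) (auto simp: \<sigma>_def)
  then have "int l \<le> int ((K + 2) * \<sigma>)" using l(2) by (simp only: of_nat_le_iff)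
  then have lp: "int l \<le> p + int \<sigma>" by (simp add: p_def algebra_simps)
  have "occ \<xi> \<pi> (reach \<sigma>)"
  proof (rule occ_of_agree[OF l(3,1), of y1 _ "g - y1"])
    fix x assume x: "y1 \<le> x" "x < y1 + int (reach \<sigma>) + int l"
    have "blk \<xi> \<sigma> (y1 + int (nat (x - y1))) = blk \<pi> \<sigma> (g + int (nat (x - y1)))"
      using x lp reach y0(2) p0 \<sigma>N by (intro follow) (auto simp: y1_def L_def)
    from blk_eqD[OF this, of 0] show "\<xi> x = \<pi> (g - y1 + x)" using x \<sigma>N by (simp add: algebra_simps)
  qed
  then show ?thesis using ploop_depth[OF J(9)] by (simp add: \<sigma>_def)
qed

lemma rsimple_pureD: "rsimple e n r \<Longrightarrow> r \<in> RS \<xi> n" "rsimple e n r \<Longrightarrow> pure e r"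
  by (auto simp: rsimple_def)

lemma lsimple_pureD: "lsimple e n r \<Longrightarrow> r \<in> LS \<xi> n" "lsimple e n r \<Longrightarrow> pure e r"
  by (auto simp: lsimple_def)

text \<open>If the loops met before and after the jump had the same color \<open>i\<close>, these
  two loops and the path between them would form a closed set: out of \<open>c\<close> one comes
  only to \<open>i\<close>, and out of \<open>i\<close> only back to \<open>c\<close>. But there is
  a third color.\<close>

lemma jump_ends_differ:
  assumes jp: "jump c n \<pi> g b h d a s"
    and F: "\<And>e. e \<in> Cs \<Longrightarrow> loop e (Suc s) (pp e) (G e) (B e) (H e) (D e)"
    and i1: "i \<in> Cs" "i \<noteq> c" "\<And>t. t < k \<Longrightarrow> blk \<xi> (Suc s) (a + int t) \<notin> RS \<xi> (Suc s)"
      "rsimple i (Suc s) (blk \<xi> (Suc s) (a + int k))"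
    and i2: "\<And>t. t < k2 \<Longrightarrow> blk \<xi> (Suc s) (a - 1 - int t) \<notin> LS \<xi> (Suc s)"
      "lsimple i (Suc s) (blk \<xi> (Suc s) (a - 1 - int k2))"
  shows False
proof -
  note J = jumpD[OF jp]
  note st = jump_struct[OF jp]
  define \<sigma> where "\<sigma> = Suc s"
  have \<sigma>N: "N0 \<le> \<sigma>" using J(8) by (simp add: \<sigma>_def)
  note i1 = i1[folded \<sigma>_def] and i2 = i2[folded \<sigma>_def] and F = F[folded \<sigma>_def]
  have dep: "\<sigma> + 10 \<le> depth \<xi> (pp e)" if "e \<in> Cs" for e
    using loop_TT_depth[OF F[OF that]] reach_gt[OF \<sigma>N] by simp
  have plF: "pure e (blk (pp e) \<sigma> \<kappa>)" if "e \<in> Cs" for e \<kappa> using ploop_pure[OF loop_ploop[OF F[OF that]]] by simp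
  define P0 where "P0 = a - 1 - int k2"
  define S where "S = range (blk \<pi> \<sigma>) \<union> range (blk (pp i) \<sigma>) \<union> blk \<xi> \<sigma> ` {P0..a + int k}"
  have neq: "v \<noteq> w" if "pure e v" "pure e' w" "e \<in> Cs" "e' \<in> Cs" "e \<noteq> e'" "length v = \<sigma>" for e e' v w
    using pure_unique[OF that(1), of e'] that \<sigma>N N0 by (cases v) auto
  \<comment> \<open>A right special word of a third color before \<open>a\<close> would lie on a run
    of that color. This run either covers the word at \<open>P0\<close>, which has color
    \<open>i\<close>, or begins after \<open>P0\<close> and gives a left special word in
    between.\<close>
  have pathi: "e' = i" if e': "e' \<in> Cs" "e' \<noteq> c" "rsimple e' \<sigma> (blk \<xi> \<sigma> x)" "x \<in> {P0..a + int k}" for e' x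
  proof (rule ccontr)
    assume ne: "e' \<noteq> i"
    consider "x = a + int k" | "a \<le> x" "x < a + int k" | "x \<le> a - 1" using e'(4) by fastforce
    then show False
    proof cases
      case 1
      then show ?thesis using neq[OF rsimple_pureD(2)[OF e'(3)] rsimple_pureD(2)[OF i1(4)]] e' i1(1) ne by auto
    next
      case 2
      then have "nat (x - a) < k" by linarith
      then show ?thesis using i1(3)[of "nat (x - a)"] rsimple_pureD(1)[OF e'(3)] 2 by auto
    next
      case 3
      have "blk \<xi> \<sigma> x = blk (pp e') \<sigma> (H e' - int \<sigma>)"
        using loop_RS_simple[OF F[OF e'(1)] e'(1) \<sigma>N order_refl _ e'(3)] dep[OF e'(1)] by simp
      from run_exists[OF F[OF e'(1)] this] obtain ar er where
        r: "run \<xi> (pp e') (G e') ar er" "ar \<le> x" "x + int \<sigma> \<le> er" by blast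
      show ?thesis
      proof (cases "ar \<le> P0")
        case True
        have "blk \<xi> \<sigma> P0 = blk (pp e') \<sigma> (G e' + P0 - ar)" using r True e'(4) by (intro run_blk[OF r(1)]) auto
        then show ?thesis
          using neq[OF plF[OF e'(1), of "G e' + P0 - ar"] lsimple_pureD(2)[OF i2(2)] e'(1) i1(1) ne] by (simp add: P0_def)
      next
        case False
        have "blk \<xi> \<sigma> ar = blk (pp e') \<sigma> (G e')" using run_blk[OF r(1), of ar \<sigma>] r by simp
        moreover have "blk (pp e') \<sigma> (G e') \<in> LS \<xi> \<sigma>"
          using loop_LS[OF F[OF e'(1)] e'(1) \<sigma>N order_refl] dep[OF e'(1)] by simp
        moreover have "ar = a - 1 - int (nat (a - 1 - ar))" using r(2) 3 by simp
        moreover have "nat (a - 1 - ar) < k2" using False r(2) 3 by (auto simp: P0_def)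
        ultimately show ?thesis using i2(1) by metis
      qed
    qed
  qed
  have SR: "pure c v \<or> v = blk \<xi> \<sigma> (a + int k)" if v: "v \<in> S" "v \<in> RS \<xi> \<sigma>" for v
  proof (cases "pure c v")
    case False
    then obtain e' where e': "e' \<in> Cs" "e' \<noteq> c" "rsimple e' \<sigma> v" using st(2)[folded \<sigma>_def, OF v(2)] by blast
    from v(1) consider \<kappa> where "v = blk \<pi> \<sigma> \<kappa>" | \<kappa> where "v = blk (pp i) \<sigma> \<kappa>" | x where "x \<in> {P0..a + int k}" "v = blk \<xi> \<sigma> x"
      unfolding S_def by blast
    then have "e' = i"
    proof cases
      case 1 then show ?thesis using False ploop_pure[OF J(9), of \<sigma>] J(5) by (simp add: \<sigma>_def)
    next
      case 2 then show ?thesis using neq[OF rsimple_pureD(2)[OF e'(3)] plF[OF i1(1)] e'(1) i1(1)] by auto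
    next
      case 3 then show ?thesis using pathi[of e' x] e' by simp
    qed
    then show ?thesis using e'(3) i1(4) unfolding rsimple_def by blast
  qed simp
  have XS: "blk \<xi> \<sigma> a \<in> S" unfolding S_def P0_def by auto
  have "blk \<xi> \<sigma> P0 = blk (pp i) \<sigma> (G i)"
    using loop_LS_simple[OF F[OF i1(1)] i1(1) \<sigma>N order_refl _ i2(2)] dep[OF i1(1)] by (simp add: P0_def)
  from run_exists[OF F[OF i1(1)] this] obtain ar er where
    r: "run \<xi> (pp i) (G i) ar er" "ar \<le> P0" "P0 + int \<sigma> \<le> er" by blast
  \<comment> \<open>The run of \<open>i\<close> through \<open>P0\<close> must end before it could
    cover the word at \<open>a - 1\<close>, which has color \<open>c\<close>. Its exit therefore
    lies on the chosen path and shows where the second letter after the exit word of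
    \<open>i\<close> leads.\<close>
  have erb: "er - int \<sigma> < a - 1"
  proof (rule ccontr)
    assume "\<not> er - int \<sigma> < a - 1"
    then have "blk \<xi> \<sigma> (a - 1) = blk (pp i) \<sigma> (G i + (a - 1) - ar)" using r by (intro run_blk[OF r(1)]) (auto simp: P0_def)
    then show False using neq[OF plF[OF i1(1), of "G i + (a - 1) - ar"] jump_RS(3)[OF jp] i1(1) J(1) i1(2)] by (simp add: \<sigma>_def)
  qed
  define y1 where "y1 = er - int \<sigma>"
  have y1b: "blk \<xi> \<sigma> y1 = blk (pp i) \<sigma> (G i + y1 - ar)" using r by (intro run_blk[OF r(1)]) (auto simp: y1_def)
  have y1l: "\<xi> (y1 + int \<sigma>) \<noteq> pp i (G i + y1 - ar + int \<sigma>)" using r(1) by (simp add: y1_def run_def algebra_simps)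
  have oci: "occ \<xi> (pp i) (Suc \<sigma>)" using ploop_depth[OF loop_ploop[OF F[OF i1(1)]]] dep[OF i1(1)] by simp
  have y1R: "blk \<xi> \<sigma> y1 \<in> RS \<xi> \<sigma>" using occ_det[OF oci y1b] y1l by blast
  have y1r: "blk \<xi> \<sigma> y1 = blk \<xi> \<sigma> (a + int k)"
    using i1(4) y1R plF[OF i1(1)] y1b unfolding rsimple_def by metis
  obtain y2 where y2: "blk \<xi> (Suc \<sigma>) y2 = blk (pp i) (Suc \<sigma>) (G i + y1 - ar)" using oci unfolding occ_def by blast
  have y2r: "blk \<xi> \<sigma> y2 = blk \<xi> \<sigma> y1" "\<xi> (y2 + int \<sigma>) = pp i (G i + y1 - ar + int \<sigma>)" using y2 y1b by (simp_all add: blk_Suc_eq)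
  have y1S: "blk \<xi> \<sigma> (y1 + 1) \<in> S" unfolding S_def using erb r by (intro UnI2 imageI) (auto simp: y1_def)
  have y2S: "blk \<xi> \<sigma> (y2 + 1) \<in> S" unfolding S_def using y2 by (simp add: blk_Suc_eq')
  have all: "blk \<xi> \<sigma> y \<in> S" for y
  proof (rule closed_fwd[OF XS])
    fix y assume y: "blk \<xi> \<sigma> y \<in> S"
    show "blk \<xi> \<sigma> (y + 1) \<in> S"
    proof (cases "blk \<xi> \<sigma> y \<in> RS \<xi> \<sigma>")
      case False
      from y consider \<kappa> where "blk \<xi> \<sigma> y = blk \<pi> \<sigma> \<kappa>" | \<kappa> where "blk \<xi> \<sigma> y = blk (pp i) \<sigma> \<kappa>" |
        x where "x \<in> {P0..a + int k}" "blk \<xi> \<sigma> y = blk \<xi> \<sigma> x" unfolding S_def by blast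
      then show ?thesis
      proof cases
        case 1
        have "occ \<xi> \<pi> (Suc \<sigma>)" using ploop_depth[OF J(9)] J(6) by (simp add: \<sigma>_def)
        from blk_step[OF 1 occ_det[OF this 1 False]] show ?thesis unfolding S_def by auto
      next
        case 2
        from blk_step[OF 2 occ_det[OF oci 2 False]] show ?thesis unfolding S_def by auto
      next
        case 3
        have "x \<noteq> a + int k" using 3 False rsimple_pureD(1)[OF i1(4)] by auto
        then have "x + 1 \<in> {P0..a + int k}" using 3 by auto
        moreover have "blk \<xi> \<sigma> (y + 1) = blk \<xi> \<sigma> (x + 1)" by (rule blk_step[OF 3(2) det_fwd[OF 3(2) False]])
        ultimately show ?thesis unfolding S_def by auto
      qed
    next
      case True
      show ?thesis
      proof (cases "pure c (blk \<xi> \<sigma> y)")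
        case pc: True
        have "blk \<pi> \<sigma> g \<in> S" unfolding S_def by blast
        then show ?thesis using st(4)[folded \<sigma>_def, OF True pc] XS by auto
      next
        case False
        then have yr: "blk \<xi> \<sigma> y = blk \<xi> \<sigma> y1" using SR[OF y True] y1r by simp
        have ne: "\<xi> (y1 + int \<sigma>) \<noteq> \<xi> (y2 + int \<sigma>)" using y1l y2r by simp
        have "card (rx \<xi> (blk \<xi> \<sigma> y1)) = 2" using i1(4) y1r unfolding rsimple_def by simp
        from two_letters[OF this y2r(1) yr ne] show ?thesis
        proof
          assume l: "\<xi> (y + int \<sigma>) = \<xi> (y1 + int \<sigma>)"
          from blk_step[OF yr l] y1S show ?thesis by simp
        next
          assume l: "\<xi> (y + int \<sigma>) = \<xi> (y2 + int \<sigma>)"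
          from blk_step[OF trans[OF yr y2r(1)[symmetric]] l] y2S show ?thesis by simp
        qed
      qed
    qed
  qed
  obtain e where e: "e \<in> Cs" "e \<noteq> c" "e \<noteq> i" using other_color2[of c i] by blast
  obtain v where v: "v \<in> RS \<xi> \<sigma>" "pure e v" using color_RS[OF \<sigma>N e(1)] by blast
  then obtain y where y: "v = blk \<xi> \<sigma> y" unfolding RS_def by blast
  then have "v \<in> S" using all by simp
  from SR[OF this v(1)] show False
  proof
    assume "pure c v" then show False using RS_pure_unique[OF v(1) \<sigma>N v(2)] e J(1) by blast
  next
    assume "v = blk \<xi> \<sigma> (a + int k)"
    then have "pure i v" using rsimple_pureD(2)[OF i1(4)] by simp
    then show False using RS_pure_unique[OF v(1) \<sigma>N v(2)] e i1(1) by blast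
  qed
qed

lemma argmin_color:
  fixes f :: "'c \<Rightarrow> nat"
  assumes "A \<subseteq> Cs" "A \<noteq> {}"
  obtains q where "q \<in> A" "\<And>e. e \<in> A \<Longrightarrow> f q \<le> f e"
proof -
  have fin: "finite (f ` A)" using finite_subset[OF assms(1) finCs] by simp
  then have "Min (f ` A) \<in> f ` A" using assms(2) by (intro Min_in) auto
  then obtain q where q: "q \<in> A" "Min (f ` A) = f q" by auto
  then have "f q \<le> f e" if "e \<in> A" for e using Min_le[OF fin, of "f e"] that by simp
  then show thesis using q that by blast
qed

text \<open>\<open>depth_is_bounded_by_first_loop\<close> requires loops of all colors at length
  \<open>s + 1\<close>: \<open>c\<close> has one by \<open>jump_deep\<close>, the others because
  \<open>jump_struct\<close> makes them simple. The \<open>+ 1\<close> in the conclusion is there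
  because a jump of length \<open>s\<close> needs
  \<open>s + 2 \<le> depth \<xi> \<pi>\<close>.\<close>

lemma no_jump:
  assumes c: "c \<in> Cs" and n: "N0 \<le> n" and L: "loop c n \<pi> g b h d"
    and R: "run \<xi> \<pi> g a e" "a + int n \<le> e"
  shows "int (depth \<xi> \<pi>) \<le> e - a + 1"
proof (rule ccontr)
  assume short: "\<not> ?thesis"
  define s where "s = nat (e - a)"
  have e: "e = a + int s" using R by (simp add: s_def)
  have jp: "jump c n \<pi> g b h d a s" unfolding jump_def using c n L R short unfolding e by auto
  have \<sigma>N: "N0 \<le> Suc s" using jumpD(8)[OF jp] .
  have "\<exists>p g b h d. loop x (Suc s) p g b h d \<and> (x = c \<longrightarrow> p = \<pi>)" if xC: "x \<in> Cs" for x
  proof (cases "x = c")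
    case True
    then show ?thesis using loop_mono[OF L _ jump_deep[OF jp]] jumpD(5)[OF jp] by auto
  next
    case False
    obtain r r' where "rsimple x (Suc s) r" "lsimple x (Suc s) r'"
      using jump_struct(3)[OF jp xC False] jump_lsimple[OF jp xC False] by blast
    then show ?thesis using loop_of_simple[OF \<sigma>N xC] False by blast
  qed
  then have "\<forall>x. \<exists>p g b h d. x \<in> Cs \<longrightarrow> loop x (Suc s) p g b h d \<and> (x = c \<longrightarrow> p = \<pi>)" by blast
  then obtain pp gg bb hh dd where F': "\<And>x. x \<in> Cs \<Longrightarrow> loop x (Suc s) (pp x) (gg x) (bb x) (hh x) (dd x) \<and> (x = c \<longrightarrow> pp x = \<pi>)"
    by metis
  then have F: "\<And>x. x \<in> Cs \<Longrightarrow> loop x (Suc s) (pp x) (gg x) (bb x) (hh x) (dd x)" and pc: "pp c = \<pi>"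
    using c by auto
  have dep: "Suc s < depth \<xi> (pp x)" if "x \<in> Cs" for x
    using loop_TT_depth[OF F[OF that]] reach_gt[OF \<sigma>N] by simp
  obtain q where q: "q \<in> Cs" "\<And>x. x \<in> Cs \<Longrightarrow> depth \<xi> (pp q) \<le> depth \<xi> (pp x)"
    using argmin_color[of Cs "\<lambda>x. depth \<xi> (pp x)"] c by blast
  obtain k i1 where i1: "i1 \<in> Cs" "i1 \<noteq> c" "\<And>t. t < k \<Longrightarrow> blk \<xi> (Suc s) (a + int t) \<notin> RS \<xi> (Suc s)"
     "rsimple i1 (Suc s) (blk \<xi> (Suc s) (a + int k))"
    using jump_fwd[OF jp] by blast
  obtain k2 i2 where i2: "i2 \<in> Cs" "i2 \<noteq> c" "\<And>t. t < k2 \<Longrightarrow> blk \<xi> (Suc s) (a - 1 - int t) \<notin> LS \<xi> (Suc s)"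
     "lsimple i2 (Suc s) (blk \<xi> (Suc s) (a - 1 - int k2))"
    using jump_bwd[OF jp] by blast
  have off: "v \<noteq> blk (pp x) (Suc s) \<kappa>"
    if "pure c v" "\<And>\<kappa>. v \<noteq> blk \<pi> (Suc s) \<kappa>" "length v = Suc s" "x \<in> Cs" for x \<kappa> v
  proof (cases "x = c")
    case True
    then show ?thesis using that(2) pc by simp
  next
    case False
    show ?thesis
    proof
      assume "v = blk (pp x) (Suc s) \<kappa>"
      then have "pure x v" using ploop_pure[OF loop_ploop[OF F[OF that(4)]]] by simp
      moreover have "v \<noteq> []" using that(3) by auto
      ultimately show False using pure_unique[OF that(1)] False c that(4) by blast
    qed
  qed
  have "q = i1"
  proof (rule depth_is_bounded_by_first_loop[OF \<sigma>N F jump_LS(1)[OF jp] off i1(1,3) _ q])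
    show "pure c (blk \<xi> (Suc s) a)" "\<And>\<kappa>. blk \<xi> (Suc s) a \<noteq> blk \<pi> (Suc s) \<kappa>"
      using jump_LS(2,3)[OF jp] by auto
    show "blk \<xi> (Suc s) (a + int k) = blk (pp i1) (Suc s) (hh i1 - int (Suc s))"
      by (rule loop_RS_simple[OF F[OF i1(1)] i1(1) \<sigma>N order_refl dep[OF i1(1)] i1(4)])
  qed auto
  moreover have "q = i2"
  proof -
    have e1: "blk (rv \<xi>) (Suc s) (1 - a - int s + int t) = rev (blk \<xi> (Suc s) (a - 1 - int t))" for t
    proof -
      have e: "1 - (1 - a - int s + int t) - int (Suc s) = a - 1 - int t" by simp
      show ?thesis by (simp only: blk_rv e)
    qed
    note e0 = e1[of 0, unfolded of_nat_0 add_0_right diff_0_right]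
    show ?thesis
    proof (rule colored_sequence.depth_is_bounded_by_first_loop[OF colored_sequence_rv \<sigma>N loop_rv[OF F], of "1 - a - int s" i2 k2 _ q])
      show "blk (rv \<xi>) (Suc s) (1 - a - int s) \<in> LS (rv \<xi>) (Suc s)"
        unfolding e0 LS_rv using jump_RS(1)[OF jp] by simp
      show "blk (rv \<xi>) (Suc s) (1 - a - int s) \<noteq> blk (rv (pp x)) (Suc s) \<kappa>" if "x \<in> Cs" for x \<kappa>
        unfolding e0 unfolding blk_rv using off[OF jump_RS(3,2)[OF jp] _ that, of "1 - \<kappa> - int (Suc s)"] by simp
      show "blk (rv \<xi>) (Suc s) (1 - a - int s + int t) \<notin> RS (rv \<xi>) (Suc s)" if "t < k2" for t
        unfolding e1 RS_rv using i2(3)[OF that] by simp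
      have "blk \<xi> (Suc s) (a - 1 - int k2) = blk (pp i2) (Suc s) (gg i2)"
        by (rule loop_LS_simple[OF F[OF i2(1)] i2(1) \<sigma>N order_refl dep[OF i2(1)] i2(4)])
      also have "gg i2 = 1 - (1 - gg i2 - int (Suc s)) - int (Suc s)" by simp
      finally show "blk (rv \<xi>) (Suc s) (1 - a - int s + int k2) = blk (rv (pp i2)) (Suc s) (1 - gg i2 - int (Suc s))"
        unfolding e1 unfolding blk_rv by simp
      show "depth (rv \<xi>) (rv (pp q)) \<le> depth (rv \<xi>) (rv (pp x))" if "x \<in> Cs" for x
        unfolding depth_rv using q(2)[OF that] .
    qed (use i2 q in auto)
  qed
  ultimately have "i2 = i1" by simp
  then show False using jump_ends_differ[OF jp F i1 i2(3), of k2] i2(4) by simp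
qed

section \<open>Colors without a loop\<close>

text \<open>Failure on both sides is required so that \<open>not_rsimple\<close> and
  \<open>not_lsimple\<close> together make every other color simple on both sides, which gives all
  of them loops.\<close>

definition heavy :: "'c \<Rightarrow> nat \<Rightarrow> bool" where
  "heavy c n \<longleftrightarrow> c \<in> Cs \<and> (\<forall>r. \<not> rsimple c n r) \<and> (\<forall>r. \<not> lsimple c n r)"

lemma ploop_of_lsimple:
  assumes n: "n \<ge> N0" and c: "c \<in> Cs" and r: "lsimple c n r"
  shows "\<exists>\<pi>. ploop c n \<pi> \<and> occ \<xi> \<pi> (reach n)"
proof -
  have "colored_sequence.rsimple (rv \<xi>) (rdev dev) eps c n (rev r)" using r by (simp add: rsimple_rv)
  from colored_sequence.ploop_of_rsimple[OF colored_sequence_rv n c this] obtain \<pi> where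
    "colored_sequence.ploop K (rdev dev) eps c n \<pi>" "occ (rv \<xi>) \<pi> (reach n)" by blast
  then show ?thesis
    using ploop_rv[of c n "rv \<pi>"] occ_rv[of \<xi> "rv \<pi>" "reach n"] by (intro exI[of _ "rv \<pi>"]) simp
qed

text \<open>One step before the depth of its loop a color cannot be simple on either side, since the
  loop would then last up to \<open>reach n\<close>.\<close>

lemma heavy_exists: "\<exists>c n. N0 \<le> n \<and> heavy c n"
proof -
  obtain c where c: "c \<in> Cs" using other_color2[of undefined undefined] by blast
  show ?thesis
  proof (cases "heavy c N0")
    case False
    then obtain r where "rsimple c N0 r \<or> lsimple c N0 r" using c unfolding heavy_def by blast
    then have "\<exists>\<pi>. ploop c N0 \<pi> \<and> occ \<xi> \<pi> (reach N0)"
    proof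
      assume "rsimple c N0 r"
      from ploop_of_rsimple[OF order_refl c this] show ?thesis by blast
    next
      assume "lsimple c N0 r"
      from ploop_of_lsimple[OF order_refl c this] show ?thesis .
    qed
    then obtain \<pi> where pl: "ploop c N0 \<pi>" and oc: "occ \<xi> \<pi> (reach N0)" by blast
    have "reach N0 \<le> depth \<xi> \<pi>" using oc ploop_depth[OF pl] by simp
    then have d: "N0 + 10 \<le> depth \<xi> \<pi>" using reach_gt[of N0] by simp
    define n where "n = depth \<xi> \<pi> - 1"
    have n: "N0 \<le> n" "Suc n = depth \<xi> \<pi>" using d by (auto simp: n_def)
    have oc1: "occ \<xi> \<pi> (Suc n)" using ploop_depth[OF pl] n by simp
    have no: "\<not> occ \<xi> \<pi> (reach n)" using ploop_depth[OF pl] n reach_gt[of n] by simp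
    have "heavy c n" unfolding heavy_def
      using c no depth_of_rsimple[OF pl c order_refl n(1) oc1] depth_of_lsimple[OF pl c order_refl n(1) oc1] by blast
    then show ?thesis using n by blast
  qed blast
qed

text \<open>With \<open>Q * eps \<ge> 8\<close>, a length of \<open>2 * Q * n\<close> has tolerance
  at least \<open>8 * n\<close> at level \<open>eps / 2\<close>, enough for \<open>4 * n\<close>
  letters and for \<open>m\<close>.\<close>

lemma pad_bound_small:
  assumes "N0 \<le> n" "k \<le> 4 * n" "2 * Q * n \<le> t"
  shows "real k + m \<le> eps / 2 * real t"
proof -
  have "8 * real n \<le> (real Q * eps) * real n" using Q by (intro mult_right_mono) auto
  also have "\<dots> = eps * (real Q * real n)" by simp
  finally have 1: "8 * real n \<le> eps * (real Q * real n)" .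
  have "real n \<le> real Q * real n" using Q_ge_1 mult_right_mono[of 1 "real Q" "real n"] by simp
  then have 2: "eps * real n \<le> eps * (real Q * real n)" using eps0 by simp
  have "real (2 * Q * n) \<le> real t" using assms(3) by (simp only: of_nat_le_iff)
  then have "eps * (2 * (real Q * real n)) \<le> eps * real t" using eps0 by simp
  moreover have "m \<le> eps / 8 * real n" using small_n[OF assms(1)] by simp
  moreover have "real k \<le> 4 * real n" using assms(2) by simp
  ultimately show ?thesis using 1 2 by simp
qed

lemma pure_pad_small:
  assumes c: "c \<in> Cs" and pl: "ploop c n \<pi>" and n: "N0 \<le> n'"
    and j: "k \<le> 4 * n'" "2 * Q * n' \<le> k + t" "n \<le> t"
    and b: "blk x t y = blk \<pi> t \<kappa>"
  shows "pure c (blk x (k + t) (y - int k))" "pure c (blk x (t + k) y)"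
proof -
  have "dev c (blk x t y) \<le> eps / 2 * real (length (blk x t y))"
    using pl j(3) b by (simp add: ploop_def)
  note p = pure_append[OF c this, of k "k + t"]
  have jk: "real k + m \<le> eps / 2 * real (k + t)" by (rule pad_bound_small[OF n j(1,2)])
  show "pure c (blk x (k + t) (y - int k))" unfolding blk_append
    using p(1)[of "blk x k (y - int k)"] jk by simp
  show "pure c (blk x (t + k) y)" unfolding blk_append
    using p(2)[of "blk x k (y + int t)"] jk by simp
qed

lemma run_blk_pure:
  assumes "ploop c n \<pi>" "run \<xi> \<pi> g a e" "n \<le> k" "a \<le> y" "y + int k \<le> e"
  shows "pure c (blk \<xi> k y)"
  using run_blk[OF assms(2,4,5)] ploop_pure[OF assms(1,3)] by simp

lemma run_exit_RS:
  assumes "loop c n \<pi> g b h d" "run \<xi> \<pi> g a e" "a + int k \<le> e" "k < depth \<xi> \<pi>"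
  shows "blk \<xi> k (e - int k) \<in> RS \<xi> k"
proof (rule ccontr)
  assume nr: "blk \<xi> k (e - int k) \<notin> RS \<xi> k"
  have 1: "blk \<xi> k (e - int k) = blk \<pi> k (g + (e - int k) - a)" using assms(3) by (intro run_blk[OF assms(2)]) auto
  have "occ \<xi> \<pi> (Suc k)" using ploop_depth[OF loop_ploop[OF assms(1)]] assms(4) by simp
  from occ_det[OF this 1 nr] show False using assms(2) by (simp add: run_def algebra_simps)
qed

lemma loop_next_RS:
  assumes L: "loop c n \<pi> g b h d" and k: "n \<le> k" "k < depth \<xi> \<pi>"
    and i: "blk \<xi> k i = blk \<pi> k \<kappa>" "\<xi> (i + int k) = \<pi> (\<kappa> + int k)" "i < i'" "\<And>y. i < y \<Longrightarrow> y < i' \<Longrightarrow> blk \<xi> k y \<notin> RS \<xi> k"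
  shows "\<exists>\<kappa>. blk \<xi> k i' = blk \<pi> k \<kappa>"
proof -
  have oc: "occ \<xi> \<pi> (Suc k)" using ploop_depth[OF loop_ploop[OF L]] k by simp
  have "\<exists>\<kappa>. blk \<xi> k (i + 1 + int t) = blk \<pi> k \<kappa>" if "i + 1 + int t \<le> i'" for t
    using that
  proof (induction t)
    case 0
    show ?case using blk_step[OF i(1,2)] by auto
  next
    case (Suc t)
    then obtain \<kappa> where \<kappa>: "blk \<xi> k (i + 1 + int t) = blk \<pi> k \<kappa>" by auto
    have "blk \<xi> k (i + 1 + int t) \<notin> RS \<xi> k" using Suc.prems by (intro i(4)) auto
    from blk_step[OF \<kappa> occ_det[OF oc \<kappa> this]] show ?case by (auto simp: algebra_simps)
  qed
  from this[of "nat (i' - i - 1)"] show ?thesis using i(3) by simp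
qed

lemma first_RS_same:
  assumes "blk \<xi> n (i + 1) = blk \<xi> n (i' + 1)" "i < y" "blk \<xi> n y \<in> RS \<xi> n" "\<And>z. i < z \<Longrightarrow> z < y \<Longrightarrow> blk \<xi> n z \<notin> RS \<xi> n"
    "i' < y'" "blk \<xi> n y' \<in> RS \<xi> n" "\<And>z. i' < z \<Longrightarrow> z < y' \<Longrightarrow> blk \<xi> n z \<notin> RS \<xi> n"
  shows "blk \<xi> n y' = blk \<xi> n y" "y' - i' = y - i"
proof -
  define k where "k = nat (y - i - 1)"
  define k' where "k' = nat (y' - i' - 1)"
  have y: "y = i + 1 + int k" and y': "y' = i' + 1 + int k'" using assms(2,5) by (auto simp: k_def k'_def)
  have a: "blk \<xi> n (i + 1 + int t) \<notin> RS \<xi> n" if "t < k" for t using that y by (intro assms(4)) auto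
  have b: "blk \<xi> n (i' + 1 + int t) \<notin> RS \<xi> n" if "t < k'" for t using that y' by (intro assms(7)) auto
  have "k = k'"
  proof (rule ccontr)
    assume "k \<noteq> k'"
    then consider "k < k'" | "k' < k" by linarith
    then show False
    proof cases
      case 1
      from det_path[OF assms(1) a order_refl] b[OF 1] assms(3) y show False by simp
    next
      case 2
      from det_path[OF assms(1) a] 2 have "blk \<xi> n (i + 1 + int k') = blk \<xi> n (i' + 1 + int k')" by simp
      then show False using a[OF 2] assms(6) y' by simp
    qed
  qed
  then show "blk \<xi> n y' = blk \<xi> n y" "y' - i' = y - i" using det_path[OF assms(1) a order_refl] y y' by simp_all
qed

text \<open>Without such a word an exit would lead back to the loop with no further choice, and the
  loop together with the gap would be closed.\<close>

lemma gap_RS: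
  assumes n: "N0 \<le> n" and c: "c \<in> Cs" and L: "loop c n \<pi> g b h d" and r: "rsimple c n r"
    and R: "run \<xi> \<pi> g a0 a1" "a0 + int n \<le> a1" "run \<xi> \<pi> g a2 a3" "a2 + int n \<le> a3" "a1 - int n < a2"
  shows "\<exists>y. a1 - int n < y \<and> y < a2 \<and> blk \<xi> n y \<in> RS \<xi> n"
proof (rule ccontr)
  assume no: "\<not> ?thesis"
  define S where "S = range (blk \<pi> n) \<union> blk \<xi> n ` {a1 - int n..a2}"
  have dep: "n < depth \<xi> \<pi>" using loop_TT_depth[OF L] reach_gt[OF n] by simp
  have oc: "occ \<xi> \<pi> (Suc n)" using ploop_depth[OF loop_ploop[OF L]] dep by simp
  have pp: "pure c (blk \<pi> n \<kappa>)" for \<kappa> using ploop_pure[OF loop_ploop[OF L]] by simp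
  have b1: "blk \<xi> n (a1 - int n) = blk \<pi> n (g + (a1 - int n) - a0)" using R by (intro run_blk[OF R(1)]) auto
  have b2: "blk \<xi> n a2 = blk \<pi> n g" using run_blk[OF R(3), of a2 n] R(4) by simp
  have SR: "v = r" if v: "v \<in> S" "v \<in> RS \<xi> n" for v
  proof -
    from v(1) consider \<kappa> where "v = blk \<pi> n \<kappa>" | x where "x \<in> {a1 - int n..a2}" "v = blk \<xi> n x" unfolding S_def by blast
    then obtain \<kappa> where "v = blk \<pi> n \<kappa>"
    proof cases
      case 2
      then have "x = a1 - int n \<or> x = a2" using no v(2) by force
      then show ?thesis using 2 b1 b2 that by auto
    qed (use that in blast)
    then show ?thesis using pp v(2) r unfolding rsimple_def by blast
  qed
  have r1: "blk \<xi> n (a1 - int n) = r" using run_exit_RS[OF L R(1,2) dep] by (intro SR) (auto simp: S_def R(5) less_imp_le)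
  obtain i where i: "blk \<xi> (Suc n) i = blk \<pi> (Suc n) (g + (a1 - int n) - a0)" using oc unfolding occ_def by blast
  have i': "blk \<xi> n i = r" "\<xi> (i + int n) = \<pi> (g + (a1 - int n) - a0 + int n)" using i b1 r1 by (simp_all add: blk_Suc_eq)
  have iS: "blk \<xi> n (i + 1) \<in> S" using i unfolding S_def by (simp add: blk_Suc_eq')
  have ne: "\<xi> (a1 - int n + int n) \<noteq> \<xi> (i + int n)" using i' R(1) by (simp add: run_def algebra_simps)
  have c2: "card (rx \<xi> (blk \<xi> n (a1 - int n))) = 2" using r r1 by (simp add: rsimple_def)
  have all: "blk \<xi> n y \<in> S" for y
  proof (rule closed_fwd)
    show "blk \<xi> n a2 \<in> S" unfolding S_def using b2 by auto
    fix y assume y: "blk \<xi> n y \<in> S"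
    show "blk \<xi> n (y + 1) \<in> S"
    proof (cases "blk \<xi> n y \<in> RS \<xi> n")
      case True
      then have yr: "blk \<xi> n y = r" using SR[OF y] by simp
      have e1: "blk \<xi> n i = blk \<xi> n (a1 - int n)" "blk \<xi> n y = blk \<xi> n (a1 - int n)" using i' r1 yr by auto
      from two_letters[OF c2 e1 ne] show ?thesis
      proof
        assume l: "\<xi> (y + int n) = \<xi> (a1 - int n + int n)"
        have "a1 - int n + 1 \<in> {a1 - int n..a2}" using R(5) by simp
        then have "blk \<xi> n (a1 - int n + 1) \<in> S" unfolding S_def by blast
        then show ?thesis using blk_step[OF e1(2) l] by simp
      next
        assume l: "\<xi> (y + int n) = \<xi> (i + int n)"
        have "blk \<xi> n y = blk \<xi> n i" using yr i' by simp
        from blk_step[OF this l] iS show ?thesis by simp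
      qed
    next
      case False
      have "(\<exists>\<kappa>. blk \<xi> n y = blk \<pi> n \<kappa>) \<or> (\<exists>x\<in>{a1 - int n..<a2}. blk \<xi> n y = blk \<xi> n x)"
      proof -
        from y consider \<kappa> where "blk \<xi> n y = blk \<pi> n \<kappa>" | x where "x \<in> {a1 - int n..a2}" "blk \<xi> n y = blk \<xi> n x"
          unfolding S_def by blast
        then show ?thesis
        proof cases
          case 2
          show ?thesis
          proof (cases "x = a2")
            case True
            then show ?thesis using 2(2) b2 by auto
          next
            case False
            then show ?thesis using 2 by (intro disjI2 bexI[of _ x]) auto
          qed
        qed blast
      qed
      then consider \<kappa> where "blk \<xi> n y = blk \<pi> n \<kappa>" | x where "x \<in> {a1 - int n..<a2}" "blk \<xi> n y = blk \<xi> n x"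
        by blast
      then show ?thesis
      proof cases
        case 1
        from blk_step[OF 1 occ_det[OF oc 1 False]] show ?thesis unfolding S_def by auto
      next
        case 2
        have "x + 1 \<in> {a1 - int n..a2}" using 2 by auto
        moreover have "blk \<xi> n (y + 1) = blk \<xi> n (x + 1)" by (rule blk_step[OF 2(2) det_fwd[OF 2(2) False]])
        ultimately show ?thesis unfolding S_def by auto
      qed
    qed
  qed
  obtain e where e: "e \<in> Cs" "e \<noteq> c" using other_color[OF c] by blast
  obtain v where v: "v \<in> RS \<xi> n" "pure e v" using color_RS[OF n e(1)] by blast
  then obtain y where "v = blk \<xi> n y" unfolding RS_def by blast
  then have "v = r" using all SR v(1) by simp
  then show False using RS_pure_unique[OF v(1) n v(2) _ e(1) c] r e(2) unfolding rsimple_def by blast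
qed

lemma gap_LS:
  assumes n: "N0 \<le> n" and c: "c \<in> Cs" and L: "loop c n \<pi> g b h d" and r: "lsimple c n r"
    and R: "run \<xi> \<pi> g a0 a1" "a0 + int n \<le> a1" "run \<xi> \<pi> g a2 a3" "a2 + int n \<le> a3" "a1 - int n < a2"
  shows "\<exists>y. a1 - int n < y \<and> y < a2 \<and> blk \<xi> n y \<in> LS \<xi> n"
proof -
  have rr: "colored_sequence.rsimple (rv \<xi>) (rdev dev) eps c n (rev r)" using r by (simp add: rsimple_rv)
  obtain y where y: "1 - a2 - int n < y" "y < 1 - a1" "blk (rv \<xi>) n y \<in> RS (rv \<xi>) n"
    using colored_sequence.gap_RS[OF colored_sequence_rv n c loop_rv[OF L] rr run_rv[OF L R(3,4)] _ run_rv[OF L R(1,2)]] R by auto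
  then show ?thesis by (intro exI[of _ "1 - y - int n"]) (auto simp: blk_rv RS_rv)
qed

lemma det_path_bwd:
  assumes "blk \<xi> n a = blk \<xi> n a'" "\<And>t. t < k \<Longrightarrow> blk \<xi> n (a - int t) \<notin> LS \<xi> n"
  shows "t \<le> k \<Longrightarrow> blk \<xi> n (a - int t) = blk \<xi> n (a' - int t)"
proof (induction t)
  case (Suc t)
  then have IH: "blk \<xi> n (a - int t) = blk \<xi> n (a' - int t)" by simp
  have "\<xi> (a - int t - 1) = \<xi> (a' - int t - 1)"
    using Suc.prems by (intro det_bwd[OF IH] assms(2)) simp
  from blk_back[OF IH this] show ?case by (simp add: algebra_simps)
qed (simp add: assms)

end

text \<open>At length \<open>n\<close> every color but \<open>j\<close> has a loop, and \<open>q\<close> is the color whose loop dies first.\<close>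

locale phase = colored_sequence \<xi> K C N0 Cs dev m eps Q M
  for \<xi> :: "int \<Rightarrow> 'a::finite" and K C N0 :: nat and Cs :: "'c set"
    and dev :: "'c \<Rightarrow> 'a list \<Rightarrow> real" and m eps :: real and Q M :: nat +
  fixes j :: 'c and n :: nat and pp :: "'c \<Rightarrow> int \<Rightarrow> 'a" and gg :: "'c \<Rightarrow> int" and bb :: "'c \<Rightarrow> 'a"
    and hh :: "'c \<Rightarrow> int" and dd :: "'c \<Rightarrow> 'a" and q :: 'c
  assumes n: "N0 \<le> n" and j: "j \<in> Cs"
    and F: "\<And>e. e \<in> Cs \<Longrightarrow> e \<noteq> j \<Longrightarrow> loop e n (pp e) (gg e) (bb e) (hh e) (dd e)"
    and Rs: "\<And>e. e \<in> Cs \<Longrightarrow> e \<noteq> j \<Longrightarrow> \<exists>r. rsimple e n r"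
    and Ls: "\<And>e. e \<in> Cs \<Longrightarrow> e \<noteq> j \<Longrightarrow> \<exists>r. lsimple e n r"
    and q: "q \<in> Cs" "q \<noteq> j" "\<And>e. e \<in> Cs \<Longrightarrow> e \<noteq> j \<Longrightarrow> depth \<xi> (pp q) \<le> depth \<xi> (pp e)"
begin

lemma phase_rev:
  "phase (rv \<xi>) K C N0 Cs (rdev dev) m eps Q M j n (\<lambda>e. rv (pp e)) (\<lambda>e. 1 - hh e) dd (\<lambda>e. 1 - gg e) bb q"
proof (rule phase.intro[OF colored_sequence_rv], unfold_locales)
  show "\<exists>r. colored_sequence.rsimple (rv \<xi>) (rdev dev) eps e n r" "\<exists>r. colored_sequence.lsimple (rv \<xi>) (rdev dev) eps e n r"
    if e: "e \<in> Cs" "e \<noteq> j" for e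
  proof -
    obtain r r' where "rsimple e n r" "lsimple e n r'" using Rs[OF e] Ls[OF e] by blast
    then show "\<exists>r. colored_sequence.rsimple (rv \<xi>) (rdev dev) eps e n r" "\<exists>r. colored_sequence.lsimple (rv \<xi>) (rdev dev) eps e n r"
      by (auto simp: rsimple_rv lsimple_rv intro: exI[of _ "rev r"] exI[of _ "rev r'"])
  qed
qed (use n j q loop_rv[OF F] in \<open>auto simp: depth_rv\<close>)

end

section \<open>Scales and special words around the loop of least depth\<close>

context phase
begin

text \<open>The scales satisfy \<open>n < n1 < nu < N1\<close>. Gaps between passages are at most a
  few \<open>n1\<close>; words of length \<open>nu\<close> tolerate \<open>4 * n1\<close> foreign
  letters because \<open>nu \<ge> 2 * Q * n1\<close>; passages, of length at least
  \<open>N1 - 1\<close>, are longer than \<open>2 * nu\<close>. Since \<open>N1\<close> is at most a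
  constant multiple of \<open>n1\<close>, a window of length \<open>M * n1\<close> contains whole
  passages.\<close>

definition N1 :: nat where "N1 = depth \<xi> (pp q)"
definition n1 :: nat where "n1 = N1 div (4 * Q + 40)"
definition nu :: nat where "nu = (2 * Q + 10) * n1"

abbreviation run_of :: "'c \<Rightarrow> int \<Rightarrow> int \<Rightarrow> bool" where
  "run_of e a a' \<equiv> run \<xi> (pp e) (gg e) a a' \<and> a + int n \<le> a'"

lemma n_pos: "n \<ge> 1"
  using n N0 by simp

lemma n1_ge: "20 * (K + 10) * n \<le> n1"
proof -
  have "80 * (K + 10) * (Q + 10) \<le> M - (3 * K + 8)" unfolding M by (simp add: algebra_simps)
  then have "80 * (K + 10) * (Q + 10) * n \<le> reach n" by (rule reach_ge)
  also have "\<dots> \<le> N1" unfolding N1_def by (rule loop_TT_depth[OF F[OF q(1,2)]])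
  also have "80 * (K + 10) * (Q + 10) * n = (20 * (K + 10) * n) * (4 * Q + 40)" by (simp add: algebra_simps)
  finally show ?thesis unfolding n1_def by (simp add: less_eq_div_iff_mult_less_eq)
qed

lemma n1_n: "20 * n \<le> n1" "(K + 3) * n \<le> n1" "n1 \<ge> 1"
proof -
  have "20 * n \<le> 20 * (K + 10) * n" by (intro mult_right_mono) auto
  then show "20 * n \<le> n1" using n1_ge by linarith
  have "(K + 3) * n \<le> 20 * (K + 10) * n" by (intro mult_right_mono) auto
  then show "(K + 3) * n \<le> n1" using n1_ge by linarith
  show "n1 \<ge> 1" using \<open>20 * n \<le> n1\<close> n_pos by linarith
qed

lemma n1_N0: "N0 \<le> n1"
  using n1_n(1) n by linarith

lemma N1_bounds: "2 * nu + 20 * n1 \<le> N1" "N1 \<le> (8 * Q + 80) * n1"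
proof -
  have "n1 * (4 * Q + 40) \<le> N1" unfolding n1_def by (rule div_times_less_eq_dividend)
  then show "2 * nu + 20 * n1 \<le> N1" by (simp add: nu_def algebra_simps)
  have "N1 < (n1 + 1) * (4 * Q + 40)" unfolding n1_def
    using dividend_less_div_times[of "4 * Q + 40" N1] by simp
  also have "\<dots> \<le> (2 * n1) * (4 * Q + 40)" using n1_n(3) by (intro mult_right_mono) auto
  finally show "N1 \<le> (8 * Q + 80) * n1" by (simp add: algebra_simps)
qed

lemma nu_n1: "10 * n1 + 2 * Q * n1 = nu" "10 * n1 \<le> nu"
  by (simp_all add: nu_def algebra_simps)

lemma M_n1: "(K + 10) * nu + N1 + 40 * n1 \<le> M * n1"
proof -
  have "(K + 10) * nu + N1 + 40 * n1 \<le> (K + 10) * ((2 * Q + 10) * n1) + (8 * Q + 80) * n1 + 40 * n1"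
    using N1_bounds(2) by (simp add: nu_def)
  also have "\<dots> = ((K + 10) * (2 * Q + 10) + (8 * Q + 80) + 40) * n1" by (simp add: algebra_simps)
  also have "\<dots> \<le> M * n1" unfolding M by (intro mult_right_mono) (auto simp: algebra_simps)
  finally show ?thesis .
qed

lemma ploop_pp: "e \<in> Cs \<Longrightarrow> e \<noteq> j \<Longrightarrow> ploop e n (pp e)"
  using loop_ploop[OF F] .

lemma run_long: "e \<in> Cs \<Longrightarrow> e \<noteq> j \<Longrightarrow> run_of e a a' \<Longrightarrow> int N1 \<le> a' - a + 1"
  using no_jump[OF _ n F, of e a a'] q(3)[of e] by (simp add: N1_def)

text \<open>In a stretch typical for \<open>q\<close> at the scales \<open>n\<close> and
  \<open>n1\<close>, consecutive short blocks of color \<open>q\<close> are met within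
  \<open>n1\<close>, and hence the exit word within \<open>2 * n1\<close>. Between two passages no
  other loop is touched: by \<open>no_jump\<close> its passage would be long enough to put a word of
  length \<open>n1\<close> of another color into the stretch.\<close>

lemma consecutive_runs:
  "\<exists>i0 a0 a1 a2 a3. (\<forall>t k. n1 \<le> t \<longrightarrow> i0 \<le> k \<longrightarrow> k + int t \<le> i0 + int (M * n1) \<longrightarrow> pure q (blk \<xi> t k)) \<and>
     run_of q a0 a1 \<and> run_of q a2 a3 \<and> i0 + int nu \<le> a1 \<and> a1 - int n < a2 \<and> a2 \<le> a1 + 2 * int n1 \<and>
     a1 + int ((K + 5) * nu) \<le> i0 + int (M * n1) \<and>
     (\<forall>y. a1 - int n < y \<longrightarrow> y < a2 \<longrightarrow> (\<forall>e\<in>Cs. e \<noteq> j \<longrightarrow> (\<forall>\<kappa>. blk \<xi> n y \<noteq> blk (pp e) n \<kappa>)))"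
proof -
  note Fq = F[OF q(1,2)]
  have nn1: "n \<le> n1" using n1_n(1) by simp
  obtain i0 where
    w1: "\<And>t k. n1 \<le> t \<Longrightarrow> i0 \<le> k \<Longrightarrow> k + int t \<le> i0 + int (M * n1) \<Longrightarrow> dev q (blk \<xi> t k) \<le> eps / 4 * real t"
    and w2: "\<And>k. i0 \<le> k \<Longrightarrow> k + int n1 + int ((K + 3) * n) \<le> i0 + int (M * n1) \<Longrightarrow>
      (\<exists>y. k \<le> y \<and> y \<le> k + int n1 \<and> (\<forall>y'. y \<le> y' \<longrightarrow> y' \<le> y + int ((K + 2) * n) \<longrightarrow> dev q (blk \<xi> n y') \<le> eps / 4 * real n))"
    using window[OF n nn1 q(1)] by blast
  have quarter: "pure q (blk \<xi> t k)" if "dev q (blk \<xi> t k) \<le> eps / 4 * real t" for t k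
  proof -
    have "eps / 4 * real t \<le> eps * real t" using eps0 by (intro mult_right_mono) auto
    then show ?thesis using that by (simp add: pure_def)
  qed
  have w1': "pure q (blk \<xi> t k)" if "n1 \<le> t" "i0 \<le> k" "k + int t \<le> i0 + int (M * n1)" for t k
    by (rule quarter[OF w1[OF that]])
  have Kn: "int ((K + 3) * n) \<le> int n1" using n1_n(2) by (simp only: of_nat_le_iff)
  have Kn2: "int ((K + 1) * n) \<le> int ((K + 2) * n)" "int ((K + 2) * n) \<le> int n1" "int ((K + 2) * n) + int n = int ((K + 3) * n)"
    using Kn by (simp_all add: algebra_simps)
  obtain r where r: "rsimple q n r" using Rs[OF q(1,2)] by blast
  have dep: "n < N1" using loop_TT_depth[OF Fq] reach_gt[OF n] by (simp add: N1_def)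
  have r_eq: "r = blk (pp q) n (hh q - int n)"
    using loop_RS_simple[OF Fq q(1) n order_refl dep[unfolded N1_def] r] .
  have visit: "\<exists>z\<ge>k. z \<le> k + 2 * int n1 \<and> blk \<xi> n z = r"
    if k: "i0 \<le> k" "k + 2 * int n1 \<le> i0 + int (M * n1)" for k
  proof -
    obtain y where y: "k \<le> y" "y \<le> k + int n1"
      "\<And>y'. y \<le> y' \<Longrightarrow> y' \<le> y + int ((K + 2) * n) \<Longrightarrow> dev q (blk \<xi> n y') \<le> eps / 4 * real n"
      using w2[of k] k Kn by auto
    obtain z where z: "y \<le> z" "z \<le> y + int ((K + 1) * n)" "blk \<xi> n z \<in> RS \<xi> n" using RS_within[OF n, of y] by blast
    have "pure q (blk \<xi> n z)" using z Kn2 by (intro quarter y(3)) auto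
    then have "blk \<xi> n z = r" using r z(3) unfolding rsimple_def by blast
    then show ?thesis using z(1,2) y(1,2) Kn2 by (intro exI[of _ z]) auto
  qed
  have Mn1: "int ((K + 10) * nu) + int N1 + 40 * int n1 \<le> int (M * n1)"
  proof -
    have "int ((K + 10) * nu + N1 + 40 * n1) \<le> int (M * n1)" using M_n1 by (simp only: of_nat_le_iff)
    then show ?thesis by (simp only: of_nat_add of_nat_mult of_nat_numeral)
  qed
  have K10: "int ((K + 10) * nu) = int ((K + 5) * nu) + 5 * int nu" "int ((K + 5) * nu) \<ge> 5 * int nu"
    by (simp_all add: algebra_simps)
  have nu0: "int nu \<ge> 10 * int n1" using nu_n1(2) by linarith
  have N1b: "int N1 \<ge> 2 * int nu + 20 * int n1" using N1_bounds(1) by linarith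
  have n20: "20 * int n \<le> int n1" using n1_n(1) by linarith
  obtain z1 where z1: "z1 \<ge> i0 + int nu" "z1 \<le> i0 + int nu + 2 * int n1" "blk \<xi> n z1 = r"
    using visit[of "i0 + int nu"] Mn1 K10 nu0 by auto
  obtain a0 a1 where a01: "run \<xi> (pp q) (gg q) a0 a1" "a0 \<le> z1" "z1 + int n \<le> a1" "a1 - a0 \<le> int N1 + int ((K + 2) * n)"
    using run_exists[OF Fq z1(3)[unfolded r_eq]] unfolding N1_def by blast
  have a1b: "a1 \<le> i0 + int nu + 3 * int n1 + int N1" using a01 z1 Kn2 by linarith
  have a1end: "a1 + int ((K + 5) * nu) + 30 * int n1 \<le> i0 + int (M * n1)" using a1b Mn1 K10 nu0 by linarith
  obtain z2 where z2: "z2 \<ge> a1 - int n + 1" "z2 \<le> a1 - int n + 1 + 2 * int n1" "blk \<xi> n z2 = r"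
  proof -
    have "i0 \<le> a1 - int n + 1" using z1 a01 nu0 by linarith
    moreover have "a1 - int n + 1 + 2 * int n1 \<le> i0 + int (M * n1)" using a1end K10(2) nu0 n_pos by linarith
    ultimately show ?thesis using visit that by blast
  qed
  define P where "P t \<longleftrightarrow> (\<exists>\<kappa>. blk \<xi> n (a1 - int n + 1 + int t) = blk (pp q) n \<kappa>)" for t
  have P2: "P (nat (z2 - (a1 - int n + 1)))" unfolding P_def using z2 r_eq by auto
  define t2 where "t2 = (LEAST t. P t)"
  have Pt2: "P t2" unfolding t2_def by (rule LeastI[where P = P, OF P2])
  have t2le: "t2 \<le> nat (z2 - (a1 - int n + 1))" unfolding t2_def by (rule Least_le[where P = P, OF P2])
  have t2min: "\<not> P t" if "t < t2" for t using not_less_Least[of t P] that unfolding t2_def by simp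
  define a2 where "a2 = a1 - int n + 1 + int t2"
  have a2: "a1 - int n < a2" "a2 \<le> a1 + 2 * int n1" using t2le z2 n_pos by (auto simp: a2_def)
  obtain \<kappa>2 where \<kappa>2: "blk \<xi> n a2 = blk (pp q) n \<kappa>2" using Pt2 unfolding P_def a2_def by blast
  obtain u a3 where a23: "run \<xi> (pp q) (gg q) u a3" "u \<le> a2" "a2 + int n \<le> a3" using run_exists[OF Fq \<kappa>2] by blast
  have ua2: "u = a2"
  proof (rule ccontr)
    assume ne: "u \<noteq> a2"
    have on: "blk \<xi> n (a2 - 1) = blk (pp q) n (gg q + (a2 - 1) - u)" using a23 ne by (intro run_blk[OF a23(1)]) auto
    show False
    proof (cases t2)
      case 0
      then have "a1 = a3" using a2 a01 a23 ne by (intro run_unique(2)[OF Fq a01(1) a23(1), of "a1 - int n"]) (auto simp: a2_def)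
      then show False using a23(3) a2(1) by simp
    next
      case (Suc t)
      then have e: "a2 - 1 = a1 - int n + 1 + int t" by (simp add: a2_def)
      have "P t" unfolding P_def using on[unfolded e] by blast
      then show False using t2min Suc by simp
    qed
  qed
  have gap: "blk \<xi> n y \<noteq> blk (pp e) n \<kappa>" if y: "a1 - int n < y" "y < a2" and e: "e \<in> Cs" "e \<noteq> j" for y e \<kappa>
  proof
    assume eq: "blk \<xi> n y = blk (pp e) n \<kappa>"
    show False
    proof (cases "e = q")
      case True
      have "P (nat (y - (a1 - int n + 1)))" unfolding P_def using y eq True by auto
      moreover have "nat (y - (a1 - int n + 1)) < t2" using y unfolding a2_def by linarith
      ultimately show False using t2min by blast
    next
      case False
      obtain x0 x1 where x: "run \<xi> (pp e) (gg e) x0 x1" "x0 \<le> y" "y + int n \<le> x1" using run_exists[OF F[OF e] eq] by blast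
      have len: "int N1 \<le> x1 - x0 + 1" using run_long[OF e, of x0 x1] x by auto
      \<comment> \<open>A block of length \<open>n1\<close> inside both the run of \<open>e\<close>
        and the window: it starts at \<open>y\<close> if the run lasts long enough, and otherwise
        ends with the run.\<close>
      define w where "w = (if y + int n1 \<le> x1 then y else x1 - int n1)"
      have w: "x0 \<le> w" "w + int n1 \<le> x1" "i0 \<le> w" "w + int n1 \<le> i0 + int (M * n1)"
      proof -
        have e1: "y + int n1 \<le> i0 + int (M * n1)" using y a2 a1end K10(2) nu0 n20 n_pos by linarith
        have e2: "i0 + int n1 \<le> y" using y a01 z1 nu0 by linarith
        have e3: "x0 + int n1 \<le> x1" using len N1b nu0 n1_n(3) by linarith
        show "x0 \<le> w" "w + int n1 \<le> x1" "i0 \<le> w" "w + int n1 \<le> i0 + int (M * n1)"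
          using e1 e2 e3 x n20 unfolding w_def by (cases "y + int n1 \<le> x1"; simp; linarith)+
      qed
      have "pure e (blk \<xi> n1 w)" using run_blk_pure[OF ploop_pp[OF e] x(1) nn1 w(1,2)] .
      moreover have "pure q (blk \<xi> n1 w)" using w1'[OF order_refl w(3,4)] .
      moreover have "blk \<xi> n1 w \<noteq> []" using n1_n(3) by (metis length_blk list.size(3) not_one_le_zero)
      ultimately show False using pure_unique[of e "blk \<xi> n1 w" q] e q(1) False by blast
    qed
  qed
  show ?thesis
  proof (rule exI[of _ i0], rule exI[of _ a0], rule exI[of _ a1], rule exI[of _ a2], rule exI[of _ a3], intro conjI)
    show "\<forall>t k. n1 \<le> t \<longrightarrow> i0 \<le> k \<longrightarrow> k + int t \<le> i0 + int (M * n1) \<longrightarrow> pure q (blk \<xi> t k)" using w1' by blast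
    show "run \<xi> (pp q) (gg q) a0 a1" by (rule a01(1))
    show "a0 + int n \<le> a1" using a01 by linarith
    show "run \<xi> (pp q) (gg q) a2 a3" using a23(1) ua2 by simp
    show "a2 + int n \<le> a3" by (rule a23(3))
    show "i0 + int nu \<le> a1" using a01 z1 by linarith
    show "a1 - int n < a2" "a2 \<le> a1 + 2 * int n1" by (rule a2)+
    show "a1 + int ((K + 5) * nu) \<le> i0 + int (M * n1)" using a1end by linarith
    show "\<forall>y. a1 - int n < y \<longrightarrow> y < a2 \<longrightarrow> (\<forall>e\<in>Cs. e \<noteq> j \<longrightarrow> (\<forall>\<kappa>. blk \<xi> n y \<noteq> blk (pp e) n \<kappa>))"
      using gap by blast
  qed
qed

text \<open>If all entrances had the same past up to the previous passage, every passage would be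
  preceded by another one at the same short distance. Going left this never stops, but another loop
  has passages longer than that distance.\<close>

lemma common_past:
  "\<exists>z. 1 \<le> z \<and> z \<le> 3 * n1 \<and>
     (\<forall>a a' x x'. run_of q a x \<longrightarrow> run_of q a' x' \<longrightarrow> (\<forall>t. 1 \<le> t \<longrightarrow> t \<le> int z \<longrightarrow> \<xi> (a - t) = \<xi> (a' - t))) \<and>
     (\<exists>a a' x x'. run_of q a x \<and> run_of q a' x' \<and> \<xi> (a - int z - 1) \<noteq> \<xi> (a' - int z - 1))"
proof -
  note Fq = F[OF q(1,2)]
  obtain a0 a1 a2 a3 where A: "run_of q a0 a1" "run_of q a2 a3" "a1 - int n < a2" "a2 \<le> a1 + 2 * int n1"
    using consecutive_runs by metis
  define En where "En = {a. \<exists>x. run_of q a x}"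
  define ag where "ag t \<longleftrightarrow> (\<forall>a\<in>En. \<forall>a'\<in>En. \<xi> (a - int t) = \<xi> (a' - int t))" for t
  define \<delta> where "\<delta> = nat (a2 - a1 + int n)"
  have \<delta>: "\<delta> \<ge> 1" "int \<delta> = a2 - a1 + int n" "\<delta> \<le> 3 * n1" using A(3,4) n1_n(1) by (auto simp: \<delta>_def)
  have N1b: "int N1 \<ge> 40 * int n1" "int n1 \<ge> 20 * int n" using N1_bounds(1) nu_n1(2) n1_n(1) by linarith+
  have inrun: "\<xi> (a + t) = pp q (gg q + t)" if aE: "a \<in> En" "0 \<le> t" "t < int N1 - 1" for a t
  proof -
    obtain x where x: "run_of q a x" using aE(1) unfolding En_def by blast
    have "a + t < x" using run_long[OF q(1,2) x] aE by simp
    then have "\<xi> (a + t) = pp q (gg q + (a + t) - a)" using x aE(2) unfolding run_def by auto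
    then show ?thesis by simp
  qed
  have ex: "\<exists>t. 1 \<le> t \<and> t \<le> \<delta> \<and> \<not> ag t"
  proof (rule ccontr)
    assume "\<not> ?thesis"
    then have all: "\<And>t. 1 \<le> t \<Longrightarrow> t \<le> \<delta> \<Longrightarrow> ag t" by blast
    have a2En: "a2 \<in> En" using A(2) by (auto simp: En_def)
    have prev: "\<exists>\<kappa>. blk \<xi> n (a - int \<delta>) = blk (pp q) n \<kappa>" if a: "a \<in> En" for a
    proof -
      have "blk \<xi> n (a - int \<delta>) = blk \<xi> n (a2 - int \<delta>)"
      proof (rule blk_eqI)
        fix t assume t: "0 \<le> t" "t < int n"
        show "\<xi> (a - int \<delta> + t) = \<xi> (a2 - int \<delta> + t)"
        proof (cases "t < int \<delta>")
          case True
          then have "ag (nat (int \<delta> - t))" using t by (intro all) auto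
          then have "\<xi> (a - int (nat (int \<delta> - t))) = \<xi> (a2 - int (nat (int \<delta> - t)))" using a a2En unfolding ag_def by blast
          moreover have "int (nat (int \<delta> - t)) = int \<delta> - t" using True by simp
          ultimately show ?thesis by (simp add: algebra_simps)
        next
          case False
          then have "\<xi> (a + (t - int \<delta>)) = \<xi> (a2 + (t - int \<delta>))" using inrun[OF a] inrun[OF a2En] t N1b by simp
          then show ?thesis by (simp add: algebra_simps)
        qed
      qed
      moreover have "a2 - int \<delta> = a1 - int n" using \<delta> by simp
      moreover have "blk \<xi> n (a1 - int n) = blk (pp q) n (gg q + (a1 - int n) - a0)" using A(1) by (intro run_blk) auto
      ultimately show ?thesis by auto
    qed
    obtain e where e: "e \<in> Cs" "e \<noteq> j" "e \<noteq> q" using other_color2[of j q] by blast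
    obtain y' where "blk \<xi> n y' = blk (pp e) n 0"
      using loop_occ[OF F[OF e(1,2)], of n 0] loop_TT_depth[OF F[OF e(1,2)]] reach_gt[OF n] by auto
    then obtain y where y: "y \<le> a2 - int n - int \<delta> - 1" "blk \<xi> n y = blk (pp e) n 0"
      using recur_left[of "a2 - int n - int \<delta> - 1" n y'] by auto
    obtain x0 x1 where x: "run \<xi> (pp e) (gg e) x0 x1" "x0 \<le> y" "y + int n \<le> x1" using run_exists[OF F[OF e(1,2)] y(2)] by blast
    have xlen: "int N1 \<le> x1 - x0 + 1" using run_long[OF e(1,2), of x0 x1] x by auto
    \<comment> \<open>The run of \<open>e\<close> reaches far beyond \<open>b\<close>. The first
      entrance into the loop of \<open>q\<close> after \<open>b\<close> is preceded by a passage
      starting at or before \<open>b\<close>, and that passage shares a block of length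
      \<open>n\<close> with the run of \<open>e\<close>.\<close>
    define b where "b = x0 + int n + int \<delta>"
    define P where "P t \<longleftrightarrow> b + 1 + int t \<in> En" for t
    have P2: "P (nat (a2 - b - 1))" unfolding P_def using a2En y(1) x(2) by (simp add: b_def)
    define t0 where "t0 = (LEAST t. P t)"
    have Pt0: "P t0" unfolding t0_def by (rule LeastI[where P = P, OF P2])
    have tmin: "\<not> P t" if "t < t0" for t using not_less_Least[of t P] that unfolding t0_def by simp
    define a where "a = b + 1 + int t0"
    have aEn: "a \<in> En" using Pt0 by (simp add: P_def a_def)
    obtain \<kappa> where \<kappa>: "blk \<xi> n (a - int \<delta>) = blk (pp q) n \<kappa>" using prev[OF aEn] by blast
    obtain u v where u: "run \<xi> (pp q) (gg q) u v" "u \<le> a - int \<delta>" "a - int \<delta> + int n \<le> v" using run_exists[OF Fq \<kappa>] by blast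
    have uEn: "u \<in> En" using u by (auto simp: En_def)
    have ub: "u \<le> b"
    proof (rule ccontr)
      assume nb: "\<not> u \<le> b"
      then have "P (nat (u - b - 1))" using uEn by (simp add: P_def)
      moreover have "nat (u - b - 1) < t0" using nb u(2) \<delta>(1) unfolding a_def by linarith
      ultimately show False using tmin by blast
    qed
    define z where "z = max u x0"
    have z: "u \<le> z" "x0 \<le> z" "z + int n \<le> v" "z + int n \<le> x1"
      using ub u xlen N1b \<delta> by (auto simp: z_def max_def a_def b_def)
    have "pure q (blk \<xi> n z)" "pure e (blk \<xi> n z)"
      using run_blk_pure[OF ploop_pp[OF q(1,2)] u(1) order_refl z(1,3)] run_blk_pure[OF ploop_pp[OF e(1,2)] x(1) order_refl z(2,4)] by auto
    moreover have "blk \<xi> n z \<noteq> []" using n_pos by (metis length_blk list.size(3) not_one_le_zero)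
    ultimately show False using pure_unique[of q "blk \<xi> n z" e] e q(1) by blast
  qed
  define P where "P t \<longleftrightarrow> 1 \<le> t \<and> \<not> ag t" for t
  obtain t' where t': "P t'" "t' \<le> \<delta>" using ex unfolding P_def by blast
  define t0 where "t0 = (LEAST t. P t)"
  have Pt0: "P t0" unfolding t0_def by (rule LeastI[where P = P, OF t'(1)])
  have t0\<delta>: "t0 \<le> \<delta>" using Least_le[where P = P, OF t'(1)] t'(2) unfolding t0_def by simp
  have tmin: "ag t" if "t < t0" "1 \<le> t" for t using not_less_Least[of t P] that unfolding t0_def P_def by blast
  \<comment> \<open>All entrances are preceded by the letter \<open>bb q\<close>, so the common past
    is not empty.\<close>
  have "ag 1" unfolding ag_def
  proof (intro ballI)
    fix a a' assume "a \<in> En" "a' \<in> En"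
    then show "\<xi> (a - int 1) = \<xi> (a' - int 1)" unfolding En_def using run_ends(1)[OF Fq] by auto
  qed
  then have t01: "t0 \<noteq> 1" using Pt0 by (auto simp: P_def)
  then have t02: "t0 \<ge> 2" using Pt0 by (simp add: P_def)
  show ?thesis
  proof (intro exI[of _ "t0 - 1"] conjI)
    show "1 \<le> t0 - 1" "t0 - 1 \<le> 3 * n1" using t02 t0\<delta> \<delta>(3) by auto
    show "\<forall>a a' x x'. run_of q a x \<longrightarrow> run_of q a' x' \<longrightarrow> (\<forall>t. 1 \<le> t \<longrightarrow> t \<le> int (t0 - 1) \<longrightarrow> \<xi> (a - t) = \<xi> (a' - t))"
    proof (intro allI impI)
      fix a a' x x' t assume a: "run_of q a x" "run_of q a' x'" "1 \<le> t" "t \<le> int (t0 - 1)"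
      have "ag (nat t)" using a t02 by (intro tmin) auto
      moreover have "a \<in> En" "a' \<in> En" using a by (auto simp: En_def)
      ultimately have "\<xi> (a - int (nat t)) = \<xi> (a' - int (nat t))" unfolding ag_def by blast
      then show "\<xi> (a - t) = \<xi> (a' - t)" using a(3) by simp
    qed
    obtain a a' where aa: "a \<in> En" "a' \<in> En" "\<xi> (a - int t0) \<noteq> \<xi> (a' - int t0)" using Pt0 unfolding P_def ag_def by blast
    obtain x x' where "run_of q a x" "run_of q a' x'" using aa(1,2) unfolding En_def by blast
    moreover
    have "int t0 = int (t0 - 1) + 1" using t02 by simp
    then have e12: "a - int t0 = a - int (t0 - 1) - 1" "a' - int t0 = a' - int (t0 - 1) - 1" by linarith+
    have "\<xi> (a - int (t0 - 1) - 1) \<noteq> \<xi> (a' - int (t0 - 1) - 1)" by (rule aa(3)[unfolded e12])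
    ultimately
    show "\<exists>a a' x x'. run_of q a x \<and> run_of q a' x' \<and> \<xi> (a - int (t0 - 1) - 1) \<noteq> \<xi> (a' - int (t0 - 1) - 1)"
      by blast
  qed
qed

end

context colored_sequence
begin

text \<open>The situation in which \<open>c\<close> has no loop: the special words of other colors are exits and entrances of
  their loops, a left special word of color \<open>c\<close> leads within color \<open>c\<close> to a right special one, and the
  first right special word met after leaving the color \<open>c\<close> is always the same.\<close>

definition good :: "'c \<Rightarrow> nat \<Rightarrow> bool" where
  "good c k \<longleftrightarrow> N0 \<le> k \<and> c \<in> Cs \<and>
    (\<forall>e\<in>Cs. e \<noteq> c \<longrightarrow> (\<exists>r. rsimple e k r) \<and> (\<exists>r. lsimple e k r)) \<and>
    (\<forall>w\<in>RS \<xi> k. \<not> pure c w \<longrightarrow> (\<exists>e\<in>Cs - {c}. rsimple e k w)) \<and>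
    (\<forall>w\<in>LS \<xi> k. \<not> pure c w \<longrightarrow> (\<exists>e\<in>Cs - {c}. lsimple e k w)) \<and>
    (\<forall>i. blk \<xi> k i \<in> LS \<xi> k \<longrightarrow> pure c (blk \<xi> k i) \<longrightarrow>
      (\<exists>i'\<ge>i. blk \<xi> k i' \<in> RS \<xi> k \<and> (\<forall>y. i \<le> y \<longrightarrow> y \<le> i' \<longrightarrow> pure c (blk \<xi> k y)))) \<and>
    (\<exists>v0. \<forall>i i'. i < i' \<longrightarrow> blk \<xi> k i \<in> RS \<xi> k \<longrightarrow> pure c (blk \<xi> k i) \<longrightarrow> blk \<xi> k i' \<in> RS \<xi> k \<longrightarrow>
      \<not> pure c (blk \<xi> k i') \<longrightarrow> (\<forall>y. i < y \<longrightarrow> y < i' \<longrightarrow> blk \<xi> k y \<notin> RS \<xi> k) \<longrightarrow> blk \<xi> k i' = v0)"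

lemma run_exists_long:
  assumes L: "loop c n \<pi> g b h d" and k: "n \<le> k" and i: "blk \<xi> k i = blk \<pi> k \<kappa>"
  shows "\<exists>a e. run \<xi> \<pi> g a e \<and> a \<le> i \<and> i + int k \<le> e \<and> (\<forall>t. \<pi> (\<kappa> + t) = \<pi> (g + i - a + t))"
proof -
  have i': "blk \<xi> n i = blk \<pi> n \<kappa>" by (rule blk_take[OF i k])
  obtain a e where a: "run \<xi> \<pi> g a e" "a \<le> i" "i + int n \<le> e" using run_exists[OF L i'] by blast
  have "blk \<pi> n \<kappa> = blk \<pi> n (g + i - a)" using run_blk[OF a] i' by simp
  then have ph: "\<pi> (\<kappa> + t) = \<pi> (g + i - a + t)" for t by (rule loop_phase[OF L order_refl])
  have "i + int k \<le> e"
  proof (rule ccontr)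
    assume "\<not> i + int k \<le> e"
    then have "\<xi> e = \<pi> (\<kappa> + e - i)" using a by (intro blk_eqD'[OF i]) auto
    also have "\<dots> = \<pi> (g + e - a)" using ph[of "e - i"] by (simp add: algebra_simps)
    finally show False using a(1) by (simp add: run_def)
  qed
  then show ?thesis using a ph by blast
qed

end

context phase
begin

lemma n1_rev: "phase.n1 (rv \<xi>) Q (\<lambda>e. rv (pp e)) q = n1"
  by (simp add: phase.n1_def[OF phase_rev] phase.N1_def[OF phase_rev] n1_def N1_def depth_rv)

lemma nu_rev: "phase.nu (rv \<xi>) Q (\<lambda>e. rv (pp e)) q = nu"
  by (simp add: phase.nu_def[OF phase_rev] nu_def n1_rev)

lemma sizes:
  "int nu + 10 * int n1 \<le> int N1" "10 * int n1 \<le> int nu" "20 * int n \<le> int n1" "int n \<ge> 1" "N0 \<le> nu" "n \<le> nu"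
  "nu < depth \<xi> (pp q)"
proof -
  show a: "int nu + 10 * int n1 \<le> int N1" "10 * int n1 \<le> int nu" "20 * int n \<le> int n1" "int n \<ge> 1"
    using N1_bounds(1) nu_n1(2) n1_n(1) n_pos by linarith+
  show "N0 \<le> nu" using nu_n1(2) n1_N0 by linarith
  show "n \<le> nu" using a by linarith
  show "nu < depth \<xi> (pp q)" using a n1_n(3) unfolding N1_def by linarith
qed

text \<open>The word starts where the common past begins, so maximality of \<open>z\<close> makes it
  left special. It contains the entrance with the letter before it, so it is off the loop and
  determines the beginning of a passage; at most \<open>3 * n1\<close> of its \<open>nu\<close>
  letters precede the entrance, so it has color \<open>q\<close>.\<close>

lemma past_special:
  "\<exists>z l. 1 \<le> z \<and> z \<le> 3 * n1 \<and> l \<in> LS \<xi> nu \<and> pure q l \<and> (\<forall>\<kappa>. l \<noteq> blk (pp q) nu \<kappa>) \<and>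
     (\<forall>a x. run_of q a x \<longrightarrow> blk \<xi> nu (a - int z) = l) \<and>
     (\<forall>i. blk \<xi> nu i = l \<longrightarrow> (\<exists>x. run_of q (i + int z) x))"
proof -
  note Fq = F[OF q(1,2)]
  obtain z where z: "1 \<le> z" "z \<le> 3 * n1"
     and past: "\<And>a a' x x' t. run_of q a x \<Longrightarrow> run_of q a' x' \<Longrightarrow> 1 \<le> t \<Longrightarrow> t \<le> int z \<Longrightarrow> \<xi> (a - t) = \<xi> (a' - t)"
     and diff: "\<exists>a a' x x'. run_of q a x \<and> run_of q a' x' \<and> \<xi> (a - int z - 1) \<noteq> \<xi> (a' - int z - 1)"
    using common_past by blast
  have zi: "int z \<ge> 1" "int z \<le> 3 * int n1" using z by linarith+
  obtain a a' x x' where A: "run_of q a x" "run_of q a' x'" "\<xi> (a - int z - 1) \<noteq> \<xi> (a' - int z - 1)" using diff by blast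
  have inrun: "\<xi> (u + t) = pp q (gg q + t)" if r: "run_of q u v" and t: "0 \<le> t" "t < int N1 - 1" for u v t
  proof -
    have "u + t < v" using run_long[OF q(1,2) r] t by simp
    then have "\<xi> (u + t) = pp q (gg q + (u + t) - u)" using r t(1) unfolding run_def by auto
    then show ?thesis by simp
  qed
  define l where "l = blk \<xi> nu (a - int z)"
  have same: "blk \<xi> nu (u - int z) = l" if r: "run_of q u v" for u v
    unfolding l_def
  proof (rule blk_eqI)
    fix t assume t: "0 \<le> t" "t < int nu"
    show "\<xi> (u - int z + t) = \<xi> (a - int z + t)"
    proof (cases "t < int z")
      case True
      then have "\<xi> (u - (int z - t)) = \<xi> (a - (int z - t))" using t by (intro past[OF r A(1)]) auto
      then show ?thesis by (simp add: algebra_simps)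
    next
      case False
      then have "\<xi> (u + (t - int z)) = \<xi> (a + (t - int z))" using inrun[OF r] inrun[OF A(1)] t sizes(1) zi(1) by simp
      then show ?thesis by (simp add: algebra_simps)
    qed
  qed
  have lLS: "l \<in> LS \<xi> nu" by (rule LSI[OF same[OF A(1)] same[OF A(2)] A(3)])
  have zn: "z \<le> nu" "int (nu - z) = int nu - int z" using zi sizes(2) by linarith+
  have lp: "pure q l"
  proof -
    have "blk \<xi> (nu - z) a = blk (pp q) (nu - z) (gg q + a - a)"
      using A(1) run_long[OF q(1,2) A(1)] sizes zn zi by (intro run_blk) auto
    then have "pure q (blk \<xi> (z + (nu - z)) (a - int z))"
    proof (rule pure_pad_small(1)[OF q(1) ploop_pp[OF q(1,2)] n1_N0, rotated 3])
      show "z \<le> 4 * n1" using z by simp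
      show "2 * Q * n1 \<le> z + (nu - z)" using nu_n1(1) zn by simp
      show "n \<le> nu - z" using zi sizes zn by linarith
    qed
    then show ?thesis using zn by (simp add: l_def)
  qed
  have li: "blk \<xi> n (i + int z) = blk (pp q) n (gg q)" "\<xi> (i + int z - 1) = bb q" if i: "blk \<xi> nu i = l" for i
  proof -
    have "blk \<xi> n (i + int z) = blk \<xi> n (a - int z + int z)"
      using zi sizes by (intro blk_sub[OF i[unfolded l_def]]) auto
    moreover have "blk \<xi> n a = blk (pp q) n (gg q + a - a)" using A(1) by (intro run_blk) auto
    ultimately show "blk \<xi> n (i + int z) = blk (pp q) n (gg q)" by simp
    have "\<xi> (i + (int z - 1)) = \<xi> (a - int z + (int z - 1))"
      using zi sizes by (intro blk_eqD[OF i[unfolded l_def]]) auto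
    moreover have "\<xi> (a - 1) = bb q" using run_ends(1)[OF Fq] A(1) by blast
    ultimately show "\<xi> (i + int z - 1) = bb q" by (simp add: algebra_simps)
  qed
  have bne: "bb q \<noteq> pp q (gg q - 1)" using run_ends(1)[OF Fq] A(1) unfolding run_def by metis
  have loff: "l \<noteq> blk (pp q) nu \<kappa>" for \<kappa>
  proof
    assume eq: "l = blk (pp q) nu \<kappa>"
    then have eq': "blk \<xi> nu (a - int z) = blk (pp q) nu \<kappa>" by (simp add: l_def)
    have "blk \<xi> n (a - int z + int z) = blk (pp q) n (\<kappa> + int z)" using zi sizes by (intro blk_sub[OF eq']) auto
    then have "blk (pp q) n (\<kappa> + int z) = blk (pp q) n (gg q)" using li(1)[of "a - int z"] by (simp add: l_def)
    then have "pp q (\<kappa> + int z + - 1) = pp q (gg q + - 1)" by (rule loop_phase[OF Fq order_refl])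
    moreover have "\<xi> (a - int z + (int z - 1)) = pp q (\<kappa> + (int z - 1))" using zi sizes by (intro blk_eqD[OF eq']) auto
    moreover have "\<xi> (a - int z + int z - 1) = bb q" using li(2)[of "a - int z"] by (simp add: l_def)
    ultimately show False using bne by (simp add: algebra_simps)
  qed
  have start: "\<exists>v. run_of q (i + int z) v" if i: "blk \<xi> nu i = l" for i
  proof -
    obtain u v where u: "run \<xi> (pp q) (gg q) u v" "u \<le> i + int z" "i + int z + int n \<le> v"
      using run_exists[OF Fq li(1)[OF i]] by blast
    have "u = i + int z"
    proof (rule ccontr)
      assume "u \<noteq> i + int z"
      then have "u \<le> i + int z - 1" "i + int z - 1 < v" using u by auto
      then have "\<xi> (i + int z - 1) = pp q (gg q + (i + int z - 1) - u)" using u(1) unfolding run_def by auto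
      moreover have "blk (pp q) n (gg q) = blk (pp q) n (gg q + (i + int z) - u)" using run_blk[OF u] li(1)[OF i] by simp
      then have "pp q (gg q + - 1) = pp q (gg q + (i + int z) - u + - 1)" by (rule loop_phase[OF Fq order_refl])
      ultimately show False using li(2)[OF i] bne by (simp add: algebra_simps)
    qed
    then show ?thesis using u by blast
  qed
  show ?thesis using z lLS lp loff same start by blast
qed

lemma future_special:
  "\<exists>z \<rho>. 1 \<le> z \<and> z \<le> 3 * n1 \<and> \<rho> \<in> RS \<xi> nu \<and> pure q \<rho> \<and> (\<forall>\<kappa>. \<rho> \<noteq> blk (pp q) nu \<kappa>) \<and>
     (\<forall>a x. run_of q a x \<longrightarrow> blk \<xi> nu (x + int z - int nu) = \<rho>)"
proof -
  note Fq = F[OF q(1,2)]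
  from phase.past_special[OF phase_rev] obtain z l where z: "1 \<le> z" "z \<le> 3 * n1" "l \<in> LS (rv \<xi>) nu"
      "colored_sequence.pure (rdev dev) eps q l" "\<And>\<kappa>. l \<noteq> blk (rv (pp q)) nu \<kappa>"
      "\<And>a x. run (rv \<xi>) (rv (pp q)) (1 - hh q) a x \<Longrightarrow> a + int n \<le> x \<Longrightarrow> blk (rv \<xi>) nu (a - int z) = l"
    unfolding n1_rev nu_rev by blast
  have 1: "rev l \<in> RS \<xi> nu" "pure q (rev l)" using z(3,4) by (simp_all add: LS_rv pure_rv)
  have 2: "rev l \<noteq> blk (pp q) nu \<kappa>" for \<kappa>
    using z(5)[of "1 - \<kappa> - int nu"] by (simp add: blk_rv rev_swap)
  have 3: "blk \<xi> nu (x + int z - int nu) = rev l" if r: "run_of q a x" for a x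
  proof -
    have "blk (rv \<xi>) nu (1 - x - int z) = l" using run_rv[OF Fq] r by (intro z(6)) auto
    moreover have "1 - (1 - x - int z) - int nu = x + int z - int nu" by simp
    ultimately show ?thesis by (metis blk_rv rev_rev_ident)
  qed
  show ?thesis using z(1,2) 1 2 3 by blast
qed

text \<open>Two special words of color \<open>q\<close> on each side let \<open>RS_struct\<close>
  and \<open>LS_struct\<close> settle the other colors. The color can be left only after
  \<open>\<rho>\<close>, and one of its two continuations stays in \<open>q\<close>, as a typical
  stretch shows; so the way out is unique.\<close>

lemma good_next: "good q nu"
proof -
  note Fq = F[OF q(1,2)] and plq = ploop_pp[OF q(1,2)]
  obtain z l where z: "1 \<le> z" "z \<le> 3 * n1" and l: "l \<in> LS \<xi> nu" "pure q l" "\<And>\<kappa>. l \<noteq> blk (pp q) nu \<kappa>"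
     and lrun: "\<And>a x. run_of q a x \<Longrightarrow> blk \<xi> nu (a - int z) = l"
     and lstart: "\<And>i. blk \<xi> nu i = l \<Longrightarrow> \<exists>x. run_of q (i + int z) x"
    using past_special by blast
  obtain z' \<rho> where z': "1 \<le> z'" "z' \<le> 3 * n1" and \<rho>: "\<rho> \<in> RS \<xi> nu" "pure q \<rho>" "\<And>\<kappa>. \<rho> \<noteq> blk (pp q) nu \<kappa>"
     and \<rho>run: "\<And>a x. run_of q a x \<Longrightarrow> blk \<xi> nu (x + int z' - int nu) = \<rho>"
    using future_special by blast
  have zi: "int z \<ge> 1" "int z \<le> 3 * int n1" "int z' \<ge> 1" "int z' \<le> 3 * int n1" using z z' by linarith+
  note sz = sizes
  define lq where "lq = blk (pp q) nu (gg q)"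
  define rq where "rq = blk (pp q) nu (hh q - int nu)"
  have lq: "lq \<in> LS \<xi> nu" "pure q lq" "lq \<noteq> l"
    unfolding lq_def using loop_LS[OF Fq q(1) n sz(6,7)] ploop_pure[OF plq sz(6)] l(3) by auto
  have rq: "rq \<in> RS \<xi> nu" "pure q rq" "rq \<noteq> \<rho>"
    unfolding rq_def using loop_RS[OF Fq q(1) n sz(6,7)] ploop_pure[OF plq sz(6)] \<rho>(3) by auto
  note LS = LS_struct[OF sz(5) q(1) lq(1) l(1) lq(3,2) l(2)]
  note RS = RS_struct[OF sz(5) q(1) rq(1) \<rho>(1) rq(3,2) \<rho>(2)]
  have S1: "\<exists>i'\<ge>i. blk \<xi> nu i' \<in> RS \<xi> nu \<and> (\<forall>y. i \<le> y \<longrightarrow> y \<le> i' \<longrightarrow> pure q (blk \<xi> nu y))"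
    if i: "blk \<xi> nu i \<in> LS \<xi> nu" "pure q (blk \<xi> nu i)" for i
  proof -
    from LS(3)[OF i] show ?thesis
    proof
      assume "blk \<xi> nu i = lq"
      from run_exists_long[OF Fq sz(6) this[unfolded lq_def]] obtain u v where
        u: "run \<xi> (pp q) (gg q) u v" "u \<le> i" "i + int nu \<le> v" by blast
      show ?thesis
      proof (intro exI[of _ "v - int nu"] conjI allI impI)
        show "i \<le> v - int nu" using u by simp
        show "blk \<xi> nu (v - int nu) \<in> RS \<xi> nu" using u by (intro run_exit_RS[OF Fq u(1) _ sz(7)]) simp
        show "pure q (blk \<xi> nu y)" if "i \<le> y" "y \<le> v - int nu" for y
          using u that by (intro run_blk_pure[OF plq u(1) sz(6)]) auto
      qed
    next
      assume "blk \<xi> nu i = l"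
      from lstart[OF this] obtain v where v: "run_of q (i + int z) v" by blast
      have len: "int N1 \<le> v - (i + int z) + 1" by (rule run_long[OF q(1,2) v])
      have v1: "i + int z + int nu \<le> v" using len sz(1,3,4) by linarith
      show ?thesis
      proof (intro exI[of _ "v - int nu"] conjI allI impI)
        show "i \<le> v - int nu" using v1 by simp
        show "blk \<xi> nu (v - int nu) \<in> RS \<xi> nu" using v v1 by (intro run_exit_RS[OF Fq _ _ sz(7)]) auto
        show "pure q (blk \<xi> nu y)" if y: "i \<le> y" "y \<le> v - int nu" for y
        proof (cases "i + int z \<le> y")
          case True
          then show ?thesis using v y by (intro run_blk_pure[OF plq _ sz(6), of "gg q" "i + int z" v]) auto
        next
          case False
          define k where "k = nat (i + int z - y)"
          have k: "int k = i + int z - y" "int k \<le> int z" using False y by (simp_all add: k_def)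
          have kn: "k \<le> nu" "int (nu - k) = int nu - int k" using k zi sz(2) by linarith+
          have "blk \<xi> (nu - k) (i + int z) = blk (pp q) (nu - k) (gg q + (i + int z) - (i + int z))"
            using v v1 kn k by (intro run_blk) auto
          then have "pure q (blk \<xi> (k + (nu - k)) (i + int z - int k))"
          proof (rule pure_pad_small(1)[OF q(1) plq n1_N0, rotated 3])
            show "k \<le> 4 * n1" using k zi by linarith
            show "2 * Q * n1 \<le> k + (nu - k)" using nu_n1(1) kn by simp
            show "n \<le> nu - k" using zi sz k kn by linarith
          qed
          then show ?thesis using kn k by simp
        qed
      qed
    qed
  qed
  obtain i0 a0 a1 where W: "\<And>t k. n1 \<le> t \<Longrightarrow> i0 \<le> k \<Longrightarrow> k + int t \<le> i0 + int (M * n1) \<Longrightarrow> pure q (blk \<xi> t k)"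
    and a01: "run_of q a0 a1" "i0 + int nu \<le> a1" "a1 + int ((K + 5) * nu) \<le> i0 + int (M * n1)"
    using consecutive_runs by blast
  \<comment> \<open>An occurrence of \<open>\<rho>\<close> at the end of a passage inside the
    window: the next right special word still has color \<open>q\<close>, so the letter read here is
    the one that stays.\<close>
  define w where "w = a1 + int z' - int nu"
  have w: "blk \<xi> nu w = \<rho>" unfolding w_def by (rule \<rho>run[OF a01(1)])
  have K5: "int ((K + 5) * nu) = int ((K + 1) * nu) + 4 * int nu" by (simp add: algebra_simps)
  have "\<exists>y>w. blk \<xi> nu y \<in> RS \<xi> nu \<and> pure q (blk \<xi> nu y) \<and> (\<forall>x. w < x \<longrightarrow> x < y \<longrightarrow> blk \<xi> nu x \<notin> RS \<xi> nu)"
  proof -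
    obtain k where k: "k \<le> (K + 1) * nu" "\<And>t. t < k \<Longrightarrow> blk \<xi> nu (w + 1 + int t) \<notin> RS \<xi> nu"
      "blk \<xi> nu (w + 1 + int k) \<in> RS \<xi> nu" using first_RS[OF sz(5), of "w + 1"] by blast
    have ki: "int k \<le> int ((K + 1) * nu)" using k(1) by (simp only: of_nat_le_iff)
    have "pure q (blk \<xi> nu (w + 1 + int k))"
    proof (rule W)
      show "n1 \<le> nu" using nu_n1(2) by simp
      show "i0 \<le> w + 1 + int k" using a01(2) zi by (simp add: w_def)
      show "w + 1 + int k + int nu \<le> i0 + int (M * n1)" using a01(3) ki K5 zi sz unfolding w_def by linarith
    qed
    moreover have "blk \<xi> nu x \<notin> RS \<xi> nu" if "w < x" "x < w + 1 + int k" for x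
      using k(2)[of "nat (x - w - 1)"] that by simp
    ultimately show ?thesis using k(3) by (intro exI[of _ "w + 1 + int k"]) auto
  qed
  then obtain y0 where y0: "w < y0" "blk \<xi> nu y0 \<in> RS \<xi> nu" "pure q (blk \<xi> nu y0)"
    "\<And>x. w < x \<Longrightarrow> x < y0 \<Longrightarrow> blk \<xi> nu x \<notin> RS \<xi> nu" by blast
  have claim: "blk \<xi> nu i = \<rho> \<and> \<xi> (i + int nu) \<noteq> \<xi> (w + int nu)"
    if i: "i < i'" "blk \<xi> nu i \<in> RS \<xi> nu" "pure q (blk \<xi> nu i)" "blk \<xi> nu i' \<in> RS \<xi> nu" "\<not> pure q (blk \<xi> nu i')"
      and no: "\<And>y. i < y \<Longrightarrow> y < i' \<Longrightarrow> blk \<xi> nu y \<notin> RS \<xi> nu" for i i'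
  proof -
    \<comment> \<open>After \<open>rq\<close> one either continues on the loop or leaves it. In the
      second case \<open>\<rho>\<close> follows within \<open>z'\<close> letters, and all words up
      to it have color \<open>q\<close> by padding.\<close>
    have "blk \<xi> nu i \<noteq> rq"
    proof
      assume "blk \<xi> nu i = rq"
      then have ir: "blk \<xi> nu i = blk (pp q) nu (hh q - int nu)" by (simp add: rq_def)
      show False
      proof (cases "\<xi> (i + int nu) = pp q (hh q - int nu + int nu)")
        case True
        obtain \<kappa> where "blk \<xi> nu i' = blk (pp q) nu \<kappa>"
          using loop_next_RS[OF Fq sz(6,7) ir True i(1) no] by blast
        then show False using ploop_pure[OF plq sz(6)] i(5) by simp
      next
        case False
        obtain u v where u: "run \<xi> (pp q) (gg q) u v" "u \<le> i" "i + int nu \<le> v"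
          "\<And>t. pp q (hh q - int nu + t) = pp q (gg q + i - u + t)" using run_exists_long[OF Fq sz(6) ir] by blast
        have v: "v = i + int nu"
        proof (rule ccontr)
          assume "v \<noteq> i + int nu"
          then have "\<xi> (i + int nu) = pp q (gg q + (i + int nu) - u)" using u unfolding run_def by auto
          then show False using u(4)[of "int nu"] False by (simp add: algebra_simps)
        qed
        have uv: "run_of q u v" using u v sz(6) by auto
        have "blk \<xi> nu (i + int z') = \<rho>" using \<rho>run[OF uv] v by simp
        then have ii: "i' \<le> i + int z'" using no[of "i + int z'"] \<rho>(1) zi by force
        define k where "k = nat (i' - i)"
        have k: "int k = i' - i" "int k \<le> int z'" using i(1) ii by (simp_all add: k_def)
        have kn: "k \<le> nu" "int (nu - k) = int nu - int k" using k zi sz(2) by linarith+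
        have "blk \<xi> (nu - k) i' = blk (pp q) (nu - k) (gg q + i' - u)"
          using u v kn k i(1) by (intro run_blk) auto
        then have "pure q (blk \<xi> ((nu - k) + k) i')"
        proof (rule pure_pad_small(2)[OF q(1) plq n1_N0, rotated 3])
          show "k \<le> 4 * n1" using k zi by linarith
          show "2 * Q * n1 \<le> k + (nu - k)" using nu_n1(1) kn by simp
          show "n \<le> nu - k" using zi sz k kn by linarith
        qed
        then show False using kn i(5) by simp
      qed
    qed
    then have ir: "blk \<xi> nu i = \<rho>" using RS(3)[OF i(2,3)] by blast
    moreover have "\<xi> (i + int nu) \<noteq> \<xi> (w + int nu)"
    proof
      assume l: "\<xi> (i + int nu) = \<xi> (w + int nu)"
      have "blk \<xi> nu i = blk \<xi> nu w" using ir w by simp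
      from blk_step[OF this l] have st: "blk \<xi> nu (i + 1) = blk \<xi> nu (w + 1)" .
      have "blk \<xi> nu y0 = blk \<xi> nu i'" by (rule first_RS_same(1)[OF st i(1,4) no y0(1,2,4)])
      then show False using y0(3) i(5) by simp
    qed
    ultimately show ?thesis by blast
  qed
  have S2: "\<exists>v0. \<forall>i i'. i < i' \<longrightarrow> blk \<xi> nu i \<in> RS \<xi> nu \<longrightarrow> pure q (blk \<xi> nu i) \<longrightarrow> blk \<xi> nu i' \<in> RS \<xi> nu \<longrightarrow>
      \<not> pure q (blk \<xi> nu i') \<longrightarrow> (\<forall>y. i < y \<longrightarrow> y < i' \<longrightarrow> blk \<xi> nu y \<notin> RS \<xi> nu) \<longrightarrow> blk \<xi> nu i' = v0"
  proof (cases "\<exists>i i'. i < i' \<and> blk \<xi> nu i \<in> RS \<xi> nu \<and> pure q (blk \<xi> nu i) \<and> blk \<xi> nu i' \<in> RS \<xi> nu \<and>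
      \<not> pure q (blk \<xi> nu i') \<and> (\<forall>y. i < y \<longrightarrow> y < i' \<longrightarrow> blk \<xi> nu y \<notin> RS \<xi> nu)")
    case True
    then obtain i i' where i: "i < i'" "blk \<xi> nu i \<in> RS \<xi> nu" "pure q (blk \<xi> nu i)" "blk \<xi> nu i' \<in> RS \<xi> nu"
      "\<not> pure q (blk \<xi> nu i')" "\<And>y. i < y \<Longrightarrow> y < i' \<Longrightarrow> blk \<xi> nu y \<notin> RS \<xi> nu" by blast
    note ci = claim[OF i]
    show ?thesis
    proof (rule exI[of _ "blk \<xi> nu i'"], intro allI impI)
      fix k k' assume k: "k < k'" "blk \<xi> nu k \<in> RS \<xi> nu" "pure q (blk \<xi> nu k)" "blk \<xi> nu k' \<in> RS \<xi> nu"
        "\<not> pure q (blk \<xi> nu k')" "\<forall>y. k < y \<longrightarrow> y < k' \<longrightarrow> blk \<xi> nu y \<notin> RS \<xi> nu"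
      have kno: "\<And>y. k < y \<Longrightarrow> y < k' \<Longrightarrow> blk \<xi> nu y \<notin> RS \<xi> nu" using k(6) by blast
      note ck = claim[OF k(1-5) kno]
      have c2: "card (rx \<xi> (blk \<xi> nu w)) = 2" using RS(2) w by simp
      have e: "blk \<xi> nu i = blk \<xi> nu w" "blk \<xi> nu k = blk \<xi> nu w" using ci ck w by auto
      have "\<xi> (k + int nu) = \<xi> (w + int nu) \<or> \<xi> (k + int nu) = \<xi> (i + int nu)"
        using ci by (intro two_letters[OF c2 e]) auto
      then have l: "\<xi> (k + int nu) = \<xi> (i + int nu)" using ck by auto
      have "blk \<xi> nu k = blk \<xi> nu i" using e by simp
      from blk_step[OF this l] have st: "blk \<xi> nu (k + 1) = blk \<xi> nu (i + 1)" .
      show "blk \<xi> nu k' = blk \<xi> nu i'" by (rule first_RS_same(1)[OF st[symmetric] i(1,4,6) k(1,4) kno])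
    qed
  next
    case False
    then show ?thesis by blast
  qed
  show ?thesis unfolding good_def
    using sz(5) q(1) RS(4,5) LS(4,5) S1 S2 by (intro conjI ballI allI impI) blast+
qed

end

section \<open>A \<open>good\<close> color cannot be the one without a loop\<close>

lemma int_next:
  fixes y0 y1 :: int
  assumes "P y1" "y0 < y1"
  shows "\<exists>y. y0 < y \<and> y \<le> y1 \<and> P y \<and> (\<forall>x. y0 < x \<longrightarrow> x < y \<longrightarrow> \<not> P x)"
proof -
  define R where "R t \<longleftrightarrow> P (y0 + 1 + int t)" for t
  have R1: "R (nat (y1 - y0 - 1))" using assms by (simp add: R_def)
  define t where "t = (LEAST t. R t)"
  have Rt: "R t" unfolding t_def by (rule LeastI[where P = R, OF R1])
  have tle: "t \<le> nat (y1 - y0 - 1)" unfolding t_def by (rule Least_le[where P = R, OF R1])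
  have "\<not> P x" if "y0 < x" "x < y0 + 1 + int t" for x
  proof
    assume "P x"
    then have "R (nat (x - y0 - 1))" using that by (simp add: R_def)
    moreover have "nat (x - y0 - 1) < t" using that by linarith
    ultimately show False using not_less_Least[of "nat (x - y0 - 1)" R] unfolding t_def by blast
  qed
  then show ?thesis using Rt tle assms(2) unfolding R_def by (intro exI[of _ "y0 + 1 + int t"]) auto
qed

lemma int_prev:
  fixes y0 y1 :: int
  assumes "P y0" "y0 < y1"
  shows "\<exists>y. y0 \<le> y \<and> y < y1 \<and> P y \<and> (\<forall>x. y < x \<longrightarrow> x < y1 \<longrightarrow> \<not> P x)"
proof -
  have "\<exists>y. - y1 < y \<and> y \<le> - y0 \<and> P (- y) \<and> (\<forall>x. - y1 < x \<longrightarrow> x < y \<longrightarrow> \<not> P (- x))"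
    using assms by (intro int_next[of "\<lambda>y. P (- y)"]) auto
  then obtain y where y: "- y1 < y" "y \<le> - y0" "P (- y)" "\<And>x. - y1 < x \<Longrightarrow> x < y \<Longrightarrow> \<not> P (- x)" by blast
  have "\<not> P x" if "- y < x" "x < y1" for x using y(4)[of "- x"] that by simp
  then show ?thesis using y(1-3) by (intro exI[of _ "- y"]) auto
qed

context colored_sequence
begin

lemma phase_exists:
  assumes n: "N0 \<le> n" and j: "j \<in> Cs"
    and s: "\<And>e. e \<in> Cs \<Longrightarrow> e \<noteq> j \<Longrightarrow> (\<exists>r. rsimple e n r) \<and> (\<exists>r. lsimple e n r)"
  shows "\<exists>pp gg bb hh dd q. phase \<xi> K C N0 Cs dev m eps Q M j n pp gg bb hh dd q"
proof -
  have "\<exists>p g b h d. loop x n p g b h d" if xC: "x \<in> Cs" "x \<noteq> j" for x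
  proof -
    obtain r r' where "rsimple x n r" "lsimple x n r'" using s[OF xC] by blast
    then show ?thesis using loop_of_simple[OF n xC(1)] by blast
  qed
  then have "\<forall>x. \<exists>p g b h d. x \<in> Cs \<longrightarrow> x \<noteq> j \<longrightarrow> loop x n p g b h d" by blast
  then obtain pp gg bb hh dd where F: "\<And>x. x \<in> Cs \<Longrightarrow> x \<noteq> j \<Longrightarrow> loop x n (pp x) (gg x) (bb x) (hh x) (dd x)"
    by metis
  have "Cs - {j} \<noteq> {}" using other_color[OF j] by blast
  then obtain q where q: "q \<in> Cs - {j}" "\<And>e. e \<in> Cs - {j} \<Longrightarrow> depth \<xi> (pp q) \<le> depth \<xi> (pp e)"
    using argmin_color[of "Cs - {j}" "\<lambda>x. depth \<xi> (pp x)"] by blast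
  have "phase \<xi> K C N0 Cs dev m eps Q M j n pp gg bb hh dd q"
    by unfold_locales (use n j F s q in auto)
  then show ?thesis by blast
qed

lemma recur_right_strict: "\<exists>k>j. blk \<xi> n k = blk \<xi> n i"
proof -
  obtain k where "j + 1 \<le> k" "blk \<xi> n k = blk \<xi> n i" using recur_right by blast
  then show ?thesis by (intro exI[of _ k]) simp
qed

end

context phase
begin

text \<open>Between two passages of the loop of least depth no loop is touched, so the special words
  there have color \<open>j\<close>: from \<open>q\<close> one comes to \<open>j\<close>, and
  looking back from an entrance into \<open>q\<close> the first left special word has color
  \<open>j\<close>. If \<open>j\<close> always led to \<open>q\<close>, the two colors would never
  be left. Otherwise some entrance into \<open>q\<close> comes right after another color, and no
  place remains for that left special word.\<close>

lemma not_good: "\<not> good j n"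
proof
  assume G: "good j n"
  have RSt: "\<And>w. w \<in> RS \<xi> n \<Longrightarrow> \<not> pure j w \<Longrightarrow> \<exists>e\<in>Cs - {j}. rsimple e n w"
    and LSt: "\<And>w. w \<in> LS \<xi> n \<Longrightarrow> \<not> pure j w \<Longrightarrow> \<exists>e\<in>Cs - {j}. lsimple e n w"
    and S1: "\<And>i. blk \<xi> n i \<in> LS \<xi> n \<Longrightarrow> pure j (blk \<xi> n i) \<Longrightarrow>
      (\<exists>i'\<ge>i. blk \<xi> n i' \<in> RS \<xi> n \<and> (\<forall>y. i \<le> y \<longrightarrow> y \<le> i' \<longrightarrow> pure j (blk \<xi> n y)))"
    using G unfolding good_def by blast+
  obtain v0 where S2: "\<And>i i'. i < i' \<Longrightarrow> blk \<xi> n i \<in> RS \<xi> n \<Longrightarrow> pure j (blk \<xi> n i) \<Longrightarrow> blk \<xi> n i' \<in> RS \<xi> n \<Longrightarrow>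
      \<not> pure j (blk \<xi> n i') \<Longrightarrow> (\<And>y. i < y \<Longrightarrow> y < i' \<Longrightarrow> blk \<xi> n y \<notin> RS \<xi> n) \<Longrightarrow> blk \<xi> n i' = v0"
    using G unfolding good_def by blast
  note Fq = F[OF q(1,2)] and plq = ploop_pp[OF q(1,2)]
  have dep: "n < depth \<xi> (pp e)" if "e \<in> Cs" "e \<noteq> j" for e
    using loop_TT_depth[OF F[OF that]] reach_gt[OF n] by simp
  have disj: "c = c'" if "pure c (blk \<xi> n y)" "pure c' (blk \<xi> n y)" "c \<in> Cs" "c' \<in> Cs" for c c' y
  proof -
    have "blk \<xi> n y \<noteq> []" using n_pos by (metis length_blk list.size(3) not_one_le_zero)
    then show ?thesis using pure_unique that by blast
  qed
  have Rloop: "w = blk (pp e) n (hh e - int n)" if "rsimple e n w" "e \<in> Cs" "e \<noteq> j" for e w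
    using loop_RS_simple[OF F[OF that(2,3)] that(2) n order_refl dep[OF that(2,3)] that(1)] .
  have Lloop: "w = blk (pp e) n (gg e)" if "lsimple e n w" "e \<in> Cs" "e \<noteq> j" for e w
    using loop_LS_simple[OF F[OF that(2,3)] that(2) n order_refl dep[OF that(2,3)] that(1)] .
  obtain a0 a1 a2 a3 where A: "run_of q a0 a1" "run_of q a2 a3" "a1 - int n < a2"
    and gap: "\<And>y e \<kappa>. a1 - int n < y \<Longrightarrow> y < a2 \<Longrightarrow> e \<in> Cs \<Longrightarrow> e \<noteq> j \<Longrightarrow> blk \<xi> n y \<noteq> blk (pp e) n \<kappa>"
    using consecutive_runs by metis
  have gapR: "pure j (blk \<xi> n y)" if "a1 - int n < y" "y < a2" "blk \<xi> n y \<in> RS \<xi> n" for y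
    using RSt[OF that(3)] Rloop gap[OF that(1,2)] by blast
  have gapL: "pure j (blk \<xi> n y)" if "a1 - int n < y" "y < a2" "blk \<xi> n y \<in> LS \<xi> n" for y
    using LSt[OF that(3)] Lloop gap[OF that(1,2)] by blast
  obtain rq where rq: "rsimple q n rq" using Rs[OF q(1,2)] by blast
  obtain lq where lq: "lsimple q n lq" using Ls[OF q(1,2)] by blast
  have rq_eq: "rq = blk (pp q) n (hh q - int n)" by (rule Rloop[OF rq q(1,2)])
  have rqP: "pure q rq" "rq \<in> RS \<xi> n" using rq by (auto simp: rsimple_def)
  obtain yR where yR: "a1 - int n < yR" "yR < a2" "blk \<xi> n yR \<in> RS \<xi> n"
    "\<And>x. a1 - int n < x \<Longrightarrow> x < yR \<Longrightarrow> blk \<xi> n x \<notin> RS \<xi> n"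
  proof -
    obtain y where y: "a1 - int n < y" "y < a2" "blk \<xi> n y \<in> RS \<xi> n"
      using gap_RS[OF n q(1) Fq rq] A by blast
    from int_next[of "\<lambda>y. blk \<xi> n y \<in> RS \<xi> n", OF y(3,1)] obtain y' where
      "a1 - int n < y'" "y' \<le> y" "blk \<xi> n y' \<in> RS \<xi> n" "\<And>x. a1 - int n < x \<Longrightarrow> x < y' \<Longrightarrow> blk \<xi> n x \<notin> RS \<xi> n" by blast
    then show ?thesis using y(2) by (intro that[of y']) auto
  qed
  obtain yL where yL: "a1 - int n < yL" "yL < a2" "blk \<xi> n yL \<in> LS \<xi> n"
    "\<And>x. yL < x \<Longrightarrow> x < a2 \<Longrightarrow> blk \<xi> n x \<notin> LS \<xi> n"
  proof -
    obtain y where y: "a1 - int n < y" "y < a2" "blk \<xi> n y \<in> LS \<xi> n"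
      using gap_LS[OF n q(1) Fq lq] A by blast
    from int_prev[of "\<lambda>y. blk \<xi> n y \<in> LS \<xi> n", OF y(3,2)] obtain y' where
      "y \<le> y'" "y' < a2" "blk \<xi> n y' \<in> LS \<xi> n" "\<And>x. y' < x \<Longrightarrow> x < a2 \<Longrightarrow> blk \<xi> n x \<notin> LS \<xi> n" by blast
    then show ?thesis using y(1) by (intro that[of y']) auto
  qed
  have a1r: "blk \<xi> n (a1 - int n) = rq"
  proof -
    have "blk \<xi> n (a1 - int n) \<in> RS \<xi> n" using run_exit_RS[OF Fq _ _ dep[OF q(1,2)]] A(1) by blast
    moreover have "pure q (blk \<xi> n (a1 - int n))" using A(1) by (intro run_blk_pure[OF plq _ order_refl]) auto
    ultimately show ?thesis using rq unfolding rsimple_def by blast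
  qed
  \<comment> \<open>All exits read the same letter \<open>dd q\<close>, so each behaves like the one
    at \<open>a1\<close> until the next right special word.\<close>
  have rq_next: "blk \<xi> n i' = rq \<or> pure j (blk \<xi> n i')"
    if i: "blk \<xi> n i = rq" "i < i'" "blk \<xi> n i' \<in> RS \<xi> n" and no: "\<And>y. i < y \<Longrightarrow> y < i' \<Longrightarrow> blk \<xi> n y \<notin> RS \<xi> n" for i i'
  proof (cases "\<xi> (i + int n) = pp q (hh q - int n + int n)")
    case True
    obtain \<kappa> where "blk \<xi> n i' = blk (pp q) n \<kappa>"
      using loop_next_RS[OF Fq order_refl dep[OF q(1,2)] i(1)[unfolded rq_eq] True i(2) no] by blast
    then have "pure q (blk \<xi> n i')" using ploop_pure[OF plq order_refl] by simp
    then show ?thesis using rq i(3) unfolding rsimple_def by blast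
  next
    case False
    have "\<xi> (i + int n) = dd q" using loop_exit_unique(1)[OF Fq order_refl i(1)[unfolded rq_eq] False] .
    moreover have "\<xi> (a1 - int n + int n) = dd q" using run_ends(2)[OF Fq, of a0 a1] A(1) by simp
    ultimately have l: "\<xi> (a1 - int n + int n) = \<xi> (i + int n)" by simp
    have "blk \<xi> n (a1 - int n) = blk \<xi> n i" using a1r i(1) by simp
    from blk_step[OF this l] have st: "blk \<xi> n (a1 - int n + 1) = blk \<xi> n (i + 1)" .
    have "blk \<xi> n i' = blk \<xi> n yR" by (rule first_RS_same(1)[OF st yR(1,3,4) i(2,3) no])
    then show ?thesis using gapR[OF yR(1-3)] by simp
  qed
  obtain e where e: "e \<in> Cs" "e \<noteq> j" "e \<noteq> q" using other_color2[of j q] by blast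
  obtain re where re: "rsimple e n re" using Rs[OF e(1,2)] by blast
  have reP: "pure e re" "re \<in> RS \<xi> n" using re by (auto simp: rsimple_def)
  obtain ye where ye: "blk \<xi> n ye = re" using reP(2) unfolding RS_def by blast
  obtain yq0 where yq0: "ye < yq0" "blk \<xi> n yq0 = rq"
    using recur_right_strict[of ye n "a1 - int n"] a1r by auto
  obtain yq where yq: "ye < yq" "blk \<xi> n yq = rq" "\<And>x. ye < x \<Longrightarrow> x < yq \<Longrightarrow> blk \<xi> n x \<noteq> rq"
    using int_next[of "\<lambda>y. blk \<xi> n y = rq", OF yq0(2,1)] by blast
  have yeR: "blk \<xi> n ye \<in> RS \<xi> n" using ye reP by simp
  obtain y' where y': "ye \<le> y'" "y' < yq" "blk \<xi> n y' \<in> RS \<xi> n" "\<And>x. y' < x \<Longrightarrow> x < yq \<Longrightarrow> blk \<xi> n x \<notin> RS \<xi> n"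
    using int_prev[of "\<lambda>y. blk \<xi> n y \<in> RS \<xi> n", OF yeR yq(1)] by blast
  have yqR: "blk \<xi> n yq \<in> RS \<xi> n" using yq(2) rqP by simp
  have yqj: "\<not> pure j (blk \<xi> n yq)" using disj[of j yq q] yq(2) rqP(1) j q by auto
  \<comment> \<open>Otherwise \<open>v0\<close> is the exit word of \<open>q\<close>. Then the first
    later right special word that neither has color \<open>j\<close> nor equals \<open>rq\<close>
    has no possible predecessor among the right special words.\<close>
  have "\<not> pure j (blk \<xi> n y')"
  proof
    assume pj: "pure j (blk \<xi> n y')"
    have v0: "v0 = rq" using S2[OF y'(2,3) pj yqR yqj y'(4)] yq(2) by simp
    define bad where "bad y \<longleftrightarrow> blk \<xi> n y \<in> RS \<xi> n \<and> \<not> pure j (blk \<xi> n y) \<and> blk \<xi> n y \<noteq> rq" for y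
    obtain yb0 where yb0: "yq < yb0" "blk \<xi> n yb0 = re" using recur_right_strict[of yq n ye] ye by auto
    have rne: "re \<noteq> rq" using disj[of e ye q] ye reP(1) rqP(1) e q(1) by auto
    have "bad yb0" unfolding bad_def using yb0(2) reP rne disj[of e yb0 j] e j by auto
    from int_next[of bad, OF this yb0(1)] obtain yb where
      yb: "yq < yb" "bad yb" "\<And>x. yq < x \<Longrightarrow> x < yb \<Longrightarrow> \<not> bad x" by blast
    obtain yc where yc: "yq \<le> yc" "yc < yb" "blk \<xi> n yc \<in> RS \<xi> n" "\<And>x. yc < x \<Longrightarrow> x < yb \<Longrightarrow> blk \<xi> n x \<notin> RS \<xi> n"
      using int_prev[of "\<lambda>y. blk \<xi> n y \<in> RS \<xi> n", OF yqR yb(1)] by blast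
    have "\<not> bad yc" using yb(3)[of yc] yc(1,2) yq(2) by (cases "yc = yq") (auto simp: bad_def)
    then have "blk \<xi> n yc = rq \<or> pure j (blk \<xi> n yc)" using yc(3) unfolding bad_def by blast
    then show False
    proof
      assume "blk \<xi> n yc = rq"
      from rq_next[OF this yc(2) _ yc(4)] yb(2) show False unfolding bad_def by blast
    next
      assume "pure j (blk \<xi> n yc)"
      from S2[OF yc(2,3) this _ _ yc(4)] yb(2) v0 show False unfolding bad_def by blast
    qed
  qed
  then obtain e' where e': "e' \<in> Cs" "e' \<noteq> j" "rsimple e' n (blk \<xi> n y')" using RSt[OF y'(3)] by blast
  have e'P: "pure e' (blk \<xi> n y')" using e'(3) by (simp add: rsimple_def)
  have "e' \<noteq> q"
  proof
    assume eq: "e' = q"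
    then have "blk \<xi> n y' = rq" using e'(3) rq unfolding rsimple_def by blast
    then have "y' = ye" using yq(3)[of y'] y'(1,2) by force
    then show False using disj[of e ye q] e'P ye reP(1) e q(1) eq by auto
  qed
  obtain aq xq where aq: "run \<xi> (pp q) (gg q) aq xq" "aq \<le> yq" "yq + int n \<le> xq"
    using run_exists[OF Fq] yq(2) rq_eq by metis
  have aq_y': "y' < aq"
  proof (rule ccontr)
    assume "\<not> y' < aq"
    then have "pure q (blk \<xi> n y')" using aq y'(2) by (intro run_blk_pure[OF plq aq(1) order_refl]) auto
    then show False using disj[OF _ e'P q(1) e'(1)] \<open>e' \<noteq> q\<close> by blast
  qed
  have aq2: "blk \<xi> n (a2 - 1) = blk \<xi> n (aq - 1)"
  proof (rule blk_back)
    have "blk \<xi> n a2 = blk (pp q) n (gg q + a2 - a2)" using A(2) by (intro run_blk) auto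
    moreover have "blk \<xi> n aq = blk (pp q) n (gg q + aq - aq)" using aq by (intro run_blk[OF aq(1)]) auto
    ultimately show "blk \<xi> n a2 = blk \<xi> n aq" by simp
    have "aq + int n \<le> xq" using aq by simp
    then show "\<xi> (a2 - 1) = \<xi> (aq - 1)" using run_ends(1)[OF Fq aq(1)] run_ends(1)[OF Fq, of a2 a3] A(2) by simp
  qed
  define k where "k = nat (a2 - 1 - yL)"
  have k: "int k = a2 - 1 - yL" using yL(2) by (simp add: k_def)
  have bk: "blk \<xi> n (a2 - 1 - int t) = blk \<xi> n (aq - 1 - int t)" if "t \<le> k" for t
  proof (rule det_path_bwd[OF aq2 _ that])
    show "blk \<xi> n (a2 - 1 - int t) \<notin> LS \<xi> n" if "t < k" for t using that k by (intro yL(4)) auto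
  qed
  \<comment> \<open>All entrances are preceded by \<open>bb q\<close>, so backwards from
    \<open>aq\<close> one reads the same words as from \<open>a2\<close>, until the left special
    word of color \<open>j\<close> at \<open>yL\<close> appears.\<close>
  define i where "i = aq - 1 - int k"
  have i: "blk \<xi> n i = blk \<xi> n yL" using bk[of k] k by (simp add: i_def)
  have iP: "blk \<xi> n i \<in> LS \<xi> n" "pure j (blk \<xi> n i)" using i yL(3) gapL[OF yL(1-3)] by auto
  have noL: "blk \<xi> n x \<notin> LS \<xi> n" if "i < x" "x < aq" for x
  proof -
    have e1: "aq - 1 - int (nat (aq - 1 - x)) = x" using that by simp
    have t: "nat (aq - 1 - x) < k" using that unfolding i_def by linarith
    have "blk \<xi> n (a2 - 1 - int (nat (aq - 1 - x))) \<notin> LS \<xi> n" using t k by (intro yL(4)) auto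
    then show ?thesis using bk[of "nat (aq - 1 - x)"] t e1 by simp
  qed
  \<comment> \<open>If \<open>i\<close> is not before \<open>y'\<close>, color \<open>j\<close>
    leads from it to a right special word between \<open>y'\<close> and \<open>yq\<close>, where
    there is none. If \<open>i\<close> is before \<open>y'\<close>, it either lies on the run of
    \<open>e'\<close> or precedes the beginning of that run, which is a left special word nearer to
    \<open>aq\<close>.\<close>
  show False
  proof (cases "i < y'")
    case False
    obtain i' where i': "i' \<ge> i" "blk \<xi> n i' \<in> RS \<xi> n" "\<And>y. i \<le> y \<Longrightarrow> y \<le> i' \<Longrightarrow> pure j (blk \<xi> n y)"
      using S1[OF iP] by blast
    have "i \<noteq> y'" using iP(2) disj[OF e'P _ e'(1) j] e'(2) by blast
    have "i' < yq"
    proof (rule ccontr)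
      assume "\<not> i' < yq"
      then have "pure j (blk \<xi> n yq)" using aq(2) by (intro i'(3)) (auto simp: i_def)
      then show False using yqj by simp
    qed
    then show False using y'(4)[of i'] i'(1,2) False \<open>i \<noteq> y'\<close> by simp
  next
    case True
    have "blk \<xi> n y' = blk (pp e') n (hh e' - int n)" by (rule Rloop[OF e'(3,1,2)])
    from run_exists[OF F[OF e'(1,2)] this] obtain u v where
      u: "run \<xi> (pp e') (gg e') u v" "u \<le> y'" "y' + int n \<le> v" by blast
    show False
    proof (cases "u \<le> i")
      case ui: True
      have "pure e' (blk \<xi> n i)" using u ui True by (intro run_blk_pure[OF ploop_pp[OF e'(1,2)] u(1) order_refl]) auto
      then show False using disj[OF _ iP(2) e'(1) j] e'(2) by blast
    next
      case False
      have "blk \<xi> n u = blk (pp e') n (gg e')" using run_blk[OF u(1), of u n] u by simp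
      then have "blk \<xi> n u \<in> LS \<xi> n" using loop_LS[OF F[OF e'(1,2)] e'(1) n order_refl dep[OF e'(1,2)]] by simp
      then show False using noL[of u] False u(2) aq_y' by simp
    qed
  qed
qed

end

context colored_sequence
begin

lemma contradiction: False
proof -
  obtain c n where n: "N0 \<le> n" and c: "heavy c n" using heavy_exists by blast
  have "\<exists>pp gg bb hh dd q. phase \<xi> K C N0 Cs dev m eps Q M c n pp gg bb hh dd q"
    using c not_rsimple[OF n, of c] not_lsimple[OF n, of c] unfolding heavy_def by (intro phase_exists[OF n]) auto
  then obtain pp gg bb hh dd q where P: "phase \<xi> K C N0 Cs dev m eps Q M c n pp gg bb hh dd q" by blast
  obtain k where G: "good q k" using phase.good_next[OF P] by blast
  then have k: "N0 \<le> k" "q \<in> Cs" "\<And>e. e \<in> Cs \<Longrightarrow> e \<noteq> q \<Longrightarrow> (\<exists>r. rsimple e k r) \<and> (\<exists>r. lsimple e k r)"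
    unfolding good_def by blast+
  from phase_exists[OF k] obtain pp gg bb hh dd q' where
    "phase \<xi> K C N0 Cs dev m eps Q M q k pp gg bb hh dd q'" by blast
  from phase.not_good[OF this] G show False by blast
qed

end

section \<open>Ergodic averages\<close>

locale ergodic_system = prob_space P for P :: "'b measure" +
  fixes T :: "'b \<Rightarrow> 'b"
  assumes T [measurable]: "T \<in> measurable P P"
    and preserving: "\<And>B. B \<in> sets P \<Longrightarrow> emeasure P (T -` B \<inter> space P) = emeasure P B"
    and ergodic: "\<And>B. B \<in> sets P \<Longrightarrow> T -` B \<inter> space P = B \<Longrightarrow> emeasure P B = 0 \<or> emeasure P B = 1"
begin

definition bsum :: "('b \<Rightarrow> real) \<Rightarrow> nat \<Rightarrow> 'b \<Rightarrow> real" where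
  "bsum f n x = (\<Sum>k<n. f ((T ^^ k) x))"

lemma bsum_Suc: "bsum f (Suc n) x = f x + bsum f n (T x)"
  unfolding bsum_def by (subst sum.lessThan_Suc_shift) (simp add: funpow_swap1)

lemma T_pow [measurable]: "T ^^ k \<in> measurable P P"
  by (induction k) (auto intro: measurable_comp[OF _ T])

lemma bsum_measurable [measurable]: "f \<in> borel_measurable P \<Longrightarrow> bsum f n \<in> borel_measurable P"
  unfolding bsum_def[abs_def] by (intro borel_measurable_sum measurable_compose[OF T_pow])

lemma distr_T: "distr P P T = P"
  by (rule measure_eqI) (simp_all add: emeasure_distr preserving)

lemma integral_T: "f \<in> borel_measurable P \<Longrightarrow> (\<integral>x. f (T x) \<partial>P) = (\<integral>x. f x \<partial>P :: real)"
  using integral_distr[OF T, of f] by (simp add: distr_T)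

lemma preserving_pow:
  assumes "B \<in> sets P"
  shows "prob ((T ^^ k) -` B \<inter> space P) = prob B"
proof (induction k)
  case 0
  then show ?case using sets.sets_into_space[OF assms] by (simp add: Int_absorb2)
next
  case (Suc k)
  have m: "(T ^^ k) -` B \<inter> space P \<in> sets P" using measurable_sets[OF T_pow assms] .
  have eq: "(T ^^ Suc k) -` B \<inter> space P = T -` ((T ^^ k) -` B \<inter> space P) \<inter> space P"
    using measurable_space[OF T] unfolding funpow_Suc_right by auto
  have "prob ((T ^^ Suc k) -` B \<inter> space P) = prob ((T ^^ k) -` B \<inter> space P)"
    unfolding eq measure_def preserving[OF m] ..
  from trans[OF this Suc] show ?case .
qed

text \<open>The maximum of the Birkhoff sums \<open>bsum f k x\<close> with
  \<open>k \<le> n\<close>, written recursively because the recursion is the identity behind the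
  maximal inequality.\<close>

primrec maxsum :: "('b \<Rightarrow> real) \<Rightarrow> nat \<Rightarrow> 'b \<Rightarrow> real" where
  "maxsum f 0 x = 0"
| "maxsum f (Suc n) x = max 0 (f x + maxsum f n (T x))"

lemma maxsum_ge: "k \<le> n \<Longrightarrow> bsum f k x \<le> maxsum f n x"
proof (induction n arbitrary: k x)
  case 0
  then show ?case by (simp add: bsum_def)
next
  case (Suc n)
  show ?case
  proof (cases k)
    case 0
    then show ?thesis by (simp add: bsum_def)
  next
    case (Suc k')
    then show ?thesis using Suc.IH[of k' "T x"] Suc.prems by (simp add: bsum_Suc le_max_iff_disj)
  qed
qed

lemma maxsum_nonneg: "0 \<le> maxsum f n x"
  by (cases n) auto

lemma maxsum_Suc_le: "maxsum f n x \<le> maxsum f (Suc n) x"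
proof (induction n arbitrary: x)
  case (Suc n)
  have "f x + maxsum f n (T x) \<le> f x + maxsum f (Suc n) (T x)" using Suc by simp
  then show ?case unfolding maxsum.simps(2)[of f n x] maxsum.simps(2)[of f "Suc n" x] by (intro max.mono) auto
qed simp

lemma maxsum_mono: "n \<le> k \<Longrightarrow> maxsum f n x \<le> maxsum f k x"
  by (rule lift_Suc_mono_le[of "\<lambda>n. maxsum f n x"]) (rule maxsum_Suc_le)

lemma maxsum_measurable [measurable]: "f \<in> borel_measurable P \<Longrightarrow> maxsum f n \<in> borel_measurable P"
proof (induction n)
  case 0
  then show ?case by (simp add: measurable_const cong: measurable_cong)
next
  case (Suc n)
  then have [measurable]: "f \<in> borel_measurable P" "maxsum f n \<in> borel_measurable P" by auto
  have "(\<lambda>x. max 0 (f x + maxsum f n (T x))) \<in> borel_measurable P" by measurable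
  then show ?case by (simp cong: measurable_cong)
qed

lemma maxsum_bounded: "(\<And>x. \<bar>f x\<bar> \<le> b) \<Longrightarrow> maxsum f n x \<le> real n * b"
proof (induction n arbitrary: x)
  case (Suc n)
  have b0: "0 \<le> b" using Suc.prems[of x] by linarith
  have "f x \<le> b" using Suc.prems[of x] by linarith
  then have "f x + maxsum f n (T x) \<le> real (Suc n) * b" using Suc.IH[OF Suc.prems, of "T x"] by (simp add: algebra_simps)
  then show ?case using b0 by simp
qed simp

text \<open>Garsia's argument: where \<open>maxsum f n x\<close> is positive, \<open>f x\<close> is
  at least \<open>maxsum f n x - maxsum f n (T x)\<close>, and elsewhere this difference is not
  positive; its integral vanishes by invariance. Then let \<open>n\<close> tend to infinity.\<close>

lemma maximal_inequality:
  assumes f [measurable]: "f \<in> borel_measurable P" and b: "\<And>x. \<bar>f x\<bar> \<le> b"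
    and E: "AE x in P. \<exists>n. 0 < maxsum f n x"
  shows "0 \<le> (\<integral>x. f x \<partial>P)"
proof -
  define g where "g n x = (if 0 < maxsum f n x then f x else 0)" for n x
  have [measurable]: "g n \<in> borel_measurable P" for n unfolding g_def by measurable
  have gb: "\<bar>g n x\<bar> \<le> b" for n x using b[of x] by (auto simp: g_def)
  have int_max: "integrable P (maxsum f n)" for n
    using maxsum_bounded[OF b, where n = n] maxsum_nonneg[of f n] by (intro integrable_const_bound[where B = "real n * b"]) auto
  have int_maxT: "integrable P (\<lambda>x. maxsum f n (T x))" for n
    using maxsum_bounded[OF b, where n = n] maxsum_nonneg[of f n] by (intro integrable_const_bound[where B = "real n * b"]) auto
  have int_g: "integrable P (g n)" for n
    using gb by (intro integrable_const_bound[where B = b]) auto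
  have pos: "0 \<le> (\<integral>x. g n x \<partial>P)" for n
  proof -
    have "maxsum f n x - maxsum f n (T x) \<le> g n x" for x
    proof (cases "0 < maxsum f n x")
      case True
      then obtain n' where n': "n = Suc n'" by (cases n) auto
      have "maxsum f n x = f x + maxsum f n' (T x)" using True unfolding n' by (auto simp: max_def split: if_splits)
      then show ?thesis using maxsum_Suc_le[of f n' "T x"] True unfolding n' g_def by simp
    next
      case False
      then show ?thesis using maxsum_nonneg[of f n "T x"] by (simp add: g_def)
    qed
    then have "(\<integral>x. maxsum f n x - maxsum f n (T x) \<partial>P) \<le> (\<integral>x. g n x \<partial>P)"
      using int_max int_maxT int_g by (intro integral_mono) auto
    then show ?thesis using int_max int_maxT integral_T[of "maxsum f n"] by simp
  qed
  have "(\<lambda>n. \<integral>x. g n x \<partial>P) \<longlonglongrightarrow> (\<integral>x. f x \<partial>P)"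
  proof (rule integral_dominated_convergence[where w = "\<lambda>_. b"])
    show "AE x in P. (\<lambda>n. g n x) \<longlonglongrightarrow> f x"
      using E
    proof eventually_elim
      case (elim x)
      then obtain n where n: "0 < maxsum f n x" by blast
      have "0 < maxsum f k x" if "n \<le> k" for k
        using maxsum_mono[OF that, of f x] n by linarith
      then have "\<forall>\<^sub>F k in sequentially. g k x = f x"
        by (intro eventually_sequentiallyI[of n]) (simp add: g_def)
      then show ?case by (rule tendsto_eventually)
    qed
    show "AE x in P. norm (g i x) \<le> b" for i using gb by simp
  qed auto
  from LIMSEQ_le_const[OF this, of 0] pos show ?thesis by blast
qed

text \<open>The set where the sums are unbounded above is strictly invariant, so by ergodicity it is null
  or conull, and the maximal inequality excludes the latter.\<close>

lemma bsum_bounded_above: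
  assumes f [measurable]: "f \<in> borel_measurable P" and b: "\<And>x. \<bar>f x\<bar> \<le> b" and neg: "(\<integral>x. f x \<partial>P) < 0"
  shows "AE x in P. \<exists>C::nat. \<forall>n. bsum f n x \<le> real C"
proof -
  define B where "B = {x \<in> space P. \<forall>C::nat. \<exists>n. bsum f n x > real C}"
  have B [measurable]: "B \<in> sets P" unfolding B_def by measurable
  have "T -` B \<inter> space P = B"
  proof (intro set_eqI iffI)
    fix x assume "x \<in> T -` B \<inter> space P"
    then have x: "x \<in> space P" "\<And>C::nat. \<exists>n. bsum f n (T x) > real C" unfolding B_def by auto
    have "\<exists>n. bsum f n x > real C" for C
    proof -
      obtain n where "bsum f n (T x) > real (C + nat \<lceil>b\<rceil>)" using x(2) by blast
      then have "bsum f (Suc n) x > real C" using b[of x] by (simp add: bsum_Suc) linarith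
      then show ?thesis by blast
    qed
    then show "x \<in> B" using x by (auto simp: B_def)
  next
    fix x assume "x \<in> B"
    then have x: "x \<in> space P" "\<And>C::nat. \<exists>n. bsum f n x > real C" unfolding B_def by auto
    have "\<exists>n. bsum f n (T x) > real C" for C
    proof -
      obtain n where n: "bsum f n x > real (C + nat \<lceil>b\<rceil>)" using x(2) by blast
      then obtain k where "n = Suc k" by (cases n) (auto simp: bsum_def)
      then have "bsum f k (T x) > real C" using n b[of x] by (simp add: bsum_Suc) linarith
      then show ?thesis by blast
    qed
    then show "x \<in> T -` B \<inter> space P" using x measurable_space[OF T] by (auto simp: B_def)
  qed
  from ergodic[OF B this] have "emeasure P B = 0"
  proof
    assume "emeasure P B = 1"
    then have "AE x in P. x \<in> B" using AE_in_set_eq_1[OF B] by (simp add: measure_def)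
    then have "AE x in P. \<exists>n. 0 < maxsum f n x"
    proof eventually_elim
      case (elim x)
      then obtain n where "bsum f n x > real 0" unfolding B_def by blast
      then show ?case using maxsum_ge[of n n f x] by (intro exI[of _ n]) simp
    qed
    then show ?thesis using maximal_inequality[OF f b] neg by simp
  qed simp
  then have "AE x in P. x \<notin> B" by (rule AE_not_in[OF null_setsI]) (rule B)
  then show ?thesis
  proof (rule AE_mp, intro AE_I2 impI)
    fix x assume x: "x \<in> space P" "x \<notin> B"
    then obtain C :: nat where "\<not> (\<exists>n. bsum f n x > real C)" by (auto simp: B_def)
    then show "\<exists>C::nat. \<forall>n. bsum f n x \<le> real C" by (intro exI[of _ C]) (simp add: not_less)
  qed
qed

text \<open>Subtracting slightly more than the mean makes the integral negative. Linear bounds with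
  a constant depending on the point take the place of convergence of the averages.\<close>

lemma bsum_upper:
  assumes h [measurable]: "h \<in> borel_measurable P" and b: "\<And>x. \<bar>h x\<bar> \<le> b" and \<eta>: "\<eta> > 0"
  shows "AE x in P. \<exists>C::nat. \<forall>n. bsum h n x \<le> real n * ((\<integral>x. h x \<partial>P) + \<eta>) + real C"
proof -
  define c where "c = (\<integral>x. h x \<partial>P) + \<eta>"
  have int: "integrable P h" using b by (intro integrable_const_bound[where B = b]) auto
  have "AE x in P. \<exists>C::nat. \<forall>n. bsum (\<lambda>x. h x - c) n x \<le> real C"
  proof (rule bsum_bounded_above)
    show "\<bar>h x - c\<bar> \<le> b + \<bar>c\<bar>" for x using b[of x] by linarith
    show "(\<integral>x. h x - c \<partial>P) < 0" using int \<eta> by (simp add: c_def prob_space)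
  qed measurable
  then show ?thesis unfolding c_def[symmetric]
    by eventually_elim (simp add: bsum_def sum_subtractf algebra_simps)
qed

lemma bsum_deviation:
  assumes h [measurable]: "h \<in> borel_measurable P" and b: "\<And>x. \<bar>h x\<bar> \<le> b" and \<eta>: "\<eta> > 0"
  shows "AE x in P. \<exists>C::nat. \<forall>n. \<bar>bsum h n x - real n * (\<integral>x. h x \<partial>P)\<bar> \<le> \<eta> * real n + real C"
proof -
  have 1: "AE x in P. \<exists>C::nat. \<forall>n. bsum h n x \<le> real n * ((\<integral>x. h x \<partial>P) + \<eta>) + real C"
    by (rule bsum_upper[OF h b \<eta>])
  have 2: "AE x in P. \<exists>C::nat. \<forall>n. bsum (\<lambda>x. - h x) n x \<le> real n * ((\<integral>x. - h x \<partial>P) + \<eta>) + real C"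
    by (rule bsum_upper[where b = b]) (use b \<eta> in auto)
  from 1 2 show ?thesis
  proof eventually_elim
    case (elim x)
    then obtain C1 C2 :: nat where C: "\<And>n. bsum h n x \<le> real n * ((\<integral>x. h x \<partial>P) + \<eta>) + real C1"
      "\<And>n. bsum (\<lambda>x. - h x) n x \<le> real n * ((\<integral>x. - h x \<partial>P) + \<eta>) + real C2" by blast
    have neg: "bsum (\<lambda>x. - h x) n x = - bsum h n x" for n by (simp add: bsum_def sum_negf)
    show ?case
    proof (intro exI[of _ "C1 + C2"] allI)
      fix n
      show "\<bar>bsum h n x - real n * (\<integral>x. h x \<partial>P)\<bar> \<le> \<eta> * real n + real (C1 + C2)"
        using C(1)[of n] C(2)[of n] unfolding neg by (simp add: algebra_simps abs_le_iff)
    qed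
  qed
qed

text \<open>An Egorov-type step: the sets on which the constant \<open>C\<close> works increase to a
  set of full measure, so one \<open>C\<close> serves all of \<open>F\<close> outside a set of
  measure less than \<open>\<theta>\<close>.\<close>

lemma uniform_deviation:
  assumes F: "finite F" and h [measurable]: "\<And>v. v \<in> F \<Longrightarrow> h v \<in> borel_measurable P"
    and b: "\<And>v x. \<bar>h v x\<bar> \<le> b" and \<eta>: "\<eta> > 0" and \<theta>: "\<theta> > 0"
  shows "\<exists>C::nat. \<exists>A\<in>sets P. prob (space P - A) < \<theta> \<and>
    (\<forall>x\<in>A. \<forall>v\<in>F. \<forall>n. \<bar>bsum (h v) n x - real n * (\<integral>x. h v x \<partial>P)\<bar> \<le> \<eta> * real n + real C)"
proof -
  define A where "A C = {x \<in> space P. \<forall>v\<in>F. \<forall>n. \<bar>bsum (h v) n x - real n * (\<integral>x. h v x \<partial>P)\<bar> \<le> \<eta> * real n + real C}" for C :: nat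
  have A [measurable]: "A C \<in> sets P" for C
    unfolding A_def by (rule sets.sets_Collect_finite_All[OF _ F]) measurable
  have A_mono: "A C \<subseteq> A C'" if "C \<le> C'" for C C'
  proof
    fix x assume x: "x \<in> A C"
    show "x \<in> A C'" unfolding A_def
    proof (intro CollectI conjI ballI allI)
      show "x \<in> space P" using x by (simp add: A_def)
      fix v n assume "v \<in> F"
      then have "\<bar>bsum (h v) n x - real n * (\<integral>x. h v x \<partial>P)\<bar> \<le> \<eta> * real n + real C" using x unfolding A_def by blast
      also have "\<dots> \<le> \<eta> * real n + real C'" using that by simp
      finally show "\<bar>bsum (h v) n x - real n * (\<integral>x. h v x \<partial>P)\<bar> \<le> \<eta> * real n + real C'" .
    qed
  qed
  have inc: "incseq A" by (simp add: incseq_def A_mono)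
  have "AE x in P. \<forall>v\<in>F. \<exists>C::nat. \<forall>n. \<bar>bsum (h v) n x - real n * (\<integral>x. h v x \<partial>P)\<bar> \<le> \<eta> * real n + real C"
    using F by (intro AE_finite_allI bsum_deviation[where b = b] \<eta> h b)
  then have "AE x in P. x \<in> (\<Union>C. A C)"
  proof (rule AE_mp, intro AE_I2 impI)
    fix x assume x: "x \<in> space P" "\<forall>v\<in>F. \<exists>C::nat. \<forall>n. \<bar>bsum (h v) n x - real n * (\<integral>x. h v x \<partial>P)\<bar> \<le> \<eta> * real n + real C"
    then obtain C :: "_ \<Rightarrow> nat" where C: "\<And>v n. v \<in> F \<Longrightarrow> \<bar>bsum (h v) n x - real n * (\<integral>x. h v x \<partial>P)\<bar> \<le> \<eta> * real n + real (C v)"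
      by metis
    have "x \<in> A (sum C F)" unfolding A_def
    proof (intro CollectI conjI ballI allI x(1))
      fix v n assume v: "v \<in> F"
      have "C v \<le> sum C F" using F v by (intro member_le_sum) auto
      then have "\<eta> * real n + real (C v) \<le> \<eta> * real n + real (sum C F)" by (simp del: of_nat_sum)
      with C[OF v, of n] show "\<bar>bsum (h v) n x - real n * (\<integral>x. h v x \<partial>P)\<bar> \<le> \<eta> * real n + real (sum C F)"
        by (rule order_trans)
    qed
    then show "x \<in> (\<Union>C. A C)" by blast
  qed
  then have "prob (\<Union>C. A C) = 1" by (subst prob_eq_1) auto
  moreover have "(\<lambda>C. prob (A C)) \<longlonglongrightarrow> prob (\<Union>C. A C)"
    by (rule finite_Lim_measure_incseq[OF _ inc]) auto
  ultimately have "(\<lambda>C. prob (A C)) \<longlonglongrightarrow> 1" by simp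
  from order_tendstoD(1)[OF this, of "1 - \<theta>"] \<theta> obtain C where "prob (A C) > 1 - \<theta>"
    by (auto simp: eventually_sequentially)
  then have "prob (space P - A C) < \<theta>" by (simp add: prob_compl)
  moreover have "\<forall>x\<in>A C. \<forall>v\<in>F. \<forall>n. \<bar>bsum (h v) n x - real n * (\<integral>x. h v x \<partial>P)\<bar> \<le> \<eta> * real n + real C"
    by (simp add: A_def)
  ultimately show ?thesis using A[of C] by blast
qed

end

section \<open>Minimal shifts\<close>

lemma funpow_left_shift: "(left_shift ^^ k) x = (\<lambda>i. x (i + k))"
  by (induction k) (auto simp: left_shift_def)

lemma open_cylinder: "open {z :: nat \<Rightarrow> 'a::discrete_topology. \<forall>k<n. z k = x k}"
proof -
  have "{z :: nat \<Rightarrow> 'a. \<forall>k<n. z k = x k} = PiE UNIV (\<lambda>k. if k < n then {x k} else UNIV)"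
    by (auto simp: PiE_def extensional_def split: if_splits)
  moreover
  have "finite {k. (if k < n then {x k} else UNIV) \<noteq> (UNIV :: 'a set)}"
    by (rule finite_subset[of _ "{..<n}"]) auto
  then have "open (PiE UNIV (\<lambda>k. if k < n then {x k} else UNIV))"
    by (rule open_PiE[rotated]) (simp add: discrete_topology_class.open_discrete)
  ultimately show ?thesis by simp
qed

lemma open_contains_cylinder:
  assumes "open (U :: (nat \<Rightarrow> 'a::discrete_topology) set)" "x \<in> U"
  shows "\<exists>n. {z. \<forall>k<n. z k = x k} \<subseteq> U"
proof -
  have "openin (product_topology (\<lambda>_. euclidean) UNIV) U" using assms(1) by (simp add: open_fun_def)
  from product_topology_open_contains_basis[OF this assms(2)] obtain X where
    X: "x \<in> PiE UNIV X" "finite {i. X i \<noteq> UNIV}" "PiE UNIV X \<subseteq> U" by auto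
  define n where "n = Suc (Max (insert 0 {i. X i \<noteq> UNIV}))"
  have n: "i < n" if "X i \<noteq> UNIV" for i
    using Max_ge[of "insert 0 {i. X i \<noteq> UNIV}" i] X(2) that by (simp add: n_def less_Suc_eq_le)
  have "{z. \<forall>k<n. z k = x k} \<subseteq> PiE UNIV X"
  proof
    fix z assume z: "z \<in> {z. \<forall>k<n. z k = x k}"
    have "z i \<in> X i" for i
    proof (cases "X i = UNIV")
      case False
      then have "z i = x i" using n z by blast
      then show ?thesis using X(1) by auto
    qed simp
    then show "z \<in> PiE UNIV X" by auto
  qed
  from subset_trans[OF this X(3)] show ?thesis by (rule exI)
qed

lemma compact_sequences: "compact (UNIV :: (nat \<Rightarrow> 'a::{finite, discrete_topology}) set)"
proof -
  have "compactin (product_topology (\<lambda>_::nat. euclidean :: 'a topology) UNIV) (PiE UNIV (\<lambda>_. UNIV))"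
    unfolding compactin_PiE by (simp add: finite_imp_compact)
  then show ?thesis by (simp add: euclidean_product_topology)
qed

section \<open>Uniform recurrence and passage to a two-sided sequence\<close>

abbreviation factor :: "(nat \<Rightarrow> 'a) \<Rightarrow> nat \<Rightarrow> nat \<Rightarrow> 'a list" where
  "factor x i n \<equiv> map x [i..<i + n]"

lemma factor_shift: "factor ((left_shift ^^ k) x) i n = factor x (i + k) n"
  by (rule nth_equalityI) (auto simp: funpow_left_shift add_ac)

lemma factor_factor: "i + k \<le> n \<Longrightarrow> take k (drop i (factor x l n)) = factor x (l + i) k"
  by (rule nth_equalityI) (auto simp: add_ac)

locale min_shift =
  fixes \<Omega> :: "(nat \<Rightarrow> 'a::{finite, discrete_topology}) set"
  assumes min: "minimal_shift \<Omega>" and nonempty: "\<Omega> \<noteq> {}"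
begin

lemma shift_in: "x \<in> \<Omega> \<Longrightarrow> (left_shift ^^ k) x \<in> \<Omega>"
  using min by (induction k) (auto simp: minimal_shift_def is_shift_def)

lemma languageI: "x \<in> \<Omega> \<Longrightarrow> factor x i n \<in> language \<Omega>"
  unfolding language_def by blast

lemma occurs:
  assumes w: "w \<in> language \<Omega>" and y: "y \<in> \<Omega>"
  shows "\<exists>i. factor y i (length w) = w"
proof -
  obtain x i n where x: "w = factor x i n" "x \<in> \<Omega>" using w unfolding language_def by blast
  define z where "z = (left_shift ^^ i) x"
  have z: "z \<in> \<Omega>" "w = factor z 0 n" using x shift_in factor_shift[of i x 0 n] by (auto simp: z_def)
  have "z \<in> closure (orbit y)" using min y z(1) unfolding minimal_shift_def by blast
  moreover have "z \<in> {u. \<forall>k<n. u k = z k}" by simp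
  ultimately have "{u. \<forall>k<n. u k = z k} \<inter> orbit y \<noteq> {}"
    using open_Int_closure_eq_empty[OF open_cylinder, of n z "orbit y"] by blast
  then obtain k where k: "\<forall>l<n. (left_shift ^^ k) y l = z l" unfolding orbit_def by blast
  have "factor y k n = factor z 0 n"
    by (rule nth_equalityI) (use k in \<open>auto simp: funpow_left_shift add_ac\<close>)
  then show ?thesis using z(2) by (intro exI[of _ k]) simp
qed

text \<open>The open sets of points showing \<open>w\<close> at position \<open>i\<close> cover the
  compact \<open>\<Omega>\<close> by \<open>occurs\<close>; a finite subcover bounds
  \<open>i\<close>.\<close>

lemma occurs_uniformly:
  assumes w: "w \<in> language \<Omega>"
  shows "\<exists>G. \<forall>y\<in>\<Omega>. \<exists>i\<le>G. factor y i (length w) = w"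
proof -
  have "closed \<Omega>" using min by (simp add: minimal_shift_def is_shift_def)
  then have comp: "compact \<Omega>" using closed_Int_compact[OF _ compact_sequences, of \<Omega>] by simp
  define U where "U i = {y :: nat \<Rightarrow> 'a. factor y i (length w) = w}" for i
  have opU: "open (U i)" for i
  proof (subst open_subopen, intro ballI)
    fix y assume y: "y \<in> U i"
    have "{z. \<forall>k<i + length w. z k = y k} \<subseteq> U i"
    proof
      fix z assume "z \<in> {z. \<forall>k<i + length w. z k = y k}"
      then have "factor z i (length w) = factor y i (length w)" by auto
      also have "\<dots> = w" using y by (simp add: U_def)
      finally show "z \<in> U i" by (simp only: U_def mem_Collect_eq)
    qed
    then show "\<exists>T. open T \<and> y \<in> T \<and> T \<subseteq> U i" using open_cylinder[of "i + length w" y] by blast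
  qed
  have cover: "\<Omega> \<subseteq> (\<Union>i\<in>UNIV. U i)" using occurs[OF w] by (auto simp: U_def)
  obtain I where I: "finite I" "\<Omega> \<subseteq> (\<Union>i\<in>I. U i)"
  proof (rule compactE_image[OF comp, of UNIV U])
    show "open (U i)" for i by (rule opU)
    show "\<Omega> \<subseteq> (\<Union>i\<in>UNIV. U i)" by (rule cover)
  qed (rule that)
  show ?thesis
  proof (rule exI[of _ "Max (insert 0 I)"], rule ballI)
    fix y assume "y \<in> \<Omega>"
    then obtain i where "i \<in> I" "y \<in> U i" using I(2) by blast
    then show "\<exists>i\<le>Max (insert 0 I). factor y i (length w) = w"
      using I(1) by (intro exI[of _ i]) (auto simp: U_def)
  qed
qed

lemma language_factor:
  assumes "w \<in> language \<Omega>" "i + k \<le> length w"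
  shows "take k (drop i w) \<in> language \<Omega>"
proof -
  obtain x l n where x: "w = factor x l n" "x \<in> \<Omega>" using assms(1) unfolding language_def by blast
  then show ?thesis using factor_factor[of i k n x l] assms(2) languageI[of x] by simp
qed

text \<open>Searching \<open>w\<close> in a shifted point guarantees a letter to the left of the
  occurrence.\<close>

lemma language_extend:
  assumes w: "w \<in> language \<Omega>"
  shows "\<exists>a b. a # w @ [b] \<in> language \<Omega>"
proof -
  obtain x where x: "x \<in> \<Omega>" using nonempty by blast
  have "(left_shift ^^ 1) x \<in> \<Omega>" by (rule shift_in[OF x])
  from occurs[OF w this] obtain i where "factor ((left_shift ^^ 1) x) i (length w) = w" by blast
  then have i: "factor x (Suc i) (length w) = w" unfolding factor_shift by simp
  have fe: "factor x i (length w + 2) = x i # factor x (Suc i) (length w) @ [x (Suc i + length w)]"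
  proof -
    have a: "[i..<Suc (i + length w)] = i # [Suc i..<Suc (i + length w)]" by (rule upt_conv_Cons) simp
    have "[i..<i + (length w + 2)] = [i..<Suc (i + length w)] @ [Suc (i + length w)]" by simp
    then show ?thesis unfolding a by (simp del: upt_Suc)
  qed
  have "x i # w @ [x (Suc i + length w)] \<in> language \<Omega>"
    using languageI[OF x, of i "length w + 2"] unfolding fe i .
  then show ?thesis by blast
qed

text \<open>Words nested symmetrically, each in the middle of the next, so that they converge to a
  two-sided sequence.\<close>

primrec center :: "nat \<Rightarrow> 'a list" where
  "center 0 = []"
| "center (Suc k) = (SOME v. v \<in> language \<Omega> \<and> (\<exists>a b. v = a # center k @ [b]))"

lemma center_lang: "center k \<in> language \<Omega>"
proof (induction k)
  case 0
  obtain x where "x \<in> \<Omega>" using nonempty by blast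
  then show ?case using languageI[of x 0 0] by simp
next
  case (Suc k)
  then have "\<exists>v. v \<in> language \<Omega> \<and> (\<exists>a b. v = a # center k @ [b])" using language_extend by blast
  from someI_ex[OF this] show ?case by simp
qed

lemma center_Suc: "\<exists>a b. center (Suc k) = a # center k @ [b]"
proof -
  have "\<exists>v. v \<in> language \<Omega> \<and> (\<exists>a b. v = a # center k @ [b])" using language_extend center_lang by blast
  from someI_ex[OF this] show ?thesis by simp
qed

lemma length_center [simp]: "length (center k) = 2 * k"
proof (induction k)
  case (Suc k)
  then show ?case using center_Suc[of k] by auto
qed simp

lemma center_nth: "i < 2 * k \<Longrightarrow> center (k + d) ! (i + d) = center k ! i"
proof (induction d)
  case (Suc d)
  obtain a b where "center (Suc (k + d)) = a # center (k + d) @ [b]" using center_Suc by blast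
  then show ?case using Suc by (simp add: nth_append)
qed simp

text \<open>A two-sided sequence with the same factors as the one-sided shift makes the left-right symmetry
  of the combinatorial argument available.\<close>

definition \<xi> :: "int \<Rightarrow> 'a" where
  "\<xi> i = center (nat \<bar>i\<bar> + 1) ! nat (i + \<bar>i\<bar> + 1)"

lemma \<xi>_center:
  assumes "\<bar>i\<bar> < int k"
  shows "\<xi> i = center k ! nat (i + int k)"
proof -
  define a where "a = nat \<bar>i\<bar> + 1"
  have a: "a \<le> k" "int a = \<bar>i\<bar> + 1" using assms by (auto simp: a_def)
  have "center (a + (k - a)) ! (nat (i + \<bar>i\<bar> + 1) + (k - a)) = center a ! nat (i + \<bar>i\<bar> + 1)"
    using a(2) by (intro center_nth) linarith
  moreover have "nat (i + \<bar>i\<bar> + 1) + (k - a) = nat (i + int k)" using a by linarith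
  ultimately show ?thesis using a(1) by (simp add: \<xi>_def a_def)
qed

lemma blk_lang: "blk \<xi> n i \<in> language \<Omega>"
proof -
  define k where "k = nat \<bar>i\<bar> + n + 1"
  have k: "int k = \<bar>i\<bar> + int n + 1" by (simp add: k_def)
  have "blk \<xi> n i = take n (drop (nat (i + int k)) (center k))"
  proof (rule nth_equalityI)
    show "length (blk \<xi> n i) = length (take n (drop (nat (i + int k)) (center k)))" using k by (simp; linarith)
    fix t assume t: "t < length (blk \<xi> n i)"
    then have "\<bar>i + int t\<bar> < int k" using k by (simp; linarith)
    then have "\<xi> (i + int t) = center k ! nat (i + int t + int k)" by (rule \<xi>_center)
    moreover have "nat (i + int t + int k) = nat (i + int k) + t" using k by linarith
    moreover have "nat (i + int k) + t < length (center k)" using k t by (simp; linarith)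
    ultimately show "blk \<xi> n i ! t = take n (drop (nat (i + int k)) (center k)) ! t"
      using t by (simp add: blk_def)
  qed
  moreover have "nat (i + int k) + n \<le> length (center k)" using k by (simp; linarith)
  ultimately show ?thesis using language_factor[OF center_lang] by metis
qed

text \<open>The bound \<open>G\<close> for points of \<open>\<Omega>\<close> carries over, because
  each block of \<open>\<xi>\<close> of length \<open>G + length w\<close> occurs in a point of
  \<open>\<Omega>\<close>. In particular \<open>\<xi>\<close> misses no word of the
  language.\<close>

lemma blk_urec:
  assumes "w \<in> language \<Omega>"
  shows "\<exists>G. \<forall>j. \<exists>k. j \<le> k \<and> k \<le> j + int G \<and> blk \<xi> (length w) k = w"
proof -
  obtain G where G: "\<And>y. y \<in> \<Omega> \<Longrightarrow> \<exists>i\<le>G. factor y i (length w) = w" using occurs_uniformly[OF assms] by blast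
  show ?thesis
  proof (rule exI[of _ G], rule allI)
    fix j
    obtain x l n where x: "blk \<xi> (G + length w) j = factor x l n" "x \<in> \<Omega>"
      using blk_lang[of "G + length w" j] unfolding language_def by blast
    have n: "n = G + length w" using arg_cong[OF x(1), of length] by simp
    obtain i where i: "i \<le> G" "factor ((left_shift ^^ l) x) i (length w) = w" using G[OF shift_in[OF x(2), of l]] by blast
    have "blk \<xi> (length w) (j + int i) = w"
    proof (rule nth_equalityI)
      fix t assume t: "t < length (blk \<xi> (length w) (j + int i))"
      have "blk \<xi> (length w) (j + int i) ! t = blk \<xi> (G + length w) j ! (i + t)" using t i(1) by (simp add: blk_def add.assoc)
      also have "\<dots> = x (l + (i + t))" using t i(1) unfolding x(1) n by simp
      also have "\<dots> = factor ((left_shift ^^ l) x) i (length w) ! t" using t by (simp add: funpow_left_shift add_ac)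
      finally show "blk \<xi> (length w) (j + int i) ! t = w ! t" unfolding i(2) .
    qed simp
    then show "\<exists>k. j \<le> k \<and> k \<le> j + int G \<and> blk \<xi> (length w) k = w"
      using i(1) by (intro exI[of _ "j + int i"]) simp
  qed
qed

lemma facs_language: "facs \<xi> n = {w \<in> language \<Omega>. length w = n}"
proof
  show "facs \<xi> n \<subseteq> {w \<in> language \<Omega>. length w = n}" using blk_lang by (auto simp: facs_def)
  show "{w \<in> language \<Omega>. length w = n} \<subseteq> facs \<xi> n"
  proof
    fix w assume w: "w \<in> {w \<in> language \<Omega>. length w = n}"
    then obtain k where "blk \<xi> n k = w" using blk_urec[of w] by blast
    then show "w \<in> facs \<xi> n" by (auto simp: facs_def)
  qed
qed

lemma card_facs_complexity: "card (facs \<xi> n) = complexity \<Omega> n"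
  by (simp add: facs_language complexity_def)

lemma \<xi>_urec: "\<exists>G. \<forall>i j. \<exists>k. j \<le> k \<and> k \<le> j + int G \<and> blk \<xi> n k = blk \<xi> n i"
proof -
  have "\<forall>w\<in>facs \<xi> n. \<exists>G. \<forall>j. \<exists>k. j \<le> k \<and> k \<le> j + int G \<and> blk \<xi> n k = w"
    using blk_urec by (auto simp: facs_language)
  then obtain g where g: "\<And>w j. w \<in> facs \<xi> n \<Longrightarrow> \<exists>k. j \<le> k \<and> k \<le> j + int (g w) \<and> blk \<xi> n k = w" by metis
  show ?thesis
  proof (intro exI[of _ "Max (g ` facs \<xi> n)"] allI)
    fix i j
    have w: "blk \<xi> n i \<in> facs \<xi> n" by (simp add: facs_def)
    have "g (blk \<xi> n i) \<le> Max (g ` facs \<xi> n)" using w by simp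
    then show "\<exists>k. j \<le> k \<and> k \<le> j + int (Max (g ` facs \<xi> n)) \<and> blk \<xi> n k = blk \<xi> n i"
      using g[OF w, of j] by (meson add_left_mono of_nat_le_iff order_trans)
  qed
qed

end

section \<open>Word frequencies\<close>

definition cnt :: "'a list \<Rightarrow> 'a list \<Rightarrow> nat" where
  "cnt v w = card {i. i + length v \<le> length w \<and> take (length v) (drop i w) = v}"

lemma cnt_finite: "finite {i. i + length v \<le> length w \<and> take (length v) (drop i w) = v}"
  by (rule finite_subset[of _ "{..length w}"]) auto

lemma cnt_le:
  assumes "v \<noteq> []" shows "cnt v w \<le> length w"
proof -
  have "{i. i + length v \<le> length w \<and> take (length v) (drop i w) = v} \<subseteq> {..<length w}"
  proof
    fix i assume i: "i \<in> {i. i + length v \<le> length w \<and> take (length v) (drop i w) = v}"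
    have "0 < length v" using assms by simp
    moreover have "i + length v \<le> length w" using i by simp
    ultimately have "i < length w" by linarith
    then show "i \<in> {..<length w}" by simp
  qed
  from card_mono[OF _ this] show ?thesis by (simp add: cnt_def)
qed

text \<open>Only occurrences across the seam are not counted, and they start among the last
  \<open>length v\<close> positions of \<open>xs\<close>.\<close>

lemma cnt_append:
  assumes "v \<noteq> []"
  shows "cnt v xs + cnt v ys \<le> cnt v (xs @ ys)" "cnt v (xs @ ys) \<le> cnt v xs + cnt v ys + length v"
proof -
  define S where "S w = {i. i + length v \<le> length w \<and> take (length v) (drop i w) = v}" for w
  have fin: "finite (S w)" for w unfolding S_def by (rule cnt_finite)
  have cnt: "cnt v w = card (S w)" for w by (simp add: cnt_def S_def)
  have lv: "length v \<ge> 1" using assms by (cases v) auto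
  define Y where "Y = (\<lambda>i. i + length xs) ` S ys"
  have cY: "card Y = card (S ys)" unfolding Y_def by (rule card_image) simp
  have disj: "S xs \<inter> Y = {}" using lv unfolding S_def Y_def by auto
  have left: "i \<in> S (xs @ ys) \<longleftrightarrow> i \<in> S xs" if "i + length v \<le> length xs" for i
    using that unfolding S_def by simp
  have right: "i + length xs \<in> S (xs @ ys) \<longleftrightarrow> i \<in> S ys" for i
    unfolding S_def by simp
  have sub: "S xs \<union> Y \<subseteq> S (xs @ ys)"
  proof -
    have "S xs \<subseteq> S (xs @ ys)"
    proof
      fix i assume i: "i \<in> S xs"
      then have "i + length v \<le> length xs" by (simp add: S_def)
      then show "i \<in> S (xs @ ys)" using left i by simp
    qed
    moreover have "Y \<subseteq> S (xs @ ys)" unfolding Y_def using right by auto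
    ultimately show ?thesis by simp
  qed
  have "card (S xs \<union> Y) = card (S xs) + card (S ys)"
    using disj fin cY by (subst card_Un_disjoint) (auto simp: Y_def)
  then show "cnt v xs + cnt v ys \<le> cnt v (xs @ ys)" unfolding cnt using card_mono[OF fin sub] by simp
  have sub2: "S (xs @ ys) \<subseteq> (S xs \<union> Y) \<union> {length xs - length v..<length xs}"
  proof
    fix i assume i: "i \<in> S (xs @ ys)"
    consider "i + length v \<le> length xs" | "length xs \<le> i" | "i < length xs" "length xs < i + length v" by linarith
    then show "i \<in> (S xs \<union> Y) \<union> {length xs - length v..<length xs}"
    proof cases
      case 1 then show ?thesis using left i by simp
    next
      case 2
      then have "i - length xs \<in> S ys" using right[of "i - length xs"] i by simp
      then have "i \<in> Y" unfolding Y_def using 2 by (intro image_eqI[of _ _ "i - length xs"]) auto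
      then show ?thesis by simp
    qed auto
  qed
  have "card (S (xs @ ys)) \<le> card ((S xs \<union> Y) \<union> {length xs - length v..<length xs})"
    using sub2 fin by (intro card_mono) (auto simp: Y_def)
  also have "\<dots> \<le> card (S xs \<union> Y) + card {length xs - length v..<length xs}" by (rule card_Un_le)
  also have "\<dots> \<le> card (S xs) + card Y + length v" using card_Un_le[of "S xs" Y] by simp
  finally show "cnt v (xs @ ys) \<le> cnt v xs + cnt v ys + length v" unfolding cnt cY .
qed

lemma cnt_factor:
  "cnt v (factor x s n) = card {i. i + length v \<le> n \<and> factor x (s + i) (length v) = v}"
proof -
  have "{i. i + length v \<le> length (factor x s n) \<and> take (length v) (drop i (factor x s n)) = v} =
     {i. i + length v \<le> n \<and> factor x (s + i) (length v) = v}"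
    using factor_factor[of _ "length v" n x s] by auto
  then show ?thesis by (simp add: cnt_def)
qed

lemma cnt_factor_sum:
  assumes "v \<noteq> []"
  shows "\<bar>real (cnt v (factor x s n)) - (\<Sum>k<n. if factor x (s + k) (length v) = v then 1 else 0)\<bar> \<le> real (length v)"
proof -
  define A where "A = {i. i + length v \<le> n \<and> factor x (s + i) (length v) = v}"
  define B where "B = {i. i < n \<and> factor x (s + i) (length v) = v}"
  have lv: "length v \<ge> 1" using assms by (cases v) auto
  have fin: "finite A" "finite B" unfolding A_def B_def by (auto intro: finite_subset[of _ "{..n}"])
  have "A \<subseteq> B" using lv by (auto simp: A_def B_def)
  then have 1: "card A \<le> card B" by (rule card_mono[OF fin(2)])
  have "B \<subseteq> A \<union> {n - length v..<n}" by (auto simp: A_def B_def)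
  then have "card B \<le> card (A \<union> {n - length v..<n})" using fin by (intro card_mono) auto
  also have "\<dots> \<le> card A + card {n - length v..<n}" by (rule card_Un_le)
  finally have 2: "card B \<le> card A + length v" by simp
  have "(\<Sum>k<n. if factor x (s + k) (length v) = v then 1 else 0) = (\<Sum>k\<in>B. 1::real)"
    by (rule sum.mono_neutral_cong_right) (auto simp: B_def)
  then have S: "(\<Sum>k<n. if factor x (s + k) (length v) = v then 1 else 0) = real (card B)" by simp
  have "cnt v (factor x s n) = card A" by (simp only: cnt_factor A_def)
  then show ?thesis unfolding S using 1 2 by linarith
qed

section \<open>Cylinders determine a measure\<close>

definition cyl :: "(nat \<Rightarrow> 'a) set \<Rightarrow> 'a list \<Rightarrow> (nat \<Rightarrow> 'a) set" where
  "cyl \<Omega> v = {x \<in> \<Omega>. factor x 0 (length v) = v}"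

lemma cyl_eq: "cyl \<Omega> v = \<Omega> \<inter> {z. \<forall>k<length v. z k = v ! k}"
proof -
  have "factor x 0 (length v) = v \<longleftrightarrow> (\<forall>k<length v. x k = v ! k)" for x :: "nat \<Rightarrow> 'a"
    by (subst list_eq_iff_nth_eq) simp
  then show ?thesis unfolding cyl_def by blast
qed

lemma cyl_sets: "cyl \<Omega> (v :: 'a::discrete_topology list) \<in> sets (restrict_space borel \<Omega>)"
  unfolding sets_restrict_space cyl_eq
  by (rule imageI) (rule borel_open, rule open_cylinder)

text \<open>The empty set is added because two cylinders may be disjoint and the family has to be
  stable under intersection.\<close>

definition cyls :: "(nat \<Rightarrow> 'a) set \<Rightarrow> (nat \<Rightarrow> 'a) set set" where
  "cyls \<Omega> = insert {} (range (cyl \<Omega>))"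

lemma cyls_Int: "Int_stable (cyls \<Omega>)"
proof -
  have *: "cyl \<Omega> v \<inter> cyl \<Omega> w \<in> cyls \<Omega>" if "length v \<le> length w" for v w
  proof (cases "take (length v) w = v")
    case True
    have "cyl \<Omega> w \<subseteq> cyl \<Omega> v"
    proof
      fix x assume x: "x \<in> cyl \<Omega> w"
      then have "factor x 0 (length w) = w" by (simp add: cyl_def)
      then have "take (length v) (factor x 0 (length w)) = v" using True by simp
      then show "x \<in> cyl \<Omega> v" using x that by (simp add: cyl_def take_map take_upt)
    qed
    then have "cyl \<Omega> v \<inter> cyl \<Omega> w = cyl \<Omega> w" by blast
    then show ?thesis by (simp add: cyls_def)
  next
    case False
    have "cyl \<Omega> v \<inter> cyl \<Omega> w = {}"
    proof (rule ccontr)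
      assume "cyl \<Omega> v \<inter> cyl \<Omega> w \<noteq> {}"
      then obtain x where x: "factor x 0 (length v) = v" "factor x 0 (length w) = w" by (auto simp: cyl_def)
      have "take (length v) (factor x 0 (length w)) = factor x 0 (length v)" using that by (simp add: take_map take_upt)
      then show False using False x by simp
    qed
    then show ?thesis by (simp add: cyls_def)
  qed
  show ?thesis
  proof (rule Int_stableI)
    fix a b assume "a \<in> cyls \<Omega>" "b \<in> cyls \<Omega>"
    then consider "a = {} \<or> b = {}" | v w where "a = cyl \<Omega> v" "b = cyl \<Omega> w" unfolding cyls_def by blast
    then show "a \<inter> b \<in> cyls \<Omega>"
    proof cases
      case 1 then show ?thesis by (auto simp: cyls_def)
    next
      case 2
      show ?thesis
      proof (cases "length v \<le> length w")
        case True then show ?thesis using * 2 by simp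
      next
        case False
        then have "cyl \<Omega> w \<inter> cyl \<Omega> v \<in> cyls \<Omega>" by (intro *) simp
        then show ?thesis using 2 by (simp add: Int_commute)
      qed
    qed
  qed
qed

text \<open>There are only countably many words, so the trace of an open set is a countable union of
  cylinders.\<close>

lemma sets_cyls: "sets (restrict_space borel \<Omega>) = sigma_sets \<Omega> (cyls (\<Omega> :: (nat \<Rightarrow> 'a::{finite, discrete_topology}) set))"
proof
  interpret sa: sigma_algebra \<Omega> "sigma_sets \<Omega> (cyls \<Omega>)"
    by (rule sigma_algebra_sigma_sets) (auto simp: cyls_def cyl_def)
  have cyl_in: "cyl \<Omega> v \<in> sigma_sets \<Omega> (cyls \<Omega>)" for v by (auto simp: cyls_def)
  have "B \<inter> \<Omega> \<in> sigma_sets \<Omega> (cyls \<Omega>)" if "B \<in> sigma_sets UNIV {S. open S}" for B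
    using that
  proof induction
    case (Basic S)
    define V where "V = {v. cyl \<Omega> v \<subseteq> S}"
    have "S \<inter> \<Omega> = (\<Union>v\<in>V. cyl \<Omega> v)"
    proof
      show "S \<inter> \<Omega> \<subseteq> (\<Union>v\<in>V. cyl \<Omega> v)"
      proof
        fix x assume x: "x \<in> S \<inter> \<Omega>"
        obtain n where n: "{z. \<forall>k<n. z k = x k} \<subseteq> S" using open_contains_cylinder[of S x] Basic x by blast
        have "cyl \<Omega> (factor x 0 n) \<subseteq> {z. \<forall>k<n. z k = x k}" by (auto simp: cyl_def)
        then have "factor x 0 n \<in> V" using n by (auto simp: V_def)
        moreover have "x \<in> cyl \<Omega> (factor x 0 n)" using x by (simp add: cyl_def)
        ultimately show "x \<in> (\<Union>v\<in>V. cyl \<Omega> v)" by blast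
      qed
    qed (auto simp: V_def cyl_def)
    moreover have "countable V" by simp
    ultimately show ?case using cyl_in by (auto intro!: sa.countable_UN')
  next
    case Empty then show ?case by (simp add: sigma_sets.Empty)
  next
    case (Compl a)
    have "(UNIV - a) \<inter> \<Omega> = \<Omega> - (a \<inter> \<Omega>)" by blast
    then show ?case using sigma_sets.Compl[OF Compl.IH] by simp
  next
    case (Union a)
    have "(\<Union>i. a i) \<inter> \<Omega> = (\<Union>i. a i \<inter> \<Omega>)" by blast
    then show ?case using sigma_sets.Union[of "\<lambda>i. a i \<inter> \<Omega>", OF Union.IH] by simp
  qed
  then show "sets (restrict_space borel \<Omega>) \<subseteq> sigma_sets \<Omega> (cyls \<Omega>)"
    by (auto simp: sets_restrict_space borel_def Int_commute)
  have "sigma_sets (space (restrict_space borel \<Omega>)) (cyls \<Omega>) \<subseteq> sets (restrict_space borel \<Omega>)"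
    using cyl_sets by (intro sets.sigma_sets_subset) (auto simp: cyls_def)
  then show "sigma_sets \<Omega> (cyls \<Omega>) \<subseteq> sets (restrict_space borel \<Omega>)" by (simp add: space_restrict_space)
qed

text \<open>Cylinders form an intersection-stable generator; the empty word, whose cylinder is all
  of \<open>\<Omega>\<close>, is taken care of by total mass 1.\<close>

lemma invariant_measure_eqI:
  fixes \<Omega> :: "(nat \<Rightarrow> 'a::{finite, discrete_topology}) set"
  assumes "\<mu> \<in> invariant_measures \<Omega>" "\<nu> \<in> invariant_measures \<Omega>"
    and eq: "\<And>v. v \<noteq> [] \<Longrightarrow> measure \<mu> (cyl \<Omega> v) = measure \<nu> (cyl \<Omega> v)"
  shows "\<mu> = \<nu>"
proof -
  interpret \<mu>: prob_space \<mu> using assms(1) by (simp add: invariant_measures_def)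
  interpret \<nu>: prob_space \<nu> using assms(2) by (simp add: invariant_measures_def)
  have s: "sets \<mu> = sets (restrict_space borel \<Omega>)" "sets \<nu> = sets (restrict_space borel \<Omega>)"
    using assms(1,2) by (auto simp: invariant_measures_def)
  have sp: "space \<mu> = \<Omega>" "space \<nu> = \<Omega>" using sets_eq_imp_space_eq[OF s(1)] sets_eq_imp_space_eq[OF s(2)]
    by (auto simp: space_restrict_space)
  have nil: "cyl \<Omega> [] = \<Omega>" by (simp add: cyl_def)
  show ?thesis
  proof (rule measure_eqI_generator_eq[OF cyls_Int])
    show "cyls \<Omega> \<subseteq> Pow \<Omega>" by (auto simp: cyls_def cyl_def)
    show "sets \<mu> = sigma_sets \<Omega> (cyls \<Omega>)" "sets \<nu> = sigma_sets \<Omega> (cyls \<Omega>)" using s sets_cyls by auto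
    show "range (\<lambda>_::nat. \<Omega>) \<subseteq> cyls \<Omega>" using nil by (auto simp: cyls_def)
    show "(\<Union>i::nat. \<Omega>) = \<Omega>" by simp
    show "emeasure \<mu> \<Omega> \<noteq> \<infinity>" by simp
    fix X assume "X \<in> cyls \<Omega>"
    then consider "X = {}" | v where "X = cyl \<Omega> v" by (auto simp: cyls_def)
    then show "emeasure \<mu> X = emeasure \<nu> X"
    proof cases
      case 2
      show ?thesis
      proof (cases "v = []")
        case True
        then show ?thesis using 2 nil \<mu>.emeasure_space_1 \<nu>.emeasure_space_1 sp by simp
      next
        case False
        then show ?thesis using 2 eq by (simp add: \<mu>.emeasure_eq_measure \<nu>.emeasure_eq_measure)
      qed
    qed simp
  qed
qed

lemma left_shift_measurable: "left_shift \<in> borel_measurable (borel :: (nat \<Rightarrow> 'a::discrete_topology) measure)"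
proof (rule borel_measurable_continuous_onI)
  show "continuous_on UNIV (left_shift :: (nat \<Rightarrow> 'a) \<Rightarrow> _)"
    unfolding left_shift_def by (intro continuous_on_coordinatewise_then_product continuous_on_product_coordinates)
qed

section \<open>Typical stretches for ergodic measures\<close>

lemma ergodic_system_of_measure:
  assumes "\<mu> \<in> ergodic_measures \<Omega>" "left_shift ` \<Omega> \<subseteq> \<Omega>"
  shows "ergodic_system \<mu> left_shift" "space \<mu> = \<Omega>" "sets \<mu> = sets (restrict_space borel \<Omega>)"
proof -
  have i: "prob_space \<mu>" "sets \<mu> = sets (restrict_space borel \<Omega>)"
    "\<And>B. B \<in> sets \<mu> \<Longrightarrow> emeasure \<mu> (left_shift -` B \<inter> \<Omega>) = emeasure \<mu> B"
    "\<And>B. B \<in> sets \<mu> \<Longrightarrow> left_shift -` B \<inter> \<Omega> = B \<Longrightarrow> emeasure \<mu> B = 0 \<or> emeasure \<mu> B = 1"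
    using assms(1) by (auto simp: ergodic_measures_def invariant_measures_def)
  show s: "space \<mu> = \<Omega>" using sets_eq_imp_space_eq[OF i(2)] by (simp add: space_restrict_space)
  show "sets \<mu> = sets (restrict_space borel \<Omega>)" by (rule i(2))
  have "left_shift \<in> measurable (restrict_space borel \<Omega>) (restrict_space borel \<Omega>)"
    using assms(2) by (intro measurable_restrict_space3 left_shift_measurable) auto
  then have "left_shift \<in> measurable \<mu> \<mu>" using measurable_cong_sets[OF i(2) i(2)] by blast
  then show "ergodic_system \<mu> left_shift"
    unfolding ergodic_system_def ergodic_system_axioms_def using i s by auto
qed

text \<open>Union bound: by invariance each of the finitely many conditions fails with probability
  at most \<open>\<theta>\<close>.\<close>

lemma (in ergodic_system) common_point:
  assumes A: "A \<in> sets P" "prob (space P - A) \<le> \<theta>" and I: "finite I" "real (card I) * \<theta> < 1"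
  shows "\<exists>x\<in>space P. \<forall>p\<in>I. (T ^^ f p) x \<in> A"
proof (rule ccontr)
  assume no: "\<not> ?thesis"
  define bad where "bad p = (T ^^ f p) -` (space P - A) \<inter> space P" for p
  have bad: "bad p \<in> sets P" for p
    unfolding bad_def using T_pow by (rule measurable_sets) (use A(1) in auto)
  have pr: "prob (bad p) \<le> \<theta>" for p
  proof -
    have "prob (bad p) = prob (space P - A)" unfolding bad_def by (rule preserving_pow) (use A(1) in auto)
    then show ?thesis using A(2) by simp
  qed
  have "x \<in> (\<Union>p\<in>I. bad p)" if x: "x \<in> space P" for x
  proof -
    obtain p where p: "p \<in> I" "(T ^^ f p) x \<notin> A" using no x by blast
    have "(T ^^ f p) x \<in> space P" by (rule measurable_space[OF T_pow x])
    then show ?thesis using p x by (auto simp: bad_def)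
  qed
  then have "(\<Union>p\<in>I. bad p) = space P" using sets.sets_into_space[OF bad] by blast
  then have "1 = prob (\<Union>p\<in>I. bad p)" by (simp add: prob_space)
  also have "\<dots> \<le> (\<Sum>p\<in>I. prob (bad p))"
    by (rule finite_measure_subadditive_finite) (use I bad in auto)
  also have "\<dots> \<le> (\<Sum>p\<in>I. \<theta>)" by (rule sum_mono) (rule pr)
  finally show False using I(2) by simp
qed

text \<open>Counts are compared instead of normalized frequencies, so that concatenation is
  subadditive up to a constant.\<close>

definition freq_dev :: "(nat \<Rightarrow> 'a) set \<Rightarrow> 'a list set \<Rightarrow> (nat \<Rightarrow> 'a) measure \<Rightarrow> 'a list \<Rightarrow> real" where
  "freq_dev \<Omega> F \<mu> w = Max ((\<lambda>v. \<bar>real (cnt v w) - real (length w) * measure \<mu> (cyl \<Omega> v)\<bar>) ` F)"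

lemma freq_dev_le_iff:
  assumes "finite F" "F \<noteq> {}"
  shows "freq_dev \<Omega> F \<mu> w \<le> z \<longleftrightarrow> (\<forall>v\<in>F. \<bar>real (cnt v w) - real (length w) * measure \<mu> (cyl \<Omega> v)\<bar> \<le> z)"
  unfolding freq_dev_def using assms by (subst Max_le_iff) auto

lemma freq_dev_ge:
  assumes "finite F" "v \<in> F"
  shows "\<bar>real (cnt v w) - real (length w) * measure \<mu> (cyl \<Omega> v)\<bar> \<le> freq_dev \<Omega> F \<mu> w"
  unfolding freq_dev_def using assms by (intro Max_ge) auto

lemma freq_dev_append:
  assumes F: "finite F" "F \<noteq> {}" "\<And>u. u \<in> F \<Longrightarrow> u \<noteq> [] \<and> length u \<le> r"
  shows "freq_dev \<Omega> F \<mu> (v @ w) \<le> freq_dev \<Omega> F \<mu> v + freq_dev \<Omega> F \<mu> w + real r"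
  unfolding freq_dev_le_iff[OF F(1,2)]
proof
  fix u assume u: "u \<in> F"
  have c: "cnt u v + cnt u w \<le> cnt u (v @ w)" "cnt u (v @ w) \<le> cnt u v + cnt u w + length u"
    using cnt_append[of u] F(3)[OF u] by auto
  define p where "p = measure \<mu> (cyl \<Omega> u)"
  have 1: "\<bar>real (cnt u v) - real (length v) * p\<bar> \<le> freq_dev \<Omega> F \<mu> v"
    "\<bar>real (cnt u w) - real (length w) * p\<bar> \<le> freq_dev \<Omega> F \<mu> w"
    unfolding p_def using freq_dev_ge[OF F(1) u] by auto
  have 2: "real (length (v @ w)) * p = real (length v) * p + real (length w) * p" by (simp add: algebra_simps)
  have 3: "real (cnt u v) + real (cnt u w) \<le> real (cnt u (v @ w))"
     "real (cnt u (v @ w)) \<le> real (cnt u v) + real (cnt u w) + real r"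
    using c F(3)[OF u] by linarith+
  show "\<bar>real (cnt u (v @ w)) - real (length (v @ w)) * measure \<mu> (cyl \<Omega> u)\<bar>
    \<le> freq_dev \<Omega> F \<mu> v + freq_dev \<Omega> F \<mu> w + real r"
    unfolding p_def[symmetric] 2 using 1 3 by linarith
qed

lemma freq_dev_le_length:
  assumes F: "finite F" "F \<noteq> {}" "[] \<notin> F" and "prob_space \<mu>"
  shows "freq_dev \<Omega> F \<mu> w \<le> real (length w)"
  unfolding freq_dev_le_iff[OF F(1,2)]
proof
  interpret prob_space \<mu> by fact
  fix v assume "v \<in> F"
  then have "cnt v w \<le> length w" using F(3) by (intro cnt_le) auto
  then have "0 \<le> real (cnt v w)" "real (cnt v w) \<le> real (length w)" by simp_all
  moreover have "0 \<le> real (length w) * prob (cyl \<Omega> v)" "real (length w) * prob (cyl \<Omega> v) \<le> real (length w) * 1"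
    by (simp, rule mult_left_mono[OF prob_le_1]) simp
  ultimately show "\<bar>real (cnt v w) - real (length w) * prob (cyl \<Omega> v)\<bar> \<le> real (length w)" by linarith
qed

lemma separating_words:
  fixes \<Omega> :: "(nat \<Rightarrow> 'a::{finite, discrete_topology}) set"
  assumes "finite Cs" and inv: "Cs \<subseteq> invariant_measures \<Omega>"
  shows "\<exists>F \<delta>. finite F \<and> F \<noteq> {} \<and> [] \<notin> F \<and> \<delta> > 0 \<and>
    (\<forall>\<mu>\<in>Cs. \<forall>\<nu>\<in>Cs. \<mu> \<noteq> \<nu> \<longrightarrow> (\<exists>v\<in>F. \<delta> \<le> \<bar>measure \<mu> (cyl \<Omega> v) - measure \<nu> (cyl \<Omega> v)\<bar>))"
proof -
  define R where "R = {p \<in> Cs \<times> Cs. fst p \<noteq> snd p}"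
  have R: "finite R" using assms(1) by (simp add: R_def)
  have "\<exists>v. v \<noteq> [] \<and> measure (fst p) (cyl \<Omega> v) \<noteq> measure (snd p) (cyl \<Omega> v)" if "p \<in> R" for p
  proof (rule ccontr)
    assume "\<nexists>v. v \<noteq> [] \<and> measure (fst p) (cyl \<Omega> v) \<noteq> measure (snd p) (cyl \<Omega> v)"
    moreover have "fst p \<in> invariant_measures \<Omega>" "snd p \<in> invariant_measures \<Omega>"
      using that inv by (auto simp: R_def)
    ultimately have "fst p = snd p" by (intro invariant_measure_eqI[of _ \<Omega>]) blast+
    then show False using that by (simp add: R_def)
  qed
  then obtain v where v: "\<And>p. p \<in> R \<Longrightarrow> v p \<noteq> [] \<and> measure (fst p) (cyl \<Omega> (v p)) \<noteq> measure (snd p) (cyl \<Omega> (v p))"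
    by metis
  define d where "d p = \<bar>measure (fst p) (cyl \<Omega> (v p)) - measure (snd p) (cyl \<Omega> (v p))\<bar>" for p
  \<comment> \<open>The word \<open>[undefined]\<close> and, below, the number \<open>1\<close> keep
    both finite sets nonempty when there is no pair of distinct measures.\<close>
  define F where "F = insert [undefined] (v ` R)"
  have d: "Min (insert 1 (d ` R)) \<le> d p" if "p \<in> R" for p using R that by (intro Min_le) auto
  have "Min (insert 1 (d ` R)) > 0" using R v by (subst Min_gr_iff) (auto simp: d_def)
  moreover have "finite F" "F \<noteq> {}" using R by (auto simp: F_def)
  moreover have "[] \<notin> F" unfolding F_def using v by (metis image_iff insert_iff list.distinct(1))
  moreover have "\<exists>u\<in>F. Min (insert 1 (d ` R)) \<le> \<bar>measure \<mu> (cyl \<Omega> u) - measure \<nu> (cyl \<Omega> u)\<bar>"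
    if "\<mu> \<in> Cs" "\<nu> \<in> Cs" "\<mu> \<noteq> \<nu>" for \<mu> \<nu>
  proof -
    have "(\<mu>, \<nu>) \<in> R" using that by (simp add: R_def)
    then show ?thesis using d[of "(\<mu>, \<nu>)"] by (intro bexI[of _ "v (\<mu>, \<nu>)"]) (auto simp: d_def F_def)
  qed
  ultimately show ?thesis by (intro exI[of _ F] exI[of _ "Min (insert 1 (d ` R))"]) blast
qed

lemma sum_shift_bound:
  fixes f :: "nat \<Rightarrow> real"
  assumes "\<And>k. 0 \<le> f k \<and> f k \<le> 1"
  shows "\<bar>(\<Sum>k<t. f (s + k)) - (\<Sum>k<t. f (s + d + k))\<bar> \<le> real d"
proof (induction d)
  case (Suc d)
  have "(\<Sum>k<t. f (s + d + k)) + f (s + d + t) = (\<Sum>k<Suc t. f (s + d + k))" by simp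
  also have "\<dots> = f (s + d) + (\<Sum>k<t. f (s + Suc d + k))" by (subst sum.lessThan_Suc_shift) simp
  finally show ?case using Suc assms[of "s + d"] assms[of "s + d + t"] by linarith
qed simp

context min_shift
begin

lemma left_shift_subset: "left_shift ` \<Omega> \<subseteq> \<Omega>"
  using min by (simp add: minimal_shift_def is_shift_def)

text \<open>A good point at \<open>s + d\<close> controls the words starting at \<open>s\<close>,
  since moving the range of summation by \<open>d\<close> changes the count by at most
  \<open>d\<close>. So good points are needed only on a grid.\<close>

lemma uniform_frequencies:
  assumes \<mu>: "\<mu> \<in> ergodic_measures \<Omega>" and F: "finite F" "F \<noteq> {}" "\<And>u. u \<in> F \<Longrightarrow> u \<noteq> [] \<and> length u \<le> r"
    and pos: "\<eta> > 0" "\<theta> > 0"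
  shows "\<exists>C::nat. \<exists>A\<in>sets \<mu>. measure \<mu> (space \<mu> - A) < \<theta> \<and>
    (\<forall>x s d t. (left_shift ^^ (s + d)) x \<in> A \<longrightarrow>
      freq_dev \<Omega> F \<mu> (factor x s t) \<le> real d + real r + \<eta> * real t + real C)"
proof -
  note e = ergodic_system_of_measure[OF \<mu> left_shift_subset]
  interpret ergodic_system \<mu> left_shift by (rule e(1))
  define h :: "'a list \<Rightarrow> (nat \<Rightarrow> 'a) \<Rightarrow> real" where
    "h v x = (if factor x 0 (length v) = v then 1 else 0)" for v x
  have cyl: "cyl \<Omega> v \<in> sets \<mu>" for v using cyl_sets e(3) by blast
  have ind: "h v x = indicator (cyl \<Omega> v) x" if "x \<in> space \<mu>" for v x
    using that by (simp add: h_def cyl_def e(2))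
  have hm: "h v \<in> borel_measurable \<mu>" for v
    using cyl by (subst measurable_cong[OF ind]) auto
  have hi: "(\<integral>x. h v x \<partial>\<mu>) = prob (cyl \<Omega> v)" for v
  proof -
    have "(\<integral>x. h v x \<partial>\<mu>) = (\<integral>x. indicator (cyl \<Omega> v) x \<partial>\<mu>)"
      by (rule Bochner_Integration.integral_cong) (auto simp: ind)
    also have "\<dots> = prob (cyl \<Omega> v)" using sets.sets_into_space[OF cyl] by (simp add: Int_absorb2)
    finally show ?thesis .
  qed
  have hb: "\<bar>h v x\<bar> \<le> 1" for v x by (simp add: h_def)
  obtain C :: nat and A where A: "A \<in> sets \<mu>" "prob (space \<mu> - A) < \<theta>"
    "\<And>x v n. x \<in> A \<Longrightarrow> v \<in> F \<Longrightarrow> \<bar>bsum (h v) n x - real n * (\<integral>x. h v x \<partial>\<mu>)\<bar> \<le> \<eta> * real n + real C"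
    using uniform_deviation[of F h 1 \<eta> \<theta>] F(1) hm hb pos by metis
  have "freq_dev \<Omega> F \<mu> (factor x s t) \<le> real d + real r + \<eta> * real t + real C"
    if x: "(left_shift ^^ (s + d)) x \<in> A" for x s d t
    unfolding freq_dev_le_iff[OF F(1,2)]
  proof
    fix v assume v: "v \<in> F"
    define f :: "nat \<Rightarrow> real" where "f k = (if factor x k (length v) = v then 1 else 0)" for k
    have "bsum (h v) t ((left_shift ^^ (s + d)) x) = (\<Sum>k<t. f (s + d + k))"
      unfolding bsum_def h_def f_def factor_shift by (simp add: add_ac)
    then have 1: "\<bar>(\<Sum>k<t. f (s + d + k)) - real t * prob (cyl \<Omega> v)\<bar> \<le> \<eta> * real t + real C"
      using A(3)[OF x v, of t] hi by simp
    have 2: "\<bar>(\<Sum>k<t. f (s + k)) - (\<Sum>k<t. f (s + d + k))\<bar> \<le> real d"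
      by (rule sum_shift_bound) (simp add: f_def)
    have 3: "\<bar>real (cnt v (factor x s t)) - (\<Sum>k<t. f (s + k))\<bar> \<le> real (length v)"
      unfolding f_def using F(3)[OF v] by (intro cnt_factor_sum) simp
    have 4: "real (length v) \<le> real r" using F(3)[OF v] by simp
    have 5: "real (length (factor x s t)) = real t" by simp
    show "\<bar>real (cnt v (factor x s t)) - real (length (factor x s t)) * prob (cyl \<Omega> v)\<bar>
      \<le> real d + real r + \<eta> * real t + real C"
      unfolding 5 using 1 2 3 4 by linarith
  qed
  then show ?thesis using A(1,2) by blast
qed

text \<open>The number of grid indices depends on \<open>h\<close> and \<open>Z\<close> but not on
  \<open>n\<close>, while every \<open>s\<close> is followed by a grid point within
  \<open>n / h\<close>; so one \<open>\<theta>\<close> in the union bound serves all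
  \<open>n\<close>.\<close>

lemma grid_point:
  fixes h n :: nat
  assumes h: "h \<ge> 1" "h \<le> n" and s: "s \<le> Z * n"
  shows "\<exists>a d. a \<le> 2 * h * Z + 1 \<and> a * (n div h) = s + d \<and> d * h \<le> n"
proof -
  define g where "g = n div h"
  have g1: "g \<ge> 1" using h by (simp add: g_def Suc_le_eq div_greater_zero_iff)
  have gh: "g * h \<le> n" by (simp add: g_def)
  have "n = g * h + n mod h" by (simp add: g_def)
  moreover have "n mod h < h" using h by simp
  moreover have "h \<le> g * h" using g1 by simp
  moreover have "2 * h * g = g * h + g * h" by simp
  ultimately have n: "n \<le> 2 * h * g" by linarith
  define a where "a = s div g + 1"
  have "s \<le> Z * (2 * h * g)" using s mult_le_mono2[OF n, of Z] by linarith
  then have "s div g \<le> (Z * (2 * h * g)) div g" by (rule div_le_mono)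
  also have "\<dots> = 2 * h * Z" using g1 by (simp add: ac_simps)
  finally have "a \<le> 2 * h * Z + 1" by (simp add: a_def)
  moreover have ag: "a * g = s + (g - s mod g)"
  proof -
    have "s = s div g * g + s mod g" by simp
    moreover have "s mod g < g" using g1 by simp
    ultimately have "s div g * g + g = s + (g - s mod g)" by linarith
    then show ?thesis by (simp add: a_def)
  qed
  moreover have "(g - s mod g) * h \<le> n" using mult_le_mono1[OF diff_le_self, of g "s mod g" h] gh by linarith
  ultimately show ?thesis unfolding g_def[symmetric] by blast
qed

text \<open>One point serves both scales: each point of the grid of step \<open>n div h\<close>
  carries a second grid of step \<open>B div h\<close>, and \<open>common_point\<close> makes all
  these places good at once. Their number does not depend on \<open>B\<close> and
  \<open>n\<close>.\<close>

lemma typical_point: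
  assumes \<mu>: "\<mu> \<in> ergodic_measures \<Omega>" and F: "finite F" "F \<noteq> {}" "\<And>u. u \<in> F \<Longrightarrow> u \<noteq> [] \<and> length u \<le> r"
    and e: "e > 0"
  shows "\<exists>N. \<forall>B n. N \<le> B \<longrightarrow> B \<le> n \<longrightarrow> (\<exists>x\<in>\<Omega>.
    (\<forall>s t. n \<le> t \<longrightarrow> s + t \<le> M * n \<longrightarrow> freq_dev \<Omega> F \<mu> (factor x s t) \<le> e / 4 * real t) \<and>
    (\<forall>s. s \<le> M * n \<longrightarrow> (\<exists>y\<ge>s. y \<le> s + n \<and>
       (\<forall>y'\<ge>y. y' \<le> y + L * B \<longrightarrow> freq_dev \<Omega> F \<mu> (factor x y' B) \<le> e / 4 * real B))))"
proof -
  note es = ergodic_system_of_measure[OF \<mu> left_shift_subset]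
  interpret ergodic_system \<mu> left_shift by (rule es(1))
  obtain h0 :: nat where h0: "16 / e \<le> real h0" using real_arch_simple by blast
  \<comment> \<open>\<open>Suc\<close> excludes \<open>h = 0\<close>. With
    \<open>16 \<le> e * h\<close> a grid distance costs at most \<open>e / 16\<close> of the length;
    adding \<open>e / 16\<close> for the frequency error and \<open>e / 8\<close> for the constants
    gives \<open>e / 4\<close>.\<close>
  define h where "h = Suc h0"
  have h1: "h \<ge> 1" by (simp add: h_def)
  have "16 / e \<le> real h" using h0 by (simp add: h_def)
  then have he: "16 \<le> e * real h" using e by (simp add: divide_le_eq mult.commute)
  define I where "I = {..2 * h * M + 1} \<times> {..2 * h * L + 1}"
  have I: "finite I" by (simp add: I_def)
  define \<theta> where "\<theta> = 1 / (real (card I) + 1)"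
  have \<theta>: "\<theta> > 0" "real (card I) * \<theta> < 1" by (simp_all add: \<theta>_def divide_simps)
  obtain C :: nat and A where A: "A \<in> sets \<mu>" "prob (space \<mu> - A) < \<theta>"
    "\<And>x s d t. (left_shift ^^ (s + d)) x \<in> A \<Longrightarrow>
      freq_dev \<Omega> F \<mu> (factor x s t) \<le> real d + real r + e / 16 * real t + real C"
    using uniform_frequencies[of \<mu> F r "e / 16" \<theta>, OF \<mu> F _ \<theta>(1)] e
    by (metis (no_types, lifting) divide_pos_pos zero_less_numeral)
  obtain N0 :: nat where N0: "(real r + real C) / (e / 8) \<le> real N0" using real_arch_simple by blast
  define N where "N = N0 + h"
  have N: "real r + real C \<le> e / 8 * real t" if "N \<le> t" for t
  proof -
    have "(real r + real C) / (e / 8) \<le> real t" using N0 that by (simp add: N_def)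
    then show ?thesis using e by (simp add: divide_le_eq mult.commute)
  qed
  have bound: "freq_dev \<Omega> F \<mu> (factor x s t) \<le> e / 4 * real t"
    if x: "(left_shift ^^ (s + d)) x \<in> A" and t: "N \<le> t" and d: "d * h \<le> t" for x s d t
  proof -
    have "16 * real d \<le> e * real h * real d" by (rule mult_right_mono[OF he]) simp
    also have "\<dots> = e * real (d * h)" by simp
    also have "\<dots> \<le> e * real t" using d e by (intro mult_left_mono) (simp_all del: of_nat_mult)
    finally have "real d \<le> e / 16 * real t" by simp
    then show ?thesis using A(3)[OF x, of t] N[OF t] by simp
  qed
  show ?thesis
  proof (intro exI[of _ N] allI impI)
    fix B n assume B: "N \<le> B" "B \<le> n"
    have hB: "h \<le> B" "h \<le> n" "N \<le> n" using B by (auto simp: N_def)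
    obtain x where x: "x \<in> space \<mu>" "\<forall>p\<in>I. (left_shift ^^ (fst p * (n div h) + snd p * (B div h))) x \<in> A"
      using common_point[of A \<theta> I "\<lambda>p. fst p * (n div h) + snd p * (B div h)"] A(1,2) I \<theta>(2) by auto
    have xA: "(left_shift ^^ (a * (n div h) + b * (B div h))) x \<in> A"
      if "a \<le> 2 * h * M + 1" "b \<le> 2 * h * L + 1" for a b
      using x(2)[rule_format, of "(a, b)"] that by (simp add: I_def)
    show "\<exists>x\<in>\<Omega>.
      (\<forall>s t. n \<le> t \<longrightarrow> s + t \<le> M * n \<longrightarrow> freq_dev \<Omega> F \<mu> (factor x s t) \<le> e / 4 * real t) \<and>
      (\<forall>s. s \<le> M * n \<longrightarrow> (\<exists>y\<ge>s. y \<le> s + n \<and>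
       (\<forall>y'\<ge>y. y' \<le> y + L * B \<longrightarrow> freq_dev \<Omega> F \<mu> (factor x y' B) \<le> e / 4 * real B)))"
    proof (rule bexI[of _ x], intro conjI allI impI)
      fix s t assume st: "n \<le> t" "s + t \<le> M * n"
      then have "s \<le> M * n" by simp
      from grid_point[OF h1 hB(2) this] obtain a d where
        ad: "a \<le> 2 * h * M + 1" "a * (n div h) = s + d" "d * h \<le> n" by blast
      have "(left_shift ^^ (s + d)) x \<in> A" using xA[of a 0] ad by simp
      then show "freq_dev \<Omega> F \<mu> (factor x s t) \<le> e / 4 * real t"
        by (rule bound) (use st ad hB in linarith)+
    next
      fix s assume s: "s \<le> M * n"
      from grid_point[OF h1 hB(2) this] obtain a d where
        ad: "a \<le> 2 * h * M + 1" "a * (n div h) = s + d" "d * h \<le> n" by blast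
      have "d * 1 \<le> d * h" using h1 by (rule mult_le_mono2)
      then have dn: "d \<le> n" using ad(3) by linarith
      show "\<exists>y\<ge>s. y \<le> s + n \<and>
       (\<forall>y'\<ge>y. y' \<le> y + L * B \<longrightarrow> freq_dev \<Omega> F \<mu> (factor x y' B) \<le> e / 4 * real B)"
      proof (rule exI[of _ "s + d"], intro conjI allI impI)
        fix y' assume y': "s + d \<le> y'" "y' \<le> s + d + L * B"
        then have "y' - (s + d) \<le> L * B" by simp
        from grid_point[OF h1 hB(1) this] obtain b d' where
          b: "b \<le> 2 * h * L + 1" "b * (B div h) = y' - (s + d) + d'" "d' * h \<le> B" by blast
        have "y' + d' = a * (n div h) + b * (B div h)" using ad b y' by simp
        then have "(left_shift ^^ (y' + d')) x \<in> A" using xA[of a b] ad b by simp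
        then show "freq_dev \<Omega> F \<mu> (factor x y' B) \<le> e / 4 * real B"
          by (rule bound) (use b B in auto)
      qed (use dn in auto)
    qed (use x es(2) in simp)
  qed
qed

text \<open>The first \<open>M * n\<close> letters of a typical point form a word of the language,
  and this word occurs somewhere in \<open>\<xi>\<close>.\<close>

lemma typical_window:
  assumes \<mu>: "\<mu> \<in> ergodic_measures \<Omega>" and F: "finite F" "F \<noteq> {}" "\<And>u. u \<in> F \<Longrightarrow> u \<noteq> [] \<and> length u \<le> r"
    and e: "e > 0"
  shows "\<exists>N. \<forall>B n. N \<le> B \<longrightarrow> B \<le> n \<longrightarrow> (\<exists>i.
    (\<forall>t k. n \<le> t \<longrightarrow> i \<le> k \<longrightarrow> k + int t \<le> i + int (M * n) \<longrightarrow> freq_dev \<Omega> F \<mu> (blk \<xi> t k) \<le> e / 4 * real t) \<and>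
    (\<forall>k. i \<le> k \<longrightarrow> k + int n + int ((K + 3) * B) \<le> i + int (M * n) \<longrightarrow>
      (\<exists>y. k \<le> y \<and> y \<le> k + int n \<and>
        (\<forall>y'. y \<le> y' \<longrightarrow> y' \<le> y + int ((K + 2) * B) \<longrightarrow> freq_dev \<Omega> F \<mu> (blk \<xi> B y') \<le> e / 4 * real B))))"
proof -
  obtain N where N: "\<And>B n. N \<le> B \<Longrightarrow> B \<le> n \<Longrightarrow> (\<exists>x\<in>\<Omega>.
    (\<forall>s t. n \<le> t \<longrightarrow> s + t \<le> M * n \<longrightarrow> freq_dev \<Omega> F \<mu> (factor x s t) \<le> e / 4 * real t) \<and>
    (\<forall>s. s \<le> M * n \<longrightarrow> (\<exists>y\<ge>s. y \<le> s + n \<and>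
       (\<forall>y'\<ge>y. y' \<le> y + (K + 2) * B \<longrightarrow> freq_dev \<Omega> F \<mu> (factor x y' B) \<le> e / 4 * real B))))"
    using typical_point[OF \<mu> F e, of M "K + 2"] by blast
  show ?thesis
  proof (intro exI[of _ N] allI impI)
    fix B n assume "N \<le> B" "B \<le> n"
    from N[OF this] obtain x where x: "x \<in> \<Omega>"
      and x1: "\<And>s t. n \<le> t \<Longrightarrow> s + t \<le> M * n \<Longrightarrow> freq_dev \<Omega> F \<mu> (factor x s t) \<le> e / 4 * real t"
      and x2: "\<And>s. s \<le> M * n \<Longrightarrow> (\<exists>y\<ge>s. y \<le> s + n \<and>
       (\<forall>y'\<ge>y. y' \<le> y + (K + 2) * B \<longrightarrow> freq_dev \<Omega> F \<mu> (factor x y' B) \<le> e / 4 * real B))"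
      by blast
    define W where "W = M * n"
    obtain i where i: "blk \<xi> W i = factor x 0 W"
      using blk_urec[OF languageI[OF x, of 0 W]] by auto
    have bf: "blk \<xi> t k = factor x (nat (k - i)) t" if "i \<le> k" "k + int t \<le> i + int W" for t k
    proof (rule nth_equalityI)
      fix q assume "q < length (blk \<xi> t k)"
      then have q: "q < t" by simp
      define p where "p = nat (k - i) + q"
      have p: "p < W" "i + int p = k + int q" using that q by (auto simp: p_def)
      have "blk \<xi> W i ! p = factor x 0 W ! p" using i by simp
      then have "\<xi> (i + int p) = x p" using p(1) by (simp add: blk_def)
      then have "\<xi> (k + int q) = x (nat (k - i) + q)" by (simp only: p(2) p_def[symmetric])
      then show "blk \<xi> t k ! q = factor x (nat (k - i)) t ! q" using q by (simp add: blk_def)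
    qed simp
    show "\<exists>i. (\<forall>t k. n \<le> t \<longrightarrow> i \<le> k \<longrightarrow> k + int t \<le> i + int (M * n) \<longrightarrow> freq_dev \<Omega> F \<mu> (blk \<xi> t k) \<le> e / 4 * real t) \<and>
    (\<forall>k. i \<le> k \<longrightarrow> k + int n + int ((K + 3) * B) \<le> i + int (M * n) \<longrightarrow>
      (\<exists>y. k \<le> y \<and> y \<le> k + int n \<and>
        (\<forall>y'. y \<le> y' \<longrightarrow> y' \<le> y + int ((K + 2) * B) \<longrightarrow> freq_dev \<Omega> F \<mu> (blk \<xi> B y') \<le> e / 4 * real B)))"
    proof (rule exI[of _ i], intro conjI allI impI)
      fix t k assume k: "n \<le> t" "i \<le> k" "k + int t \<le> i + int (M * n)"
      have "nat (k - i) + t \<le> M * n" using k by linarith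
      from x1[OF k(1) this] show "freq_dev \<Omega> F \<mu> (blk \<xi> t k) \<le> e / 4 * real t"
        using bf[of k t] k unfolding W_def by simp
    next
      fix k assume k: "i \<le> k" "k + int n + int ((K + 3) * B) \<le> i + int (M * n)"
      have "nat (k - i) \<le> M * n" using k by linarith
      from x2[OF this] obtain y where y: "nat (k - i) \<le> y" "y \<le> nat (k - i) + n"
        "\<And>y'. y \<le> y' \<Longrightarrow> y' \<le> y + (K + 2) * B \<Longrightarrow> freq_dev \<Omega> F \<mu> (factor x y' B) \<le> e / 4 * real B" by blast
      have KB: "int ((K + 3) * B) = int ((K + 2) * B) + int B" by (simp add: algebra_simps)
      show "\<exists>y. k \<le> y \<and> y \<le> k + int n \<and>
        (\<forall>y'. y \<le> y' \<longrightarrow> y' \<le> y + int ((K + 2) * B) \<longrightarrow> freq_dev \<Omega> F \<mu> (blk \<xi> B y') \<le> e / 4 * real B)"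
      proof (rule exI[of _ "i + int y"], intro conjI allI impI)
        show "k \<le> i + int y" "i + int y \<le> k + int n" using y(1,2) k(1) by linarith+
        fix y' assume y': "i + int y \<le> y'" "y' \<le> i + int y + int ((K + 2) * B)"
        have "y' + int B \<le> i + int W" using y' y(2) k KB unfolding W_def by linarith
        then have "blk \<xi> B y' = factor x (nat (y' - i)) B" using y' by (intro bf) linarith+
        moreover have "y \<le> nat (y' - i)" "nat (y' - i) \<le> y + (K + 2) * B" using y' by linarith+
        ultimately show "freq_dev \<Omega> F \<mu> (blk \<xi> B y') \<le> e / 4 * real B" using y(3) by simp
      qed
    qed
  qed
qed

end

theorem theorem1p1:
  fixes \<Omega> :: "(nat \<Rightarrow> 'a::{finite, discrete_topology}) set"
    and K n\<^sub>0 C :: nat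
  assumes "minimal_shift \<Omega>"
    and "n\<^sub>0 \<ge> 1"
    and "\<And>n. n \<ge> n\<^sub>0 \<Longrightarrow> complexity \<Omega> n = K * n + C"
    and "K \<ge> 4"
  shows "finite (ergodic_measures \<Omega>) \<and> card (ergodic_measures \<Omega>) \<le> K - 2"
proof (rule ccontr)
  assume many: "\<not> ?thesis"
  have "\<exists>Cs \<subseteq> ergodic_measures \<Omega>. finite Cs \<and> card Cs = K - 1"
  proof (cases "finite (ergodic_measures \<Omega>)")
    case True
    then have "K - 1 \<le> card (ergodic_measures \<Omega>)" using many by simp
    then obtain Cs where "Cs \<subseteq> ergodic_measures \<Omega>" "card Cs = K - 1" "finite Cs"
      using obtain_subset_with_card_n by blast
    then show ?thesis by blast
  next
    case False
    then show ?thesis using infinite_arbitrarily_large by blast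
  qed
  then obtain Cs where Cs: "Cs \<subseteq> ergodic_measures \<Omega>" "finite Cs" "card Cs = K - 1" by blast
  have "complexity \<Omega> n\<^sub>0 > 0" using assms(2-4) by simp
  then have "\<Omega> \<noteq> {}" by (auto simp: complexity_def language_def)
  then interpret min_shift \<Omega> using assms(1) by unfold_locales
  have inv: "Cs \<subseteq> invariant_measures \<Omega>" using Cs(1) by (auto simp: ergodic_measures_def)
  obtain F \<delta> where F: "finite F" "F \<noteq> {}" "[] \<notin> F" "\<delta> > 0"
    "\<And>\<mu> \<nu>. \<mu> \<in> Cs \<Longrightarrow> \<nu> \<in> Cs \<Longrightarrow> \<mu> \<noteq> \<nu> \<Longrightarrow> \<exists>v\<in>F. \<delta> \<le> \<bar>measure \<mu> (cyl \<Omega> v) - measure \<nu> (cyl \<Omega> v)\<bar>"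
    using separating_words[OF Cs(2) inv] by metis
  define r where "r = Max (length ` F)"
  have r: "u \<noteq> [] \<and> length u \<le> r" if "u \<in> F" for u
    unfolding r_def using that F(1,3) by (auto intro!: Max_ge)
  \<comment> \<open>Two measures that both fit a nonempty word within \<open>e\<close> differ by at
    most \<open>2 * e < \<delta>\<close> on each word of \<open>F\<close>, which contradicts the
    separation.\<close>
  define e where "e = \<delta> / 3"
  have e: "e > 0" using F(4) by (simp add: e_def)
  define Q where "Q = nat \<lceil>8 / e\<rceil>"
  have "8 / e \<le> real Q" unfolding Q_def by linarith
  then have Q: "real Q * e \<ge> 8" using e by (simp add: divide_le_eq)
  define M where "M = 100 * (K + 10) * (Q + 20)"
  define window where "window \<mu> B n \<longleftrightarrow> (\<exists>i.
    (\<forall>t k. n \<le> t \<longrightarrow> i \<le> k \<longrightarrow> k + int t \<le> i + int (M * n) \<longrightarrow> freq_dev \<Omega> F \<mu> (blk \<xi> t k) \<le> e / 4 * real t) \<and>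
    (\<forall>k. i \<le> k \<longrightarrow> k + int n + int ((K + 3) * B) \<le> i + int (M * n) \<longrightarrow>
      (\<exists>y. k \<le> y \<and> y \<le> k + int n \<and>
        (\<forall>y'. y \<le> y' \<longrightarrow> y' \<le> y + int ((K + 2) * B) \<longrightarrow> freq_dev \<Omega> F \<mu> (blk \<xi> B y') \<le> e / 4 * real B))))"
    for \<mu> B n
  have "\<forall>\<mu>\<in>Cs. \<exists>N. \<forall>B n. N \<le> B \<longrightarrow> B \<le> n \<longrightarrow> window \<mu> B n"
  proof
    fix \<mu> assume "\<mu> \<in> Cs"
    then have "\<mu> \<in> ergodic_measures \<Omega>" using Cs(1) by blast
    from typical_window[OF this F(1,2) r e] show "\<exists>N. \<forall>B n. N \<le> B \<longrightarrow> B \<le> n \<longrightarrow> window \<mu> B n"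
      unfolding window_def .
  qed
  from bchoice[OF this] obtain N where N: "\<forall>\<mu>\<in>Cs. \<forall>B n. N \<mu> \<le> B \<longrightarrow> B \<le> n \<longrightarrow> window \<mu> B n" ..
  \<comment> \<open>The summands ensure, in this order, the complexity formula,
    \<open>C \<le> N0\<close>, the condition \<open>small\<close>, and typical windows for all
    measures in \<open>Cs\<close>.\<close>
  define N0 where "N0 = n\<^sub>0 + C + nat \<lceil>8 * (real r + 2) / e\<rceil> + Max (N ` Cs)"
  have "Cs \<noteq> {}" using Cs(3) assms(4) by auto
  have NC: "N \<mu> \<le> N0" if "\<mu> \<in> Cs" for \<mu>
  proof -
    have "N \<mu> \<le> Max (N ` Cs)" using Cs(2) that by simp
    then show ?thesis unfolding N0_def by linarith
  qed
  have "8 * (real r + 2) / e \<le> real N0" unfolding N0_def by linarith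
  then have small: "8 * (real r + 2) \<le> e * real N0" using e by (simp add: divide_le_eq mult.commute)
  have separated: "c = c'"
    if c: "c \<in> Cs" "c' \<in> Cs" "v \<noteq> []" and
      dev: "freq_dev \<Omega> F c v \<le> e * real (length v)" "freq_dev \<Omega> F c' v \<le> e * real (length v)" for c c' v
  proof (rule ccontr)
    assume "c \<noteq> c'"
    from F(5)[OF c(1,2) this] obtain u where u: "u \<in> F" "\<delta> \<le> \<bar>measure c (cyl \<Omega> u) - measure c' (cyl \<Omega> u)\<bar>" by blast
    define p q where "p = measure c (cyl \<Omega> u)" and "q = measure c' (cyl \<Omega> u)"
    have "\<bar>real (cnt u v) - real (length v) * p\<bar> \<le> e * real (length v)"
      "\<bar>real (cnt u v) - real (length v) * q\<bar> \<le> e * real (length v)"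
      unfolding p_def q_def using freq_dev_ge[OF F(1) u(1)] dev order_trans by blast+
    then have "\<bar>real (length v) * p - real (length v) * q\<bar> \<le> 2 * (e * real (length v))" by linarith
    moreover have "\<bar>real (length v) * p - real (length v) * q\<bar> = real (length v) * \<bar>p - q\<bar>"
      by (simp only: right_diff_distrib[symmetric] abs_mult abs_of_nat)
    ultimately have "real (length v) * \<bar>p - q\<bar> \<le> real (length v) * (2 * e)" by (simp add: mult_ac)
    then have "\<bar>p - q\<bar> \<le> 2 * e" using c(3) by simp
    then show False using u(2) e unfolding p_def q_def e_def by simp
  qed
  interpret colored_sequence \<xi> K C N0 Cs "freq_dev \<Omega> F" "real r" e Q M
  proof
    show "card (facs \<xi> n) = K * n + C" if "n \<ge> N0" for n
      using assms(3)[of n] that card_facs_complexity by (simp add: N0_def)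
    show "freq_dev \<Omega> F c (v @ w) \<le> freq_dev \<Omega> F c v + freq_dev \<Omega> F c w + real r" for c v w
      by (rule freq_dev_append[OF F(1,2) r])
    show "freq_dev \<Omega> F c v \<le> real (length v)" if "c \<in> Cs" for c v
      using that inv by (intro freq_dev_le_length[OF F(1-3)]) (auto simp: invariant_measures_def)
    show "c = c'" if "c \<in> Cs" "c' \<in> Cs" "v \<noteq> []" "freq_dev \<Omega> F c v \<le> e * real (length v)"
      "freq_dev \<Omega> F c' v \<le> e * real (length v)" for c c' v
      by (rule separated[OF that])
    show "\<exists>G. \<forall>i j. \<exists>k. j \<le> k \<and> k \<le> j + int G \<and> blk \<xi> n k = blk \<xi> n i" for n by (rule \<xi>_urec)
    show "\<exists>i. (\<forall>t k. n \<le> t \<longrightarrow> i \<le> k \<longrightarrow> k + int t \<le> i + int (M * n) \<longrightarrow> freq_dev \<Omega> F c (blk \<xi> t k) \<le> e / 4 * real t) \<and>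
          (\<forall>k. i \<le> k \<longrightarrow> k + int n + int ((K + 3) * B) \<le> i + int (M * n) \<longrightarrow>
             (\<exists>y. k \<le> y \<and> y \<le> k + int n \<and>
               (\<forall>y'. y \<le> y' \<longrightarrow> y' \<le> y + int ((K + 2) * B) \<longrightarrow> freq_dev \<Omega> F c (blk \<xi> B y') \<le> e / 4 * real B)))"
      if "N0 \<le> B" "B \<le> n" "c \<in> Cs" for B n c
    proof -
      have "window c B n" using N NC[OF that(3)] that le_trans by blast
      then show ?thesis unfolding window_def .
    qed
    show "M = 100 * (K + 10) * (Q + 20)" by (rule M_def)
  qed (use assms Cs e Q small in \<open>auto simp: N0_def\<close>)
  show False by (rule contradiction)
qed

end
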